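(* Let $R=R(X,S_1,S_2)$ be a reduced non-simply laced extended affine root system, $\mathcal W$ its Weyl group and $\psi:\hat{\mathcal W}\to\mathcal W$ the epimorphism $\hat w_\alpha\mapsto w_\alpha$. For an integral collection $\bar\epsilon=\{\epsilon_J\}_{J\in\mathcal J}$ for $(S_1,S_2)$ put $$\hat u(\bar\epsilon):=\prod_{1\le r<s\le\nu}\hat z_{\{r,s\}}^{-\bar\epsilon_{r,s}}\prod_{J\in\mathcal J}\hat z_J^{\epsilon_J},\qquad \bar\epsilon_{r,s}:=\Delta(r,s)^{-1}\sum_{J\in\mathcal J}\chi_J(r,s)\epsilon_J\in\mathbb Z .$$ (i) $\ker(\psi)=\{\hat u\in Z(\hat{\mathcal W})\mid\hat u^2=1\}=\{\hat u\in Z(\hat{\mathcal W})\mid\hat u\text{ has finite order}\}=\{\hat u(\bar\epsilon)\mid\bar\epsilon\text{ is an integral collection for }(S_1,S_2)\}$. (ii) The assignment $\bar\epsilon\mapsto\hat u(\bar\epsilon)$ is a one-to-one correspondence from the set of integral collections for $(S_1,S_2)$ onto $\ker(\psi)$.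
   Context: Setting. $X$ is one of $B_\ell$ ($\ell\ge 2$), $C_\ell$ ($\ell\ge 3$), $F_4$, $G_2$; $k=3$ if $X=G_2$ and $k=2$ otherwise. A semilattice in a finite-dimensional real vector space $U$ is a discrete spanning subset $S\subseteq U$ with $0\in S$ and $S=S\pm 2S$; $\langle S\rangle$ is its $\mathbb Z$-span, and $S$ is a lattice if $S=\langle S\rangle$. A reduced non-simply laced extended affine root system of type $X$, rank $\ell$, nullity $\nu$ and twist number $t$ is described as follows: $\mathcal V=\dot{\mathcal V}\oplus\mathcal V^0$ is a real vector space with a positive semidefinite symmetric bilinear form $(\cdot,\cdot)$ with radical $\mathcal V^0=\mathcal V^0_1\oplus\mathcal V^0_2$, $\dim\mathcal V^0_1=t$, $\dim\mathcal V_2^0=\nu-t$; $\dot R=\{0\}\cup\dot R_{sh}\cup\dot R_{lg}$ is an irreducible finite root system of type $X$ and rank $\ell$ spanning $\dot{\mathcal V}$ ($\dot R_{sh}$ short roots, $\dot R_{lg}$ long roots); $S_i$ is a semilattice in $\mathcal V^0_i$ ($i=1,2$), where $S_2$ is a lattice if $X=B_\ell$ with $\ell\ge3$, $S_1$ is a lattice if $X=C_\ell$ with $\ell\ge3$, and both are lattices if $X=F_4,G_2$; and with $S:=S_1\oplus\langle S_2\rangle$, $$R=R(X,S_1,S_2)=(S+S)\cup(\dot R_{sh}+S_1\oplus\langle S_2\rangle)\cup(\dot R_{lg}+k\langle S_1\rangle\oplus S_2).$$ $R^\times=\{\alpha\in R:(\alpha,\alpha)\ne0\}$ and $\alpha^\vee=2\alpha/(\alpha,\alpha)$.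 Let $\tilde{\mathcal V}=\mathcal V\oplus(\mathcal V^0)^*$ with the form extended by $(\dot\beta_1+\delta_1+\lambda_1,\dot\beta_2+\delta_2+\lambda_2)=(\dot\beta_1,\dot\beta_2)+\lambda_1(\delta_2)+\lambda_2(\delta_1)$ for $\dot\beta_i\in\dot{\mathcal V},\delta_i\in\mathcal V^0,\lambda_i\in(\mathcal V^0)^*$. The extended affine Weyl group $\mathcal W$ is the subgroup of $GL(\tilde{\mathcal V})$ generated by the reflections $w_\alpha(u)=u-(u,\alpha^\vee)\alpha$, $\alpha\in R^\times$. $\hat{\mathcal W}$ is the group with generators $\hat w_\alpha$ ($\alpha\in R^\times$) and relations $\hat w_\alpha^2=1$, $\hat w_\alpha\hat w_\beta\hat w_\alpha=\hat w_{w_\alpha(\beta)}$ ($\alpha,\beta\in R^\times$); $\psi:\hat{\mathcal W}\to\mathcal W$ is the epimorphism with $\psi(\hat w_\alpha)=w_\alpha$. $Z(G)$ is the center of $G$ and $[x,y]=x^{-1}y^{-1}xy$. Bases and supports. $J_n=\{1,\dots,n\}$, $J_\nu^t=\{t+1,\dots,\nu\}$. Fix $\sigma_1,\dots,\sigma_t\in S_1$ forming a $\mathbb Z$-basis of $\langle S_1\rangle$ and $\sigma_{t+1},\dots,\sigma_\nu\in S_2$ forming a $\mathbb Z$-basis of $\langle S_2\rangle$. For $J\subseteq J_\nu$, $\tau_J=\sum_{r\in J}\sigma_r$. $\mathrm{supp}(S_1)=\{J\subseteq J_t:\tau_J\in S_1\}$, $\mathrm{supp}(S_2)=\{J\subseteq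 J_\nu^t:\tau_J\in S_2\}$, $\mathrm{Esupp}(S_j)=\{J\in\mathrm{supp}(S_j):|J|\ge3\}$. Elements $\hat z_J$. For $\alpha\in R^\times$, $\sigma\in\mathcal V^0$ with $\alpha+\sigma\in R$, put $\hat t_\alpha^{\sigma}=\hat w_{\alpha+\sigma}\hat w_\alpha$. Let $\alpha,\alpha'\in\dot R_{sh}$, $\beta,\beta'\in\dot R_{lg}$ with $(\alpha',\beta')<0$. For $J\subseteq J_\nu$ (products in increasing order of index): $\hat z_J=\hat t_\alpha^{-\tau_J}\prod_{r\in J}\hat t_\alpha^{\sigma_r}$ if $J\in\mathrm{supp}(S_1)$; $\hat z_J=[\hat t_\alpha^{\sigma_r},\hat t_\alpha^{\sigma_s}]$ if $J=\{r,s\}\notin\mathrm{supp}(S_1)$, $r<s\in J_t$; $\hat z_J=\hat t_\beta^{-\tau_J}\prod_{r\in J}\hat t_\beta^{\sigma_r}$ if $J\in\mathrm{supp}(S_2)$; $\hat z_J=[\hat t_\beta^{\sigma_r},\hat t_\beta^{\sigma_s}]$ if $J=\{r,s\}\notin\mathrm{supp}(S_2)$, $r<s\in J_\nu^t$; $\hat z_J=[\hat t_{\beta'}^{\sigma_s},\hat t_{\alpha'}^{\sigma_r}]$ if $J=\{r,s\}$, $r\in J_t$, $s\in J_\nu^t$; $\hat z_J=1$ otherwise. These are central and independent of the choice of $\alpha,\beta,\alpha',\beta'$. Integral collections. $\mathcal J=\mathrm{Esupp}(S_1)\cup\mathrm{Esupp}(S_2)$ if $X=B_2$; $\mathcal J=\mathrm{Esupp}(S_1)$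 if $X=B_\ell$, $\ell\ge3$; $\mathcal J=\mathrm{Esupp}(S_2)$ if $X=C_\ell$, $\ell\ge3$; $\mathcal J=\emptyset$ if $X=F_4,G_2$. For $r<s$ in $J_\nu$: $\Delta(r,s)=1$ if $r\in J_t,s\in J^t_\nu$; if $r<s\in J_t$ (resp. $r<s\in J_\nu^t$), $\Delta(r,s)=1$ when $\{r,s\}\in\mathrm{supp}(S_1)$ (resp. $\mathrm{supp}(S_2)$) and $\Delta(r,s)=2$ otherwise. $\chi_J(r,s)=1$ if $\{r,s\}\subsetneq J$ and $0$ otherwise. An integral collection for $(S_1,S_2)$ is a family $\bar\epsilon=\{\epsilon_J\}_{J\in\mathcal J}$, $\epsilon_J\in\{0,1\}$, with $\Delta(r,s)^{-1}\sum_{J\in\mathcal J}\chi_J(r,s)\epsilon_J\in\mathbb Z$ for all $r<s$ in $J_\nu$ (if $\mathcal J=\emptyset$ there is exactly one, the trivial collection).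
   Formalization: The nullity ν is assumed to be at least 1; for ν = 0 the Weyl group is finite and contains the central involution −1 while ker(ψ) is trivial, so the equalities in (i) fail. *)

theory Defs
  imports "HOL-Analysis.Analysis" "HOL-Algebra.Generated_Groups" "HOL-Algebra.FiniteProduct"
begin

section \<open>Reflections and finite root systems\<close>

definition reflection :: "('v::real_vector \<Rightarrow> 'v \<Rightarrow> real) \<Rightarrow> 'v \<Rightarrow> 'v \<Rightarrow> 'v" where
  "reflection b \<alpha> u = u - b u ((2 / b \<alpha> \<alpha>) *\<^sub>R \<alpha>) *\<^sub>R \<alpha>"

datatype root_type = TypeB nat | TypeC nat | TypeF4 | TypeG2

fun valid_type :: "root_type \<Rightarrow> bool" where
  "valid_type (TypeB l) \<longleftrightarrow> l \<ge> 2"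
| "valid_type (TypeC l) \<longleftrightarrow> l \<ge> 3"
| "valid_type TypeF4 \<longleftrightarrow> True"
| "valid_type TypeG2 \<longleftrightarrow> True"

fun type_rank :: "root_type \<Rightarrow> nat" where
  "type_rank (TypeB l) = l"
| "type_rank (TypeC l) = l"
| "type_rank TypeF4 = 4"
| "type_rank TypeG2 = 2"

fun type_const :: "root_type \<Rightarrow> real" where
  "type_const TypeG2 = 3"
| "type_const _ = 2"

text \<open>The one Cartan matrix entry that differs from those of type \<open>A\<close>, in the convention
  \<open>c\<^sub>i\<^sub>j = 2 (\<alpha>\<^sub>i, \<alpha>\<^sub>j) / (\<alpha>\<^sub>j, \<alpha>\<^sub>j)\<close> and Bourbaki's numbering of the simple roots.\<close>

fun multiple_bond :: "root_type \<Rightarrow> (nat \<times> nat) \<times> int" where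
  "multiple_bond (TypeB l) = ((l - 1, l), -2)"
| "multiple_bond (TypeC l) = ((l, l - 1), -2)"
| "multiple_bond TypeF4 = ((2, 3), -2)"
| "multiple_bond TypeG2 = ((2, 1), -3)"

definition cartan_matrix :: "root_type \<Rightarrow> nat \<Rightarrow> nat \<Rightarrow> int" where
  "cartan_matrix X i j =
     (if i = j then 2
      else if (i, j) = fst (multiple_bond X) then snd (multiple_bond X)
      else if i = Suc j \<or> j = Suc i then -1
      else 0)"

text \<open>Root systems are given by their nonzero roots; the form is the inner product of the type.\<close>

definition root_system :: "'a::euclidean_space set \<Rightarrow> bool" where
  "root_system \<Phi> \<longleftrightarrow>
     finite \<Phi> \<and> 0 \<notin> \<Phi> \<and> span \<Phi> = UNIV \<and>
     (\<forall>\<alpha>\<in>\<Phi>. reflection (\<bullet>) \<alpha> ` \<Phi> = \<Phi>) \<and>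
     (\<forall>\<alpha>\<in>\<Phi>. \<forall>\<beta>\<in>\<Phi>. 2 * (\<beta> \<bullet> \<alpha>) / (\<alpha> \<bullet> \<alpha>) \<in> \<int>) \<and>
     (\<forall>\<alpha>\<in>\<Phi>. \<forall>c::real. c *\<^sub>R \<alpha> \<in> \<Phi> \<longrightarrow> c = 1 \<or> c = -1)"

definition irreducible_roots :: "'a::euclidean_space set \<Rightarrow> bool" where
  "irreducible_roots \<Phi> \<longleftrightarrow> \<Phi> \<noteq> {} \<and>
     \<not> (\<exists>A B. A \<noteq> {} \<and> B \<noteq> {} \<and> A \<inter> B = {} \<and> A \<union> B = \<Phi> \<and> (\<forall>\<alpha>\<in>A. \<forall>\<beta>\<in>B. \<alpha> \<bullet> \<beta> = 0))"

definition root_base :: "'a::euclidean_space set \<Rightarrow> nat \<Rightarrow> (nat \<Rightarrow> 'a) \<Rightarrow> bool" where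
  "root_base \<Phi> l a \<longleftrightarrow>
     inj_on a {1..l} \<and> independent (a ` {1..l}) \<and> a ` {1..l} \<subseteq> \<Phi> \<and>
     (\<forall>\<beta>\<in>\<Phi>. \<exists>c::nat \<Rightarrow> int. \<beta> = (\<Sum>i=1..l. of_int (c i) *\<^sub>R a i) \<and>
        ((\<forall>i\<in>{1..l}. c i \<ge> 0) \<or> (\<forall>i\<in>{1..l}. c i \<le> 0)))"

definition root_system_of_type :: "root_type \<Rightarrow> 'a::euclidean_space set \<Rightarrow> bool" where
  "root_system_of_type X \<Phi> \<longleftrightarrow> root_system \<Phi> \<and> irreducible_roots \<Phi> \<and>
     (\<exists>a. root_base \<Phi> (type_rank X) a \<and>
        (\<forall>i\<in>{1..type_rank X}. \<forall>j\<in>{1..type_rank X}.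
           2 * (a i \<bullet> a j) / (a j \<bullet> a j) = of_int (cartan_matrix X i j)))"

definition short_roots :: "'a::euclidean_space set \<Rightarrow> 'a set" where
  "short_roots \<Phi> = {\<alpha>\<in>\<Phi>. \<forall>\<beta>\<in>\<Phi>. norm \<alpha> \<le> norm \<beta>}"

definition long_roots :: "'a::euclidean_space set \<Rightarrow> 'a set" where
  "long_roots \<Phi> = {\<alpha>\<in>\<Phi>. \<forall>\<beta>\<in>\<Phi>. norm \<beta> \<le> norm \<alpha>}"


section \<open>Semilattices\<close>

definition int_span :: "'b::real_vector set \<Rightarrow> 'b set" where
  "int_span S = {\<Sum>x\<in>F. of_int (c x) *\<^sub>R x | F (c :: 'b \<Rightarrow> int). finite F \<and> F \<subseteq> S}"

definition int_basis :: "'i set \<Rightarrow> ('i \<Rightarrow> 'b::real_vector) \<Rightarrow> 'b set \<Rightarrow> bool" where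
  "int_basis I \<sigma> L \<longleftrightarrow> finite I \<and> int_span (\<sigma> ` I) = L \<and>
     (\<forall>c::'i \<Rightarrow> int. (\<Sum>i\<in>I. of_int (c i) *\<^sub>R \<sigma> i) = 0 \<longrightarrow> (\<forall>i\<in>I. c i = 0))"

definition semilattice_in :: "'b::euclidean_space set \<Rightarrow> 'b set \<Rightarrow> bool" where
  "semilattice_in U S \<longleftrightarrow> S \<subseteq> U \<and> span S = U \<and> discrete S \<and> 0 \<in> S \<and>
     S = {x + 2 *\<^sub>R y | x y. x \<in> S \<and> y \<in> S} \<union> {x - 2 *\<^sub>R y | x y. x \<in> S \<and> y \<in> S}"

definition is_lattice :: "'b::real_vector set \<Rightarrow> bool" where
  "is_lattice S \<longleftrightarrow> S = int_span S"


section \<open>Extended affine root systems and their Weyl groups\<close>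

text \<open>The space \<open>\<V>\<close> is the product type \<open>'a \<times> 'b\<close>, where \<open>'a\<close> carries the finite root system and
  \<open>'b\<close> is the radical \<open>\<V>\<^sup>0\<close> of the form; only the topology and the vector space structure of \<open>'b\<close>
  are used. Thus the nullity is \<open>DIM('b) \<ge> 1\<close>. The space \<open>\<V> \<oplus> (\<V>\<^sup>0)\<^sup>*\<close> is
  \<open>('a \<times> 'b) \<times> ('b \<Rightarrow>\<^sub>L real)\<close>; all linear functionals on \<open>'b\<close> are bounded.\<close>

type_synonym ('a, 'b) ext_space = "('a \<times> 'b) \<times> ('b \<Rightarrow>\<^sub>L real)"

definition form :: "'a::euclidean_space \<times> 'b::euclidean_space \<Rightarrow> 'a \<times> 'b \<Rightarrow> real" where
  "form u v = fst u \<bullet> fst v"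

definition ext_form ::
    "('a::euclidean_space, 'b::euclidean_space) ext_space \<Rightarrow> ('a, 'b) ext_space \<Rightarrow> real" where
  "ext_form u v = form (fst u) (fst v)
     + blinfun_apply (snd u) (snd (fst v)) + blinfun_apply (snd v) (snd (fst u))"

definition ears :: "root_type \<Rightarrow> 'a::euclidean_space set \<Rightarrow> 'b::euclidean_space set \<Rightarrow> 'b set
    \<Rightarrow> ('a \<times> 'b) set" where
  "ears X \<Phi> S1 S2 =
     (let S = S1 + int_span S2 in
      {0} \<times> (S + S)
      \<union> short_roots \<Phi> \<times> S
      \<union> long_roots \<Phi> \<times> ((\<lambda>x. type_const X *\<^sub>R x) ` int_span S1 + S2))"

definition nonisotropic :: "('a::euclidean_space \<times> 'b::euclidean_space) set \<Rightarrow> ('a \<times> 'b) set" where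
  "nonisotropic R = {\<alpha>\<in>R. form \<alpha> \<alpha> \<noteq> 0}"

definition weyl_refl :: "'a::euclidean_space \<times> 'b::euclidean_space
    \<Rightarrow> ('a, 'b) ext_space \<Rightarrow> ('a, 'b) ext_space" where
  "weyl_refl \<alpha> = reflection ext_form (\<alpha>, 0)"

definition general_linear_group :: "('v::real_vector \<Rightarrow> 'v) monoid" where
  "general_linear_group = \<lparr>carrier = {f. linear f \<and> bij f}, mult = (\<circ>), one = id\<rparr>"

definition weyl_group :: "('a::euclidean_space \<times> 'b::euclidean_space) set
    \<Rightarrow> (('a, 'b) ext_space \<Rightarrow> ('a, 'b) ext_space) monoid" where
  "weyl_group R = subgroup_generated general_linear_group (weyl_refl ` nonisotropic R)"


section \<open>Groups given by generators and relations\<close>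

text \<open>A letter \<open>(x, True)\<close> stands for the generator \<open>x\<close> and \<open>(x, False)\<close> for its inverse.\<close>

type_synonym 'x word = "('x \<times> bool) list"

inductive_set word_cong :: "'x set \<Rightarrow> ('x word \<times> 'x word) set \<Rightarrow> ('x word \<times> 'x word) set"
  for X :: "'x set" and E :: "('x word \<times> 'x word) set" where
  refl: "u \<in> lists (X \<times> UNIV) \<Longrightarrow> (u, u) \<in> word_cong X E"
| sym: "(u, v) \<in> word_cong X E \<Longrightarrow> (v, u) \<in> word_cong X E"
| trans: "(u, v) \<in> word_cong X E \<Longrightarrow> (v, w) \<in> word_cong X E \<Longrightarrow> (u, w) \<in> word_cong X E"
| append: "(u, v) \<in> word_cong X E \<Longrightarrow> (u', v') \<in> word_cong X E
    \<Longrightarrow> (u @ u', v @ v') \<in> word_cong X E"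
| cancel: "x \<in> X \<Longrightarrow> ([(x, b), (x, \<not> b)], []) \<in> word_cong X E"
| relation: "(u, v) \<in> E \<Longrightarrow> u \<in> lists (X \<times> UNIV) \<Longrightarrow> v \<in> lists (X \<times> UNIV)
    \<Longrightarrow> (u, v) \<in> word_cong X E"

definition presented_group :: "'x set \<Rightarrow> ('x word \<times> 'x word) set \<Rightarrow> 'x word set monoid" where
  "presented_group X E =
     \<lparr>carrier = lists (X \<times> UNIV) // word_cong X E,
      mult = (\<lambda>A B. \<Union>u\<in>A. \<Union>v\<in>B. word_cong X E `` {u @ v}),
      one = word_cong X E `` {[]}\<rparr>"

definition presented_gen :: "'x set \<Rightarrow> ('x word \<times> 'x word) set \<Rightarrow> 'x \<Rightarrow> 'x word set" where
  "presented_gen X E x = word_cong X E `` {[(x, True)]}"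

definition eval_word :: "('g, 'm) monoid_scheme \<Rightarrow> ('x \<Rightarrow> 'g) \<Rightarrow> 'x word \<Rightarrow> 'g" where
  "eval_word G f u =
     foldr (\<lambda>(x, b) g. (if b then f x else inv\<^bsub>G\<^esub> f x) \<otimes>\<^bsub>G\<^esub> g) u \<one>\<^bsub>G\<^esub>"

text \<open>The homomorphism out of a presented group induced by \<open>f\<close>, defined when the images of the
  generators satisfy the relations.\<close>

definition presented_lift :: "('g, 'm) monoid_scheme \<Rightarrow> ('x \<Rightarrow> 'g) \<Rightarrow> 'x word set \<Rightarrow> 'g" where
  "presented_lift G f A = the_elem (eval_word G f ` A)"

definition group_center :: "('g, 'm) monoid_scheme \<Rightarrow> 'g set" where
  "group_center G = {z \<in> carrier G. \<forall>g\<in>carrier G. z \<otimes>\<^bsub>G\<^esub> g = g \<otimes>\<^bsub>G\<^esub> z}"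

definition commutator :: "('g, 'm) monoid_scheme \<Rightarrow> 'g \<Rightarrow> 'g \<Rightarrow> 'g" where
  "commutator G x y = inv\<^bsub>G\<^esub> x \<otimes>\<^bsub>G\<^esub> inv\<^bsub>G\<^esub> y \<otimes>\<^bsub>G\<^esub> x \<otimes>\<^bsub>G\<^esub> y"

lemma word_cong_lists:
  "(u, v) \<in> word_cong X E \<Longrightarrow> u \<in> lists (X \<times> UNIV) \<and> v \<in> lists (X \<times> UNIV)"
  by (induction rule: word_cong.induct) auto

lemma equiv_word_cong: "equiv (lists (X \<times> UNIV)) (word_cong X E)"
proof (rule equivI)
  show "word_cong X E \<subseteq> lists (X \<times> UNIV) \<times> lists (X \<times> UNIV)"
    using word_cong_lists by (metis SigmaI subrelI)
  show "refl_on (lists (X \<times> UNIV)) (word_cong X E)"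
    by (intro refl_onI word_cong.refl)
  show "sym (word_cong X E)" by (rule symI) (rule word_cong.sym)
  show "trans (word_cong X E)" by (meson transI word_cong.trans)
qed

lemma presented_mult:
  assumes "u \<in> lists (X \<times> UNIV)" "v \<in> lists (X \<times> UNIV)"
  shows "word_cong X E `` {u} \<otimes>\<^bsub>presented_group X E\<^esub> word_cong X E `` {v} = word_cong X E `` {u @ v}"
proof -
  let ?C = "word_cong X E"
  have *: "?C `` {u' @ v'} = ?C `` {u @ v}" if "u' \<in> ?C `` {u}" "v' \<in> ?C `` {v}" for u' v'
  proof -
    from that have "(u, u') \<in> ?C" "(v, v') \<in> ?C" by blast+
    from equiv_class_eq[OF equiv_word_cong word_cong.append[OF this]] show ?thesis by (rule HOL.sym)
  qed
  have u: "u \<in> ?C `` {u}" and v: "v \<in> ?C `` {v}"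
    using assms word_cong.refl by blast+
  have "(\<Union>v'\<in>?C `` {v}. ?C `` {u' @ v'}) = ?C `` {u @ v}" if "u' \<in> ?C `` {u}" for u'
    using * that by (intro UN_constant_eq[OF v]) blast
  then have "(\<Union>u'\<in>?C `` {u}. \<Union>v'\<in>?C `` {v}. ?C `` {u' @ v'}) = ?C `` {u @ v}"
    by (intro UN_constant_eq[OF u]) blast
  then show ?thesis unfolding presented_group_def by simp
qed

lemma presented_carrier:
  "A \<in> carrier (presented_group X E) \<longleftrightarrow> (\<exists>u\<in>lists (X \<times> UNIV). A = word_cong X E `` {u})"
  by (auto simp: presented_group_def quotient_def)

lemma word_cong_inverse:
  assumes "u \<in> lists (X \<times> UNIV)"
  shows "(rev (map (\<lambda>(x, b). (x, \<not> b)) u) @ u, []) \<in> word_cong X E"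
  using assms
proof (induction u)
  case Nil
  show ?case by (auto intro: word_cong.refl)
next
  case (Cons p u)
  obtain x b where p: "p = (x, b)" by (cases p)
  let ?v = "rev (map (\<lambda>(x, b). (x, \<not> b)) u)"
  from Cons have x: "x \<in> X" and u: "u \<in> lists (X \<times> UNIV)"
    and IH: "(?v @ u, []) \<in> word_cong X E" by (auto simp: p)
  have v: "?v \<in> lists (X \<times> UNIV)" using u by auto
  have "([(x, \<not> b), (x, \<not> \<not> b)] @ u, [] @ u) \<in> word_cong X E"
    by (rule word_cong.append[OF word_cong.cancel[OF x] word_cong.refl[OF u]])
  then have "(?v @ [(x, \<not> b), (x, \<not> \<not> b)] @ u, ?v @ [] @ u) \<in> word_cong X E"
    by (rule word_cong.append[OF word_cong.refl[OF v]])
  then show ?case using word_cong.trans[OF _ IH] by (simp add: p)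
qed

lemma group_presented_group: "group (presented_group X E)"
proof (rule groupI)
  let ?G = "presented_group X E"
  have one: "\<one>\<^bsub>?G\<^esub> = word_cong X E `` {[]}" by (simp add: presented_group_def)
  show "\<one>\<^bsub>?G\<^esub> \<in> carrier ?G" unfolding one presented_carrier by (rule bexI[of _ "[]"]) simp_all
  show "x \<otimes>\<^bsub>?G\<^esub> y \<in> carrier ?G" if "x \<in> carrier ?G" "y \<in> carrier ?G" for x y
  proof -
    from that obtain u v where u: "u \<in> lists (X \<times> UNIV)" "x = word_cong X E `` {u}"
      and v: "v \<in> lists (X \<times> UNIV)" "y = word_cong X E `` {v}"
      unfolding presented_carrier by blast
    have "x \<otimes>\<^bsub>?G\<^esub> y = word_cong X E `` {u @ v}"
      unfolding u(2) v(2) by (rule presented_mult[OF u(1) v(1)])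
    moreover have "u @ v \<in> lists (X \<times> UNIV)" using u(1) v(1) by simp
    ultimately show ?thesis unfolding presented_carrier by blast
  qed
  show "x \<otimes>\<^bsub>?G\<^esub> y \<otimes>\<^bsub>?G\<^esub> z = x \<otimes>\<^bsub>?G\<^esub> (y \<otimes>\<^bsub>?G\<^esub> z)"
    if "x \<in> carrier ?G" "y \<in> carrier ?G" "z \<in> carrier ?G" for x y z
  proof -
    from that obtain u v w where u: "u \<in> lists (X \<times> UNIV)" "x = word_cong X E `` {u}"
      and v: "v \<in> lists (X \<times> UNIV)" "y = word_cong X E `` {v}"
      and w: "w \<in> lists (X \<times> UNIV)" "z = word_cong X E `` {w}"
      unfolding presented_carrier by blast
    have uv: "u @ v \<in> lists (X \<times> UNIV)" and vw: "v @ w \<in> lists (X \<times> UNIV)"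
      using u(1) v(1) w(1) by simp_all
    show ?thesis
      unfolding u(2) v(2) w(2) presented_mult[OF u(1) v(1)] presented_mult[OF v(1) w(1)]
        presented_mult[OF uv w(1)] presented_mult[OF u(1) vw] append_assoc ..
  qed
  show "\<one>\<^bsub>?G\<^esub> \<otimes>\<^bsub>?G\<^esub> x = x" if "x \<in> carrier ?G" for x
  proof -
    from that obtain u where "u \<in> lists (X \<times> UNIV)" "x = word_cong X E `` {u}"
      unfolding presented_carrier by blast
    then show ?thesis using presented_mult[OF lists.Nil, of u X E] unfolding one by simp
  qed
  show "\<exists>y\<in>carrier ?G. y \<otimes>\<^bsub>?G\<^esub> x = \<one>\<^bsub>?G\<^esub>" if "x \<in> carrier ?G" for x
  proof -
    from that obtain u where u: "u \<in> lists (X \<times> UNIV)" "x = word_cong X E `` {u}"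
      unfolding presented_carrier by blast
    let ?v = "rev (map (\<lambda>(x, b). (x, \<not> b)) u)"
    have v: "?v \<in> lists (X \<times> UNIV)" using u by auto
    show ?thesis
    proof (rule bexI)
      show "word_cong X E `` {?v} \<otimes>\<^bsub>?G\<^esub> x = \<one>\<^bsub>?G\<^esub>"
        unfolding u(2) presented_mult[OF v u(1)] one
        by (rule equiv_class_eq[OF equiv_word_cong word_cong_inverse[OF u(1)]])
      show "word_cong X E `` {?v} \<in> carrier ?G" unfolding presented_carrier using v by blast
    qed
  qed
qed

lemma presented_lift_hom:
  assumes "group G" and f: "f ` X \<subseteq> carrier G"
    and E: "\<And>u v. (u, v) \<in> E \<Longrightarrow> u \<in> lists (X \<times> UNIV) \<Longrightarrow> v \<in> lists (X \<times> UNIV)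
              \<Longrightarrow> eval_word G f u = eval_word G f v"
  shows "presented_lift G f \<in> hom (presented_group X E) G"
    and "\<And>x. x \<in> X \<Longrightarrow> presented_lift G f (presented_gen X E x) = f x"
proof -
  interpret group G by fact
  have fx: "f x \<in> carrier G" if "x \<in> X" for x using f that by auto
  have ev_in: "eval_word G f u \<in> carrier G" if "u \<in> lists (X \<times> UNIV)" for u
    using that by (induction u) (auto simp: eval_word_def fx)
  have ev_app: "eval_word G f (u @ v) = eval_word G f u \<otimes>\<^bsub>G\<^esub> eval_word G f v"
    if "u \<in> lists (X \<times> UNIV)" "v \<in> lists (X \<times> UNIV)" for u v
    using that
  proof (induction u)
    case Nil
    then show ?case using ev_in[of v] by (simp add: eval_word_def)
  next
    case (Cons p u)
    then show ?case using ev_in[of v] ev_in[of u]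
      by (cases p) (auto simp: eval_word_def fx m_assoc)
  qed
  have ev_cong: "eval_word G f u = eval_word G f v" if "(u, v) \<in> word_cong X E" for u v
    using that
  proof (induction rule: word_cong.induct)
    case (append u v u' v')
    from word_cong_lists[OF append.hyps(1)] word_cong_lists[OF append.hyps(2)]
    show ?case by (simp only: ev_app append.IH)
  next
    case (cancel x b)
    then show ?case using fx[of x] by (cases b) (auto simp: eval_word_def)
  qed (simp_all only: E)
  have lift: "presented_lift G f (word_cong X E `` {u}) = eval_word G f u"
    if "u \<in> lists (X \<times> UNIV)" for u
  proof -
    have "eval_word G f ` (word_cong X E `` {u}) = {eval_word G f u}"
    proof
      show "{eval_word G f u} \<subseteq> eval_word G f ` (word_cong X E `` {u})"
        using word_cong.refl[OF that, of E] by blast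
      show "eval_word G f ` (word_cong X E `` {u}) \<subseteq> {eval_word G f u}"
      proof
        fix g assume "g \<in> eval_word G f ` (word_cong X E `` {u})"
        then obtain v where "(u, v) \<in> word_cong X E" "g = eval_word G f v" by blast
        then show "g \<in> {eval_word G f u}" using ev_cong[of u v] by simp
      qed
    qed
    then show ?thesis by (simp add: presented_lift_def)
  qed
  show "presented_lift G f \<in> hom (presented_group X E) G"
  proof (rule homI)
    fix A assume "A \<in> carrier (presented_group X E)"
    then obtain u where "u \<in> lists (X \<times> UNIV)" "A = word_cong X E `` {u}"
      unfolding presented_carrier by blast
    then show "presented_lift G f A \<in> carrier G" by (simp only: lift ev_in)
  next
    fix A B assume "A \<in> carrier (presented_group X E)" "B \<in> carrier (presented_group X E)"
    then obtain u v where u: "u \<in> lists (X \<times> UNIV)" "A = word_cong X E `` {u}"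
      and v: "v \<in> lists (X \<times> UNIV)" "B = word_cong X E `` {v}"
      unfolding presented_carrier by blast
    then have uv: "u @ v \<in> lists (X \<times> UNIV)" by auto
    show "presented_lift G f (A \<otimes>\<^bsub>presented_group X E\<^esub> B)
        = presented_lift G f A \<otimes>\<^bsub>G\<^esub> presented_lift G f B"
      unfolding u(2) v(2) presented_mult[OF u(1) v(1)] lift[OF u(1)] lift[OF v(1)] lift[OF uv]
      by (rule ev_app[OF u(1) v(1)])
  qed
  show "presented_lift G f (presented_gen X E x) = f x" if "x \<in> X" for x
    unfolding presented_gen_def using that lift[of "[(x, True)]"] fx[OF that]
    by (simp add: eval_word_def)
qed


section \<open>The group presented by conjugation\<close>

definition conj_relations :: "('a::euclidean_space \<times> 'b::euclidean_space) set
    \<Rightarrow> (('a \<times> 'b) word \<times> ('a \<times> 'b) word) set" where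
  "conj_relations R =
     {([(\<alpha>, True), (\<alpha>, True)], []) | \<alpha>. \<alpha> \<in> nonisotropic R} \<union>
     {([(\<alpha>, True), (\<beta>, True), (\<alpha>, True)], [(reflection form \<alpha> \<beta>, True)]) | \<alpha> \<beta>.
        \<alpha> \<in> nonisotropic R \<and> \<beta> \<in> nonisotropic R}"

definition hat_weyl :: "('a::euclidean_space \<times> 'b::euclidean_space) set
    \<Rightarrow> ('a \<times> 'b) word set monoid" where
  "hat_weyl R = presented_group (nonisotropic R) (conj_relations R)"

definition hat_w :: "('a::euclidean_space \<times> 'b::euclidean_space) set \<Rightarrow> 'a \<times> 'b
    \<Rightarrow> ('a \<times> 'b) word set" where
  "hat_w R \<alpha> = presented_gen (nonisotropic R) (conj_relations R) \<alpha>"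

definition weyl_proj :: "('a::euclidean_space \<times> 'b::euclidean_space) set \<Rightarrow> ('a \<times> 'b) word set
    \<Rightarrow> ('a, 'b) ext_space \<Rightarrow> ('a, 'b) ext_space" where
  "weyl_proj R = presented_lift (weyl_group R) weyl_refl"

lemma group_general_linear_group: "group (general_linear_group :: ('v::real_vector \<Rightarrow> 'v) monoid)"
proof (rule groupI)
  let ?GL = "general_linear_group :: ('v \<Rightarrow> 'v) monoid"
  show "f \<otimes>\<^bsub>?GL\<^esub> g \<in> carrier ?GL" if "f \<in> carrier ?GL" "g \<in> carrier ?GL" for f g
    using that by (simp add: general_linear_group_def linear_compose bij_comp)
  show "\<one>\<^bsub>?GL\<^esub> \<in> carrier ?GL" by (simp add: general_linear_group_def linear_id)
  show "f \<otimes>\<^bsub>?GL\<^esub> g \<otimes>\<^bsub>?GL\<^esub> h = f \<otimes>\<^bsub>?GL\<^esub> (g \<otimes>\<^bsub>?GL\<^esub> h)" for f g h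
    by (simp add: general_linear_group_def comp_assoc)
  show "\<one>\<^bsub>?GL\<^esub> \<otimes>\<^bsub>?GL\<^esub> f = f" for f by (simp add: general_linear_group_def)
  show "\<exists>g\<in>carrier ?GL. g \<otimes>\<^bsub>?GL\<^esub> f = \<one>\<^bsub>?GL\<^esub>" if "f \<in> carrier ?GL" for f
  proof -
    have f: "linear f" "bij f" using that by (simp_all add: general_linear_group_def)
    obtain g where g: "linear g" "g \<circ> f = id"
      using linear_injective_left_inverse[OF f(1) bij_is_inj[OF f(2)]] by blast
    have "g = inv_into UNIV f"
      using g(2) bij_is_surj[OF f(2)] by (metis comp_assoc comp_id id_comp surj_iff)
    then have "bij g" using bij_imp_bij_inv[OF f(2)] by simp
    then show ?thesis using g by (intro bexI[of _ g]) (simp_all add: general_linear_group_def)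
  qed
qed

lemma weyl_refl_apply:
  "weyl_refl \<alpha> u = u - (2 * ext_form u (\<alpha>, 0) / form \<alpha> \<alpha>) *\<^sub>R (\<alpha>, 0)"
  by (simp add: weyl_refl_def reflection_def ext_form_def form_def blinfun.scaleR_right
      distrib_left add_divide_distrib del: scaleR_Pair)

lemma ext_form_linear:
  "ext_form (u + v) w = ext_form u w + ext_form v w"
  "ext_form (u - v) w = ext_form u w - ext_form v w"
  "ext_form (c *\<^sub>R u) w = c * ext_form u w"
  by (simp_all add: ext_form_def form_def blinfun.add_left blinfun.diff_left blinfun.scaleR_left
      blinfun.add_right blinfun.diff_right blinfun.scaleR_right inner_simps algebra_simps)

lemma ext_form_commute: "ext_form u v = ext_form v u"
  by (simp add: ext_form_def form_def inner_commute)

lemma ext_form_roots: "ext_form (\<alpha>, 0) (\<beta>, 0) = form \<alpha> \<beta>"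
  by (simp add: ext_form_def)

lemma weyl_refl_involution:
  assumes "form \<alpha> \<alpha> \<noteq> 0" shows "weyl_refl \<alpha> (weyl_refl \<alpha> u) = u"
proof -
  have "ext_form (weyl_refl \<alpha> u) (\<alpha>, 0) = - ext_form u (\<alpha>, 0)"
    using assms by (simp add: weyl_refl_apply ext_form_linear ext_form_roots del: scaleR_Pair)
  then show ?thesis
    by (subst weyl_refl_apply) (simp add: weyl_refl_apply del: scaleR_Pair)
qed

lemma linear_weyl_refl: "linear (weyl_refl \<alpha>)"
  by (rule linearI)
    (simp_all add: weyl_refl_apply ext_form_linear scaleR_add_left scaleR_diff_right
      add_divide_distrib distrib_left del: scaleR_Pair)

lemma weyl_refl_GL:
  assumes "form \<alpha> \<alpha> \<noteq> 0" shows "weyl_refl \<alpha> \<in> carrier general_linear_group"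
proof -
  have "weyl_refl \<alpha> \<circ> weyl_refl \<alpha> = id" using weyl_refl_involution[OF assms] by (intro ext) simp
  then have "bij (weyl_refl \<alpha>)" by (intro o_bij)
  then show ?thesis using linear_weyl_refl[of \<alpha>] by (simp add: general_linear_group_def)
qed

lemma weyl_refl_conj:
  assumes "form \<alpha> \<alpha> \<noteq> 0"
  shows "weyl_refl \<alpha> (weyl_refl \<beta> (weyl_refl \<alpha> u)) = weyl_refl (reflection form \<alpha> \<beta>) u"
proof -
  have r: "(reflection form \<alpha> \<beta>, 0) = weyl_refl \<alpha> (\<beta>, 0)"
    by (simp add: weyl_refl_apply ext_form_roots reflection_def form_def)
  have isom: "ext_form (weyl_refl \<alpha> v) (weyl_refl \<alpha> w) = ext_form v w" for v w
  proof -
    have a: "ext_form (weyl_refl \<alpha> v) (\<alpha>, 0) = - ext_form v (\<alpha>, 0)"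
      using assms by (simp add: weyl_refl_apply ext_form_linear ext_form_roots del: scaleR_Pair)
    have "ext_form (weyl_refl \<alpha> w) (weyl_refl \<alpha> v)
        = ext_form w (weyl_refl \<alpha> v) + 2 * ext_form w (\<alpha>, 0) / form \<alpha> \<alpha> * ext_form v (\<alpha>, 0)"
      unfolding weyl_refl_apply[of \<alpha> w] ext_form_linear
        ext_form_commute[of "(\<alpha>, 0)" "weyl_refl \<alpha> v"] a by simp
    also have "ext_form w (weyl_refl \<alpha> v) = ext_form (weyl_refl \<alpha> v) w"
      by (rule ext_form_commute)
    also have "\<dots> = ext_form v w - 2 * ext_form v (\<alpha>, 0) / form \<alpha> \<alpha> * ext_form w (\<alpha>, 0)"
      unfolding weyl_refl_apply[of \<alpha> v] ext_form_linear
        ext_form_commute[of "(\<alpha>, 0)" w] by simp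
    finally show ?thesis unfolding ext_form_commute[of "weyl_refl \<alpha> w"] by simp
  qed
  have f: "form (reflection form \<alpha> \<beta>) (reflection form \<alpha> \<beta>) = form \<beta> \<beta>"
    using isom[of "(\<beta>, 0)" "(\<beta>, 0)"] by (simp add: r[symmetric] ext_form_roots)
  have e: "ext_form u (reflection form \<alpha> \<beta>, 0) = ext_form (weyl_refl \<alpha> u) (\<beta>, 0)"
    unfolding r using isom[of "weyl_refl \<alpha> u" "(\<beta>, 0)"] weyl_refl_involution[OF assms] by simp
  have "weyl_refl \<alpha> (weyl_refl \<beta> (weyl_refl \<alpha> u))
      = weyl_refl \<alpha> (weyl_refl \<alpha> u)
        - (2 * ext_form (weyl_refl \<alpha> u) (\<beta>, 0) / form \<beta> \<beta>) *\<^sub>R weyl_refl \<alpha> (\<beta>, 0)"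
    by (simp only: weyl_refl_apply[of \<beta>] linear_diff[OF linear_weyl_refl]
        linear_scale[OF linear_weyl_refl])
  also have "\<dots> = weyl_refl (reflection form \<alpha> \<beta>) u"
    unfolding weyl_refl_apply[of "reflection form \<alpha> \<beta>"] f e r[symmetric]
    using weyl_refl_involution[OF assms] by simp
  finally show ?thesis .
qed

lemma weyl_proj_epi:
  shows "weyl_proj R \<in> epi (hat_weyl R) (weyl_group R)"
    and "\<And>\<alpha>. \<alpha> \<in> nonisotropic R \<Longrightarrow> weyl_proj R (hat_w R \<alpha>) = weyl_refl \<alpha>"
proof -
  interpret GL: group general_linear_group by (rule group_general_linear_group)
  interpret W: group "weyl_group R"
    unfolding weyl_group_def by (rule GL.group_subgroup_generated)
  let ?Q = "nonisotropic R"
  have ni: "form \<alpha> \<alpha> \<noteq> 0" if "\<alpha> \<in> ?Q" for \<alpha> using that by (simp add: nonisotropic_def)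
  have sub: "weyl_refl ` ?Q \<subseteq> carrier general_linear_group" using ni weyl_refl_GL by auto
  have im: "weyl_refl ` ?Q \<subseteq> carrier (weyl_group R)"
    unfolding weyl_group_def by (rule GL.subgroup_generated_subset_carrier_subset[OF sub])
  have ops: "(\<otimes>\<^bsub>weyl_group R\<^esub>) = (\<circ>)" "\<one>\<^bsub>weyl_group R\<^esub> = id"
    by (simp_all add: weyl_group_def subgroup_generated_def general_linear_group_def)
  have rel: "eval_word (weyl_group R) weyl_refl u = eval_word (weyl_group R) weyl_refl v"
    if "(u, v) \<in> conj_relations R" for u v
    using that
    by (auto simp: conj_relations_def eval_word_def ops fun_eq_iff
        weyl_refl_involution weyl_refl_conj dest!: ni simp del: split_paired_All)
  show gen: "weyl_proj R (hat_w R \<alpha>) = weyl_refl \<alpha>" if "\<alpha> \<in> ?Q" for \<alpha>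
    unfolding weyl_proj_def hat_w_def
    by (rule presented_lift_hom(2)[OF W.is_group im]) (auto intro: rel that)
  have hom: "weyl_proj R \<in> hom (hat_weyl R) (weyl_group R)"
    unfolding weyl_proj_def hat_weyl_def
    by (rule presented_lift_hom(1)[OF W.is_group im]) (auto intro: rel)
  interpret psi: group_hom "hat_weyl R" "weyl_group R" "weyl_proj R"
    using hom group_presented_group[of ?Q "conj_relations R"] W.is_group
    by (simp add: group_hom_def group_hom_axioms_def hat_weyl_def)
  have gen_in: "hat_w R \<alpha> \<in> carrier (hat_weyl R)" if "\<alpha> \<in> ?Q" for \<alpha>
    unfolding hat_w_def hat_weyl_def presented_gen_def presented_carrier
    using that by (intro bexI[of _ "[(\<alpha>, True)]"]) auto
  have img: "subgroup (weyl_proj R ` carrier (hat_weyl R)) (weyl_group R)"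
    by (rule psi.img_is_subgroup)
  have "carrier (weyl_group R) \<subseteq> weyl_proj R ` carrier (hat_weyl R)"
  proof -
    have "subgroup (weyl_proj R ` carrier (hat_weyl R)) general_linear_group"
      using img unfolding weyl_group_def subgroup_generated_def
      by (rule GL.incl_subgroup[OF GL.generate_is_subgroup[OF Int_lower1]])
    moreover have "weyl_refl ` ?Q \<subseteq> weyl_proj R ` carrier (hat_weyl R)"
      using gen gen_in by (metis (no_types, lifting) image_iff image_subsetI)
    ultimately show ?thesis
      using GL.subgroup_generated_minimal unfolding weyl_group_def by blast
  qed
  then show "weyl_proj R \<in> epi (hat_weyl R) (weyl_group R)"
    using hom psi.hom_closed by (auto simp: epi_def)
qed


section \<open>Supports, the elements \<open>z\<^sub>J\<close> and integral collections\<close>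

definition hat_t :: "('a::euclidean_space \<times> 'b::euclidean_space) set \<Rightarrow> 'a \<times> 'b \<Rightarrow> 'b
    \<Rightarrow> ('a \<times> 'b) word set" where
  "hat_t R \<alpha> s = hat_w R (\<alpha> + (0, s)) \<otimes>\<^bsub>hat_weyl R\<^esub> hat_w R \<alpha>"

definition tau :: "(nat \<Rightarrow> 'b::real_vector) \<Rightarrow> nat set \<Rightarrow> 'b" where
  "tau \<sigma> J = (\<Sum>r\<in>J. \<sigma> r)"

text \<open>\<open>I\<close> is the index set of the part of the basis that belongs to \<open>S\<close>.\<close>

definition supp :: "(nat \<Rightarrow> 'b::real_vector) \<Rightarrow> nat set \<Rightarrow> 'b set \<Rightarrow> nat set set" where
  "supp \<sigma> I S = {J. J \<subseteq> I \<and> tau \<sigma> J \<in> S}"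

definition Esupp :: "(nat \<Rightarrow> 'b::real_vector) \<Rightarrow> nat set \<Rightarrow> 'b set \<Rightarrow> nat set set" where
  "Esupp \<sigma> I S = {J \<in> supp \<sigma> I S. card J \<ge> 3}"

definition ordered_prod :: "('g, 'm) monoid_scheme \<Rightarrow> (nat \<Rightarrow> 'g) \<Rightarrow> nat set \<Rightarrow> 'g" where
  "ordered_prod G f J = foldr (\<lambda>r g. f r \<otimes>\<^bsub>G\<^esub> g) (sorted_list_of_set J) \<one>\<^bsub>G\<^esub>"

definition hat_z :: "('a::euclidean_space \<times> 'b::euclidean_space) set \<Rightarrow> nat \<Rightarrow> nat
    \<Rightarrow> (nat \<Rightarrow> 'b) \<Rightarrow> 'b set \<Rightarrow> 'b set \<Rightarrow> 'a \<Rightarrow> 'a \<Rightarrow> 'a \<Rightarrow> 'a \<Rightarrow> nat set \<Rightarrow> ('a \<times> 'b) word set" where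
  "hat_z R t \<nu> \<sigma> S1 S2 \<alpha> \<beta> \<alpha>' \<beta>' J =
     (let G = hat_weyl R; T = (\<lambda>\<gamma>. hat_t R (\<gamma>, 0)) in
      if J \<in> supp \<sigma> {1..t} S1
      then T \<alpha> (- tau \<sigma> J) \<otimes>\<^bsub>G\<^esub> ordered_prod G (\<lambda>r. T \<alpha> (\<sigma> r)) J
      else if card J = 2 \<and> J \<subseteq> {1..t}
      then commutator G (T \<alpha> (\<sigma> (Min J))) (T \<alpha> (\<sigma> (Max J)))
      else if J \<in> supp \<sigma> {t+1..\<nu>} S2
      then T \<beta> (- tau \<sigma> J) \<otimes>\<^bsub>G\<^esub> ordered_prod G (\<lambda>r. T \<beta> (\<sigma> r)) J
      else if card J = 2 \<and> J \<subseteq> {t+1..\<nu>}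
      then commutator G (T \<beta> (\<sigma> (Min J))) (T \<beta> (\<sigma> (Max J)))
      else if card J = 2 \<and> Min J \<in> {1..t} \<and> Max J \<in> {t+1..\<nu>}
      then commutator G (T \<beta>' (\<sigma> (Max J))) (T \<alpha>' (\<sigma> (Min J)))
      else \<one>\<^bsub>G\<^esub>)"

definition index_sets :: "root_type \<Rightarrow> nat \<Rightarrow> nat \<Rightarrow> (nat \<Rightarrow> 'b::real_vector) \<Rightarrow> 'b set \<Rightarrow> 'b set
    \<Rightarrow> nat set set" where
  "index_sets X t \<nu> \<sigma> S1 S2 =
     (case X of
        TypeB l \<Rightarrow> if l = 2 then Esupp \<sigma> {1..t} S1 \<union> Esupp \<sigma> {t+1..\<nu>} S2 else Esupp \<sigma> {1..t} S1
      | TypeC l \<Rightarrow> Esupp \<sigma> {t+1..\<nu>} S2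
      | TypeF4 \<Rightarrow> {}
      | TypeG2 \<Rightarrow> {})"

definition Delta :: "nat \<Rightarrow> nat \<Rightarrow> (nat \<Rightarrow> 'b::real_vector) \<Rightarrow> 'b set \<Rightarrow> 'b set \<Rightarrow> nat \<Rightarrow> nat \<Rightarrow> real"
  where
  "Delta t \<nu> \<sigma> S1 S2 r s =
     (if r \<in> {1..t} \<and> s \<in> {t+1..\<nu>} then 1
      else if {r, s} \<in> supp \<sigma> {1..t} S1 \<or> {r, s} \<in> supp \<sigma> {t+1..\<nu>} S2 then 1
      else 2)"

definition chi :: "nat set \<Rightarrow> nat \<Rightarrow> nat \<Rightarrow> int" where
  "chi J r s = (if {r, s} \<subset> J then 1 else 0)"

definition eps_bar :: "root_type \<Rightarrow> nat \<Rightarrow> nat \<Rightarrow> (nat \<Rightarrow> 'b::real_vector) \<Rightarrow> 'b set \<Rightarrow> 'b set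
    \<Rightarrow> (nat set \<Rightarrow> int) \<Rightarrow> nat \<Rightarrow> nat \<Rightarrow> real" where
  "eps_bar X t \<nu> \<sigma> S1 S2 \<epsilon> r s =
     inverse (Delta t \<nu> \<sigma> S1 S2 r s) * of_int (\<Sum>J\<in>index_sets X t \<nu> \<sigma> S1 S2. chi J r s * \<epsilon> J)"

definition index_pairs :: "nat \<Rightarrow> (nat \<times> nat) set" where
  "index_pairs \<nu> = {(r, s). 1 \<le> r \<and> r < s \<and> s \<le> \<nu>}"

text \<open>Families indexed by the index sets are extensional functions, so that each family is a
  single element.\<close>

definition integral_collections :: "root_type \<Rightarrow> nat \<Rightarrow> nat \<Rightarrow> (nat \<Rightarrow> 'b::real_vector) \<Rightarrow> 'b set
    \<Rightarrow> 'b set \<Rightarrow> (nat set \<Rightarrow> int) set" where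
  "integral_collections X t \<nu> \<sigma> S1 S2 =
     {\<epsilon> \<in> index_sets X t \<nu> \<sigma> S1 S2 \<rightarrow>\<^sub>E {0, 1}.
        \<forall>(r, s)\<in>index_pairs \<nu>. eps_bar X t \<nu> \<sigma> S1 S2 \<epsilon> r s \<in> \<int>}"

text \<open>The factors are central, so the unordered products are taken in the center. The exponent
  \<open>eps_bar\<close> is an integer for integral collections; the floor only converts its type.\<close>

definition hat_u :: "root_type \<Rightarrow> ('a::euclidean_space \<times> 'b::euclidean_space) set \<Rightarrow> nat \<Rightarrow> nat
    \<Rightarrow> (nat \<Rightarrow> 'b) \<Rightarrow> 'b set \<Rightarrow> 'b set \<Rightarrow> 'a \<Rightarrow> 'a \<Rightarrow> 'a \<Rightarrow> 'a \<Rightarrow> (nat set \<Rightarrow> int) \<Rightarrow> ('a \<times> 'b) word set" where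
  "hat_u X R t \<nu> \<sigma> S1 S2 \<alpha> \<beta> \<alpha>' \<beta>' \<epsilon> =
     (let G = hat_weyl R; Z = G\<lparr>carrier := group_center G\<rparr>;
          z = hat_z R t \<nu> \<sigma> S1 S2 \<alpha> \<beta> \<alpha>' \<beta>' in
      finprod Z (\<lambda>(r, s). z {r, s} [^]\<^bsub>G\<^esub> (- \<lfloor>eps_bar X t \<nu> \<sigma> S1 S2 \<epsilon> r s\<rfloor>)) (index_pairs \<nu>)
      \<otimes>\<^bsub>G\<^esub> finprod Z (\<lambda>J. z J [^]\<^bsub>G\<^esub> \<epsilon> J) (index_sets X t \<nu> \<sigma> S1 S2))"

end

theory Submission
  imports Defs
begin

text \<open>
The presented group \<open>G\<close> acts on \<open>V\<close> through \<open>\<psi>\<close>, and its relations say that conjugation by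
an element \<open>u\<close> permutes the generators in the way \<open>u\<close> permutes the roots (\<open>act_root_conj\<close>). Hence
an element that acts trivially on \<open>V\<close> is central. Conversely a central element can only change the
sign of a root, and it cannot do so because it fixes the radical. So the center is the kernel \<open>K\<close>
of the action on \<open>V\<close>. On an element of \<open>K\<close> the only further information in \<open>\<psi>\<close> is a linear map
from the dual of the radical to \<open>V\<close>, its \<open>shear\<close>; shears add up under multiplication, so central
elements of finite order lie in the kernel of \<open>\<psi>\<close>. What remains is to describe \<open>K\<close> by generators
and relations and to see which of its elements have zero shear.

Generators. The finite Weyl group is presented by conjugation, by the exchange argument
(\<open>wprod_trivial\<close>), so \<open>K\<close> consists of products of translations \<open>t \<alpha> \<sigma>\<close>. The key relation
\<open>t_add\<close> comes from conjugating a reflection by a translation: the commutator of \<open>t \<gamma> \<sigma>\<close> and \<open>t \<alpha> \<tau>\<close>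
is the defect \<open>t \<alpha> (\<tau> + c \<sigma>) (t \<alpha> \<tau> t \<alpha> (c \<sigma>))\<inverse>\<close>, where \<open>c\<close> is the pairing of \<open>\<alpha>\<close> with
\<open>\<gamma>\<close>. Being central, this defect depends only on the length of \<open>\<alpha>\<close>, so
all commutators and all defects lie in the group \<open>Z0\<close> generated by the \<open>z\<^sub>J\<close> with \<open>J\<close> a pair or an
index of an integral collection. Modulo \<open>Z0\<close> the translations along the simple roots in the basis
directions generate a group in which coordinates can be read off from the action, and an element of
\<open>K\<close> has zero coordinates. Therefore \<open>K = Z0\<close> (\<open>K_eq_Z0\<close>).

Relations. Comparing two expressions for \<open>t \<gamma> (2 \<tau>\<^sub>J)\<close> shows that the square of \<open>z\<^sub>J\<close> is the
product of the commutators of the translations in the directions of the pairs inside \<open>J\<close>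
(\<open>zz_square\<close>), so that every element of \<open>K\<close> is a product of powers of the \<open>z\<close> of pairs and of the
\<open>z\<^sub>J\<close> with exponents \<open>0\<close> or \<open>1\<close>, and the elements \<open>u(\<epsilon>)\<close> have square one. The shears of the \<open>z\<close> of
pairs are multiples of the linearly independent bivectors \<open>\<sigma>\<^sub>r \<and> \<sigma>\<^sub>s\<close>. If an element of \<open>K\<close> has zero
shear, then so has its square, which involves the pairs only; the vanishing of all exponents of the
square is the integrality condition and forces the element to be \<open>u(\<epsilon>)\<close>.

Independence. The relations of \<open>G\<close> only identify generators of roots in one orbit, so every function
on the orbits with values \<open>1\<close> and \<open>-1\<close> extends to a character. For each index \<open>J\<close> the roots with
translation part congruent to \<open>\<tau>\<^sub>J\<close> form such an orbit-invariant set, and the resulting character is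
\<open>-1\<close> on \<open>z\<^sub>J\<close> and \<open>1\<close> on all other generators of \<open>Z0\<close>; it recovers \<open>\<epsilon>\<^sub>J\<close> from \<open>u(\<epsilon>)\<close>.
\<close>

section \<open>Reflections and pairings\<close>

definition pairing :: "'a::euclidean_space \<Rightarrow> 'a \<Rightarrow> real" where
  "pairing \<beta> \<alpha> = 2 * (\<beta> \<bullet> \<alpha>) / (\<alpha> \<bullet> \<alpha>)"

abbreviation rfl :: "'a::euclidean_space \<Rightarrow> 'a \<Rightarrow> 'a" where
  "rfl \<equiv> reflection (\<bullet>)"

lemma rfl_eq: "rfl \<alpha> \<beta> = \<beta> - pairing \<beta> \<alpha> *\<^sub>R \<alpha>"
  by (simp add: reflection_def pairing_def)

lemma reflection_form_eq:
  "reflection form (\<alpha>, \<sigma>) (\<beta>, \<tau>) = (rfl \<alpha> \<beta>, \<tau> - pairing \<beta> \<alpha> *\<^sub>R \<sigma>)"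
  by (simp add: reflection_def pairing_def form_def)

lemma weyl_refl_eq:
  "weyl_refl (\<alpha>, \<sigma>) ((x, y), l)
     = ((x - (pairing x \<alpha> + 2 * blinfun_apply l \<sigma> / (\<alpha> \<bullet> \<alpha>)) *\<^sub>R \<alpha>,
         y - (pairing x \<alpha> + 2 * blinfun_apply l \<sigma> / (\<alpha> \<bullet> \<alpha>)) *\<^sub>R \<sigma>), l)"
  by (simp add: weyl_refl_apply ext_form_def form_def pairing_def add_divide_distrib distrib_left)

lemma pairing_simps:
  "pairing (x + y) \<alpha> = pairing x \<alpha> + pairing y \<alpha>"
  "pairing (x - y) \<alpha> = pairing x \<alpha> - pairing y \<alpha>"
  "pairing (c *\<^sub>R x) \<alpha> = c * pairing x \<alpha>"
  "pairing (- x) \<alpha> = - pairing x \<alpha>"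
  "pairing x (- \<alpha>) = - pairing x \<alpha>"
  "pairing 0 \<alpha> = 0"
  by (simp_all add: pairing_def inner_simps add_divide_distrib diff_divide_distrib right_diff_distrib distrib_left)

lemma pairing_self: "\<alpha> \<noteq> 0 \<Longrightarrow> pairing \<alpha> \<alpha> = 2"
  by (simp add: pairing_def)

lemma rfl_simps:
  "rfl \<alpha> (x + y) = rfl \<alpha> x + rfl \<alpha> y"
  "rfl \<alpha> (x - y) = rfl \<alpha> x - rfl \<alpha> y"
  "rfl \<alpha> (c *\<^sub>R x) = c *\<^sub>R rfl \<alpha> x"
  "rfl \<alpha> (- x) = - rfl \<alpha> x"
  "rfl \<alpha> 0 = 0"
  by (simp_all add: rfl_eq pairing_simps algebra_simps)

lemma rfl_self: "\<alpha> \<noteq> 0 \<Longrightarrow> rfl \<alpha> \<alpha> = - \<alpha>"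
  by (simp add: rfl_eq pairing_self scaleR_2)

lemma rfl_rfl: "\<alpha> \<noteq> 0 \<Longrightarrow> rfl \<alpha> (rfl \<alpha> x) = x"
  by (subst (2) rfl_eq) (simp add: rfl_simps rfl_self, simp add: rfl_eq)

lemma rfl_inner: "\<alpha> \<noteq> 0 \<Longrightarrow> rfl \<alpha> x \<bullet> rfl \<alpha> y = x \<bullet> y"
  by (simp add: rfl_eq pairing_def inner_simps field_simps inner_commute)

section \<open>Conjugation in the presented group\<close>

text \<open>Only two features of an extended affine root system matter for the relations among its reflections:
each root \<open>\<alpha>\<close> of \<open>\<Phi>\<close> carries a set \<open>L \<alpha>\<close> of translations, and reflections respect these sets. The
latter is the last assumption.\<close>

locale fibred_roots =
  fixes \<Phi> :: "'a::euclidean_space set" and L :: "'a \<Rightarrow> 'b::euclidean_space set"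
    and R :: "('a \<times> 'b) set"
  assumes roots: "root_system \<Phi>"
    and nonisotropic_eq: "nonisotropic R = {(\<alpha>, \<sigma>). \<alpha> \<in> \<Phi> \<and> \<sigma> \<in> L \<alpha>}"
    and fibre_zero: "\<alpha> \<in> \<Phi> \<Longrightarrow> 0 \<in> L \<alpha>"
    and fibre_rfl: "\<lbrakk>\<alpha> \<in> \<Phi>; \<beta> \<in> \<Phi>; \<sigma> \<in> L \<alpha>; \<tau> \<in> L \<beta>\<rbrakk> \<Longrightarrow> \<tau> - pairing \<beta> \<alpha> *\<^sub>R \<sigma> \<in> L (rfl \<alpha> \<beta>)"
begin

lemma root_nz: "\<alpha> \<in> \<Phi> \<Longrightarrow> \<alpha> \<noteq> 0" 
  using roots by (auto simp: root_system_def)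

lemma rfl_root: "\<alpha> \<in> \<Phi> \<Longrightarrow> \<beta> \<in> \<Phi> \<Longrightarrow> rfl \<alpha> \<beta> \<in> \<Phi>" 
  using roots by (auto simp: root_system_def)

lemma neg_root: "\<alpha> \<in> \<Phi> \<Longrightarrow> - \<alpha> \<in> \<Phi>" 
  using rfl_root[of \<alpha> \<alpha>] by (simp add: rfl_self root_nz)

lemma fibre_rfl_eq:
  assumes "\<alpha> \<in> \<Phi>" "\<beta> \<in> \<Phi>" shows "L (rfl \<alpha> \<beta>) = L \<beta>"
proof -
  have *: "L \<gamma> \<subseteq> L (rfl \<alpha> \<gamma>)" if "\<gamma> \<in> \<Phi>" for \<gamma>
    using fibre_rfl[OF assms(1) that fibre_zero[OF assms(1)]] by auto
  from *[OF assms(2)] *[OF rfl_root[OF assms]] show ?thesis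
    using assms by (simp add: rfl_rfl root_nz)
qed

lemma fibre_diff: "\<lbrakk>\<alpha> \<in> \<Phi>; \<beta> \<in> \<Phi>; \<sigma> \<in> L \<alpha>; \<tau> \<in> L \<beta>\<rbrakk> \<Longrightarrow> \<tau> - pairing \<beta> \<alpha> *\<^sub>R \<sigma> \<in> L \<beta>"
  using fibre_rfl fibre_rfl_eq by metis

lemma fibre_neg: "\<alpha> \<in> \<Phi> \<Longrightarrow> \<sigma> \<in> L \<alpha> \<Longrightarrow> - \<sigma> \<in> L \<alpha>"
  using fibre_diff[of \<alpha> \<alpha> \<sigma> \<sigma>] by (simp add: pairing_self root_nz scaleR_2)

lemma fibre_minus: "\<alpha> \<in> \<Phi> \<Longrightarrow> L (- \<alpha>) = L \<alpha>"
  using fibre_rfl_eq[of \<alpha> \<alpha>] by (simp add: rfl_self root_nz)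

lemma fibre_add: "\<lbrakk>\<alpha> \<in> \<Phi>; \<beta> \<in> \<Phi>; \<sigma> \<in> L \<alpha>; \<tau> \<in> L \<beta>\<rbrakk> \<Longrightarrow> \<tau> + pairing \<beta> \<alpha> *\<^sub>R \<sigma> \<in> L \<beta>"
  using fibre_diff[of \<alpha> \<beta> "- \<sigma>" \<tau>] fibre_neg by simp

lemma fibre_scale: "\<lbrakk>\<alpha> \<in> \<Phi>; \<beta> \<in> \<Phi>; \<sigma> \<in> L \<alpha>\<rbrakk> \<Longrightarrow> pairing \<beta> \<alpha> *\<^sub>R \<sigma> \<in> L \<beta>"
  using fibre_add[of \<alpha> \<beta> \<sigma> 0] fibre_zero by simp

abbreviation G :: "('a \<times> 'b) word set monoid" where "G \<equiv> hat_weyl R"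
abbreviation W :: "(('a, 'b) ext_space \<Rightarrow> ('a, 'b) ext_space) monoid" where "W \<equiv> weyl_group R"
abbreviation \<psi> where "\<psi> \<equiv> weyl_proj R"
abbreviation w :: "'a \<Rightarrow> 'b \<Rightarrow> ('a \<times> 'b) word set" where "w \<alpha> \<sigma> \<equiv> hat_w R (\<alpha>, \<sigma>)"
abbreviation t :: "'a \<Rightarrow> 'b \<Rightarrow> ('a \<times> 'b) word set" where "t \<alpha> \<sigma> \<equiv> hat_t R (\<alpha>, 0) \<sigma>"

sublocale G: group G
  unfolding hat_weyl_def by (rule group_presented_group)

sublocale W: group W
  unfolding weyl_group_def by (rule group.group_subgroup_generated[OF group_general_linear_group])

lemma nonisotropicI: "\<alpha> \<in> \<Phi> \<Longrightarrow> \<sigma> \<in> L \<alpha> \<Longrightarrow> (\<alpha>, \<sigma>) \<in> nonisotropic R"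
  by (simp add: nonisotropic_eq)

lemma w_closed [simp]: "\<alpha> \<in> \<Phi> \<Longrightarrow> \<sigma> \<in> L \<alpha> \<Longrightarrow> w \<alpha> \<sigma> \<in> carrier G"
  unfolding hat_w_def hat_weyl_def presented_gen_def presented_carrier
  using nonisotropicI by (intro bexI[of _ "[((\<alpha>, \<sigma>), True)]"]) auto

lemma w_square [simp]: assumes "\<alpha> \<in> \<Phi>" "\<sigma> \<in> L \<alpha>" shows "w \<alpha> \<sigma> \<otimes>\<^bsub>G\<^esub> w \<alpha> \<sigma> = \<one>\<^bsub>G\<^esub>"
proof -
  let ?X = "nonisotropic R" and ?E = "conj_relations R" and ?a = "[((\<alpha>, \<sigma>), True)]"
  have a: "?a \<in> lists (?X \<times> UNIV)" using nonisotropicI[OF assms] by auto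
  have "(?a @ ?a, []) \<in> word_cong ?X ?E"
    using nonisotropicI[OF assms] by (intro word_cong.relation) (auto simp: conj_relations_def)
  from equiv_class_eq[OF equiv_word_cong this] show ?thesis
    unfolding hat_w_def presented_gen_def hat_weyl_def presented_mult[OF a a]
    by (simp add: presented_group_def)
qed

lemma w_conj_w:
  assumes "\<alpha> \<in> \<Phi>" "\<sigma> \<in> L \<alpha>" "\<beta> \<in> \<Phi>" "\<tau> \<in> L \<beta>"
  shows "w \<alpha> \<sigma> \<otimes>\<^bsub>G\<^esub> w \<beta> \<tau> \<otimes>\<^bsub>G\<^esub> w \<alpha> \<sigma> = w (rfl \<alpha> \<beta>) (\<tau> - pairing \<beta> \<alpha> *\<^sub>R \<sigma>)"
proof -
  let ?X = "nonisotropic R" and ?E = "conj_relations R" and ?a = "[((\<alpha>, \<sigma>), True)]"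
    and ?b = "[((\<beta>, \<tau>), True)]" and ?c = "[((rfl \<alpha> \<beta>, \<tau> - pairing \<beta> \<alpha> *\<^sub>R \<sigma>), True)]"
  have ab: "?a \<in> lists (?X \<times> UNIV)" "?b \<in> lists (?X \<times> UNIV)" "?a @ ?b \<in> lists (?X \<times> UNIV)"
    using nonisotropicI assms by auto
  have c: "?c \<in> lists (?X \<times> UNIV)"
    using nonisotropicI assms fibre_rfl rfl_root by auto
  have "((?a @ ?b) @ ?a, ?c) \<in> word_cong ?X ?E"
    using c nonisotropicI assms
    by (intro word_cong.relation) (force simp: conj_relations_def reflection_form_eq)+
  from equiv_class_eq[OF equiv_word_cong this] show ?thesis
    unfolding hat_w_def presented_gen_def hat_weyl_def presented_mult[OF ab(1,2)]
     presented_mult[OF ab(3,1)] by simp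
qed

text \<open>The generators are involutions, so every element is a product of generators without inverses.\<close>

lemma G_induct [consumes 1, case_names one mult]:
  assumes u: "u \<in> carrier G" and one: "P \<one>\<^bsub>G\<^esub>"
    and mult: "\<And>\<alpha> \<sigma> v. \<alpha> \<in> \<Phi> \<Longrightarrow> \<sigma> \<in> L \<alpha> \<Longrightarrow> v \<in> carrier G \<Longrightarrow> P v \<Longrightarrow> P (w \<alpha> \<sigma> \<otimes>\<^bsub>G\<^esub> v)"
  shows "P u"
proof -
  let ?X = "nonisotropic R" and ?E = "conj_relations R"
  have "word_cong ?X ?E `` {l} \<in> carrier G \<and> P (word_cong ?X ?E `` {l})"
    if "l \<in> lists (?X \<times> UNIV)" for l
    using that
  proof (induction l)
    case Nil
    show ?case using one G.one_closed by (simp add: hat_weyl_def presented_group_def)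
  next
    case (Cons p l)
    obtain \<alpha> \<sigma> b where p: "p = ((\<alpha>, \<sigma>), b)" by (metis prod.exhaust)
    let ?v = "word_cong ?X ?E `` {l}"
    have as: "\<alpha> \<in> \<Phi>" "\<sigma> \<in> L \<alpha>" "(\<alpha>, \<sigma>) \<in> ?X" using Cons p by (auto simp: nonisotropic_eq)
    have x: "[((\<alpha>, \<sigma>), c)] \<in> lists (?X \<times> UNIV)" for c :: bool using as by auto
    have IH: "?v \<in> carrier G" "P ?v" using Cons by auto
    have inv: "word_cong ?X ?E `` {[((\<alpha>, \<sigma>), False)]} = inv\<^bsub>G\<^esub> (w \<alpha> \<sigma>)"
    proof -
      have "([((\<alpha>, \<sigma>), False)] @ [((\<alpha>, \<sigma>), True)], []) \<in> word_cong ?X ?E"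
        using word_cong.cancel[OF as(3), of False] by simp
      from equiv_class_eq[OF equiv_word_cong this]
      have "word_cong ?X ?E `` {[((\<alpha>, \<sigma>), False)]} \<otimes>\<^bsub>G\<^esub> w \<alpha> \<sigma> = \<one>\<^bsub>G\<^esub>"
        unfolding hat_w_def presented_gen_def hat_weyl_def presented_mult[OF x x]
        by (simp add: presented_group_def)
      moreover have "word_cong ?X ?E `` {[((\<alpha>, \<sigma>), False)]} \<in> carrier G"
        unfolding hat_weyl_def presented_carrier using x by blast
      ultimately show ?thesis using as G.inv_equality by simp
    qed
    have "word_cong ?X ?E `` {[p]} = w \<alpha> \<sigma>"
    proof (cases b)
      case True then show ?thesis by (simp add: hat_w_def presented_gen_def p)
    next
      case False
      then show ?thesis using inv as G.inv_equality[OF w_square] by (simp add: p)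
    qed
    then have "word_cong ?X ?E `` {p # l} = w \<alpha> \<sigma> \<otimes>\<^bsub>G\<^esub> ?v"
      using presented_mult[of "[p]" ?X l ?E] x Cons p as by (simp add: hat_weyl_def)
    then show ?case using mult[OF as(1,2) IH] IH as by simp
  qed
  then show ?thesis using u unfolding hat_weyl_def presented_carrier by auto
qed

lemma psi_hom: "\<psi> \<in> hom G W" using weyl_proj_epi(1)[of R] by (simp add: epi_def)

sublocale psi: group_hom G W \<psi>
  by unfold_locales (rule psi_hom)

declare psi.hom_mult [simp del] psi.hom_one [simp del]

lemma W_mult: "x \<otimes>\<^bsub>W\<^esub> y = x \<circ> y" and W_one: "\<one>\<^bsub>W\<^esub> = id"
  by (simp_all add: weyl_group_def subgroup_generated_def general_linear_group_def)

lemma psi_mult [simp]: "u \<in> carrier G \<Longrightarrow> v \<in> carrier G \<Longrightarrow> \<psi> (u \<otimes>\<^bsub>G\<^esub> v) x = \<psi> u (\<psi> v x)"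
  by (simp add: W_mult psi.hom_mult)

lemma psi_one [simp]: "\<psi> \<one>\<^bsub>G\<^esub> x = x"
  by (simp add: W_one psi.hom_one)

lemma psi_w: "\<alpha> \<in> \<Phi> \<Longrightarrow> \<sigma> \<in> L \<alpha> \<Longrightarrow> \<psi> (w \<alpha> \<sigma>) = weyl_refl (\<alpha>, \<sigma>)"
  using weyl_proj_epi(2) nonisotropicI by blast

lemma psi_linear: assumes "u \<in> carrier G" shows "linear (\<psi> u)"
  using assms
proof (induction rule: G_induct)
  case one then show ?case using linear_id by (simp only: W_one psi.hom_one)
next
  case (mult \<alpha> \<sigma> v)
  have "\<psi> (w \<alpha> \<sigma> \<otimes>\<^bsub>G\<^esub> v) = weyl_refl (\<alpha>, \<sigma>) \<circ> \<psi> v"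
    using mult psi_w[of \<alpha> \<sigma>] psi.hom_mult[of "w \<alpha> \<sigma>" v] by (simp add: W_mult)
  then show ?case using mult(4) linear_weyl_refl linear_compose by metis
qed

text \<open>Reflections add multiples of roots, hence they preserve \<open>V\<close>, the vectors without a component in
the dual of the radical.\<close>

definition act :: "('a \<times> 'b) word set \<Rightarrow> 'a \<times> 'b \<Rightarrow> 'a \<times> 'b" where
  "act u v = fst (\<psi> u (v, 0))"

lemma snd_psi: assumes "u \<in> carrier G" shows "snd (\<psi> u x) = snd x"
  using assms
proof (induction rule: G_induct)
  case (mult \<alpha> \<sigma> v)
  obtain a b c where "\<psi> v x = ((a, b), c)" by (metis prod.exhaust)
  then show ?case using mult by (simp add: psi_w weyl_refl_eq)
qed simp

lemma psi_act: "u \<in> carrier G \<Longrightarrow> \<psi> u (v, 0) = (act u v, 0)"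
  using snd_psi[of u "(v, 0)"] by (simp add: act_def prod_eq_iff)

lemma act_mult [simp]: "u \<in> carrier G \<Longrightarrow> v \<in> carrier G \<Longrightarrow> act (u \<otimes>\<^bsub>G\<^esub> v) x = act u (act v x)"
  by (metis act_def psi_act psi_mult)

lemma act_one [simp]: "act \<one>\<^bsub>G\<^esub> x = x" by (simp add: act_def)

lemma act_w: "\<alpha> \<in> \<Phi> \<Longrightarrow> \<sigma> \<in> L \<alpha> \<Longrightarrow> act (w \<alpha> \<sigma>) (x, y) = (rfl \<alpha> x, y - pairing x \<alpha> *\<^sub>R \<sigma>)"
  by (simp add: act_def psi_w weyl_refl_eq rfl_eq)

lemma act_inv [simp]: "u \<in> carrier G \<Longrightarrow> act (inv\<^bsub>G\<^esub> u) (act u x) = x"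
  using act_mult[of "inv\<^bsub>G\<^esub> u" u x] by (simp del: act_mult)

lemma act_inv' [simp]: "u \<in> carrier G \<Longrightarrow> act u (act (inv\<^bsub>G\<^esub> u) x) = x"
  using act_mult[of u "inv\<^bsub>G\<^esub> u" x] by (simp del: act_mult)

text \<open>The defining relations express this for a generator \<open>u\<close>, and both sides are compatible with
products. All later relations are instances.\<close>

lemma act_root_conj:
  assumes "u \<in> carrier G" "\<beta> \<in> \<Phi>" "\<tau> \<in> L \<beta>" "act u (\<beta>, \<tau>) = (\<gamma>, \<delta>)"
  shows "\<gamma> \<in> \<Phi> \<and> \<delta> \<in> L \<gamma> \<and> u \<otimes>\<^bsub>G\<^esub> w \<beta> \<tau> \<otimes>\<^bsub>G\<^esub> inv\<^bsub>G\<^esub> u = w \<gamma> \<delta>"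
  using assms
proof (induction arbitrary: \<gamma> \<delta> rule: G_induct)
  case one then show ?case by simp
next
  case (mult \<alpha> \<sigma> v)
  obtain \<gamma>' \<delta>' where v: "act v (\<beta>, \<tau>) = (\<gamma>', \<delta>')" by (metis prod.exhaust)
  from mult.IH[OF mult.prems(1,2) v] have IH: "\<gamma>' \<in> \<Phi>" "\<delta>' \<in> L \<gamma>'"
    "v \<otimes>\<^bsub>G\<^esub> w \<beta> \<tau> \<otimes>\<^bsub>G\<^esub> inv\<^bsub>G\<^esub> v = w \<gamma>' \<delta>'" by auto
  have e: "\<gamma> = rfl \<alpha> \<gamma>'" "\<delta> = \<delta>' - pairing \<gamma>' \<alpha> *\<^sub>R \<sigma>"
    using mult v act_w[of \<alpha> \<sigma>] by auto
  have inv: "inv\<^bsub>G\<^esub> (w \<alpha> \<sigma>) = w \<alpha> \<sigma>" using mult G.inv_equality[OF w_square] by simp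
  have "(w \<alpha> \<sigma> \<otimes>\<^bsub>G\<^esub> v) \<otimes>\<^bsub>G\<^esub> w \<beta> \<tau> \<otimes>\<^bsub>G\<^esub> inv\<^bsub>G\<^esub> (w \<alpha> \<sigma> \<otimes>\<^bsub>G\<^esub> v)
      = w \<alpha> \<sigma> \<otimes>\<^bsub>G\<^esub> (v \<otimes>\<^bsub>G\<^esub> w \<beta> \<tau> \<otimes>\<^bsub>G\<^esub> inv\<^bsub>G\<^esub> v) \<otimes>\<^bsub>G\<^esub> w \<alpha> \<sigma>"
    using mult by (simp add: G.inv_mult_group inv G.m_assoc)
  also have "\<dots> = w \<gamma> \<delta>" unfolding IH(3) e using mult IH by (simp add: w_conj_w)
  finally show ?case using mult IH e fibre_rfl rfl_root by simp
qed

end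

section \<open>Commutators and the center\<close>

lemma (in group) inv_cancel_left [simp]:
  assumes "x \<in> carrier G" "y \<in> carrier G"
  shows "x \<otimes> (inv x \<otimes> y) = y" "inv x \<otimes> (x \<otimes> y) = y"
  using assms by (simp_all add: m_assoc[symmetric])

lemma (in group) commutator_closed [simp]:
  "x \<in> carrier G \<Longrightarrow> y \<in> carrier G \<Longrightarrow> commutator G x y \<in> carrier G"
  by (simp add: commutator_def)

lemma (in group) mult_commutator:
  assumes "x \<in> carrier G" "y \<in> carrier G" shows "x \<otimes> y = y \<otimes> x \<otimes> commutator G x y"
  using assms by (simp add: commutator_def m_assoc)

lemma (in group) commutator_eqI:
  assumes "x \<in> carrier G" "y \<in> carrier G" "c \<in> carrier G" "x \<otimes> y = y \<otimes> x \<otimes> c"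
  shows "commutator G x y = c"
  using assms mult_commutator[of x y] by (metis commutator_closed Units_eq Units_l_cancel m_closed)

lemma (in group) commutator_inverse:
  assumes "x \<in> carrier G" "y \<in> carrier G" 
  shows "commutator G y x = inv (commutator G x y)"
  using assms by (simp add: commutator_def inv_mult_group m_assoc)

lemma (in group) centerD: "c \<in> group_center G \<Longrightarrow> x \<in> carrier G \<Longrightarrow> c \<otimes> x = x \<otimes> c"
  by (simp add: group_center_def)

lemma (in group) center_carrier: "c \<in> group_center G \<Longrightarrow> c \<in> carrier G"
  by (simp add: group_center_def)

lemma (in group) center_lcomm:
  "c \<in> group_center G \<Longrightarrow> x \<in> carrier G \<Longrightarrow> y \<in> carrier G \<Longrightarrow> x \<otimes> (c \<otimes> y) = c \<otimes> (x \<otimes> y)"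
  using centerD[of c x] center_carrier[of c] by (metis m_assoc)

lemma (in group) commutator_mult_left:
  assumes "x \<in> carrier G" "x' \<in> carrier G" "y \<in> carrier G"
    "commutator G x y \<in> group_center G" "commutator G x' y \<in> group_center G"
  shows "commutator G (x \<otimes> x') y = commutator G x y \<otimes> commutator G x' y"
proof (rule commutator_eqI)
  let ?c = "commutator G x y" and ?d = "commutator G x' y"
  have cd: "?c \<in> carrier G" "?d \<in> carrier G" using assms by auto
  have "x \<otimes> x' \<otimes> y = x \<otimes> (y \<otimes> x' \<otimes> ?d)"
    using assms mult_commutator[of x' y] by (simp add: m_assoc)
  also have "\<dots> = (y \<otimes> x \<otimes> ?c) \<otimes> x' \<otimes> ?d"
    using assms mult_commutator[of x y] cd by (simp add: m_assoc[symmetric])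
  also have "\<dots> = y \<otimes> (x \<otimes> x') \<otimes> (?c \<otimes> ?d)"
    using assms cd by (simp add: m_assoc center_lcomm[OF assms(4), of x'])
  finally show "x \<otimes> x' \<otimes> y = y \<otimes> (x \<otimes> x') \<otimes> (?c \<otimes> ?d)" .
qed (use assms in auto)

lemma (in group) commutator_inv_left:
  assumes "x \<in> carrier G" "y \<in> carrier G" "commutator G x y \<in> group_center G"
  shows "commutator G (inv x) y = inv (commutator G x y)"
proof (rule commutator_eqI)
  let ?c = "commutator G x y"
  have "x \<otimes> (y \<otimes> inv x \<otimes> inv ?c) = (y \<otimes> x \<otimes> ?c) \<otimes> inv x \<otimes> inv ?c"
    using assms mult_commutator[of x y] by (simp add: m_assoc[symmetric])
  also have "\<dots> = y" using assms by (simp add: m_assoc center_lcomm centerD)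
  finally have "inv x \<otimes> y = inv x \<otimes> (x \<otimes> (y \<otimes> inv x \<otimes> inv ?c))" by simp
  then show "inv x \<otimes> y = y \<otimes> inv x \<otimes> inv ?c"
    using assms by (simp add: m_assoc[symmetric])
qed (use assms in auto)

lemma (in group) subgroup_center: "subgroup (group_center G) G"
proof (rule subgroupI)
  show "group_center G \<subseteq> carrier G" "group_center G \<noteq> {}"
    by (auto simp: group_center_def intro!: exI[of _ \<one>])
  show "inv a \<in> group_center G" if "a \<in> group_center G" for a
    using that by (auto simp: group_center_def) (metis inv_closed inv_mult_group inv_inv)
  show "a \<otimes> b \<in> group_center G" if ab: "a \<in> group_center G" "b \<in> group_center G" for a b
  proof -
    have c: "a \<in> carrier G" "b \<in> carrier G" using ab center_carrier by auto
    have "a \<otimes> b \<otimes> g = g \<otimes> (a \<otimes> b)" if g: "g \<in> carrier G" for g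
    proof -
      have "a \<otimes> b \<otimes> g = a \<otimes> (g \<otimes> b)" using c g centerD[OF ab(2) g] by (simp add: m_assoc)
      also have "\<dots> = g \<otimes> (a \<otimes> b)" using c g centerD[OF ab(1) g] by (metis m_assoc)
      finally show ?thesis .
    qed
    then show ?thesis using c by (simp add: group_center_def)
  qed
qed

section \<open>Translations and the kernel of the action\<close>

context fibred_roots begin

lemma t_closed [simp]: "\<alpha> \<in> \<Phi> \<Longrightarrow> \<sigma> \<in> L \<alpha> \<Longrightarrow> t \<alpha> \<sigma> \<in> carrier G"
  by (simp add: hat_t_def fibre_zero)

lemma t_eq: "t \<alpha> \<sigma> = w \<alpha> \<sigma> \<otimes>\<^bsub>G\<^esub> w \<alpha> 0"
  by (simp add: hat_t_def)

lemma w_inv: "\<alpha> \<in> \<Phi> \<Longrightarrow> \<sigma> \<in> L \<alpha> \<Longrightarrow> inv\<^bsub>G\<^esub> (w \<alpha> \<sigma>) = w \<alpha> \<sigma>"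
  using G.inv_equality[OF w_square] by simp

lemma w_square_left [simp]:
  "\<alpha> \<in> \<Phi> \<Longrightarrow> \<sigma> \<in> L \<alpha> \<Longrightarrow> u \<in> carrier G \<Longrightarrow> w \<alpha> \<sigma> \<otimes>\<^bsub>G\<^esub> (w \<alpha> \<sigma> \<otimes>\<^bsub>G\<^esub> u) = u"
  using G.m_assoc[of "w \<alpha> \<sigma>" "w \<alpha> \<sigma>" u] by simp

lemma t_zero [simp]: "\<alpha> \<in> \<Phi> \<Longrightarrow> t \<alpha> 0 = \<one>\<^bsub>G\<^esub>"
  by (simp add: t_eq fibre_zero)

lemma w_eq_t: "\<alpha> \<in> \<Phi> \<Longrightarrow> \<sigma> \<in> L \<alpha> \<Longrightarrow> w \<alpha> \<sigma> = t \<alpha> \<sigma> \<otimes>\<^bsub>G\<^esub> w \<alpha> 0"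
  by (simp add: t_eq fibre_zero G.m_assoc)

lemma act_t: "\<alpha> \<in> \<Phi> \<Longrightarrow> \<sigma> \<in> L \<alpha> \<Longrightarrow> act (t \<alpha> \<sigma>) (x, y) = (x, y + pairing x \<alpha> *\<^sub>R \<sigma>)"
  by (simp add: t_eq fibre_zero act_w rfl_rfl root_nz)
    (simp add: rfl_eq pairing_simps pairing_self root_nz)

lemma conj_w:
  assumes "u \<in> carrier G" "\<beta> \<in> \<Phi>" "\<tau> \<in> L \<beta>" "act u (\<beta>, \<tau>) = (\<gamma>, \<delta>)"
  shows "u \<otimes>\<^bsub>G\<^esub> w \<beta> \<tau> \<otimes>\<^bsub>G\<^esub> inv\<^bsub>G\<^esub> u = w \<gamma> \<delta>"
  using act_root_conj[OF assms] by simp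

lemma w_conj_t:
  assumes "\<gamma> \<in> \<Phi>" "\<beta> \<in> \<Phi>" "\<tau> \<in> L \<beta>"
  shows "w \<gamma> 0 \<otimes>\<^bsub>G\<^esub> t \<beta> \<tau> \<otimes>\<^bsub>G\<^esub> w \<gamma> 0 = t (rfl \<gamma> \<beta>) \<tau>"
proof -
  have "t (rfl \<gamma> \<beta>) \<tau> = (w \<gamma> 0 \<otimes>\<^bsub>G\<^esub> w \<beta> \<tau> \<otimes>\<^bsub>G\<^esub> w \<gamma> 0) \<otimes>\<^bsub>G\<^esub> (w \<gamma> 0 \<otimes>\<^bsub>G\<^esub> w \<beta> 0 \<otimes>\<^bsub>G\<^esub> w \<gamma> 0)"
    using assms by (simp add: t_eq w_conj_w fibre_zero)
  also have "\<dots> = w \<gamma> 0 \<otimes>\<^bsub>G\<^esub> t \<beta> \<tau> \<otimes>\<^bsub>G\<^esub> w \<gamma> 0"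
    using assms by (simp add: t_eq G.m_assoc fibre_zero)
  finally show ?thesis ..
qed

lemma t_uminus_root:
  assumes "\<alpha> \<in> \<Phi>" "\<sigma> \<in> L \<alpha>" shows "t (- \<alpha>) \<sigma> = inv\<^bsub>G\<^esub> (t \<alpha> \<sigma>)"
proof -
  have "t (- \<alpha>) \<sigma> = w \<alpha> 0 \<otimes>\<^bsub>G\<^esub> t \<alpha> \<sigma> \<otimes>\<^bsub>G\<^esub> w \<alpha> 0"
    using w_conj_t[OF assms(1,1,2)] assms by (simp add: rfl_self root_nz)
  also have "\<dots> = inv\<^bsub>G\<^esub> (t \<alpha> \<sigma>)"
    using assms by (simp add: t_eq G.inv_mult_group w_inv fibre_zero G.m_assoc)
  finally show ?thesis .
qed

lemma w_uminus: assumes "\<alpha> \<in> \<Phi>" "\<sigma> \<in> L \<alpha>" shows "w (- \<alpha>) (- \<sigma>) = w \<alpha> \<sigma>"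
  using w_conj_w[OF assms assms] assms by (simp add: rfl_self pairing_self root_nz scaleR_2 G.m_assoc)

lemma t_uminus:
  assumes "\<alpha> \<in> \<Phi>" "\<sigma> \<in> L \<alpha>" shows "t \<alpha> (- \<sigma>) = inv\<^bsub>G\<^esub> (t \<alpha> \<sigma>)"
proof -
  have "t \<alpha> (- \<sigma>) = t (- \<alpha>) \<sigma>"
    using w_uminus[OF assms(1), of 0] w_uminus[OF neg_root[OF assms(1)], of \<sigma>] assms
    by (simp add: t_eq fibre_minus fibre_zero)
  then show ?thesis using t_uminus_root assms by simp
qed

definition K where "K = {u \<in> carrier G. \<forall>v. act u v = v}"

lemma K_carrier: "u \<in> K \<Longrightarrow> u \<in> carrier G" by (simp add: K_def)

lemma subgroup_K: "subgroup K G"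
proof (rule G.subgroupI)
  show "K \<subseteq> carrier G" "K \<noteq> {}" by (auto simp: K_def intro!: exI[of _ "\<one>\<^bsub>G\<^esub>"])
  show "inv\<^bsub>G\<^esub> u \<in> K" if "u \<in> K" for u
    using that by (auto simp: K_def) (metis act_inv prod.exhaust)
  show "u \<otimes>\<^bsub>G\<^esub> v \<in> K" if "u \<in> K" "v \<in> K" for u v
    using that by (auto simp: K_def)
qed

text \<open>By \<open>conj_w\<close>, conjugation by an element of \<open>K\<close> fixes every generator.\<close>

lemma K_central: assumes u: "u \<in> K" shows "u \<in> group_center G"
proof -
  have uG: "u \<in> carrier G" using u by (rule K_carrier)
  have "u \<otimes>\<^bsub>G\<^esub> g = g \<otimes>\<^bsub>G\<^esub> u" if "g \<in> carrier G" for g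
    using that
  proof (induction rule: G_induct)
    case one then show ?case using uG by simp
  next
    case (mult \<alpha> \<sigma> v)
    have "u \<otimes>\<^bsub>G\<^esub> w \<alpha> \<sigma> \<otimes>\<^bsub>G\<^esub> inv\<^bsub>G\<^esub> u = w \<alpha> \<sigma>"
      using conj_w[OF uG mult(1,2), of \<alpha> \<sigma>] u by (simp add: K_def)
    then have *: "u \<otimes>\<^bsub>G\<^esub> w \<alpha> \<sigma> = w \<alpha> \<sigma> \<otimes>\<^bsub>G\<^esub> u"
      using uG mult by (metis G.inv_solve_right' G.m_closed w_closed)
    then show ?case using uG mult by (metis G.m_assoc w_closed)
  qed
  then show ?thesis using uG by (simp add: group_center_def)
qed

lemma same_act_K:
  assumes "u \<in> carrier G" "v \<in> carrier G" "\<And>x. act u x = act v x"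
  shows "u \<otimes>\<^bsub>G\<^esub> inv\<^bsub>G\<^esub> v \<in> K" "inv\<^bsub>G\<^esub> v \<otimes>\<^bsub>G\<^esub> u \<in> K"
  using assms by (auto simp: K_def simp del: split_paired_All)

text \<open>Elements that shift vectors along the radical only. Two of them commute on \<open>V\<close>, so their
commutators lie in \<open>K\<close> and are central; on \<open>H\<close> commutators are therefore multiplicative in each
argument.\<close>

definition H where "H = {u \<in> carrier G. \<exists>f. \<forall>x y. act u (x, y) = (x, y + f x)}"

lemma H_carrier: "u \<in> H \<Longrightarrow> u \<in> carrier G" by (simp add: H_def)

lemma subgroup_H: "subgroup H G"
proof (rule G.subgroupI)
  show "H \<subseteq> carrier G" by (auto simp: H_def)
  show "H \<noteq> {}" by (auto simp: H_def intro!: exI[of _ "\<one>\<^bsub>G\<^esub>"] exI[of _ "\<lambda>_. 0"])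
  show "inv\<^bsub>G\<^esub> u \<in> H" if u: "u \<in> H" for u
  proof -
    from u obtain f where f: "\<And>x y. act u (x, y) = (x, y + f x)" and uG: "u \<in> carrier G" by (auto simp: H_def)
    have "act (inv\<^bsub>G\<^esub> u) (x, y) = (x, y + (- f x))" for x y
      using act_inv[OF uG, of "(x, y - f x)"] by (simp add: f)
    then show ?thesis using uG by (auto simp: H_def intro!: exI[of _ "\<lambda>x. - f x"])
  qed
  show "u \<otimes>\<^bsub>G\<^esub> v \<in> H" if u: "u \<in> H" and v: "v \<in> H" for u v
  proof -
    from u obtain f where f: "\<And>x y. act u (x, y) = (x, y + f x)" and uG: "u \<in> carrier G" by (auto simp: H_def)
    from v obtain g where g: "\<And>x y. act v (x, y) = (x, y + g x)" and vG: "v \<in> carrier G" by (auto simp: H_def)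
    show ?thesis using uG vG by (auto simp: H_def f g intro!: exI[of _ "\<lambda>x. g x + f x"])
  qed
qed

lemma t_H [simp]: "\<alpha> \<in> \<Phi> \<Longrightarrow> \<sigma> \<in> L \<alpha> \<Longrightarrow> t \<alpha> \<sigma> \<in> H"
  by (auto simp: H_def act_t)

abbreviation cm where "cm \<equiv> commutator G"

lemma H_commute_act:
  assumes "u \<in> H" "v \<in> H" shows "act (u \<otimes>\<^bsub>G\<^esub> v) x = act (v \<otimes>\<^bsub>G\<^esub> u) x"
proof -
  from assms obtain f g where "\<And>x y. act u (x, y) = (x, y + f x)" "\<And>x y. act v (x, y) = (x, y + g x)"
    "u \<in> carrier G" "v \<in> carrier G" by (auto simp: H_def)
  then show ?thesis by (cases x) (simp add: add_ac)
qed

lemma cm_K: assumes "u \<in> H" "v \<in> H" shows "cm u v \<in> K"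
proof -
  have uv: "u \<in> carrier G" "v \<in> carrier G" using assms H_carrier by auto
  have "inv\<^bsub>G\<^esub> (v \<otimes>\<^bsub>G\<^esub> u) \<otimes>\<^bsub>G\<^esub> (u \<otimes>\<^bsub>G\<^esub> v) \<in> K"
    using uv H_commute_act[OF assms] by (intro same_act_K) auto
  also have "inv\<^bsub>G\<^esub> (v \<otimes>\<^bsub>G\<^esub> u) \<otimes>\<^bsub>G\<^esub> (u \<otimes>\<^bsub>G\<^esub> v) = cm u v"
    using uv by (simp add: commutator_def G.inv_mult_group G.m_assoc)
  finally show ?thesis .
qed

lemma cm_central [simp]: "u \<in> H \<Longrightarrow> v \<in> H \<Longrightarrow> cm u v \<in> group_center G"
  using cm_K K_central by blast

lemma cm_inv: "u \<in> H \<Longrightarrow> v \<in> H \<Longrightarrow> cm (inv\<^bsub>G\<^esub> u) v = inv\<^bsub>G\<^esub> (cm u v)"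
  by (intro G.commutator_inv_left) (auto simp: H_carrier)

lemma cm_swap: "u \<in> H \<Longrightarrow> v \<in> H \<Longrightarrow> cm v u = inv\<^bsub>G\<^esub> (cm u v)"
  by (intro G.commutator_inverse) (auto simp: H_carrier)

lemma cm_K_left: "u \<in> K \<Longrightarrow> v \<in> H \<Longrightarrow> cm u v = \<one>\<^bsub>G\<^esub>"
  using K_central[of u] K_carrier[of u] H_carrier[of v] 
  by (intro G.commutator_eqI) (auto dest: G.centerD)

lemma mult_cm:
  assumes "u \<in> H" "v \<in> H" shows "u \<otimes>\<^bsub>G\<^esub> v = cm u v \<otimes>\<^bsub>G\<^esub> (v \<otimes>\<^bsub>G\<^esub> u)"
  using G.mult_commutator[of u v] G.centerD[OF cm_central[OF assms], of "v \<otimes>\<^bsub>G\<^esub> u"] assms by (simp add: H_carrier)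

lemma K_conj:
  assumes "u \<in> K" "g \<in> carrier G" shows "g \<otimes>\<^bsub>G\<^esub> u \<otimes>\<^bsub>G\<^esub> inv\<^bsub>G\<^esub> g = u"
  using G.centerD[OF K_central[OF assms(1)], of g] K_carrier[of u] assms
  by (metis G.inv_solve_right' G.m_closed)

text \<open>Conjugation by \<open>t \<gamma> \<sigma>\<close> sends the root \<open>(\<alpha>, \<tau>)\<close> to \<open>(\<alpha>, \<tau> + pairing \<alpha> \<gamma> \<sigma>)\<close>. Written in terms
of \<open>t \<alpha>\<close>, this says that a commutator with \<open>t \<gamma> \<sigma>\<close> measures how far \<open>t \<alpha>\<close> is from being additive.\<close>

lemma t_add:
  assumes "\<gamma> \<in> \<Phi>" "\<alpha> \<in> \<Phi>" "\<sigma> \<in> L \<gamma>" "\<tau> \<in> L \<alpha>"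
  shows "t \<alpha> (\<tau> + pairing \<alpha> \<gamma> *\<^sub>R \<sigma>)
    = cm (t \<gamma> \<sigma>) (t \<alpha> \<tau>) \<otimes>\<^bsub>G\<^esub> (t \<alpha> \<tau> \<otimes>\<^bsub>G\<^esub> t \<alpha> (pairing \<alpha> \<gamma> *\<^sub>R \<sigma>))"
proof -
  let ?n = "pairing \<alpha> \<gamma>" and ?x = "t \<gamma> \<sigma>"
  note [simp] = assms fibre_zero fibre_scale
  have x: "?x \<otimes>\<^bsub>G\<^esub> w \<alpha> \<delta> \<otimes>\<^bsub>G\<^esub> inv\<^bsub>G\<^esub> ?x = w \<alpha> (\<delta> + ?n *\<^sub>R \<sigma>)" if "\<delta> \<in> L \<alpha>" for \<delta>
    using that by (intro conj_w) (auto simp: act_t)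
  have "t \<alpha> (\<tau> + ?n *\<^sub>R \<sigma>) = (?x \<otimes>\<^bsub>G\<^esub> w \<alpha> \<tau> \<otimes>\<^bsub>G\<^esub> inv\<^bsub>G\<^esub> ?x) \<otimes>\<^bsub>G\<^esub> w \<alpha> 0"
    by (simp add: x t_eq[of \<alpha>])
  also have "\<dots> = ?x \<otimes>\<^bsub>G\<^esub> (t \<alpha> \<tau> \<otimes>\<^bsub>G\<^esub> w \<alpha> 0) \<otimes>\<^bsub>G\<^esub> inv\<^bsub>G\<^esub> ?x \<otimes>\<^bsub>G\<^esub> w \<alpha> 0"
    by (simp add: w_eq_t[symmetric])
  also have "\<dots> = ?x \<otimes>\<^bsub>G\<^esub> t \<alpha> \<tau> \<otimes>\<^bsub>G\<^esub> inv\<^bsub>G\<^esub> ?x \<otimes>\<^bsub>G\<^esub> ((?x \<otimes>\<^bsub>G\<^esub> w \<alpha> 0 \<otimes>\<^bsub>G\<^esub> inv\<^bsub>G\<^esub> ?x) \<otimes>\<^bsub>G\<^esub> w \<alpha> 0)"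
    by (simp add: G.m_assoc G.inv_solve_left')
  also have "(?x \<otimes>\<^bsub>G\<^esub> w \<alpha> 0 \<otimes>\<^bsub>G\<^esub> inv\<^bsub>G\<^esub> ?x) \<otimes>\<^bsub>G\<^esub> w \<alpha> 0 = t \<alpha> (?n *\<^sub>R \<sigma>)"
    by (simp add: x t_eq[of \<alpha>])
  also have "?x \<otimes>\<^bsub>G\<^esub> t \<alpha> \<tau> = cm ?x (t \<alpha> \<tau>) \<otimes>\<^bsub>G\<^esub> (t \<alpha> \<tau> \<otimes>\<^bsub>G\<^esub> ?x)"
    by (intro mult_cm) auto
  finally show ?thesis by (simp add: G.m_assoc)
qed

text \<open>Again a conjugation by a translation, now of the reflection in \<open>\<beta>\<close>. It reduces the translations
along a reflected root to those along the two roots involved.\<close>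

lemma t_rfl:
  assumes "\<beta> \<in> \<Phi>" "\<gamma> \<in> \<Phi>" "\<sigma> \<in> L \<gamma>"
  shows "t (rfl \<beta> \<gamma>) \<sigma> = inv\<^bsub>G\<^esub> (t \<beta> (pairing \<beta> \<gamma> *\<^sub>R \<sigma>)) \<otimes>\<^bsub>G\<^esub> t \<gamma> \<sigma>"
proof -
  let ?x = "t \<gamma> \<sigma>"
  note [simp] = assms fibre_zero fibre_scale
  have "?x \<otimes>\<^bsub>G\<^esub> w \<beta> 0 \<otimes>\<^bsub>G\<^esub> inv\<^bsub>G\<^esub> ?x = w \<beta> (pairing \<beta> \<gamma> *\<^sub>R \<sigma>)"
    by (intro conj_w) (auto simp: act_t)
  then have "inv\<^bsub>G\<^esub> (t \<beta> (pairing \<beta> \<gamma> *\<^sub>R \<sigma>)) = inv\<^bsub>G\<^esub> (?x \<otimes>\<^bsub>G\<^esub> w \<beta> 0 \<otimes>\<^bsub>G\<^esub> inv\<^bsub>G\<^esub> ?x \<otimes>\<^bsub>G\<^esub> w \<beta> 0)"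
    by (simp add: t_eq[of \<beta>])
  also have "\<dots> \<otimes>\<^bsub>G\<^esub> ?x = w \<beta> 0 \<otimes>\<^bsub>G\<^esub> ?x \<otimes>\<^bsub>G\<^esub> w \<beta> 0"
    by (simp add: G.inv_mult_group w_inv G.m_assoc)
  finally show ?thesis by (simp add: w_conj_t)
qed

lemma t_orthogonal:
  assumes "\<gamma> \<in> \<Phi>" "\<alpha> \<in> \<Phi>" "\<sigma> \<in> L \<gamma>" "\<tau> \<in> L \<alpha>" "\<alpha> \<bullet> \<gamma> = 0"
  shows "cm (t \<gamma> \<sigma>) (t \<alpha> \<tau>) = \<one>\<^bsub>G\<^esub>"
  using t_add[OF assms(1-4)] assms by (simp add: pairing_def)

text \<open>The translations generate a subgroup that is normalized by the reflections \<open>w \<gamma> 0\<close>, and each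
generator is the product of a translation and such a reflection.\<close>

definition Ht where "Ht = generate G {t \<alpha> \<sigma> | \<alpha> \<sigma>. \<alpha> \<in> \<Phi> \<and> \<sigma> \<in> L \<alpha>}"
definition Wf where "Wf = generate G {w \<alpha> 0 | \<alpha>. \<alpha> \<in> \<Phi>}"

lemma subgroup_Ht: "subgroup Ht G" unfolding Ht_def by (rule G.generate_is_subgroup) auto
lemma subgroup_Wf: "subgroup Wf G" unfolding Wf_def by (rule G.generate_is_subgroup) (auto simp: fibre_zero)

lemma Ht_H: "Ht \<subseteq> H"
  unfolding Ht_def by (rule G.generate_subgroup_incl[OF _ subgroup_H]) auto

lemma Ht_w_conj:
  assumes "h \<in> Ht" "\<gamma> \<in> \<Phi>" shows "w \<gamma> 0 \<otimes>\<^bsub>G\<^esub> h \<otimes>\<^bsub>G\<^esub> w \<gamma> 0 \<in> Ht"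
  using assms(1) unfolding Ht_def
proof (induction rule: generate.induct)
  case one then show ?case using assms fibre_zero by (simp add: generate.one)
next
  case (incl h)
  then obtain \<alpha> \<sigma> where "h = t \<alpha> \<sigma>" "\<alpha> \<in> \<Phi>" "\<sigma> \<in> L \<alpha>" by auto
  then have "w \<gamma> 0 \<otimes>\<^bsub>G\<^esub> h \<otimes>\<^bsub>G\<^esub> w \<gamma> 0 = t (rfl \<gamma> \<alpha>) \<sigma>" "rfl \<gamma> \<alpha> \<in> \<Phi>" "\<sigma> \<in> L (rfl \<gamma> \<alpha>)"
    using assms by (auto simp: w_conj_t rfl_root fibre_rfl_eq)
  then show ?case by (metis (mono_tags, lifting) generate.incl mem_Collect_eq)
next
  case (inv h)
  then obtain \<alpha> \<sigma> where h: "h = t \<alpha> \<sigma>" "\<alpha> \<in> \<Phi>" "\<sigma> \<in> L \<alpha>" by auto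
  then have r: "w \<gamma> 0 \<otimes>\<^bsub>G\<^esub> h \<otimes>\<^bsub>G\<^esub> w \<gamma> 0 = t (rfl \<gamma> \<alpha>) \<sigma>" "rfl \<gamma> \<alpha> \<in> \<Phi>" "\<sigma> \<in> L (rfl \<gamma> \<alpha>)"
    using assms by (auto simp: w_conj_t rfl_root fibre_rfl_eq)
  have "w \<gamma> 0 \<otimes>\<^bsub>G\<^esub> inv\<^bsub>G\<^esub> h \<otimes>\<^bsub>G\<^esub> w \<gamma> 0 = inv\<^bsub>G\<^esub> (w \<gamma> 0 \<otimes>\<^bsub>G\<^esub> h \<otimes>\<^bsub>G\<^esub> w \<gamma> 0)"
    using assms h by (simp add: G.inv_mult_group w_inv fibre_zero G.m_assoc)
  then show ?case using r by (metis (mono_tags, lifting) generate.inv mem_Collect_eq)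
next
  case (eng h1 h2)
  have c: "h1 \<in> carrier G" "h2 \<in> carrier G" 
    using eng subgroup.mem_carrier[OF subgroup_Ht] unfolding Ht_def by auto
  have "w \<gamma> 0 \<otimes>\<^bsub>G\<^esub> (h1 \<otimes>\<^bsub>G\<^esub> h2) \<otimes>\<^bsub>G\<^esub> w \<gamma> 0
     = (w \<gamma> 0 \<otimes>\<^bsub>G\<^esub> h1 \<otimes>\<^bsub>G\<^esub> w \<gamma> 0) \<otimes>\<^bsub>G\<^esub> (w \<gamma> 0 \<otimes>\<^bsub>G\<^esub> h2 \<otimes>\<^bsub>G\<^esub> w \<gamma> 0)"
    using assms c by (simp add: fibre_zero G.m_assoc)
  then show ?case using generate.eng[OF eng.IH] by simp
qed

lemma Ht_Wf_decomp: "u \<in> carrier G \<Longrightarrow> \<exists>h\<in>Ht. \<exists>v\<in>Wf. u = h \<otimes>\<^bsub>G\<^esub> v"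
proof (induction rule: G_induct)
  case one
  show ?case
    by (intro bexI[of _ "\<one>\<^bsub>G\<^esub>"]) (simp_all add: subgroup.one_closed[OF subgroup_Ht] subgroup.one_closed[OF subgroup_Wf])
next
  case (mult \<alpha> \<sigma> u)
  from mult.IH obtain h v where hv: "h \<in> Ht" "v \<in> Wf" "u = h \<otimes>\<^bsub>G\<^esub> v" by (elim bexE)
  have c: "h \<in> carrier G" "v \<in> carrier G"
    using hv subgroup.mem_carrier[OF subgroup_Ht] subgroup.mem_carrier[OF subgroup_Wf] by auto
  have "w \<alpha> \<sigma> \<otimes>\<^bsub>G\<^esub> u = (t \<alpha> \<sigma> \<otimes>\<^bsub>G\<^esub> (w \<alpha> 0 \<otimes>\<^bsub>G\<^esub> h \<otimes>\<^bsub>G\<^esub> w \<alpha> 0)) \<otimes>\<^bsub>G\<^esub> (w \<alpha> 0 \<otimes>\<^bsub>G\<^esub> v)"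
    using mult(1-3) c by (simp add: hv(3) w_eq_t[of \<alpha> \<sigma>] G.m_assoc fibre_zero)
  moreover have "t \<alpha> \<sigma> \<otimes>\<^bsub>G\<^esub> (w \<alpha> 0 \<otimes>\<^bsub>G\<^esub> h \<otimes>\<^bsub>G\<^esub> w \<alpha> 0) \<in> Ht"
  proof (rule subgroup.m_closed[OF subgroup_Ht _ Ht_w_conj[OF hv(1) mult(1)]])
    show "t \<alpha> \<sigma> \<in> Ht" unfolding Ht_def using mult(1,2) by (intro generate.incl) blast
  qed
  moreover have "w \<alpha> 0 \<otimes>\<^bsub>G\<^esub> v \<in> Wf"
  proof (rule subgroup.m_closed[OF subgroup_Wf _ hv(2)])
    show "w \<alpha> 0 \<in> Wf" unfolding Wf_def using mult(1) by (intro generate.incl) blast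
  qed
  ultimately show ?case by (intro bexI)
qed

end

declare One_nat_def [simp del]

section \<open>Simple reflections\<close>

locale root_basis =
  fixes \<Phi> :: "'a::euclidean_space set" and l :: nat and a :: "nat \<Rightarrow> 'a"
  assumes root_system: "root_system \<Phi>" and base: "root_base \<Phi> l a"
begin

lemma root_nonzero: "\<alpha> \<in> \<Phi> \<Longrightarrow> \<alpha> \<noteq> 0" 
  using root_system by (auto simp: root_system_def)

lemma root_rfl: "\<alpha> \<in> \<Phi> \<Longrightarrow> \<beta> \<in> \<Phi> \<Longrightarrow> rfl \<alpha> \<beta> \<in> \<Phi>" 
  using root_system by (auto simp: root_system_def)

lemma root_uminus: "\<alpha> \<in> \<Phi> \<Longrightarrow> - \<alpha> \<in> \<Phi>" 
  using root_rfl[of \<alpha> \<alpha>] by (simp add: rfl_self root_nonzero)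

lemma simple_root: "i \<in> {1..l} \<Longrightarrow> a i \<in> \<Phi>"
  using base by (auto simp: root_base_def)

lemma simple_inj: "inj_on a {1..l}" and simple_independent: "independent (a ` {1..l})"
  using base by (auto simp: root_base_def)

lemma span_simple: "span (a ` {1..l}) = UNIV"
proof -
  have "\<Phi> \<subseteq> span (a ` {1..l})"
  proof
    fix \<beta> assume "\<beta> \<in> \<Phi>"
    then obtain c :: "nat \<Rightarrow> int" where "\<beta> = (\<Sum>i=1..l. of_int (c i) *\<^sub>R a i)"
      using base unfolding root_base_def by blast
    then show "\<beta> \<in> span (a ` {1..l})" by (simp only:) (intro span_sum span_scale span_base imageI)
  qed
  then have "span \<Phi> \<subseteq> span (a ` {1..l})" by (simp add: span_minimal)
  then show ?thesis using root_system by (auto simp: root_system_def)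
qed

definition simple_co :: "nat \<Rightarrow> 'a \<Rightarrow> real" where
  "simple_co i x = representation (a ` {1..l}) x (a i)"

lemma simple_co_linear: "simple_co i (x + y) = simple_co i x + simple_co i y" "simple_co i (x - y) = simple_co i x - simple_co i y"
    "simple_co i (c *\<^sub>R x) = c * simple_co i x"
  using simple_independent
  by (simp_all add: simple_co_def span_simple representation_add representation_diff representation_scale)

lemma simple_co_simple: "i \<in> {1..l} \<Longrightarrow> j \<in> {1..l} \<Longrightarrow> simple_co i (a j) = (if i = j then 1 else 0)"
  using simple_inj simple_independent by (auto simp: simple_co_def representation_basis dest: inj_onD)

lemma simple_co_uminus: "simple_co i (- x) = - simple_co i x" using simple_co_linear(3)[of i "-1" x] by simp

lemma simple_co_zero: "simple_co i 0 = 0" using simple_co_linear(3)[of i 0 0] by simp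

lemma simple_co_sum: "simple_co i (sum f S) = (\<Sum>s\<in>S. simple_co i (f s))"
  by (induction S rule: infinite_finite_induct) (auto simp: simple_co_zero simple_co_linear)

lemma expand: "x = (\<Sum>i=1..l. simple_co i x *\<^sub>R a i)"
proof -
  have "x = (\<Sum>b\<in>a ` {1..l}. representation (a ` {1..l}) x b *\<^sub>R b)"
    using simple_independent by (simp add: sum_representation_eq span_simple)
  then show ?thesis using simple_inj by (simp add: sum.reindex simple_co_def)
qed

lemma simple_co_root: assumes "\<beta> \<in> \<Phi>"
  shows "i \<in> {1..l} \<Longrightarrow> simple_co i \<beta> \<in> \<int>"
    and "(\<forall>i\<in>{1..l}. simple_co i \<beta> \<ge> 0) \<or> (\<forall>i\<in>{1..l}. simple_co i \<beta> \<le> 0)"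
proof -
  obtain c :: "nat \<Rightarrow> int" where c: "\<beta> = (\<Sum>i=1..l. of_int (c i) *\<^sub>R a i)"
      "(\<forall>i\<in>{1..l}. c i \<ge> 0) \<or> (\<forall>i\<in>{1..l}. c i \<le> 0)"
    using base assms unfolding root_base_def by blast
  have "simple_co i \<beta> = of_int (c i)" if "i \<in> {1..l}" for i
  proof -
    have "simple_co i \<beta> = (\<Sum>j=1..l. if j = i then of_int (c j) else 0)"
      unfolding c(1) simple_co_sum simple_co_linear using that by (intro sum.cong) (auto simp: simple_co_simple)
    also have "\<dots> = of_int (c i)" using that by simp
    finally show ?thesis .
  qed
  then show "i \<in> {1..l} \<Longrightarrow> simple_co i \<beta> \<in> \<int>"
    and "(\<forall>i\<in>{1..l}. simple_co i \<beta> \<ge> 0) \<or> (\<forall>i\<in>{1..l}. simple_co i \<beta> \<le> 0)"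
    using c(2) by auto
qed

definition pos :: "'a \<Rightarrow> bool" where "pos \<beta> \<longleftrightarrow> (\<forall>i\<in>{1..l}. simple_co i \<beta> \<ge> 0)"

lemma pos_simple: "i \<in> {1..l} \<Longrightarrow> pos (a i)" by (auto simp: pos_def simple_co_simple)

lemma eq_zeroI: "(\<And>i. i \<in> {1..l} \<Longrightarrow> simple_co i x = 0) \<Longrightarrow> x = 0"
  by (subst expand) simp

lemma not_pos_uminus: assumes "\<beta> \<in> \<Phi>" "pos \<beta>" shows "\<not> pos (- \<beta>)"
proof
  assume "pos (- \<beta>)"
  then have "simple_co i \<beta> = 0" if "i \<in> {1..l}" for i
    using assms that by (force simp: pos_def simple_co_uminus)
  then show False using eq_zeroI root_nonzero assms by blast
qed

lemma pos_or_uminus: "\<beta> \<in> \<Phi> \<Longrightarrow> pos \<beta> \<or> pos (- \<beta>)"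
  using simple_co_root(2)[of \<beta>] by (auto simp: pos_def simple_co_uminus)

text \<open>A simple reflection changes only one coordinate, so it cannot make a positive root negative
  unless that root has no other coordinate.\<close>

lemma pos_rfl_simple:
  assumes i: "i \<in> {1..l}" and b: "\<beta> \<in> \<Phi>" "pos \<beta>" "\<beta> \<noteq> a i"
  shows "pos (rfl (a i) \<beta>)"
proof -
  have "\<exists>j\<in>{1..l}. j \<noteq> i \<and> simple_co j \<beta> > 0"
  proof (rule ccontr)
    assume "\<not> ?thesis"
    then have z: "simple_co j \<beta> = 0" if "j \<in> {1..l}" "j \<noteq> i" for j using b(2) that by (force simp: pos_def)
    have "\<beta> = (\<Sum>j=1..l. if j = i then simple_co i \<beta> *\<^sub>R a i else 0)"
      by (subst expand) (intro sum.cong, auto simp: z)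
    then have e: "\<beta> = simple_co i \<beta> *\<^sub>R a i" using i by simp
    then have "simple_co i \<beta> = 1 \<or> simple_co i \<beta> = -1"
      using root_system simple_root[OF i] b(1) unfolding root_system_def by metis
    moreover have "simple_co i \<beta> \<ge> 0" using b(2) i by (auto simp: pos_def)
    ultimately show False using e b(3) by auto
  qed
  then obtain j where j: "j \<in> {1..l}" "j \<noteq> i" "simple_co j \<beta> > 0" by blast
  have "simple_co j (rfl (a i) \<beta>) > 0" using i j by (simp add: rfl_eq simple_co_linear simple_co_simple)
  then show ?thesis using simple_co_root(2)[OF root_rfl[OF simple_root[OF i] b(1)]] j(1)
    by (force simp: pos_def)
qed

abbreviation rfls :: "nat list \<Rightarrow> 'a \<Rightarrow> 'a" where
  "rfls ks \<equiv> foldr (\<lambda>k. rfl (a k)) ks"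

lemma rfls_root: "set ks \<subseteq> {1..l} \<Longrightarrow> \<beta> \<in> \<Phi> \<Longrightarrow> rfls ks \<beta> \<in> \<Phi>"
  by (induction ks) (auto simp: root_rfl simple_root)

lemma rfls_inner: "set ks \<subseteq> {1..l} \<Longrightarrow> rfls ks x \<bullet> rfls ks y = x \<bullet> y"
  by (induction ks) (auto simp: rfl_inner simple_root root_nonzero)

lemma rfls_uminus: "rfls ks (- x) = - rfls ks x"
  by (induction ks) (auto simp: rfl_simps)

lemma rfls_rev: "set ks \<subseteq> {1..l} \<Longrightarrow> rfls (rev ks) (rfls ks x) = x"
  by (induction ks arbitrary: x) (auto simp: rfl_rfl simple_root root_nonzero)

text \<open>Along the word the sign must change at some letter, and there the root is the simple root of that
letter by \<open>pos_rfl_simple\<close>.\<close>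

lemma sign_change:
  assumes "set ks \<subseteq> {1..l}" "\<gamma> \<in> \<Phi>" "pos \<gamma>" "\<not> pos (rfls ks \<gamma>)"
  shows "\<exists>us i vs. ks = us @ i # vs \<and> rfls vs \<gamma> = a i"
  using assms
proof (induction ks)
  case (Cons k ks)
  show ?case
  proof (cases "pos (rfls ks \<gamma>)")
    case True
    then have "rfls ks \<gamma> = a k"
      using pos_rfl_simple[of k "rfls ks \<gamma>"] Cons rfls_root[of ks \<gamma>] by auto
    then show ?thesis by (intro exI[of _ "[]"] exI[of _ k] exI[of _ ks]) simp
  next
    case False
    then obtain us i vs where "ks = us @ i # vs \<and> rfls vs \<gamma> = a i" using Cons by auto
    then show ?thesis by (intro exI[of _ "k # us"] exI[of _ i] exI[of _ vs]) simp
  qed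
qed simp

text \<open>Induction on the height. Some simple root has positive inner product with \<open>\<beta>\<close>, as otherwise
\<open>\<beta> \<bullet> \<beta>\<close> would be nonpositive, and reflecting in it lowers the height.\<close>

lemma pos_root_from_simple:
  assumes "\<beta> \<in> \<Phi>" "pos \<beta>"
  shows "\<exists>ks i. set ks \<subseteq> {1..l} \<and> i \<in> {1..l} \<and> \<beta> = rfls ks (a i)"
  using assms
proof (induction "nat \<lfloor>\<Sum>i=1..l. simple_co i \<beta>\<rfloor>" arbitrary: \<beta> rule: less_induct)
  case less
  show ?case
  proof (cases "\<exists>i\<in>{1..l}. \<beta> = a i")
    case True
    then show ?thesis by (metis empty_set empty_subsetI foldr.simps(1) id_apply)
  next
    case False
    have "\<exists>i\<in>{1..l}. \<beta> \<bullet> a i > 0"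
    proof (rule ccontr)
      assume "\<not> ?thesis"
      then have "(\<Sum>i=1..l. simple_co i \<beta> * (\<beta> \<bullet> a i)) \<le> 0"
        using less(3) by (intro sum_nonpos) (force simp: pos_def intro: mult_nonneg_nonpos)
      moreover have "\<beta> \<bullet> \<beta> = (\<Sum>i=1..l. simple_co i \<beta> * (\<beta> \<bullet> a i))"
        by (subst (2) expand) (simp add: inner_sum_right)
      ultimately show False using root_nonzero[OF less(2)] by (metis inner_gt_zero_iff not_less)
    qed
    then obtain i where i: "i \<in> {1..l}" "\<beta> \<bullet> a i > 0" by blast
    let ?b = "rfl (a i) \<beta>" and ?n = "pairing \<beta> (a i)"
    have ai: "a i \<in> \<Phi>" "a i \<noteq> 0" using simple_root root_nonzero i by auto
    have b: "?b \<in> \<Phi>" "pos ?b"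
      using pos_rfl_simple[of i \<beta>] root_rfl[of "a i" \<beta>] i less False simple_root by auto
    have "?n > 0" using i ai by (simp add: pairing_def)
    moreover have "?n \<in> \<int>" using root_system ai(1) less(2) by (simp add: root_system_def pairing_def)
    ultimately have n: "?n \<ge> 1" by (auto elim!: Ints_cases)
    have "simple_co j ?b = simple_co j \<beta> - (if j = i then ?n else 0)" if "j \<in> {1..l}" for j
      using i that by (simp add: rfl_eq simple_co_linear simple_co_simple)
    then have "(\<Sum>j=1..l. simple_co j ?b) = (\<Sum>j=1..l. simple_co j \<beta>) - (\<Sum>j=1..l. if j = i then ?n else 0)"
      by (simp add: sum_subtractf)
    also have "(\<Sum>j=1..l. if j = i then ?n else 0) = ?n" using i by simp
    finally have e: "(\<Sum>j=1..l. simple_co j ?b) = (\<Sum>j=1..l. simple_co j \<beta>) - ?n" .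
    have "(\<Sum>j=1..l. simple_co j ?b) \<ge> 0" using b(2) by (intro sum_nonneg) (auto simp: pos_def)
    then have "nat \<lfloor>\<Sum>j=1..l. simple_co j ?b\<rfloor> < nat \<lfloor>\<Sum>j=1..l. simple_co j \<beta>\<rfloor>" using n unfolding e by linarith
    from less(1)[OF this b] obtain ks j where "set ks \<subseteq> {1..l}" "j \<in> {1..l}" "?b = rfls ks (a j)" by blast
    moreover from this have "\<beta> = rfls (i # ks) (a j)" using ai rfl_rfl[of "a i" \<beta>] by simp
    ultimately show ?thesis using i by (intro exI[of _ "i # ks"] exI[of _ j]) auto
  qed
qed

lemma root_from_simple:
  assumes "\<beta> \<in> \<Phi>"
  shows "\<exists>ks i. set ks \<subseteq> {1..l} \<and> i \<in> {1..l} \<and> \<beta> = rfls ks (a i)"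
proof (cases "pos \<beta>")
  case False
  then obtain ks i where k: "set ks \<subseteq> {1..l}" "i \<in> {1..l}" "- \<beta> = rfls ks (a i)"
    using pos_or_uminus assms pos_root_from_simple root_uminus by blast
  then have "\<beta> = rfls (ks @ [i]) (a i)"
    by (simp add: rfl_self simple_root root_nonzero rfls_uminus flip: k(3))
  then show ?thesis using k by (intro exI[of _ "ks @ [i]"] exI[of _ i]) auto
qed (use pos_root_from_simple assms in blast)

end

section \<open>The finite Weyl group is presented by conjugation\<close>

locale fibred_roots_basis = fibred_roots \<Phi> L R + root_basis \<Phi> l a
  for \<Phi> :: "'a::euclidean_space set" and L :: "'a \<Rightarrow> 'b::euclidean_space set" 
    and R :: "('a \<times> 'b) set" and l a
begin

definition wprod :: "nat list \<Rightarrow> ('a \<times> 'b) word set" where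
  "wprod ks = foldr (\<lambda>k g. w (a k) 0 \<otimes>\<^bsub>G\<^esub> g) ks \<one>\<^bsub>G\<^esub>"

lemma wprod_simps: "wprod [] = \<one>\<^bsub>G\<^esub>" "wprod (k # ks) = w (a k) 0 \<otimes>\<^bsub>G\<^esub> wprod ks"
  by (simp_all add: wprod_def)

lemma wprod_closed: "set ks \<subseteq> {1..l} \<Longrightarrow> wprod ks \<in> carrier G"
  by (induction ks) (auto simp: wprod_simps simple_root fibre_zero)

lemma wprod_append: "set ks \<subseteq> {1..l} \<Longrightarrow> set ms \<subseteq> {1..l} \<Longrightarrow> wprod (ks @ ms) = wprod ks \<otimes>\<^bsub>G\<^esub> wprod ms"
  by (induction ks) (auto simp: wprod_simps simple_root fibre_zero wprod_closed G.m_assoc)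

lemma wprod_rev: "set ks \<subseteq> {1..l} \<Longrightarrow> inv\<^bsub>G\<^esub> (wprod ks) = wprod (rev ks)"
  by (induction ks)
    (auto simp: wprod_simps wprod_append simple_root fibre_zero wprod_closed G.inv_mult_group w_inv)

lemma act_wprod: "set ks \<subseteq> {1..l} \<Longrightarrow> act (wprod ks) (x, y) = (rfls ks x, y)"
  by (induction ks arbitrary: x y) (auto simp: wprod_simps simple_root fibre_zero wprod_closed act_w)

lemma wprod_conj:
  assumes "set ks \<subseteq> {1..l}" "\<beta> \<in> \<Phi>"
  shows "wprod ks \<otimes>\<^bsub>G\<^esub> w \<beta> 0 \<otimes>\<^bsub>G\<^esub> inv\<^bsub>G\<^esub> (wprod ks) = w (rfls ks \<beta>) 0"
  using assms by (intro conj_w) (auto simp: wprod_closed act_wprod fibre_zero)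

text \<open>The exchange argument: a trivial word in simple reflections of positive length can be
  shortened by two letters, using only conjugation relations.\<close>

lemma wprod_trivial:
  assumes "set ks \<subseteq> {1..l}" "\<And>x. rfls ks x = x"
  shows "wprod ks = \<one>\<^bsub>G\<^esub>"
  using assms
proof (induction "length ks" arbitrary: ks rule: less_induct)
  case less
  show ?case
  proof (cases ks rule: rev_cases)
    case Nil then show ?thesis by (simp add: wprod_simps)
  next
    case (snoc ms s)
    have s: "s \<in> {1..l}" "set ms \<subseteq> {1..l}" using less snoc by auto
    \<comment> \<open>The last letter makes \<open>a s\<close> negative and the rest of the word has to make it positive again.\<close>
    have "rfls ms (- a s) = a s" using less(3)[of "a s"] s by (simp add: snoc rfl_self simple_root root_nonzero)
    then have "\<not> pos (rfls ms (a s))"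
      using not_pos_uminus[of "a s"] s pos_simple simple_root by (simp add: rfls_uminus minus_equation_iff[of "rfls ms (a s)"])
    then obtain us i vs where m: "ms = us @ i # vs" and e: "rfls vs (a s) = a i"
      using sign_change[of ms "a s"] s pos_simple simple_root by blast
    have uv: "set us \<subseteq> {1..l}" "set vs \<subseteq> {1..l}" "i \<in> {1..l}" using s m by auto
    note c = wprod_closed[OF uv(1)] wprod_closed[OF uv(2)]
    have ws: "w (a s) 0 \<in> carrier G" using s by (simp add: simple_root fibre_zero)
    \<comment> \<open>The letters \<open>i\<close> and \<open>s\<close> cancel: conjugation by \<open>vs\<close> carries the reflection \<open>s\<close> to \<open>i\<close>.\<close>
    have "wprod ks = wprod us \<otimes>\<^bsub>G\<^esub> (w (a i) 0 \<otimes>\<^bsub>G\<^esub> wprod vs) \<otimes>\<^bsub>G\<^esub> w (a s) 0"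
      using uv s by (simp add: snoc m wprod_append wprod_simps c ws G.m_assoc simple_root fibre_zero)
    also have "w (a i) 0 = wprod vs \<otimes>\<^bsub>G\<^esub> w (a s) 0 \<otimes>\<^bsub>G\<^esub> inv\<^bsub>G\<^esub> (wprod vs)"
      using wprod_conj[OF uv(2), of "a s"] s e by (simp add: simple_root)
    also have "wprod us \<otimes>\<^bsub>G\<^esub> (wprod vs \<otimes>\<^bsub>G\<^esub> w (a s) 0 \<otimes>\<^bsub>G\<^esub> inv\<^bsub>G\<^esub> (wprod vs) \<otimes>\<^bsub>G\<^esub> wprod vs) \<otimes>\<^bsub>G\<^esub> w (a s) 0
      = wprod us \<otimes>\<^bsub>G\<^esub> wprod vs"
      using c ws s by (simp add: G.m_assoc simple_root fibre_zero)
    also have "\<dots> = wprod (us @ vs)" using uv by (simp add: wprod_append)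
    finally have eq: "wprod ks = wprod (us @ vs)" .
    also have "\<dots> = \<one>\<^bsub>G\<^esub>"
    proof (rule less(1))
      show "length (us @ vs) < length ks" "set (us @ vs) \<subseteq> {1..l}" using uv by (auto simp: snoc m)
      fix x
      have "act (wprod ks) (x, 0) = (x, 0)" using less(2,3) by (simp add: act_wprod)
      then show "rfls (us @ vs) x = x" using uv act_wprod[of "us @ vs" x 0] by (simp add: eq)
    qed
    finally show ?thesis .
  qed
qed

text \<open>The reflection in \<open>rfls ks (a i)\<close> is the palindromic word \<open>ks @ [i] @ rev ks\<close>.\<close>

lemma Wf_wprod: assumes "v \<in> Wf" shows "\<exists>ks. set ks \<subseteq> {1..l} \<and> v = wprod ks"
  using assms unfolding Wf_def
proof (induction rule: generate.induct)
  case one show ?case by (intro exI[of _ "[]"]) (simp add: wprod_simps)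
next
  have *: "\<exists>ks. set ks \<subseteq> {1..l} \<and> w \<beta> 0 = wprod ks" if \<beta>: "\<beta> \<in> \<Phi>" for \<beta>
  proof -
    obtain ks i where k: "set ks \<subseteq> {1..l}" "i \<in> {1..l}" "\<beta> = rfls ks (a i)"
      using root_from_simple[OF \<beta>] by blast
    then have "w \<beta> 0 = wprod (ks @ [i] @ rev ks)"
      using wprod_conj[of ks "a i"]
      by (simp add: simple_root wprod_append wprod_rev wprod_closed wprod_simps fibre_zero G.m_assoc)
    then show ?thesis using k by (intro exI[of _ "ks @ [i] @ rev ks"]) auto
  qed
  {
    case (incl v) then show ?case using * by blast
  next
    case (inv v)
    then show ?case using * w_inv fibre_zero by fastforce
  }
next
  case (eng u v)
  then obtain ks ms where "set ks \<subseteq> {1..l}" "u = wprod ks" "set ms \<subseteq> {1..l}" "v = wprod ms" by blast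
  then show ?case by (intro exI[of _ "ks @ ms"]) (auto simp: wprod_append)
qed

text \<open>An element of the finite part is determined by its action on the finite root space: this is the
presentation by conjugation of the finite Weyl group.\<close>

lemma Wf_trivial:
  assumes "v \<in> Wf" "\<And>x. fst (act v (x, 0)) = x" shows "v = \<one>\<^bsub>G\<^esub>"
  using Wf_wprod[OF assms(1)] assms(2) wprod_trivial by (auto simp: act_wprod)

text \<open>Translations do not change the component in the finite root space, so the finite part of an
element of \<open>K\<close> acts trivially and \<open>Wf_trivial\<close> applies.\<close>

lemma K_subset_Ht: assumes u: "u \<in> K" shows "u \<in> Ht"
proof -
  obtain h v where hv: "h \<in> Ht" "v \<in> Wf" "u = h \<otimes>\<^bsub>G\<^esub> v"
    using Ht_Wf_decomp u K_carrier by blast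
  have c: "h \<in> carrier G" "v \<in> carrier G"
    using hv subgroup.mem_carrier[OF subgroup_Ht] subgroup.mem_carrier[OF subgroup_Wf] by auto
  obtain f where f: "\<And>x y. act h (x, y) = (x, y + f x)" using hv Ht_H by (auto simp: H_def)
  have "fst (act v (x, 0)) = x" for x
  proof -
    have "act h (act v (x, 0)) = (x, 0)" using u c hv by (simp add: K_def flip: act_mult)
    then show ?thesis by (cases "act v (x, 0)") (simp add: f)
  qed
  from Wf_trivial[OF hv(2) this] show ?thesis using hv c by simp
qed

end

section \<open>Roots of equal length\<close>

context root_basis begin

lemma rfl_word: assumes "\<gamma> \<in> \<Phi>" shows "\<exists>ks. set ks \<subseteq> {1..l} \<and> (\<forall>x. rfl \<gamma> x = rfls ks x)"
proof -
  obtain ks i where k: "set ks \<subseteq> {1..l}" "i \<in> {1..l}" "\<gamma> = rfls ks (a i)"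
    using root_from_simple[OF assms] by blast
  have lin: "rfls ks (x - c *\<^sub>R y) = rfls ks x - c *\<^sub>R rfls ks y" for c x y
    by (induction ks) (auto simp: rfl_simps)
  have "rfl \<gamma> x = rfls (ks @ [i] @ rev ks) x" for x
  proof -
    have r: "rfls ks (rfls (rev ks) x) = x" using rfls_rev[of "rev ks" x] k by simp
    have p: "pairing x \<gamma> = pairing (rfls (rev ks) x) (a i)"
      using rfls_inner[of ks "rfls (rev ks) x" "a i"] rfls_inner[of ks "a i" "a i"] k r
      by (simp add: pairing_def)
    have "rfls (ks @ [i] @ rev ks) x = rfls ks (rfls (rev ks) x - pairing (rfls (rev ks) x) (a i) *\<^sub>R a i)"
      by (simp add: rfl_eq)
    also have "\<dots> = x - pairing x \<gamma> *\<^sub>R \<gamma>" unfolding lin r using p k(3) by simp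
    finally show ?thesis by (simp add: rfl_eq)
  qed
  then show ?thesis using k by (intro exI[of _ "ks @ [i] @ rev ks"]) auto
qed

lemma pairing_rfls: "set ks \<subseteq> {1..l} \<Longrightarrow> pairing (rfls ks x) (rfls ks y) = pairing x y"
  by (simp add: pairing_def rfls_inner)

lemma root_pairing_int: "\<alpha> \<in> \<Phi> \<Longrightarrow> \<beta> \<in> \<Phi> \<Longrightarrow> pairing \<beta> \<alpha> \<in> \<int>"
  using root_system by (simp add: root_system_def pairing_def)

text \<open>The pairing is an integer of absolute value at most \<open>2\<close> by the Cauchy-Schwarz inequality, with
equality only for proportional vectors.\<close>

lemma same_norm_cases:
  assumes ab: "\<alpha> \<in> \<Phi>" "\<beta> \<in> \<Phi>" "\<alpha> \<bullet> \<alpha> = \<beta> \<bullet> \<beta>"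
  shows "pairing \<alpha> \<beta> = 0 \<or> pairing \<alpha> \<beta> = 1 \<or> pairing \<alpha> \<beta> = -1 \<or> \<alpha> = \<beta> \<or> \<alpha> = - \<beta>"
proof -
  let ?n = "pairing \<alpha> \<beta>"
  have nz: "\<beta> \<noteq> 0" using ab root_nonzero by blast
  have "\<bar>\<alpha> \<bullet> \<beta>\<bar> \<le> \<beta> \<bullet> \<beta>"
    using Cauchy_Schwarz_ineq2[of \<alpha> \<beta>] ab by (simp add: norm_eq_sqrt_inner)
  then have "\<bar>?n\<bar> \<le> 2" using nz by (simp add: pairing_def abs_mult divide_le_eq)
  moreover obtain i where i: "?n = of_int i" using root_pairing_int[OF ab(2,1)] by (auto elim: Ints_cases)
  ultimately have "\<bar>i\<bar> \<le> 2" by auto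
  then have "i = 0 \<or> i = 1 \<or> i = -1 \<or> i = 2 \<or> i = -2" by arith
  then consider "?n = 0 \<or> ?n = 1 \<or> ?n = -1" | "?n = 2" | "?n = -2" using i by auto
  then show ?thesis
  proof cases
    case 2
    then have "\<alpha> \<bullet> \<beta> = \<beta> \<bullet> \<beta>" using nz by (simp add: pairing_def field_simps)
    then have "(\<alpha> - \<beta>) \<bullet> (\<alpha> - \<beta>) = 0" using ab by (simp add: inner_simps inner_commute)
    then show ?thesis by simp
  next
    case 3
    then have "\<alpha> \<bullet> \<beta> = - (\<beta> \<bullet> \<beta>)" using nz by (simp add: pairing_def field_simps)
    then have "(\<alpha> + \<beta>) \<bullet> (\<alpha> + \<beta>) = 0" using ab by (simp add: inner_simps inner_commute)
    then show ?thesis by (simp add: eq_neg_iff_add_eq_0)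
  qed auto
qed

text \<open>Every root lies in the span of the orbit of \<open>\<alpha>\<close> or is orthogonal to it, and irreducibility excludes
the second case. Hence some root \<open>x\<close> of the orbit is not orthogonal to \<open>\<beta>\<close>, and for roots of equal
norm the reflections in \<open>x\<close> and \<open>\<beta>\<close> connect \<open>x\<close> with \<open>\<beta>\<close>.\<close>

lemma transitive_same_norm:
  assumes irr: "irreducible_roots \<Phi>" and ab: "\<alpha> \<in> \<Phi>" "\<beta> \<in> \<Phi>" "\<alpha> \<bullet> \<alpha> = \<beta> \<bullet> \<beta>"
  shows "\<exists>ks. set ks \<subseteq> {1..l} \<and> \<beta> = rfls ks \<alpha>"
proof -
  define O' where "O' = {rfls ks \<alpha> | ks. set ks \<subseteq> {1..l}}"
  have step: "rfls ms x \<in> O'" if "x \<in> O'" "set ms \<subseteq> {1..l}" for x ms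
  proof -
    from that obtain ks where "x = rfls ks \<alpha>" "set ks \<subseteq> {1..l}" by (auto simp: O'_def)
    then show ?thesis using that unfolding O'_def by (intro CollectI exI[of _ "ms @ ks"]) auto
  qed
  have stepr: "rfl \<gamma> x \<in> O'" if "x \<in> O'" "\<gamma> \<in> \<Phi>" for x \<gamma>
    using rfl_word[OF that(2)] step[OF that(1)] by auto
  have OPhi: "O' \<subseteq> \<Phi>" using rfls_root ab by (auto simp: O'_def)
  have aO: "\<alpha> \<in> O'" unfolding O'_def by (intro CollectI exI[of _ "[]"]) simp
  \<comment> \<open>If \<open>\<gamma>\<close> is not orthogonal to some \<open>x\<close> in the orbit, then \<open>x - rfl \<gamma> x\<close> is a nonzero multiple of \<open>\<gamma>\<close>.\<close>
  have "\<gamma> \<in> span O' \<or> (\<forall>x\<in>span O'. \<gamma> \<bullet> x = 0)" if g: "\<gamma> \<in> \<Phi>" for \<gamma>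
  proof (cases "\<forall>x\<in>O'. \<gamma> \<bullet> x = 0")
    case True
    have "\<gamma> \<bullet> x = 0" if "x \<in> span O'" for x
      using that by (induction rule: span_induct_alt) (auto simp: inner_simps True)
    then show ?thesis by blast
  next
    case False
    then obtain x where x: "x \<in> O'" "\<gamma> \<bullet> x \<noteq> 0" by blast
    then have n: "pairing x \<gamma> \<noteq> 0" using root_nonzero[OF g] by (simp add: pairing_def inner_commute)
    have "x - rfl \<gamma> x \<in> span O'" using x stepr[OF x(1) g] by (intro span_diff span_base)
    then have "pairing x \<gamma> *\<^sub>R \<gamma> \<in> span O'" by (simp add: rfl_eq)
    moreover have "\<gamma> = (1 / pairing x \<gamma>) *\<^sub>R (pairing x \<gamma> *\<^sub>R \<gamma>)" using n by simp
    ultimately show ?thesis by (metis span_scale)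
  qed
  then have "\<Phi> = (\<Phi> \<inter> span O') \<union> {\<gamma> \<in> \<Phi>. \<forall>x\<in>span O'. \<gamma> \<bullet> x = 0}" by blast
  moreover have "(\<Phi> \<inter> span O') \<inter> {\<gamma> \<in> \<Phi>. \<forall>x\<in>span O'. \<gamma> \<bullet> x = 0} = {}"
    using root_nonzero by auto
  moreover have "\<Phi> \<inter> span O' \<noteq> {}" using aO ab by (auto intro: span_base)
  ultimately have "{\<gamma> \<in> \<Phi>. \<forall>x\<in>span O'. \<gamma> \<bullet> x = 0} = {}"
    using irr unfolding irreducible_roots_def
    by (smt (verit, ccfv_SIG) Int_iff inner_commute mem_Collect_eq)
  then have "\<not> (\<forall>x\<in>span O'. \<beta> \<bullet> x = 0)" using ab by blast
  then have "\<exists>x\<in>O'. \<beta> \<bullet> x \<noteq> 0"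
  proof (rule contrapos_np)
    assume *: "\<not> (\<exists>x\<in>O'. \<beta> \<bullet> x \<noteq> 0)"
    have "\<beta> \<bullet> x = 0" if "x \<in> span O'" for x
      using that * by (induction rule: span_induct_alt) (auto simp: inner_simps)
    then show "\<forall>x\<in>span O'. \<beta> \<bullet> x = 0" by blast
  qed
  then obtain x where x: "x \<in> O'" "\<beta> \<bullet> x \<noteq> 0" by blast
  have xx: "x \<bullet> x = \<beta> \<bullet> \<beta>" using x ab rfls_inner by (auto simp: O'_def)
  have xP: "x \<in> \<Phi>" using OPhi x by blast
  let ?n = "pairing x \<beta>"
  have n': "pairing \<beta> x = ?n" using xx by (simp add: pairing_def inner_commute)
  have nz: "?n \<noteq> 0" using x root_nonzero[OF ab(2)] by (simp add: pairing_def inner_commute)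
  have rb: "rfl \<beta> x = x - ?n *\<^sub>R \<beta>" and rx: "rfl x \<beta> = \<beta> - ?n *\<^sub>R x" by (simp_all add: rfl_eq n')
  have rn: "rfl \<beta> (- \<beta>) = \<beta>" "rfl x x = - x"
    using root_nonzero ab xP by (simp_all add: rfl_simps rfl_self)
  have "\<beta> \<in> O'"
  proof -
    from same_norm_cases[OF xP ab(2) xx] nz
    consider "?n = 1" | "?n = -1" | "x = \<beta>" | "x = - \<beta>" by auto
    then show ?thesis
    proof cases
      case 1
      then have "rfl \<beta> (rfl x (rfl \<beta> x)) = \<beta>" using rn by (simp add: rb rfl_simps rx)
      then show ?thesis using stepr x xP ab(2) by metis
    next
      case 2
      then have "rfl x (rfl \<beta> x) = \<beta>" using rn by (simp add: rb rfl_simps rx)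
      then show ?thesis using stepr x xP ab(2) by metis
    next
      case 3
      then show ?thesis using x by simp
    next
      case 4
      then have "rfl \<beta> x = \<beta>" using rn by simp
      then show ?thesis using stepr[OF x(1) ab(2)] by simp
    qed
  qed
  then show ?thesis by (auto simp: O'_def)
qed

end

section \<open>Short and long roots\<close>
text \<open>The simple roots joined by the multiple bond, the long one first.\<close>

fun bond :: "root_type \<Rightarrow> nat \<times> nat" where
  "bond (TypeB l) = (l - 1, l)"
| "bond (TypeC l) = (l, l - 1)"
| "bond TypeF4 = (2, 3)"
| "bond TypeG2 = (2, 1)"

locale typed_roots = root_basis \<Phi> "type_rank X" a
  for \<Phi> :: "'a::euclidean_space set" and X a +
  assumes valid: "valid_type X" and irreducible: "irreducible_roots \<Phi>"
    and cartan: "\<And>i j. i \<in> {1..type_rank X} \<Longrightarrow> j \<in> {1..type_rank X} \<Longrightarrow>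
       pairing (a i) (a j) = of_int (cartan_matrix X i j)"
begin

abbreviation l where "l \<equiv> type_rank X"
abbreviation k where "k \<equiv> type_const X"
abbreviation p where "p \<equiv> fst (bond X)"
abbreviation q where "q \<equiv> snd (bond X)"

lemma k_cases: "k = 2 \<or> k = 3" by (cases X) auto

lemma pq: "p \<in> {1..l}" "q \<in> {1..l}" "p \<noteq> q"
  using valid by (cases X; auto)+

lemma pairing_pq: "pairing (a p) (a q) = - k" "pairing (a q) (a p) = -1"
  unfolding cartan[OF pq(1,2)] cartan[OF pq(2,1)] using valid
  by (cases X; auto simp: cartan_matrix_def)+

lemma norm_pq: "a p \<bullet> a p = k * (a q \<bullet> a q)"
proof -
  have "a p \<noteq> 0" "a q \<noteq> 0" using pq simple_root root_nonzero by auto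
  then show ?thesis using pairing_pq by (simp add: pairing_def field_simps inner_commute)
qed

lemma norm_adjacent:
  assumes "i \<in> {1..l}" "Suc i \<in> {1..l}" "(i, Suc i) \<noteq> bond X" "(Suc i, i) \<noteq> bond X"
  shows "a i \<bullet> a i = a (Suc i) \<bullet> a (Suc i)"
proof -
  have "pairing (a i) (a (Suc i)) = -1" "pairing (a (Suc i)) (a i) = -1"
    unfolding cartan[OF assms(1,2)] cartan[OF assms(2,1)] using assms(3,4)
    by (cases X; auto simp: cartan_matrix_def)+
  moreover have "a i \<noteq> 0" "a (Suc i) \<noteq> 0" using assms simple_root root_nonzero by auto
  ultimately show ?thesis by (simp add: pairing_def field_simps inner_commute)
qed

lemma norm_chain:
  assumes "i \<le> j" "1 \<le> i" "j \<le> l" "\<And>n. i \<le> n \<Longrightarrow> n < j \<Longrightarrow> (n, Suc n) \<noteq> bond X \<and> (Suc n, n) \<noteq> bond X"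
  shows "a i \<bullet> a i = a j \<bullet> a j"
  using assms
proof (induction j rule: dec_induct)
  case (step n)
  then have "a i \<bullet> a i = a n \<bullet> a n" by simp
  also have "\<dots> = a (Suc n) \<bullet> a (Suc n)" using step by (intro norm_adjacent) auto
  finally show ?case .
qed simp

text \<open>Simple roots joined by a simple bond have the same length, and removing the multiple bond leaves
two connected pieces.\<close>

lemma norm_simple:
  assumes "i \<in> {1..l}" shows "a i \<bullet> a i = a p \<bullet> a p \<or> a i \<bullet> a i = a q \<bullet> a q"
proof (cases X)
  case (TypeB n)
  show ?thesis
  proof (cases "i = n")
    case False
    then have "a i \<bullet> a i = a p \<bullet> a p" using assms TypeB by (intro norm_chain) auto
    then show ?thesis ..
  qed (simp add: TypeB)
next
  case (TypeC n)
  show ?thesis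
  proof (cases "i = n")
    case False
    then have "a i \<bullet> a i = a q \<bullet> a q" using assms TypeC by (intro norm_chain) auto
    then show ?thesis ..
  qed (simp add: TypeC)
next
  case TypeF4
  then have "a 1 \<bullet> a 1 = a 2 \<bullet> a 2" "a 3 \<bullet> a 3 = a 4 \<bullet> a 4"
    by (intro norm_chain; auto)+
  moreover have "i = 1 \<or> i = 2 \<or> i = 3 \<or> i = 4" using assms TypeF4 by auto
  ultimately show ?thesis using TypeF4 by auto
next
  case TypeG2
  then have "i = 1 \<or> i = 2" using assms by auto
  then show ?thesis using TypeG2 by auto
qed

lemma norm_root:
  assumes "\<beta> \<in> \<Phi>" shows "\<beta> \<bullet> \<beta> = a p \<bullet> a p \<or> \<beta> \<bullet> \<beta> = a q \<bullet> a q"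
proof -
  obtain ks i where "set ks \<subseteq> {1..l}" "i \<in> {1..l}" "\<beta> = rfls ks (a i)"
    using root_from_simple[OF assms] by blast
  then show ?thesis using norm_simple[of i] by (simp add: rfls_inner)
qed

lemma norm_less: "0 < a q \<bullet> a q" "a q \<bullet> a q < a p \<bullet> a p"
proof -
  show "0 < a q \<bullet> a q" using pq simple_root root_nonzero by auto
  then show "a q \<bullet> a q < a p \<bullet> a p" using k_cases by (auto simp: norm_pq)
qed

lemma simple_pq: "a p \<in> \<Phi>" "a q \<in> \<Phi>" using pq simple_root by auto

lemma short_eq: "short_roots \<Phi> = {\<beta> \<in> \<Phi>. \<beta> \<bullet> \<beta> = a q \<bullet> a q}"
  using norm_root norm_less simple_pq
  by (auto simp: short_roots_def norm_le) force+

lemma long_eq: "long_roots \<Phi> = {\<beta> \<in> \<Phi>. \<beta> \<bullet> \<beta> = a p \<bullet> a p}"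
  using norm_root norm_less simple_pq
  by (auto simp: long_roots_def norm_le) force+

lemma short_or_long: "\<beta> \<in> \<Phi> \<Longrightarrow> \<beta> \<in> short_roots \<Phi> \<or> \<beta> \<in> long_roots \<Phi>"
  using norm_root by (auto simp: short_eq long_eq)

lemma not_short_and_long: "\<beta> \<in> short_roots \<Phi> \<Longrightarrow> \<beta> \<notin> long_roots \<Phi>"
  using norm_less by (auto simp: short_eq long_eq)

lemma short_root: "\<beta> \<in> short_roots \<Phi> \<Longrightarrow> \<beta> \<in> \<Phi>" and long_root: "\<beta> \<in> long_roots \<Phi> \<Longrightarrow> \<beta> \<in> \<Phi>"
  by (auto simp: short_eq long_eq)

lemma rfl_short_long:
  assumes "\<alpha> \<in> \<Phi>" "\<beta> \<in> \<Phi>"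
  shows "rfl \<alpha> \<beta> \<in> short_roots \<Phi> \<longleftrightarrow> \<beta> \<in> short_roots \<Phi>"
    and "rfl \<alpha> \<beta> \<in> long_roots \<Phi> \<longleftrightarrow> \<beta> \<in> long_roots \<Phi>"
  using assms by (auto simp: short_eq long_eq rfl_inner root_nonzero root_rfl)

lemma rfls_short_long:
  assumes "set ks \<subseteq> {1..l}" 
  shows "\<beta> \<in> short_roots \<Phi> \<Longrightarrow> rfls ks \<beta> \<in> short_roots \<Phi>"
    and "\<beta> \<in> long_roots \<Phi> \<Longrightarrow> rfls ks \<beta> \<in> long_roots \<Phi>"
  using assms by (auto simp: short_eq long_eq rfls_inner rfls_root)

lemma uminus_short_long:
  "\<beta> \<in> short_roots \<Phi> \<Longrightarrow> - \<beta> \<in> short_roots \<Phi>" "\<beta> \<in> long_roots \<Phi> \<Longrightarrow> - \<beta> \<in> long_roots \<Phi>"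
  by (auto simp: short_eq long_eq root_uminus)

lemma short_q: "a q \<in> short_roots \<Phi>" and long_p: "a p \<in> long_roots \<Phi>"
  using simple_pq by (auto simp: short_eq long_eq)

lemma short_transitive:
  "\<alpha> \<in> short_roots \<Phi> \<Longrightarrow> \<beta> \<in> short_roots \<Phi> \<Longrightarrow> \<exists>ks. set ks \<subseteq> {1..l} \<and> \<beta> = rfls ks \<alpha>"
  using transitive_same_norm[OF irreducible] by (auto simp: short_eq)

lemma long_transitive:
  "\<alpha> \<in> long_roots \<Phi> \<Longrightarrow> \<beta> \<in> long_roots \<Phi> \<Longrightarrow> \<exists>ks. set ks \<subseteq> {1..l} \<and> \<beta> = rfls ks \<alpha>"
  using transitive_same_norm[OF irreducible] by (auto simp: long_eq)

lemma pairing_long_short: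
  assumes "\<alpha> \<in> short_roots \<Phi>" "\<beta> \<in> long_roots \<Phi>"
  shows "pairing \<beta> \<alpha> = k * pairing \<alpha> \<beta>"
  using assms norm_less norm_pq by (auto simp: short_eq long_eq pairing_def inner_commute)

lemma small_int_cases: assumes "x \<in> \<int>" "x\<^sup>2 < (4::real)" shows "x = 0 \<or> x = 1 \<or> x = -1"
proof -
  obtain m where m: "x = of_int m" using assms by (auto elim: Ints_cases)
  have "\<bar>x\<bar> < 2" using assms(2) abs_square_less_1[of "x / 2"] by (simp add: power_divide)
  then have "\<bar>m\<bar> < 2" by (simp add: m)
  then have "m = 0 \<or> m = 1 \<or> m = -1" by arith
  then show ?thesis by (auto simp: m)
qed

lemma pairing_short_long:
  assumes "\<alpha> \<in> short_roots \<Phi>" "\<beta> \<in> long_roots \<Phi>"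
  shows "pairing \<alpha> \<beta> = 0 \<or> pairing \<alpha> \<beta> = 1 \<or> pairing \<alpha> \<beta> = -1"
proof (rule small_int_cases)
  show "pairing \<alpha> \<beta> \<in> \<int>" using assms root_pairing_int short_root long_root by blast
  have nz: "\<alpha> \<bullet> \<alpha> > 0" "\<beta> \<bullet> \<beta> > 0"
    using assms short_root long_root root_nonzero by (metis inner_gt_zero_iff)+
  have "(\<alpha> \<bullet> \<beta>)\<^sup>2 \<le> (\<alpha> \<bullet> \<alpha>) * (\<beta> \<bullet> \<beta>)" by (rule Cauchy_Schwarz_ineq)
  also have "\<dots> < (\<beta> \<bullet> \<beta>) * (\<beta> \<bullet> \<beta>)" using assms norm_less nz by (auto simp: short_eq long_eq)
  finally show "(pairing \<alpha> \<beta>)\<^sup>2 < 4"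
    using nz by (simp add: pairing_def power_divide power_mult_distrib power2_eq_square divide_less_eq)
qed

text \<open>By transitivity, a configuration of two roots can be moved so that its first root is any given
root of the same length. Partners with pairing \<open>1\<close> (or \<open>k\<close>) are what makes \<open>t_add\<close> useful.\<close>

lemma ex_pairing:
  assumes "\<alpha>0 \<in> \<Phi>" "\<gamma>0 \<in> \<Phi>" "\<alpha> \<in> \<Phi>" "\<alpha> \<bullet> \<alpha> = \<alpha>0 \<bullet> \<alpha>0"
  shows "\<exists>\<gamma>\<in>\<Phi>. \<gamma> \<bullet> \<gamma> = \<gamma>0 \<bullet> \<gamma>0 \<and> pairing \<alpha> \<gamma> = pairing \<alpha>0 \<gamma>0"
proof -
  obtain ks where "set ks \<subseteq> {1..l}" "\<alpha> = rfls ks \<alpha>0"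
    using transitive_same_norm[OF irreducible assms(1,3)] assms(4) by auto
  then show ?thesis using assms by (intro bexI[of _ "rfls ks \<gamma>0"]) (auto simp: pairing_rfls rfls_inner rfls_root)
qed

lemma short_long_partner:
  assumes "\<alpha> \<in> short_roots \<Phi>" shows "\<exists>\<gamma>\<in>long_roots \<Phi>. pairing \<alpha> \<gamma> = 1"
  using ex_pairing[of "a q" "- a p" \<alpha>] assms simple_pq root_uminus pairing_pq
  by (auto simp: short_eq long_eq pairing_simps)

lemma long_short_partner:
  assumes "\<beta> \<in> long_roots \<Phi>" shows "\<exists>\<gamma>\<in>short_roots \<Phi>. pairing \<beta> \<gamma> = k"
  using ex_pairing[of "a p" "- a q" \<beta>] assms simple_pq root_uminus pairing_pq
  by (auto simp: short_eq long_eq pairing_simps)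

lemma partner_from_simple:
  assumes "i \<in> {1..l}" "\<gamma>0 \<in> \<Phi>" "\<gamma>0 \<bullet> \<gamma>0 = a i \<bullet> a i" "pairing (a i) \<gamma>0 = -1"
    and "\<alpha> \<in> \<Phi>" "\<alpha> \<bullet> \<alpha> = a i \<bullet> a i"
  shows "\<exists>\<gamma>\<in>\<Phi>. \<gamma> \<bullet> \<gamma> = a i \<bullet> a i \<and> pairing \<alpha> \<gamma> = 1"
  using ex_pairing[of "a i" "- \<gamma>0" \<alpha>] assms simple_root root_uminus by (auto simp: pairing_simps)

text \<open>Outside type \<open>B\<close> there are two short roots at an angle of 60 degrees: two adjacent short simple
roots in types \<open>C\<close> and \<open>F\<close>, and a short simple root with the negative of a reflected one in type
\<open>G\<close>.\<close>

lemma short_short_partner: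
  assumes "\<And>n. X \<noteq> TypeB n" "\<alpha> \<in> short_roots \<Phi>"
  shows "\<exists>\<gamma>\<in>short_roots \<Phi>. pairing \<alpha> \<gamma> = 1"
proof -
  have "\<exists>\<gamma>0\<in>\<Phi>. \<gamma>0 \<bullet> \<gamma>0 = a q \<bullet> a q \<and> pairing (a q) \<gamma>0 = -1"
  proof (cases X)
    case (TypeC n)
    then have n: "n \<ge> 3" using valid by auto
    have i: "n - 2 \<in> {1..l}" "n - 1 \<in> {1..l}" using n TypeC by auto
    have "pairing (a (n - 1)) (a (n - 2)) = -1"
      unfolding cartan[OF i(2,1)] using n TypeC by (auto simp: cartan_matrix_def)
    moreover have "a (n - 2) \<bullet> a (n - 2) = a (n - 1) \<bullet> a (n - 1)" using n TypeC by (intro norm_chain) auto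
    ultimately show ?thesis using TypeC i simple_root by auto
  next
    case TypeF4
    then have i: "3 \<in> {1..l}" "4 \<in> {1..l}" by auto
    have "pairing (a 3) (a 4) = -1" unfolding cartan[OF i] using TypeF4 by (auto simp: cartan_matrix_def)
    moreover have "a 3 \<bullet> a 3 = a 4 \<bullet> a 4" using TypeF4 by (intro norm_chain) auto
    ultimately show ?thesis using TypeF4 i simple_root by auto
  next
    \<comment> \<open>The short roots \<open>a q\<close> and \<open>- (a q + a p)\<close> form an angle of 60 degrees.\<close>
    case TypeG2
    have e: "rfl (a p) (a q) = a q + a p" using pairing_pq by (simp add: rfl_eq)
    have "rfl (a p) (a q) \<bullet> rfl (a p) (a q) = a q \<bullet> a q" using rfl_inner simple_pq root_nonzero by blast
    moreover have "pairing (a q) (rfl (a p) (a q)) = -1"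
    proof -
      have "pairing (a q) (rfl (a p) (a q)) = 2 * (a q \<bullet> (a q + a p)) / (a q \<bullet> a q)"
        unfolding pairing_def[of _ "rfl (a p) (a q)"] calculation using e by simp
      also have "\<dots> = pairing (a q) (a q) + pairing (a p) (a q)"
        by (simp add: pairing_def inner_simps inner_commute add_divide_distrib)
      finally show ?thesis using pairing_pq simple_pq root_nonzero TypeG2 by (simp add: pairing_self)
    qed
    ultimately show ?thesis using root_rfl simple_pq by blast
  qed (use assms in auto)
  then show ?thesis using partner_from_simple[OF pq(2)] assms(2) by (auto simp: short_eq)
qed

lemma long_long_partner:
  assumes "X \<noteq> TypeB 2" "\<And>n. X \<noteq> TypeC n" "\<beta> \<in> long_roots \<Phi>"
  shows "\<exists>\<gamma>\<in>long_roots \<Phi>. pairing \<beta> \<gamma> = 1"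
proof -
  have "\<exists>\<gamma>0\<in>\<Phi>. \<gamma>0 \<bullet> \<gamma>0 = a p \<bullet> a p \<and> pairing (a p) \<gamma>0 = -1"
  proof (cases X)
    case (TypeB n)
    then have n: "n \<ge> 3" using valid assms(1) by (cases "n = 2") auto
    have i: "n - 2 \<in> {1..l}" "n - 1 \<in> {1..l}" using n TypeB by auto
    have "pairing (a (n - 1)) (a (n - 2)) = -1"
      unfolding cartan[OF i(2,1)] using n TypeB by (auto simp: cartan_matrix_def)
    moreover have "a (n - 2) \<bullet> a (n - 2) = a (n - 1) \<bullet> a (n - 1)" using n TypeB by (intro norm_chain) auto
    ultimately show ?thesis using TypeB i simple_root by auto
  next
    case TypeF4
    then have i: "1 \<in> {1..l}" "2 \<in> {1..l}" by auto
    have "pairing (a 2) (a 1) = -1" unfolding cartan[OF i(2,1)] using TypeF4 by (auto simp: cartan_matrix_def)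
    moreover have "a 1 \<bullet> a 1 = a 2 \<bullet> a 2" using TypeF4 by (intro norm_chain) auto
    ultimately show ?thesis using TypeF4 i simple_root by auto
  next
    \<comment> \<open>The long roots \<open>a p\<close> and \<open>- (a p + 3 a q)\<close> form an angle of 60 degrees.\<close>
    case TypeG2
    have e: "rfl (a q) (a p) = a p + 3 *\<^sub>R a q" using pairing_pq TypeG2 by (simp add: rfl_eq)
    have "rfl (a q) (a p) \<bullet> rfl (a q) (a p) = a p \<bullet> a p" using rfl_inner simple_pq root_nonzero by blast
    moreover have "pairing (a p) (rfl (a q) (a p)) = -1"
    proof -
      have "pairing (a p) (rfl (a q) (a p)) = 2 * (a p \<bullet> (a p + 3 *\<^sub>R a q)) / (a p \<bullet> a p)"
        unfolding pairing_def[of _ "rfl (a q) (a p)"] calculation using e by simp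
      also have "\<dots> = pairing (a p) (a p) + 3 * pairing (a q) (a p)"
        by (simp add: pairing_def inner_simps inner_commute add_divide_distrib)
      finally show ?thesis using pairing_pq simple_pq root_nonzero by (simp add: pairing_self)
    qed
    ultimately show ?thesis using root_rfl simple_pq by blast
  qed (use assms in auto)
  then show ?thesis using partner_from_simple[OF pq(1)] assms(3) by (auto simp: long_eq)
qed

lemma pairing_expand:
  assumes "j \<in> {1..l}" shows "pairing x (a j) = (\<Sum>i=1..l. simple_co i x * of_int (cartan_matrix X i j))"
proof -
  have "pairing x (a j) = pairing (\<Sum>i=1..l. simple_co i x *\<^sub>R a i) (a j)" using expand[of x] by simp
  also have "\<dots> = (\<Sum>i=1..l. simple_co i x * pairing (a i) (a j))"
    by (simp add: pairing_def inner_sum_left sum_divide_distrib sum_distrib_left mult_ac)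
  finally show ?thesis using assms by (simp add: cartan)
qed

lemma Ints_half_mult: "x / 2 \<in> \<int> \<Longrightarrow> y \<in> \<int> \<Longrightarrow> x * y / 2 \<in> (\<int> :: real set)"
  using Ints_mult[of "x / 2" y] by simp

text \<open>In type \<open>B\<close> the column of the Cartan matrix at the short simple root is even.\<close>

lemma even_pairing_short:
  assumes "X = TypeB n" "\<alpha> \<in> short_roots \<Phi>" "\<gamma> \<in> \<Phi>"
  shows "pairing \<gamma> \<alpha> / 2 \<in> \<int>"
proof -
  obtain ks where ks: "set ks \<subseteq> {1..l}" "\<alpha> = rfls ks (a q)" using short_transitive[OF short_q assms(2)] by blast
  let ?g = "rfls (rev ks) \<gamma>"
  have g: "?g \<in> \<Phi>" using ks assms by (intro rfls_root) auto
  have "pairing \<gamma> \<alpha> = pairing ?g (a q)"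
    using pairing_rfls[of ks ?g "a q"] rfls_rev[of "rev ks" \<gamma>] ks by simp
  also have "\<dots> / 2 = (\<Sum>i=1..l. of_int (cartan_matrix X i q) * simple_co i ?g / 2)"
    by (simp add: pairing_expand[OF pq(2)] sum_divide_distrib mult.commute)
  also have "\<dots> \<in> \<int>"
  proof (intro Ints_sum Ints_half_mult)
    fix i assume i: "i \<in> {1..l}"
    show "simple_co i ?g \<in> \<int>" using simple_co_root(1)[OF g i] .
    show "of_int (cartan_matrix X i q) / 2 \<in> (\<int> :: real set)"
      using i assms(1) valid by (auto simp: cartan_matrix_def)
  qed
  finally show ?thesis .
qed

text \<open>Here the row of the Cartan matrix at the long simple root \<open>a p\<close> is even. Consequently the simple
reflections preserve the set of integral vectors whose coordinates other than the one at \<open>a p\<close> are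
even, and this set contains all long roots.\<close>

lemma even_pairing_long:
  assumes X: "X = TypeB 2 \<or> X = TypeC n" and b: "\<beta> \<in> long_roots \<Phi>" "\<gamma> \<in> long_roots \<Phi>"
  shows "pairing \<gamma> \<beta> / 2 \<in> \<int>"
proof -
  have even: "of_int (cartan_matrix X p j) / 2 \<in> (\<int> :: real set)" if "j \<in> {1..l}" for j
    using X that valid by (auto simp: cartan_matrix_def)
  define E where "E x \<longleftrightarrow> (\<forall>i\<in>{1..l}. simple_co i x \<in> \<int> \<and> (i \<noteq> p \<longrightarrow> simple_co i x / 2 \<in> \<int>))" for x
  have Ep: "pairing x (a j) / 2 \<in> \<int>" if "E x" "j \<in> {1..l}" for x j
  proof -
    have "simple_co i x * of_int (cartan_matrix X i j) / 2 \<in> \<int>" if "i \<in> {1..l}" for i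
    proof (cases "i = p")
      case True
      then show ?thesis using Ints_half_mult[OF even[OF \<open>j \<in> _\<close>], of "simple_co p x"] \<open>E x\<close> that
        by (simp add: E_def mult.commute)
    next
      case False
      then show ?thesis using \<open>E x\<close> that by (intro Ints_half_mult) (auto simp: E_def)
    qed
    then show ?thesis unfolding pairing_expand[OF that(2)] sum_divide_distrib by (intro Ints_sum)
  qed
  \<comment> \<open>Only the coordinate at \<open>j\<close> changes, by an even integer.\<close>
  have Er: "E (rfl (a j) x)" if "E x" "j \<in> {1..l}" for x j
  proof -
    have "simple_co i (rfl (a j) x) = simple_co i x - (if i = j then pairing x (a j) else 0)" if "i \<in> {1..l}" for i
      using that \<open>j \<in> _\<close> by (simp add: rfl_eq simple_co_linear simple_co_simple)
    moreover have "pairing x (a j) \<in> \<int>" using Ints_mult[OF Ep[OF that], of 2] by simp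
    ultimately show ?thesis using that Ep[OF that] by (auto simp: E_def diff_divide_distrib)
  qed
  have Es: "E (rfls ks (a p))" if "set ks \<subseteq> {1..l}" for ks
    using that
  proof (induction ks)
    case Nil show ?case using pq(1) by (auto simp: E_def simple_co_simple)
  qed (auto intro: Er)
  obtain ks where ks: "set ks \<subseteq> {1..l}" "\<beta> = rfls ks (a p)" using long_transitive[OF long_p b(1)] by blast
  have "rfls (rev ks) \<gamma> \<in> long_roots \<Phi>" using ks b by (intro rfls_short_long) auto
  from long_transitive[OF long_p this] have "E (rfls (rev ks) \<gamma>)" using Es by auto
  moreover have "pairing \<gamma> \<beta> = pairing (rfls (rev ks) \<gamma>) (a p)"
    using pairing_rfls[of ks "rfls (rev ks) \<gamma>" "a p"] rfls_rev[of "rev ks" \<gamma>] ks by simp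
  ultimately show ?thesis using Ep pq(1) by simp
qed

end

section \<open>The center and the action on the dual of the radical\<close>

context fibred_roots begin

lemma act_linear: assumes "u \<in> carrier G" shows "linear (act u)"
proof -
  have "linear (\<lambda>v::'a \<times> 'b. (v, 0 :: 'b \<Rightarrow>\<^sub>L real))" by (rule linearI) auto
  note linear_compose[OF linear_compose[OF this psi_linear[OF assms]] linear_fst]
  moreover have "act u = (\<lambda>v. fst (\<psi> u (v, 0)))" by (rule ext) (simp add: act_def)
  ultimately show ?thesis by (simp add: comp_def)
qed

lemma act_radical: "u \<in> carrier G \<Longrightarrow> act u (0, y) = (0, y)"
  by (induction rule: G_induct) (simp_all add: act_w rfl_simps pairing_simps)

text \<open>A reflection determines its root up to sign, and its image under \<open>\<psi>\<close> is a reflection.\<close>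

lemma w_eq_imp:
  assumes "\<alpha> \<in> \<Phi>" "\<sigma> \<in> L \<alpha>" "\<gamma> \<in> \<Phi>" "\<delta> \<in> L \<gamma>" "w \<gamma> \<delta> = w \<alpha> \<sigma>"
  shows "(\<gamma>, \<delta>) = (\<alpha>, \<sigma>) \<or> (\<gamma>, \<delta>) = (- \<alpha>, - \<sigma>)"
proof -
  let ?c = "pairing \<alpha> \<gamma>"
  have "act (w \<gamma> \<delta>) (\<alpha>, \<sigma>) = act (w \<alpha> \<sigma>) (\<alpha>, \<sigma>)" by (simp only: assms(5))
  then have "(\<alpha> - ?c *\<^sub>R \<gamma>, \<sigma> - ?c *\<^sub>R \<delta>) = (- \<alpha>, - \<sigma>)"
    using assms(1-4) by (simp add: act_w rfl_self root_nz pairing_self scaleR_2 rfl_eq[of \<gamma>])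
  then have e: "\<alpha> - ?c *\<^sub>R \<gamma> = - \<alpha>" "\<sigma> - ?c *\<^sub>R \<delta> = - \<sigma>" by simp_all
  have c: "?c *\<^sub>R \<gamma> = 2 *\<^sub>R \<alpha>" "?c *\<^sub>R \<delta> = 2 *\<^sub>R \<sigma>"
    using e by (simp_all add: scaleR_2 algebra_simps) 
  have c0: "?c \<noteq> 0" using c(1) root_nz[OF assms(1)] by auto
  then have g: "\<gamma> = (2 / ?c) *\<^sub>R \<alpha>" "\<delta> = (2 / ?c) *\<^sub>R \<sigma>"
  proof -
    have "\<gamma> = (1 / ?c) *\<^sub>R (?c *\<^sub>R \<gamma>)" "\<delta> = (1 / ?c) *\<^sub>R (?c *\<^sub>R \<delta>)" using c0 by simp_all
    then show "\<gamma> = (2 / ?c) *\<^sub>R \<alpha>" "\<delta> = (2 / ?c) *\<^sub>R \<sigma>" unfolding c by simp_all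
  qed
  then have "2 / ?c = 1 \<or> 2 / ?c = -1"
    using roots assms(1,3) unfolding root_system_def by metis
  then show ?thesis using g by auto
qed

text \<open>Conjugation by a central element fixes each \<open>w \<alpha> \<sigma>\<close>, so the element sends each root to itself or
to its negative. If it negated \<open>(\<alpha>, 0)\<close>, it would send \<open>(\<alpha>, \<sigma>)\<close> to \<open>(- \<alpha>, \<sigma>)\<close>, because it fixes
the radical; this is neither \<open>(\<alpha>, \<sigma>)\<close> nor its negative when \<open>\<sigma> \<noteq> 0\<close>.\<close>

lemma center_eq_K:
  assumes sp: "\<And>\<alpha>. \<alpha> \<in> \<Phi> \<Longrightarrow> \<exists>\<sigma>\<in>L \<alpha>. \<sigma> \<noteq> 0"
  shows "group_center G = K"
proof
  show "K \<subseteq> group_center G" using K_central by blast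
  show "group_center G \<subseteq> K"
  proof
    fix u assume u: "u \<in> group_center G"
    then have uG: "u \<in> carrier G" by (simp add: group_center_def)
    interpret act: linear "act u" by (rule act_linear[OF uG])
    have pm: "act u (\<alpha>, \<sigma>) = (\<alpha>, \<sigma>) \<or> act u (\<alpha>, \<sigma>) = (- \<alpha>, - \<sigma>)"
      if as: "\<alpha> \<in> \<Phi>" "\<sigma> \<in> L \<alpha>" for \<alpha> \<sigma>
    proof -
      obtain \<gamma> \<delta> where gd: "act u (\<alpha>, \<sigma>) = (\<gamma>, \<delta>)" by (metis prod.exhaust)
      have "u \<otimes>\<^bsub>G\<^esub> w \<alpha> \<sigma> \<otimes>\<^bsub>G\<^esub> inv\<^bsub>G\<^esub> u = w \<alpha> \<sigma>"
        using G.centerD[OF u, of "w \<alpha> \<sigma>"] as uG by (simp add: G.m_assoc)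
      then show ?thesis using w_eq_imp[OF as] act_root_conj[OF uG as gd] gd by auto
    qed
    have fix_root: "act u (\<alpha>, 0) = (\<alpha>, 0)" if a: "\<alpha> \<in> \<Phi>" for \<alpha>
    proof (rule ccontr)
      assume "act u (\<alpha>, 0) \<noteq> (\<alpha>, 0)"
      then have m: "act u (\<alpha>, 0) = (- \<alpha>, 0)" using pm[OF a fibre_zero[OF a]] by auto
      obtain \<sigma> where s: "\<sigma> \<in> L \<alpha>" "\<sigma> \<noteq> 0" using sp[OF a] by blast
      have "act u (\<alpha>, \<sigma>) = (- \<alpha>, \<sigma>)"
        using act.add[of "(\<alpha>, 0)" "(0, \<sigma>)"] m act_radical[OF uG] by simp
      then show False using pm[OF a s(1)] s(2) root_nz[OF a] by (auto simp: eq_neg_iff_add_eq_0 neg_eq_iff_add_eq_0 simp flip: scaleR_2)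
    qed
    have "act u (x, 0) = (x, 0)" for x
    proof -
      have "x \<in> span \<Phi>" using roots by (simp add: root_system_def)
      then show ?thesis
      proof (induction rule: span_induct_alt)
        case base show ?case using act.zero by (simp add: zero_prod_def)
      next
        case (step c x y)
        have "act u (c *\<^sub>R x + y, 0) = c *\<^sub>R act u (x, 0) + act u (y, 0)"
          using act.add[of "c *\<^sub>R (x, 0)" "(y, 0)"] act.scale[of c "(x, 0)"] by simp
        then show ?case using step fix_root by simp
      qed
    qed
    then have "act u (x, y) = (x, y)" for x y
      using act.add[of "(x, 0)" "(0, y)"] act_radical[OF uG, of y] by simp
    then show "u \<in> K" using uG by (auto simp: K_def)
  qed
qed

text \<open>An element of \<open>K\<close> fixes \<open>V\<close> and adds a vector of \<open>V\<close> to each functional on the radical. This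
vector is all that \<open>\<psi>\<close> remembers of the element.\<close>

definition shear :: "('a \<times> 'b) word set \<Rightarrow> ('b \<Rightarrow>\<^sub>L real) \<Rightarrow> 'a \<times> 'b" where
  "shear u l = fst (\<psi> u (0, l))"

lemma psi_K: assumes "u \<in> K" shows "\<psi> u (v, l) = (v + shear u l, l)"
proof -
  interpret f: linear "\<psi> u" by (rule psi_linear[OF K_carrier[OF assms]])
  have "\<psi> u (v, l) = \<psi> u (v, 0) + \<psi> u (0, l)" using f.add[of "(v, 0)" "(0, l)"] by simp
  then show ?thesis using assms snd_psi[of u "(0, l)"] K_carrier[of u]
    by (cases v) (auto simp: psi_act prod_eq_iff shear_def K_def simp del: split_paired_All)
qed

lemma shear_mult: "u \<in> K \<Longrightarrow> v \<in> K \<Longrightarrow> shear (u \<otimes>\<^bsub>G\<^esub> v) l = shear u l + shear v l"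
  unfolding shear_def[of "u \<otimes>\<^bsub>G\<^esub> v"] by (simp add: K_carrier psi_K)

lemma shear_one: "shear \<one>\<^bsub>G\<^esub> l = 0" by (simp add: shear_def)

lemma shear_inv: assumes "u \<in> K" shows "shear (inv\<^bsub>G\<^esub> u) l = - shear u l"
  using shear_mult[OF assms, of "inv\<^bsub>G\<^esub> u" l] subgroup.m_inv_closed[OF subgroup_K assms]
  by (simp add: K_carrier assms shear_one eq_neg_iff_add_eq_0 add.commute)

lemma K_pow: "u \<in> K \<Longrightarrow> u [^]\<^bsub>G\<^esub> (i::nat) \<in> K"
  by (induction i) (auto simp: subgroup.one_closed[OF subgroup_K] subgroup.m_closed[OF subgroup_K])

lemma shear_pow: "u \<in> K \<Longrightarrow> shear (u [^]\<^bsub>G\<^esub> (i::nat)) l = real i *\<^sub>R shear u l"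
  by (induction i) (simp_all add: shear_one shear_mult K_pow algebra_simps)

lemma K_int_pow: "u \<in> K \<Longrightarrow> u [^]\<^bsub>G\<^esub> (i::int) \<in> K"
  by (cases i rule: int_cases2)
    (simp_all add: int_pow_int G.int_pow_neg K_carrier K_pow subgroup.m_inv_closed[OF subgroup_K])

lemma shear_int_pow: "u \<in> K \<Longrightarrow> shear (u [^]\<^bsub>G\<^esub> (i::int)) l = of_int i *\<^sub>R shear u l"
  by (cases i rule: int_cases2)
    (simp_all add: int_pow_int G.int_pow_neg K_carrier K_pow shear_pow shear_inv)

lemma kernel_iff: "u \<in> kernel G W \<psi> \<longleftrightarrow> u \<in> K \<and> (\<forall>l. shear u l = 0)"
proof
  assume "u \<in> kernel G W \<psi>"
  then have u: "u \<in> carrier G" "\<psi> u = id" by (auto simp: kernel_def W_one)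
  then show "u \<in> K \<and> (\<forall>l. shear u l = 0)" by (auto simp: K_def act_def shear_def)
next
  assume u: "u \<in> K \<and> (\<forall>l. shear u l = 0)"
  then have "\<psi> u = id" by (auto simp: fun_eq_iff psi_K)
  then show "u \<in> kernel G W \<psi>" using u by (simp add: kernel_def W_one K_carrier)
qed

text \<open>Shears are added under multiplication, and vectors have no torsion.\<close>

lemma finite_order_kernel:
  assumes "u \<in> K" "(i::nat) > 0" "u [^]\<^bsub>G\<^esub> i = \<one>\<^bsub>G\<^esub>"
  shows "u \<in> kernel G W \<psi>"
  unfolding kernel_iff
proof (intro conjI allI)
  fix l
  have "real i *\<^sub>R shear u l = 0" using shear_pow[OF assms(1), of i l] assms(3) by (simp add: shear_one)
  then show "shear u l = 0" using assms(2) by simp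
qed (rule assms(1))

lemma psi_t:
  assumes "\<alpha> \<in> \<Phi>" "\<sigma> \<in> L \<alpha>"
  shows "\<psi> (t \<alpha> \<sigma>) ((x, y), l) =
    ((x - (2 * blinfun_apply l \<sigma> / (\<alpha> \<bullet> \<alpha>)) *\<^sub>R \<alpha>,
      y + pairing x \<alpha> *\<^sub>R \<sigma> - (2 * blinfun_apply l \<sigma> / (\<alpha> \<bullet> \<alpha>)) *\<^sub>R \<sigma>), l)"
  using assms
  by (simp add: t_eq fibre_zero psi_w weyl_refl_eq pairing_simps pairing_self root_nz)
     (simp add: algebra_simps)

text \<open>The shear of a commutator of translations is a multiple of the bivector \<open>\<sigma> \<and> \<tau>\<close>. It is nonzero for
nonorthogonal roots and independent translations.\<close>

lemma shear_cm:
  assumes "\<alpha> \<in> \<Phi>" "\<sigma> \<in> L \<alpha>" "\<beta> \<in> \<Phi>" "\<tau> \<in> L \<beta>"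
  shows "shear (cm (t \<alpha> \<sigma>) (t \<beta> \<tau>)) l =
    (0, (4 * (\<alpha> \<bullet> \<beta>) / ((\<alpha> \<bullet> \<alpha>) * (\<beta> \<bullet> \<beta>))) *\<^sub>R (blinfun_apply l \<sigma> *\<^sub>R \<tau> - blinfun_apply l \<tau> *\<^sub>R \<sigma>))"
proof -
  let ?u = "t \<alpha> \<sigma>" and ?v = "t \<beta> \<tau>"
  have H: "?u \<in> H" "?v \<in> H" using assms by auto
  note c = H_carrier[OF H(1)] H_carrier[OF H(2)]
  obtain x y where xy: "\<psi> (?v \<otimes>\<^bsub>G\<^esub> ?u) ((0, 0), l) = ((x, y), l)"
    using snd_psi[of "?v \<otimes>\<^bsub>G\<^esub> ?u" "((0, 0), l)"] c by (metis G.m_closed prod.collapse snd_conv)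
  have "\<psi> (?u \<otimes>\<^bsub>G\<^esub> ?v) ((0, 0), l) = ((x, y) + shear (cm ?u ?v) l, l)"
    unfolding mult_cm[OF H] using psi_K[OF cm_K[OF H]] xy c by (simp add: K_carrier)
  then have "shear (cm ?u ?v) l = fst (\<psi> (?u \<otimes>\<^bsub>G\<^esub> ?v) ((0, 0), l)) - fst (\<psi> (?v \<otimes>\<^bsub>G\<^esub> ?u) ((0, 0), l))"
    unfolding xy by (simp del: psi_mult)
  also have "\<dots> = (0, (4 * (\<alpha> \<bullet> \<beta>) / ((\<alpha> \<bullet> \<alpha>) * (\<beta> \<bullet> \<beta>))) *\<^sub>R (blinfun_apply l \<sigma> *\<^sub>R \<tau> - blinfun_apply l \<tau> *\<^sub>R \<sigma>))"
    using assms c by (simp add: psi_t pairing_simps)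
      (simp add: pairing_def algebra_simps inner_commute)
  finally show ?thesis .
qed

end

section \<open>Integral spans and semilattices\<close>

lemma int_span_base: "x \<in> S \<Longrightarrow> x \<in> int_span S"
  unfolding int_span_def by (intro CollectI exI[of _ "{x}"] exI[of _ "\<lambda>_. 1"]) auto

lemma int_span_zero: "0 \<in> int_span S"
  unfolding int_span_def by (intro CollectI exI[of _ "{}"]) auto

lemma int_span_add: assumes "x \<in> int_span S" "y \<in> int_span S" shows "x + y \<in> int_span S"
proof -
  obtain F c where x: "x = (\<Sum>s\<in>F. of_int (c s) *\<^sub>R s)" "finite F" "F \<subseteq> S"
    using assms(1) by (auto simp: int_span_def)
  obtain F' c' where y: "y = (\<Sum>s\<in>F'. of_int (c' s) *\<^sub>R s)" "finite F'" "F' \<subseteq> S"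
    using assms(2) by (auto simp: int_span_def)
  let ?d = "\<lambda>s. (if s \<in> F then c s else 0) + (if s \<in> F' then c' s else 0)"
  have "x = (\<Sum>s\<in>F \<union> F'. of_int (if s \<in> F then c s else 0) *\<^sub>R s)"
    unfolding x(1) using x y by (intro sum.mono_neutral_cong_left) auto
  moreover have "y = (\<Sum>s\<in>F \<union> F'. of_int (if s \<in> F' then c' s else 0) *\<^sub>R s)"
    unfolding y(1) using x y by (intro sum.mono_neutral_cong_left) auto
  ultimately have "x + y = (\<Sum>s\<in>F \<union> F'. of_int (?d s) *\<^sub>R s)"
    by (simp only: of_int_add scaleR_add_left sum.distrib)
  then show ?thesis unfolding int_span_def using x y
    by (intro CollectI exI[of _ "F \<union> F'"] exI[of _ ?d]) auto
qed

lemma int_span_scale: assumes "x \<in> int_span S" shows "of_int i *\<^sub>R x \<in> int_span S"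
proof -
  obtain F c where x: "x = (\<Sum>s\<in>F. of_int (c s) *\<^sub>R s)" "finite F" "F \<subseteq> S"
    using assms(1) by (auto simp: int_span_def)
  then have "of_int i *\<^sub>R x = (\<Sum>s\<in>F. of_int (i * c s) *\<^sub>R s)" by (simp add: scaleR_sum_right)
  then show ?thesis unfolding int_span_def using x
    by (intro CollectI exI[of _ F] exI[of _ "\<lambda>s. i * c s"]) auto
qed

lemma int_span_uminus: "x \<in> int_span S \<Longrightarrow> - x \<in> int_span S"
  using int_span_scale[of x S "-1"] by simp

lemma int_span_diff: "x \<in> int_span S \<Longrightarrow> y \<in> int_span S \<Longrightarrow> x - y \<in> int_span S"
  using int_span_add[of x S "- y"] int_span_uminus[of y S] by simp

lemma int_span_Ints: "c \<in> \<int> \<Longrightarrow> x \<in> int_span S \<Longrightarrow> c *\<^sub>R x \<in> int_span S"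
  using int_span_scale by (auto elim!: Ints_cases)

lemma int_span_induct [consumes 1, case_names zero add diff]:
  assumes "x \<in> int_span S" "P 0" 
    and add: "\<And>x y. y \<in> S \<Longrightarrow> P x \<Longrightarrow> P (x + y)" and diff: "\<And>x y. y \<in> S \<Longrightarrow> P x \<Longrightarrow> P (x - y)"
  shows "P x"
proof -
  have mult: "P (of_int i *\<^sub>R s + y)" if "s \<in> S" "P y" for y s i
  proof (induction i rule: int_induct[where k = 0])
    case base then show ?case using that by simp
  next
    case (step1 i) then show ?case using add[OF that(1) step1(2)] by (simp add: algebra_simps)
  next
    case (step2 i) then show ?case using diff[OF that(1) step2(2)] by (simp add: algebra_simps)
  qed
  have "P (\<Sum>s\<in>F. of_int (c s) *\<^sub>R s)" if "finite F" "F \<subseteq> S" for F c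
    using that
  proof (induction F)
    case (insert s F) then show ?case using mult[of s _ "c s"] by simp
  qed (simp add: assms)
  then show ?thesis using assms(1) by (auto simp: int_span_def)
qed

lemma int_span_minimal:
  assumes "S \<subseteq> T" "0 \<in> T" "\<And>x y. x \<in> T \<Longrightarrow> y \<in> T \<Longrightarrow> x + y \<in> T" "\<And>x y. x \<in> T \<Longrightarrow> y \<in> T \<Longrightarrow> x - y \<in> T"
  shows "int_span S \<subseteq> T"
proof
  fix x assume "x \<in> int_span S" then show "x \<in> T"
    by (induction rule: int_span_induct) (use assms in auto)
qed

lemma int_span_image:
  assumes "finite I" "x \<in> int_span (\<sigma> ` I)"
  shows "\<exists>c::_ \<Rightarrow> int. x = (\<Sum>i\<in>I. of_int (c i) *\<^sub>R \<sigma> i)"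
  using assms(2)
proof (induction rule: int_span_induct)
  case zero show ?case by (intro exI[of _ "\<lambda>_. 0"]) simp
next
  case (add x y)
  then obtain c :: "_ \<Rightarrow> int" and j where c: "x = (\<Sum>i\<in>I. of_int (c i) *\<^sub>R \<sigma> i)" "j \<in> I" "y = \<sigma> j" by auto
  then have "x + y = (\<Sum>i\<in>I. of_int (c i) *\<^sub>R \<sigma> i + (if i = j then \<sigma> j else 0))"
    using assms(1) by (simp add: sum.distrib)
  also have "\<dots> = (\<Sum>i\<in>I. of_int (c i + (if i = j then 1 else 0)) *\<^sub>R \<sigma> i)"
    by (intro sum.cong) (auto simp: scaleR_add_left)
  finally show ?case by (intro exI[of _ "\<lambda>i. c i + (if i = j then 1 else 0)"])
next
  case (diff x y)
  then obtain c :: "_ \<Rightarrow> int" and j where c: "x = (\<Sum>i\<in>I. of_int (c i) *\<^sub>R \<sigma> i)" "j \<in> I" "y = \<sigma> j" by auto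
  then have "x - y = (\<Sum>i\<in>I. of_int (c i) *\<^sub>R \<sigma> i - (if i = j then \<sigma> j else 0))"
    using assms(1) by (simp add: sum_subtractf)
  also have "\<dots> = (\<Sum>i\<in>I. of_int (c i - (if i = j then 1 else 0)) *\<^sub>R \<sigma> i)"
    by (intro sum.cong) (auto simp: scaleR_diff_left)
  finally show ?case by (intro exI[of _ "\<lambda>i. c i - (if i = j then 1 else 0)"])
qed

lemma semilattice_step:
  assumes "semilattice_in U S" "x \<in> S" "y \<in> S" shows "x + 2 *\<^sub>R y \<in> S" "x - 2 *\<^sub>R y \<in> S"
proof -
  have S: "S = {x + 2 *\<^sub>R y | x y. x \<in> S \<and> y \<in> S} \<union> {x - 2 *\<^sub>R y | x y. x \<in> S \<and> y \<in> S}"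
    using assms(1) unfolding semilattice_in_def by blast
  show "x + 2 *\<^sub>R y \<in> S" "x - 2 *\<^sub>R y \<in> S" using assms(2,3) by (subst S, blast)+
qed

lemma semilattice_add_double:
  assumes "semilattice_in U S" "x \<in> S" "y \<in> int_span S" shows "x + 2 *\<^sub>R y \<in> S"
  using assms(3)
proof (induction rule: int_span_induct)
  case (add y s)
  then show ?case using semilattice_step(1)[OF assms(1), of "x + 2 *\<^sub>R y" s] by (simp add: algebra_simps)
next
  case (diff y s)
  then show ?case using semilattice_step(2)[OF assms(1), of "x + 2 *\<^sub>R y" s] by (simp add: algebra_simps)
qed (simp add: assms)

lemma semilattice_diff_double:
  "semilattice_in U S \<Longrightarrow> x \<in> S \<Longrightarrow> y \<in> int_span S \<Longrightarrow> x - 2 *\<^sub>R y \<in> S"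
  using semilattice_add_double[of U S x "- y"] int_span_uminus[of y S] by simp

section \<open>Groups that are commutative modulo a central subgroup\<close>

lemma (in group) subgroup_commute_mod:
  assumes Z: "subgroup Z G" "Z \<subseteq> group_center G" and y: "y \<in> carrier G"
  shows "subgroup {v \<in> carrier G. commutator G v y \<in> Z} G"
proof (rule subgroupI)
  have "commutator G \<one> y = \<one>" using y by (simp add: commutator_def)
  then have "\<one> \<in> {v \<in> carrier G. commutator G v y \<in> Z}"
    using subgroup.one_closed[OF Z(1)] by simp
  then show "{v \<in> carrier G. commutator G v y \<in> Z} \<noteq> {}" by blast
  show "inv v \<in> {v \<in> carrier G. commutator G v y \<in> Z}" if "v \<in> {v \<in> carrier G. commutator G v y \<in> Z}" for v
    using that Z y commutator_inv_left[of v y] subgroup.m_inv_closed[OF Z(1)] by auto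
  show "v \<otimes> v' \<in> {v \<in> carrier G. commutator G v y \<in> Z}"
    if "v \<in> {v \<in> carrier G. commutator G v y \<in> Z}" "v' \<in> {v \<in> carrier G. commutator G v y \<in> Z}" for v v'
  proof -
    have c: "commutator G v y \<in> group_center G" "commutator G v' y \<in> group_center G" using that Z by auto
    show ?thesis using that y by (simp add: commutator_mult_left[OF _ _ y c] subgroup.m_closed[OF Z(1)])
  qed
qed auto

lemma (in group) commute_mod_sym:
  assumes "subgroup Z G" "x \<in> carrier G" "y \<in> carrier G" "commutator G x y \<in> Z"
  shows "commutator G y x \<in> Z"
  unfolding commutator_inverse[OF assms(2,3)] by (rule subgroup.m_inv_closed[OF assms(1,4)])

text \<open>Commutators are multiplicative in each argument as soon as they are central, so it suffices to
check generators.\<close>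

lemma (in group) generate_commute_mod:
  assumes Z: "subgroup Z G" "Z \<subseteq> group_center G" 
    and A: "A \<subseteq> carrier G" and B: "B \<subseteq> carrier G"
    and AB: "\<And>x y. x \<in> A \<Longrightarrow> y \<in> B \<Longrightarrow> commutator G x y \<in> Z"
    and x: "x \<in> generate G A" and y: "y \<in> generate G B"
  shows "commutator G x y \<in> Z"
proof -
  have *: "commutator G x' y' \<in> Z" if "x' \<in> generate G A" "y' \<in> B" for x' y'
  proof -
    have "generate G A \<subseteq> {v \<in> carrier G. commutator G v y' \<in> Z}"
      using that A B AB by (intro generate_subgroup_incl[OF _ subgroup_commute_mod[OF Z]]) auto
    then show ?thesis using that by blast
  qed
  have xG: "x \<in> carrier G" using generate_in_carrier[OF A] x by blast
  have "generate G B \<subseteq> {v \<in> carrier G. commutator G v x \<in> Z}"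
    using B * x xG by (intro generate_subgroup_incl[OF _ subgroup_commute_mod[OF Z]])
      (auto intro: commute_mod_sym[OF Z(1)])
  then have "y \<in> carrier G" "commutator G y x \<in> Z" using y by auto
  then show ?thesis using commute_mod_sym[OF Z(1)] xG by blast
qed

text \<open>Powers of \<open>x\<close> can be collected on the left at the cost of commutators, which lie in \<open>N\<close>.\<close>

lemma (in group) generate_insert_mod:
  assumes Z: "subgroup Z G" "Z \<subseteq> group_center G" and N: "subgroup N G" "Z \<subseteq> N"
    and x: "x \<in> carrier G" and xN: "\<And>y. y \<in> N \<Longrightarrow> commutator G x y \<in> Z"
    and u: "u \<in> generate G (insert x N)"
  shows "\<exists>c::int. \<exists>y\<in>N. u = x [^] c \<otimes> y"
proof -
  have Nc: "y \<in> carrier G" if "y \<in> N" for y using that subgroup.mem_carrier[OF N(1)] by blast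
  have pw: "commutator G y (x [^] c) \<in> Z" if "y \<in> N" for y and c :: int
  proof -
    have "x [^] c \<in> generate G {x}" using generate_pow[OF x] by auto
    moreover have "y \<in> generate G N" using that by (rule generate.incl)
    moreover have "N \<subseteq> carrier G" "{x} \<subseteq> carrier G" using Nc x by auto
    moreover have "commutator G v x' \<in> Z" if v: "v \<in> N" and x': "x' \<in> {x}" for v x'
      unfolding singletonD[OF x'] by (rule commute_mod_sym[OF Z(1) x Nc[OF v] xN[OF v]])
    ultimately show ?thesis using generate_commute_mod[OF Z, of N "{x}" y "x [^] c"] by blast
  qed
  have sw: "\<exists>z\<in>N. y \<otimes> x [^] c = x [^] c \<otimes> z" if y: "y \<in> N" for y and c :: int
  proof -
    have "y \<otimes> x [^] c = x [^] c \<otimes> (y \<otimes> commutator G y (x [^] c))"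
      using mult_commutator[OF Nc[OF y], of "x [^] c"] x Nc[OF y] by (simp add: m_assoc)
    moreover have "y \<otimes> commutator G y (x [^] c) \<in> N"
      using pw[OF y] y N subgroup.m_closed[OF N(1)] by blast
    ultimately show ?thesis by blast
  qed
  let ?T = "{x [^] c \<otimes> y | (c::int) y. y \<in> N}"
  have "subgroup ?T G"
  proof (rule subgroupI)
    show "?T \<subseteq> carrier G" using x Nc by auto
    show "?T \<noteq> {}" using subgroup.one_closed[OF N(1)] by blast
    show "inv g \<in> ?T" if "g \<in> ?T" for g
    proof -
      from that obtain c :: int and y where g: "g = x [^] c \<otimes> y" "y \<in> N" by blast
      then have "inv g = inv y \<otimes> x [^] (- c)" using x Nc by (simp add: inv_mult_group int_pow_neg)
      moreover have "inv y \<in> N" using g subgroup.m_inv_closed[OF N(1)] by blast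
      ultimately show ?thesis using sw[of "inv y" "- c"] by auto
    qed
    show "g \<otimes> h \<in> ?T" if "g \<in> ?T" "h \<in> ?T" for g h
    proof -
      from that obtain c d :: int and y y' where g: "g = x [^] c \<otimes> y" "y \<in> N" "h = x [^] d \<otimes> y'" "y' \<in> N" by blast
      from sw[OF g(2), of d] obtain z where z: "z \<in> N" "y \<otimes> x [^] d = x [^] d \<otimes> z" by blast
      have "g \<otimes> h = x [^] c \<otimes> (y \<otimes> x [^] d) \<otimes> y'" using g x Nc by (simp add: m_assoc)
      also have "\<dots> = x [^] (c + d) \<otimes> (z \<otimes> y')" using z g x Nc by (simp add: m_assoc int_pow_mult)
      finally show ?thesis using subgroup.m_closed[OF N(1) z(1) g(4)] by blast
    qed
  qed
  moreover have "insert x N \<subseteq> ?T"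
  proof
    fix v assume "v \<in> insert x N"
    then consider "v = x" | "v \<in> N" by blast
    then show "v \<in> ?T"
    proof cases
      case 1
      then have "v = x [^] (1::int) \<otimes> \<one>" using x by simp
      then show ?thesis using subgroup.one_closed[OF N(1)] by blast
    next
      case 2
      then have "v = x [^] (0::int) \<otimes> v" using Nc by simp
      then show ?thesis using 2 by blast
    qed
  qed
  ultimately have "generate G (insert x N) \<subseteq> ?T" by (intro generate_subgroup_incl)
  then show ?thesis using u by blast
qed

text \<open>The generators are removed one at a time: by \<open>generate_insert_mod\<close> the element is a power of
\<open>b i\<close> times a product of the other generators, and its coordinate \<open>f i\<close> shows that the exponent
is zero.\<close>

lemma (in group) in_center_by_coordinates:
  assumes Z: "subgroup Z G" "Z \<subseteq> group_center G" and D: "subgroup D G" "Z \<subseteq> D"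
    and f_mult: "\<And>i x y. x \<in> D \<Longrightarrow> y \<in> D \<Longrightarrow> f i (x \<otimes> y) = f i x + (f i y :: real)"
    and fZ: "\<And>i z. z \<in> Z \<Longrightarrow> f i z = 0"
    and I: "finite I" "b ` I \<subseteq> D" 
    and comm: "\<And>i j. i \<in> I \<Longrightarrow> j \<in> I \<Longrightarrow> commutator G (b i) (b j) \<in> Z"
    and diag: "\<And>i. i \<in> I \<Longrightarrow> f i (b i) \<noteq> 0" and off: "\<And>i j. i \<in> I \<Longrightarrow> j \<in> I \<Longrightarrow> i \<noteq> j \<Longrightarrow> f i (b j) = 0"
    and u: "u \<in> generate G (b ` I \<union> Z)" "\<And>i. i \<in> I \<Longrightarrow> f i u = 0"
  shows "u \<in> Z"
  using I comm diag off u
proof (induction I arbitrary: u)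
  case empty
  then show ?case using generate_subgroup_incl[OF subset_refl Z(1)] by auto
next
  case (insert i I)
  let ?N = "generate G (b ` I \<union> Z)"
  have Dc: "D \<subseteq> carrier G" using subgroup.subset[OF D(1)] .
  have sub: "b ` I \<union> Z \<subseteq> D" "b ` I \<union> Z \<subseteq> carrier G" and bi: "b i \<in> D" "b i \<in> carrier G"
    using insert.prems(1) D Dc by auto
  have N: "subgroup ?N G" using sub by (intro generate_is_subgroup)
  have ND: "?N \<subseteq> D" using sub D by (intro generate_subgroup_incl)
  have ZN: "Z \<subseteq> ?N" using generate.incl[of _ "b ` I \<union> Z" G] by auto
  have cN: "commutator G (b i) y \<in> Z" if "y \<in> ?N" for y
  proof (rule generate_commute_mod[OF Z, of "{b i}" "b ` I \<union> Z"])
    have "commutator G (b i) z \<in> Z" if "z \<in> Z" for z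
    proof -
      have "commutator G (b i) z = \<one>"
        using centerD[of z "b i"] that Z bi center_carrier[of z] by (intro commutator_eqI) auto
      then show ?thesis using subgroup.one_closed[OF Z(1)] by simp
    qed
    then show "commutator G x y \<in> Z" if "x \<in> {b i}" "y \<in> b ` I \<union> Z" for x y
      using that insert.prems(2) by auto
  qed (use sub bi that in \<open>auto intro: generate.incl\<close>)
  have "b ` insert i I \<union> Z \<subseteq> insert (b i) ?N"
    using generate.incl[of _ "b ` I \<union> Z" G] by auto
  then have "u \<in> generate G (insert (b i) ?N)" using insert.prems(5) mono_generate by blast
  from generate_insert_mod[OF Z N ZN bi(2) cN this]
  obtain c :: int and y where y: "y \<in> ?N" "u = b i [^] c \<otimes> y" by blast
  have yc: "y \<in> carrier G" using subgroup.mem_carrier[OF N y(1)] .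
  have f1: "f j \<one> = 0" for j using f_mult[of \<one> \<one> j] subgroup.one_closed[OF D(1)] by simp
  have finv: "f j (inv x) = - f j x" if "x \<in> D" for j x
  proof -
    have "x \<otimes> inv x = \<one>" using that Dc by auto
    then show ?thesis using f_mult[OF that subgroup.m_inv_closed[OF D(1) that], of j] f1[of j] by simp
  qed
  have fpow: "b i [^] c \<in> D \<and> f j (b i [^] c) = of_int c * f j (b i)" for j and c :: int
  proof -
    have nat: "b i [^] d \<in> D \<and> f j (b i [^] d) = real d * f j (b i)" for d :: nat
      by (induction d) (auto simp: f1 f_mult bi subgroup.one_closed[OF D(1)] subgroup.m_closed[OF D(1)] algebra_simps)
    show ?thesis
      by (cases c rule: int_cases2)
        (use nat finv bi subgroup.m_inv_closed[OF D(1)] in \<open>auto simp: int_pow_int int_pow_neg\<close>)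
  qed
  have "?N \<subseteq> {v \<in> D. f i v = 0}"
  proof (rule generate_subgroup_incl)
    show "b ` I \<union> Z \<subseteq> {v \<in> D. f i v = 0}" using sub insert.prems(4)[of i] insert.hyps fZ by auto
    show "subgroup {v \<in> D. f i v = 0} G"
      using Dc f1 finv f_mult subgroup.one_closed[OF D(1)]
      by (intro subgroupI) (auto intro: subgroup.m_inv_closed[OF D(1)] subgroup.m_closed[OF D(1)])
  qed
  then have "f i y = 0" using y(1) by blast
  \<comment> \<open>The coordinate of \<open>u\<close> at \<open>i\<close> is \<open>c\<close> times that of \<open>b i\<close>.\<close>
  moreover have "f i u = 0" using insert.prems(6) by simp
  moreover have "f i u = of_int c * f i (b i) + f i y" unfolding y(2) using f_mult[of "b i [^] c" y i] fpow[of c i] y(1) ND by auto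
  ultimately have "c = 0" using insert.prems(3) by auto
  then have "u = y" using y(2) yc by simp
  show ?case unfolding \<open>u = y\<close>
  proof (rule insert.IH)
    show "b ` I \<subseteq> D" using insert.prems(1) by blast
    show "commutator G (b j) (b j') \<in> Z" if "j \<in> I" "j' \<in> I" for j j' using that insert.prems(2) by blast
    show "f j (b j) \<noteq> 0" if "j \<in> I" for j using that insert.prems(3) by blast
    show "f j (b j') = 0" if "j \<in> I" "j' \<in> I" "j \<noteq> j'" for j j' using that insert.prems(4) by blast
    show "f j y = 0" if "j \<in> I" for j using that insert.prems(6)[of j] \<open>u = y\<close> by blast
  qed (rule y(1))
qed

section \<open>Extended affine root systems as fibred root systems\<close>
text \<open>The letter \<open>t\<close> is taken by the translations, so \<open>m\<close> stands for the twist number and \<open>n\<close> for the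
nullity.\<close>

locale ears_data = typed_roots \<Phi> X a for \<Phi> :: "'a::euclidean_space set" and X a +
  fixes V1 V2 S1 S2 :: "'b::euclidean_space set" and R :: "('a \<times> 'b) set"
    and \<sigma> :: "nat \<Rightarrow> 'b" and m n :: nat
  assumes subspaces: "subspace V1" "subspace V2" and V12: "V1 \<inter> V2 = {0}" "V1 + V2 = UNIV"
    and mn: "m = dim V1" "n = DIM('b)"
    and semi: "semilattice_in V1 S1" "semilattice_in V2 S2"
    and lattice_B: "\<And>l. X = TypeB l \<Longrightarrow> l \<ge> 3 \<Longrightarrow> is_lattice S2"
    and lattice_C: "\<And>l. X = TypeC l \<Longrightarrow> is_lattice S1"
    and lattice_FG: "X = TypeF4 \<or> X = TypeG2 \<Longrightarrow> is_lattice S1 \<and> is_lattice S2"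
    and R_def: "R = ears X \<Phi> S1 S2"
    and basis1: "\<sigma> ` {1..m} \<subseteq> S1" "int_basis {1..m} \<sigma> (int_span S1)"
    and basis2: "\<sigma> ` {m+1..n} \<subseteq> S2" "int_basis {m+1..n} \<sigma> (int_span S2)"
begin

lemma S1_lattice: assumes "\<And>l. X \<noteq> TypeB l" shows "int_span S1 = S1"
proof -
  have "is_lattice S1" using assms lattice_C lattice_FG by (cases X) auto
  then show ?thesis by (simp add: is_lattice_def)
qed

lemma S2_lattice: assumes "X \<noteq> TypeB 2" "\<And>l. X \<noteq> TypeC l" shows "int_span S2 = S2"
proof -
  have "is_lattice S2"
  proof (cases X)
    case (TypeB l)
    then have "l \<ge> 3" using assms(1) valid by (cases "l = 2") auto
    then show ?thesis using lattice_B TypeB by simp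
  qed (use assms lattice_FG in auto)
  then show ?thesis by (simp add: is_lattice_def)
qed

lemma S_zero: "0 \<in> S1" "0 \<in> S2" using semi by (auto simp: semilattice_in_def)

lemma S1_add_k: assumes "x \<in> S1" "y \<in> int_span S1" shows "x + k *\<^sub>R y \<in> S1"
proof (cases "k = 2")
  case True then show ?thesis using semilattice_add_double[OF semi(1)] assms by simp
next
  case False
  then have "X = TypeG2" by (cases X) auto
  then have l: "int_span S1 = S1" by (intro S1_lattice) auto
  have "x + of_int 3 *\<^sub>R y \<in> int_span S1"
    using assms by (intro int_span_add int_span_scale) (auto intro: int_span_base)
  then show ?thesis using l \<open>X = TypeG2\<close> by simp
qed

lemma S2_add_k: assumes "x \<in> S2" "y \<in> int_span S2" shows "x + k *\<^sub>R y \<in> S2"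
proof (cases "k = 2")
  case True then show ?thesis using semilattice_add_double[OF semi(2)] assms by simp
next
  case False
  then have "X = TypeG2" by (cases X) auto
  then have l: "int_span S2 = S2" by (intro S2_lattice) auto
  have "x + of_int 3 *\<^sub>R y \<in> int_span S2"
    using assms by (intro int_span_add int_span_scale) (auto intro: int_span_base)
  then show ?thesis using l \<open>X = TypeG2\<close> by simp
qed

definition L :: "'a \<Rightarrow> 'b set" where
  "L \<gamma> = (if \<gamma> \<in> short_roots \<Phi> then S1 + int_span S2 else (\<lambda>x. k *\<^sub>R x) ` int_span S1 + S2)"

lemma L_short: "\<gamma> \<in> short_roots \<Phi> \<Longrightarrow> s \<in> L \<gamma> \<longleftrightarrow> (\<exists>x\<in>S1. \<exists>y\<in>int_span S2. s = x + y)"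
  by (auto simp: L_def set_plus_def)

lemma L_long: "\<gamma> \<in> long_roots \<Phi> \<Longrightarrow> s \<in> L \<gamma> \<longleftrightarrow> (\<exists>x\<in>int_span S1. \<exists>y\<in>S2. s = k *\<^sub>R x + y)"
  using not_short_and_long by (auto simp: L_def set_plus_def)

lemma pairing_even_step:
  assumes "c / 2 \<in> \<int>" "semilattice_in U S" "x \<in> S" "y \<in> int_span S" shows "x - c *\<^sub>R y \<in> S"
proof -
  obtain i where "c / 2 = of_int i" using assms(1) by (auto elim: Ints_cases)
  then have "c = 2 * of_int i" by simp
  then show ?thesis using semilattice_diff_double[OF assms(2,3) int_span_scale[OF assms(4), of i]] by simp
qed

text \<open>A semilattice is closed under adding doubles of its integral span only. Therefore the pairing has to
be even or the semilattice has to be a lattice; the conditions on the types are made for this.\<close>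

lemma L_closed:
  assumes "\<alpha> \<in> \<Phi>" "\<beta> \<in> \<Phi>" "s \<in> L \<alpha>" "u \<in> L \<beta>"
  shows "u - pairing \<beta> \<alpha> *\<^sub>R s \<in> L \<beta>"
proof -
  let ?c = "pairing \<beta> \<alpha>"
  have c: "?c \<in> \<int>" using assms root_pairing_int by blast
  consider (ss) "\<alpha> \<in> short_roots \<Phi>" "\<beta> \<in> short_roots \<Phi>" | (ls) "\<alpha> \<in> long_roots \<Phi>" "\<beta> \<in> short_roots \<Phi>"
    | (sl) "\<alpha> \<in> short_roots \<Phi>" "\<beta> \<in> long_roots \<Phi>" | (ll) "\<alpha> \<in> long_roots \<Phi>" "\<beta> \<in> long_roots \<Phi>"
    using short_or_long assms by blast
  then show ?thesis
  proof cases
    case ss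
    obtain x y x' y' where e: "s = x + y" "u = x' + y'" and m: "x \<in> S1" "x' \<in> S1" "y \<in> int_span S2" "y' \<in> int_span S2"
      using assms ss by (auto simp: L_short)
    have "x' - ?c *\<^sub>R x \<in> S1"
    proof (cases "\<exists>l. X = TypeB l")
      case True
      then show ?thesis using pairing_even_step[OF _ semi(1)] even_pairing_short ss m assms int_span_base by blast
    next
      case False
      then have "int_span S1 = S1" using S1_lattice by blast
      then show ?thesis using m int_span_diff[of x' S1 "?c *\<^sub>R x"] int_span_Ints[OF c, of x S1] by simp
    qed
    moreover have "y' - ?c *\<^sub>R y \<in> int_span S2" using m c by (intro int_span_diff int_span_Ints)
    moreover have "u - ?c *\<^sub>R s = (x' - ?c *\<^sub>R x) + (y' - ?c *\<^sub>R y)" by (simp add: e algebra_simps)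
    ultimately show ?thesis using ss by (auto simp: L_short)
  next
    case ls
    obtain x y x' y' where e: "s = k *\<^sub>R x + y" "u = x' + y'" and m: "x \<in> int_span S1" "x' \<in> S1" "y \<in> S2" "y' \<in> int_span S2"
      using assms ls by (auto simp: L_short L_long)
    have "x' + k *\<^sub>R (- ?c *\<^sub>R x) \<in> S1" using m c by (intro S1_add_k int_span_Ints) auto
    moreover have "y' - ?c *\<^sub>R y \<in> int_span S2"
      using int_span_diff[OF m(4) int_span_Ints[OF c int_span_base[OF m(3)]]] .
    moreover have "u - ?c *\<^sub>R s = (x' + k *\<^sub>R (- ?c *\<^sub>R x)) + (y' - ?c *\<^sub>R y)" by (simp add: e algebra_simps)
    ultimately show ?thesis using ls by (auto simp: L_short)
  next
    case sl
    obtain x y x' y' where e: "s = x + y" "u = k *\<^sub>R x' + y'" and m: "x \<in> S1" "x' \<in> int_span S1" "y \<in> int_span S2" "y' \<in> S2"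
      using assms sl by (auto simp: L_short L_long)
    have d: "pairing \<alpha> \<beta> \<in> \<int>" "?c = k * pairing \<alpha> \<beta>" using assms root_pairing_int pairing_long_short sl by auto
    have "x' - pairing \<alpha> \<beta> *\<^sub>R x \<in> int_span S1"
      using int_span_diff[OF m(2) int_span_Ints[OF d(1) int_span_base[OF m(1)]]] .
    moreover have "y' + k *\<^sub>R (- pairing \<alpha> \<beta> *\<^sub>R y) \<in> S2" using m d by (intro S2_add_k int_span_Ints) auto
    moreover have "u - ?c *\<^sub>R s = k *\<^sub>R (x' - pairing \<alpha> \<beta> *\<^sub>R x) + (y' + k *\<^sub>R (- pairing \<alpha> \<beta> *\<^sub>R y))"
      by (simp add: e d algebra_simps)
    ultimately show ?thesis unfolding L_long[OF sl(2)] by blast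
  next
    case ll
    obtain x y x' y' where e: "s = k *\<^sub>R x + y" "u = k *\<^sub>R x' + y'" and m: "x \<in> int_span S1" "x' \<in> int_span S1" "y \<in> S2" "y' \<in> S2"
      using assms ll by (auto simp: L_long)
    have "y' - ?c *\<^sub>R y \<in> S2"
    proof (cases "X = TypeB 2 \<or> (\<exists>l. X = TypeC l)")
      case True
      then show ?thesis using pairing_even_step[OF _ semi(2)] even_pairing_long ll m int_span_base by blast
    next
      case False
      then have "int_span S2 = S2" using S2_lattice by blast
      then show ?thesis using m int_span_diff[of y' S2 "?c *\<^sub>R y"] int_span_Ints[OF c, of y S2] by simp
    qed
    moreover have "x' - ?c *\<^sub>R x \<in> int_span S1" using m c by (intro int_span_diff int_span_Ints)
    moreover have "u - ?c *\<^sub>R s = k *\<^sub>R (x' - ?c *\<^sub>R x) + (y' - ?c *\<^sub>R y)" by (simp add: e algebra_simps)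
    ultimately show ?thesis unfolding L_long[OF ll(2)] by blast
  qed
qed

lemma L_zero: "\<gamma> \<in> \<Phi> \<Longrightarrow> 0 \<in> L \<gamma>"
  using S_zero int_span_zero short_or_long[of \<gamma>] by (force simp: L_short L_long)

lemma S_in_L_short: assumes "\<gamma> \<in> short_roots \<Phi>" shows "S1 \<subseteq> L \<gamma>" "int_span S2 \<subseteq> L \<gamma>"
  using S_zero int_span_zero assms by (force simp: L_short)+

lemma S_in_L_long: assumes "\<gamma> \<in> long_roots \<Phi>" shows "x \<in> int_span S1 \<Longrightarrow> k *\<^sub>R x \<in> L \<gamma>" "S2 \<subseteq> L \<gamma>"
  using S_zero int_span_zero assms by (force simp: L_long)+

lemma nonisotropic_R: "nonisotropic R = {(\<alpha>, s). \<alpha> \<in> \<Phi> \<and> s \<in> L \<alpha>}"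
proof -
  have "(\<gamma>, s) \<in> nonisotropic R \<longleftrightarrow> \<gamma> \<in> \<Phi> \<and> s \<in> L \<gamma>" for \<gamma> s
  proof -
    have "(\<gamma>, s) \<in> nonisotropic R \<longleftrightarrow> \<gamma> \<noteq> 0 \<and> (\<gamma> = 0 \<and> s \<in> S1 + int_span S2 + (S1 + int_span S2)
       \<or> \<gamma> \<in> short_roots \<Phi> \<and> s \<in> S1 + int_span S2
       \<or> \<gamma> \<in> long_roots \<Phi> \<and> s \<in> (\<lambda>x. k *\<^sub>R x) ` int_span S1 + S2)"
      by (auto simp: nonisotropic_def R_def ears_def Let_def form_def)
    also have "\<dots> \<longleftrightarrow> \<gamma> \<in> short_roots \<Phi> \<and> s \<in> L \<gamma> \<or> \<gamma> \<in> long_roots \<Phi> \<and> s \<in> L \<gamma>"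
      using not_short_and_long root_nonzero short_root long_root unfolding L_def by auto
    also have "\<dots> \<longleftrightarrow> \<gamma> \<in> \<Phi> \<and> s \<in> L \<gamma>" using short_or_long short_root long_root by blast
    finally show ?thesis .
  qed
  then show ?thesis by auto
qed

sublocale fibred_roots_basis \<Phi> L R "type_rank X" a
proof unfold_locales
  fix \<alpha> \<beta> s u assume "\<alpha> \<in> \<Phi>" "\<beta> \<in> \<Phi>" "s \<in> L \<alpha>" "u \<in> L \<beta>"
  then show "u - pairing \<beta> \<alpha> *\<^sub>R s \<in> L (rfl \<alpha> \<beta>)"
    using L_closed rfl_short_long(1)[of \<alpha> \<beta>] by (simp add: L_def)
qed (use root_system nonisotropic_R L_zero in auto)

lemma m_le_n: "m \<le> n" by (simp add: mn dim_subset_UNIV)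

lemma sigma_S1: "r \<in> {1..m} \<Longrightarrow> \<sigma> r \<in> S1" and sigma_S2: "r \<in> {m+1..n} \<Longrightarrow> \<sigma> r \<in> S2"
  using basis1 basis2 by auto

lemma expand_S1: "x \<in> int_span S1 \<Longrightarrow> \<exists>c::nat \<Rightarrow> int. x = (\<Sum>r=1..m. of_int (c r) *\<^sub>R \<sigma> r)"
  using int_span_image[of "{1..m}" x \<sigma>] basis1 by (simp add: int_basis_def)

lemma expand_S2: "x \<in> int_span S2 \<Longrightarrow> \<exists>c::nat \<Rightarrow> int. x = (\<Sum>r=m+1..n. of_int (c r) *\<^sub>R \<sigma> r)"
  using int_span_image[of "{m+1..n}" x \<sigma>] basis2 by (simp add: int_basis_def)

lemma span_sigma: "span (\<sigma> ` {1..n}) = UNIV"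
proof -
  let ?T = "span (\<sigma> ` {1..n})"
  have s: "\<sigma> r \<in> ?T" if "r \<in> {1..n}" for r using that by (intro span_base) auto
  have "S1 \<subseteq> ?T"
  proof
    fix x assume "x \<in> S1"
    then obtain c :: "nat \<Rightarrow> int" where "x = (\<Sum>r=1..m. of_int (c r) *\<^sub>R \<sigma> r)"
      using expand_S1 int_span_base by blast
    then show "x \<in> ?T" using s m_le_n by (auto intro!: span_sum span_scale)
  qed
  moreover have "S2 \<subseteq> ?T"
  proof
    fix x assume "x \<in> S2"
    then obtain c :: "nat \<Rightarrow> int" where "x = (\<Sum>r=m+1..n. of_int (c r) *\<^sub>R \<sigma> r)"
      using expand_S2 int_span_base by blast
    then show "x \<in> ?T" using s by (auto intro!: span_sum span_scale)
  qed
  ultimately have "span S1 \<subseteq> ?T" "span S2 \<subseteq> ?T" by (simp_all add: span_minimal)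
  then have "V1 \<subseteq> ?T" "V2 \<subseteq> ?T" using semi by (auto simp: semilattice_in_def)
  then have "V1 + V2 \<subseteq> ?T" by (auto simp: set_plus_def intro: span_add)
  then show ?thesis using V12 by auto
qed

lemma sigma_basis: "independent (\<sigma> ` {1..n})" "inj_on \<sigma> {1..n}"
proof -
  have "DIM('b) \<le> card (\<sigma> ` {1..n})" using span_sigma by (metis dim_UNIV dim_le_card finite_atLeastAtMost finite_imageI order_refl dim_span)
  moreover have "card (\<sigma> ` {1..n}) \<le> n" using card_image_le[of "{1..n}" \<sigma>] by simp
  ultimately have c: "card (\<sigma> ` {1..n}) = n" using mn by simp
  then show "inj_on \<sigma> {1..n}" by (intro eq_card_imp_inj_on) auto
  show "independent (\<sigma> ` {1..n})"
    using card_eq_dim[of "\<sigma> ` {1..n}" UNIV] span_sigma c mn by simp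
qed

definition coord :: "nat \<Rightarrow> 'b \<Rightarrow> real" where "coord r y = representation (\<sigma> ` {1..n}) y (\<sigma> r)"

lemma coord_linear: "coord r (x + y) = coord r x + coord r y" "coord r (x - y) = coord r x - coord r y" "coord r (c *\<^sub>R x) = c * coord r x"
  using sigma_basis(1) by (simp_all add: coord_def span_sigma representation_add representation_diff representation_scale)

lemma coord_sigma: "r \<in> {1..n} \<Longrightarrow> s \<in> {1..n} \<Longrightarrow> coord r (\<sigma> s) = (if r = s then 1 else 0)"
  using sigma_basis by (auto simp: coord_def representation_basis dest: inj_onD)

lemma coord_zero: "coord r 0 = 0" using coord_linear(3)[of r 0 0] by simp

lemma coord_sum: "coord r (sum f A) = (\<Sum>s\<in>A. coord r (f s))"
  by (induction A rule: infinite_finite_induct) (auto simp: coord_zero coord_linear)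

definition coord_fun :: "nat \<Rightarrow> ('b \<Rightarrow>\<^sub>L real)" where "coord_fun r = Blinfun (coord r)"

lemma coord_fun_apply: "blinfun_apply (coord_fun r) y = coord r y"
proof -
  have "linear (coord r)" by (rule linearI) (simp_all add: coord_linear)
  then show ?thesis by (simp add: coord_fun_def bounded_linear_Blinfun_apply linear_conv_bounded_linear)
qed

lemma sigma_nonzero: "r \<in> {1..n} \<Longrightarrow> \<sigma> r \<noteq> 0"
  using coord_sigma[of r r] coord_zero by auto

lemma center_is_K: "group_center G = K"
proof (rule center_eq_K)
  fix \<gamma> assume g: "\<gamma> \<in> \<Phi>"
  have n: "1 \<in> {1..n}" using DIM_positive[where 'a = 'b] by (simp add: mn Suc_le_eq One_nat_def)
  have "k \<noteq> 0" using k_cases by auto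
  show "\<exists>s\<in>L \<gamma>. s \<noteq> 0"
  proof (cases "1 \<le> m")
    case True
    then have "\<sigma> 1 \<in> S1" "\<sigma> 1 \<noteq> 0" using sigma_S1 sigma_nonzero n by auto
    then have "\<sigma> 1 \<in> L \<gamma> \<or> k *\<^sub>R \<sigma> 1 \<in> L \<gamma>" "k *\<^sub>R \<sigma> 1 \<noteq> 0"
      using short_or_long[OF g] S_in_L_short(1) S_in_L_long(1) int_span_base[of "\<sigma> 1" S1] \<open>k \<noteq> 0\<close> by auto
    then show ?thesis using \<open>\<sigma> 1 \<noteq> 0\<close> by blast
  next
    case False
    then have "\<sigma> 1 \<in> S2" "\<sigma> 1 \<noteq> 0" using sigma_S2 sigma_nonzero n by auto
    then have "\<sigma> 1 \<in> L \<gamma>" 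
      using short_or_long[OF g] S_in_L_short(2) S_in_L_long(2) int_span_base[of "\<sigma> 1" S2] by auto
    then show ?thesis using \<open>\<sigma> 1 \<noteq> 0\<close> by blast
  qed
qed

end

section \<open>Defects of additivity\<close>

lemma (in group) conj_mult:
  assumes "g \<in> carrier G" "x \<in> carrier G" "y \<in> carrier G"
  shows "g \<otimes> (x \<otimes> y) \<otimes> inv g = (g \<otimes> x \<otimes> inv g) \<otimes> (g \<otimes> y \<otimes> inv g)"
  using assms by (simp add: m_assoc)

lemma (in group) conj_inv:
  assumes "g \<in> carrier G" "x \<in> carrier G"
  shows "g \<otimes> inv x \<otimes> inv g = inv (g \<otimes> x \<otimes> inv g)"
  using assms by (simp add: m_assoc inv_mult_group)

lemmas (in group) conj_hom = conj_mult conj_inv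

lemma (in group) conj_commutator:
  assumes "g \<in> carrier G" "x \<in> carrier G" "y \<in> carrier G"
  shows "g \<otimes> commutator G x y \<otimes> inv g = commutator G (g \<otimes> x \<otimes> inv g) (g \<otimes> y \<otimes> inv g)"
  using assms by (simp add: commutator_def conj_hom)

context fibred_roots_basis begin

lemma conj_t:
  assumes "set ks \<subseteq> {1..l}" "\<beta> \<in> \<Phi>" "\<tau> \<in> L \<beta>"
  shows "wprod ks \<otimes>\<^bsub>G\<^esub> t \<beta> \<tau> \<otimes>\<^bsub>G\<^esub> inv\<^bsub>G\<^esub> (wprod ks) = t (rfls ks \<beta>) \<tau>"
proof -
  have "wprod ks \<otimes>\<^bsub>G\<^esub> w \<beta> \<delta> \<otimes>\<^bsub>G\<^esub> inv\<^bsub>G\<^esub> (wprod ks) = w (rfls ks \<beta>) \<delta>" if "\<delta> \<in> L \<beta>" for \<delta>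
    using assms that by (intro conj_w) (auto simp: wprod_closed act_wprod)
  then show ?thesis using assms by (simp add: t_eq G.conj_hom wprod_closed fibre_zero)
qed

lemma fibre_rfls: "set ks \<subseteq> {1..l} \<Longrightarrow> \<beta> \<in> \<Phi> \<Longrightarrow> L (rfls ks \<beta>) = L \<beta>"
  by (induction ks) (auto simp: fibre_rfl_eq simple_root rfls_root)

lemma cm_rfls:
  assumes "set ks \<subseteq> {1..l}" "\<gamma> \<in> \<Phi>" "\<delta> \<in> \<Phi>" "\<sigma> \<in> L \<gamma>" "\<tau> \<in> L \<delta>"
  shows "cm (t (rfls ks \<gamma>) \<sigma>) (t (rfls ks \<delta>) \<tau>) = cm (t \<gamma> \<sigma>) (t \<delta> \<tau>)"
proof -
  have "cm (t (rfls ks \<gamma>) \<sigma>) (t (rfls ks \<delta>) \<tau>)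
      = wprod ks \<otimes>\<^bsub>G\<^esub> cm (t \<gamma> \<sigma>) (t \<delta> \<tau>) \<otimes>\<^bsub>G\<^esub> inv\<^bsub>G\<^esub> (wprod ks)"
    using assms by (simp add: G.conj_commutator wprod_closed conj_t)
  also have "\<dots> = cm (t \<gamma> \<sigma>) (t \<delta> \<tau>)" using assms by (intro K_conj cm_K wprod_closed) auto
  finally show ?thesis .
qed

text \<open>Defects are elements of \<open>K\<close>, hence they are unchanged when the root is moved by the finite Weyl
group.\<close>

definition defect :: "'a \<Rightarrow> 'b \<Rightarrow> 'b \<Rightarrow> ('a \<times> 'b) word set" where
  "defect \<gamma> \<tau> \<delta> = t \<gamma> (\<tau> + \<delta>) \<otimes>\<^bsub>G\<^esub> inv\<^bsub>G\<^esub> (t \<gamma> \<tau> \<otimes>\<^bsub>G\<^esub> t \<gamma> \<delta>)"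

lemma defect_K:
  assumes "\<gamma> \<in> \<Phi>" "\<tau> \<in> L \<gamma>" "\<delta> \<in> L \<gamma>" "\<tau> + \<delta> \<in> L \<gamma>" shows "defect \<gamma> \<tau> \<delta> \<in> K"
  unfolding defect_def using assms by (intro same_act_K) (auto simp: act_t algebra_simps)

lemma t_add_defect:
  assumes "\<gamma> \<in> \<Phi>" "\<tau> \<in> L \<gamma>" "\<delta> \<in> L \<gamma>" "\<tau> + \<delta> \<in> L \<gamma>"
  shows "t \<gamma> (\<tau> + \<delta>) = defect \<gamma> \<tau> \<delta> \<otimes>\<^bsub>G\<^esub> (t \<gamma> \<tau> \<otimes>\<^bsub>G\<^esub> t \<gamma> \<delta>)"
  using assms by (simp add: defect_def G.m_assoc)

lemma defect_rfls:
  assumes "set ks \<subseteq> {1..l}" "\<gamma> \<in> \<Phi>" "\<tau> \<in> L \<gamma>" "\<delta> \<in> L \<gamma>" "\<tau> + \<delta> \<in> L \<gamma>"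
  shows "defect (rfls ks \<gamma>) \<tau> \<delta> = defect \<gamma> \<tau> \<delta>"
proof -
  have "defect (rfls ks \<gamma>) \<tau> \<delta> = wprod ks \<otimes>\<^bsub>G\<^esub> defect \<gamma> \<tau> \<delta> \<otimes>\<^bsub>G\<^esub> inv\<^bsub>G\<^esub> (wprod ks)"
    unfolding defect_def using assms G.conj_inv[of "wprod ks" "t \<gamma> \<tau> \<otimes>\<^bsub>G\<^esub> t \<gamma> \<delta>"]
    by (simp add: conj_t[symmetric] G.conj_mult wprod_closed)
  also have "\<dots> = defect \<gamma> \<tau> \<delta>" using assms by (intro K_conj defect_K wprod_closed) auto
  finally show ?thesis .
qed

text \<open>The right-hand side does not involve \<open>\<gamma>\<close> except through the pairing. This is how commutators of
translations along different pairs of roots are compared.\<close>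

lemma cm_eq_defect:
  assumes "\<gamma> \<in> \<Phi>" "\<alpha> \<in> \<Phi>" "\<sigma> \<in> L \<gamma>" "\<tau> \<in> L \<alpha>"
  shows "cm (t \<gamma> \<sigma>) (t \<alpha> \<tau>) = defect \<alpha> \<tau> (pairing \<alpha> \<gamma> *\<^sub>R \<sigma>)"
  using t_add[OF assms] assms fibre_scale fibre_add
  by (simp add: defect_def G.m_assoc G.inv_mult_group)

lemma t_double:
  assumes "\<gamma> \<in> \<Phi>" "\<sigma> \<in> L \<gamma>" shows "t \<gamma> (2 *\<^sub>R \<sigma>) = t \<gamma> \<sigma> \<otimes>\<^bsub>G\<^esub> t \<gamma> \<sigma>"
proof -
  have p: "pairing \<gamma> \<gamma> = 2" using assms by (simp add: pairing_self root_nz)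
  have two: "2 *\<^sub>R \<sigma> \<in> L \<gamma>" using fibre_scale[OF assms(1,1,2)] p by simp
  have "t \<gamma> (- \<sigma> + 2 *\<^sub>R \<sigma>) = cm (t \<gamma> \<sigma>) (t \<gamma> (- \<sigma>)) \<otimes>\<^bsub>G\<^esub> (t \<gamma> (- \<sigma>) \<otimes>\<^bsub>G\<^esub> t \<gamma> (2 *\<^sub>R \<sigma>))"
    using t_add[OF assms(1,1,2) fibre_neg[OF assms]] p by simp
  also have "cm (t \<gamma> \<sigma>) (t \<gamma> (- \<sigma>)) = \<one>\<^bsub>G\<^esub>"
    using assms by (simp add: t_uminus commutator_def)
  finally have "t \<gamma> \<sigma> = inv\<^bsub>G\<^esub> (t \<gamma> \<sigma>) \<otimes>\<^bsub>G\<^esub> t \<gamma> (2 *\<^sub>R \<sigma>)"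
    using assms two by (simp add: t_uminus scaleR_2)
  then have "t \<gamma> \<sigma> \<otimes>\<^bsub>G\<^esub> t \<gamma> \<sigma> = t \<gamma> \<sigma> \<otimes>\<^bsub>G\<^esub> (inv\<^bsub>G\<^esub> (t \<gamma> \<sigma>) \<otimes>\<^bsub>G\<^esub> t \<gamma> (2 *\<^sub>R \<sigma>))" by simp
  then show ?thesis using assms two by simp
qed

lemma t_sandwich:
  assumes "\<gamma> \<in> \<Phi>" "\<sigma> \<in> L \<gamma>" "\<tau> \<in> L \<gamma>"
  shows "t \<gamma> (\<tau> + 2 *\<^sub>R \<sigma>) = t \<gamma> \<sigma> \<otimes>\<^bsub>G\<^esub> t \<gamma> \<tau> \<otimes>\<^bsub>G\<^esub> t \<gamma> \<sigma>"
proof -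
  have p: "pairing \<gamma> \<gamma> = 2" using assms by (simp add: pairing_self root_nz)
  have "t \<gamma> (\<tau> + 2 *\<^sub>R \<sigma>) = (cm (t \<gamma> \<sigma>) (t \<gamma> \<tau>) \<otimes>\<^bsub>G\<^esub> (t \<gamma> \<tau> \<otimes>\<^bsub>G\<^esub> t \<gamma> \<sigma>)) \<otimes>\<^bsub>G\<^esub> t \<gamma> \<sigma>"
    using t_add[OF assms(1,1,2,3)] p assms by (simp add: t_double G.m_assoc)
  also have "cm (t \<gamma> \<sigma>) (t \<gamma> \<tau>) \<otimes>\<^bsub>G\<^esub> (t \<gamma> \<tau> \<otimes>\<^bsub>G\<^esub> t \<gamma> \<sigma>) = t \<gamma> \<sigma> \<otimes>\<^bsub>G\<^esub> t \<gamma> \<tau>"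
    using assms by (intro mult_cm[symmetric]) auto
  finally show ?thesis .
qed

lemma fibre_add_double: "\<gamma> \<in> \<Phi> \<Longrightarrow> \<sigma> \<in> L \<gamma> \<Longrightarrow> \<tau> \<in> L \<gamma> \<Longrightarrow> \<tau> + 2 *\<^sub>R \<sigma> \<in> L \<gamma>"
  using fibre_add[of \<gamma> \<gamma> \<sigma> \<tau>] by (simp add: pairing_self root_nz)

text \<open>Lists keep track of the order of the factors, which matters up to commutators.\<close>

definition tlist :: "'a \<Rightarrow> 'b list \<Rightarrow> ('a \<times> 'b) word set" where
  "tlist \<gamma> xs = foldr (\<lambda>x g. t \<gamma> x \<otimes>\<^bsub>G\<^esub> g) xs \<one>\<^bsub>G\<^esub>"

lemma tlist_simps: "tlist \<gamma> [] = \<one>\<^bsub>G\<^esub>" "tlist \<gamma> (x # xs) = t \<gamma> x \<otimes>\<^bsub>G\<^esub> tlist \<gamma> xs"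
  by (simp_all add: tlist_def)

lemma tlist_H: "\<gamma> \<in> \<Phi> \<Longrightarrow> set xs \<subseteq> L \<gamma> \<Longrightarrow> tlist \<gamma> xs \<in> H"
  by (induction xs)
    (auto simp: tlist_simps subgroup.one_closed[OF subgroup_H] intro!: subgroup.m_closed[OF subgroup_H])

lemma tlist_closed [simp]: "\<gamma> \<in> \<Phi> \<Longrightarrow> set xs \<subseteq> L \<gamma> \<Longrightarrow> tlist \<gamma> xs \<in> carrier G"
  using tlist_H H_carrier by blast

lemma tlist_append: "\<gamma> \<in> \<Phi> \<Longrightarrow> set xs \<subseteq> L \<gamma> \<Longrightarrow> set ys \<subseteq> L \<gamma> \<Longrightarrow> tlist \<gamma> (xs @ ys) = tlist \<gamma> xs \<otimes>\<^bsub>G\<^esub> tlist \<gamma> ys"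
  by (induction xs) (auto simp: tlist_simps G.m_assoc)

lemma act_tlist:
  "\<gamma> \<in> \<Phi> \<Longrightarrow> set xs \<subseteq> L \<gamma> \<Longrightarrow> act (tlist \<gamma> xs) (x, y) = (x, y + pairing x \<gamma> *\<^sub>R sum_list xs)"
  by (induction xs) (auto simp: tlist_simps act_t algebra_simps)

lemma tlist_rfls:
  assumes "set ks \<subseteq> {1..l}" "\<gamma> \<in> \<Phi>" "set xs \<subseteq> L \<gamma>"
  shows "tlist (rfls ks \<gamma>) xs = wprod ks \<otimes>\<^bsub>G\<^esub> tlist \<gamma> xs \<otimes>\<^bsub>G\<^esub> inv\<^bsub>G\<^esub> (wprod ks)"
  using assms(3)
  by (induction xs) (use assms(1,2) in \<open>auto simp: tlist_simps wprod_closed G.conj_hom conj_t\<close>)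

text \<open>For the list of the \<open>\<sigma> r\<close> with \<open>r\<close> in a support set \<open>J\<close>, this is the element \<open>z\<^sub>J\<close>.\<close>

definition zlist :: "'a \<Rightarrow> 'b list \<Rightarrow> ('a \<times> 'b) word set" where
  "zlist \<gamma> xs = t \<gamma> (- sum_list xs) \<otimes>\<^bsub>G\<^esub> tlist \<gamma> xs"

lemma zlist_K:
  assumes "\<gamma> \<in> \<Phi>" "set xs \<subseteq> L \<gamma>" "sum_list xs \<in> L \<gamma>" shows "zlist \<gamma> xs \<in> K"
  using assms fibre_neg by (auto simp: zlist_def K_def act_t act_tlist)

lemma zlist_rfls:
  assumes "set ks \<subseteq> {1..l}" "\<gamma> \<in> \<Phi>" "set xs \<subseteq> L \<gamma>" "sum_list xs \<in> L \<gamma>"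
  shows "zlist (rfls ks \<gamma>) xs = zlist \<gamma> xs"
proof -
  have "zlist (rfls ks \<gamma>) xs = wprod ks \<otimes>\<^bsub>G\<^esub> zlist \<gamma> xs \<otimes>\<^bsub>G\<^esub> inv\<^bsub>G\<^esub> (wprod ks)"
    unfolding zlist_def using assms fibre_neg
    by (simp add: tlist_rfls conj_t[symmetric] G.conj_hom wprod_closed)
  also have "\<dots> = zlist \<gamma> xs" using assms by (intro K_conj zlist_K wprod_closed)
  finally show ?thesis .
qed

text \<open>By \<open>t_sandwich\<close> a double can be added symmetrically from both sides.\<close>

lemma tlist_palindrome:
  assumes "\<gamma> \<in> \<Phi>" "set xs \<subseteq> L \<gamma>"
  shows "2 *\<^sub>R sum_list xs \<in> L \<gamma> \<and> t \<gamma> (2 *\<^sub>R sum_list xs) = tlist \<gamma> xs \<otimes>\<^bsub>G\<^esub> tlist \<gamma> (rev xs)"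
  using assms(2)
proof (induction xs)
  case Nil then show ?case using assms fibre_zero by (simp add: tlist_simps)
next
  case (Cons x xs)
  have e: "2 *\<^sub>R sum_list (x # xs) = 2 *\<^sub>R sum_list xs + 2 *\<^sub>R x" by (simp add: algebra_simps)
  have "t \<gamma> (2 *\<^sub>R sum_list (x # xs)) = t \<gamma> x \<otimes>\<^bsub>G\<^esub> t \<gamma> (2 *\<^sub>R sum_list xs) \<otimes>\<^bsub>G\<^esub> t \<gamma> x"
    unfolding e using Cons assms(1) by (intro t_sandwich) auto
  also have "\<dots> = tlist \<gamma> (x # xs) \<otimes>\<^bsub>G\<^esub> tlist \<gamma> (rev (x # xs))"
    using Cons assms(1) by (simp add: tlist_simps tlist_append G.m_assoc)
  finally show ?case using Cons assms(1) fibre_add_double unfolding e by simp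
qed

text \<open>Both \<open>t \<gamma> s t \<gamma> s\<close> and the palindrome of \<open>tlist_palindrome\<close> are equal to \<open>t \<gamma> (2 s)\<close>, where \<open>s\<close> is
the sum of the list.\<close>

lemma zlist_square:
  assumes "\<gamma> \<in> \<Phi>" "set xs \<subseteq> L \<gamma>" "sum_list xs \<in> L \<gamma>"
  shows "zlist \<gamma> xs \<otimes>\<^bsub>G\<^esub> zlist \<gamma> xs = inv\<^bsub>G\<^esub> (tlist \<gamma> (rev xs)) \<otimes>\<^bsub>G\<^esub> tlist \<gamma> xs"
proof -
  let ?T = "t \<gamma> (sum_list xs)" and ?p = "tlist \<gamma> xs" and ?q = "tlist \<gamma> (rev xs)" and ?z = "zlist \<gamma> xs"
  have c: "?T \<in> carrier G" "?p \<in> carrier G" "?q \<in> carrier G" using assms by auto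
  have z: "?z \<in> group_center G" "?z \<in> carrier G" using zlist_K[OF assms] K_central K_carrier by auto
  have p: "?p = ?T \<otimes>\<^bsub>G\<^esub> ?z" using assms c by (simp add: zlist_def t_uminus)
  have TT: "?T \<otimes>\<^bsub>G\<^esub> ?T = ?p \<otimes>\<^bsub>G\<^esub> ?q" using tlist_palindrome[OF assms(1,2)] t_double[OF assms(1,3)] by simp
  have "?p \<otimes>\<^bsub>G\<^esub> ?p = (?p \<otimes>\<^bsub>G\<^esub> ?q) \<otimes>\<^bsub>G\<^esub> (?z \<otimes>\<^bsub>G\<^esub> ?z)"
  proof -
    have "?p \<otimes>\<^bsub>G\<^esub> ?p = (?T \<otimes>\<^bsub>G\<^esub> ?z) \<otimes>\<^bsub>G\<^esub> (?T \<otimes>\<^bsub>G\<^esub> ?z)" using p by simp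
    also have "\<dots> = (?T \<otimes>\<^bsub>G\<^esub> ?T) \<otimes>\<^bsub>G\<^esub> (?z \<otimes>\<^bsub>G\<^esub> ?z)"
      using c z by (simp add: G.m_assoc G.center_lcomm[OF z(1) c(1)])
    finally show ?thesis using TT by simp
  qed
  then have "?p = ?q \<otimes>\<^bsub>G\<^esub> (?z \<otimes>\<^bsub>G\<^esub> ?z)" using c z by (simp add: G.m_assoc)
  then show ?thesis using c z by (simp add: G.inv_solve_left)
qed

lemma zlist_pair_square:
  assumes "\<gamma> \<in> \<Phi>" "x \<in> L \<gamma>" "y \<in> L \<gamma>" "x + y \<in> L \<gamma>"
  shows "zlist \<gamma> [x, y] \<otimes>\<^bsub>G\<^esub> zlist \<gamma> [x, y] = cm (t \<gamma> x) (t \<gamma> y)"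
  using zlist_square[of \<gamma> "[x, y]"] assms
  by (simp add: tlist_simps commutator_def G.inv_mult_group G.m_assoc)

lemma defect_zlist:
  assumes "\<gamma> \<in> \<Phi>" "x \<in> L \<gamma>" "y \<in> L \<gamma>" "x + y \<in> L \<gamma>"
  shows "defect \<gamma> x y = inv\<^bsub>G\<^esub> (zlist \<gamma> [x, y])"
proof -
  have z: "zlist \<gamma> [x, y] \<in> K" using assms by (intro zlist_K) auto
  have p: "t \<gamma> x \<otimes>\<^bsub>G\<^esub> t \<gamma> y = t \<gamma> (x + y) \<otimes>\<^bsub>G\<^esub> zlist \<gamma> [x, y]"
    using assms t_uminus[of \<gamma> "x + y"] by (simp add: zlist_def tlist_simps)
  show ?thesis unfolding defect_def p
    using assms K_conj[OF subgroup.m_inv_closed[OF subgroup_K z], of "t \<gamma> (x + y)"] K_carrier[OF z]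
    by (simp add: G.inv_mult_group G.m_assoc)
qed

lemma defect_same:
  assumes "\<gamma> \<in> \<Phi>" "x \<in> L \<gamma>" shows "defect \<gamma> x x = \<one>\<^bsub>G\<^esub>"
  using assms by (simp add: defect_def t_double flip: scaleR_2)

lemma defect_swap:
  assumes "\<gamma> \<in> \<Phi>" "x \<in> L \<gamma>" "y \<in> L \<gamma>" "x + y \<in> L \<gamma>"
  shows "defect \<gamma> y x = defect \<gamma> x y \<otimes>\<^bsub>G\<^esub> cm (t \<gamma> x) (t \<gamma> y)"
proof -
  have "defect \<gamma> y x = t \<gamma> (x + y) \<otimes>\<^bsub>G\<^esub> inv\<^bsub>G\<^esub> (t \<gamma> y \<otimes>\<^bsub>G\<^esub> t \<gamma> x)" by (simp add: defect_def add.commute)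
  also have "t \<gamma> y \<otimes>\<^bsub>G\<^esub> t \<gamma> x = inv\<^bsub>G\<^esub> (cm (t \<gamma> x) (t \<gamma> y)) \<otimes>\<^bsub>G\<^esub> (t \<gamma> x \<otimes>\<^bsub>G\<^esub> t \<gamma> y)"
    using mult_cm[of "t \<gamma> x" "t \<gamma> y"] assms by simp
  finally show ?thesis using assms by (simp add: defect_def G.inv_mult_group G.m_assoc)
qed

text \<open>A translation along \<open>\<gamma>\<close> is a quotient of translations along \<open>\<delta>\<close> and its mirror image. This
exchanges short and long roots.\<close>

lemma t_partner:
  assumes "\<gamma> \<in> \<Phi>" "\<delta> \<in> \<Phi>" "\<sigma> \<in> L \<delta>"
  shows "t \<gamma> (pairing \<gamma> \<delta> *\<^sub>R \<sigma>) = t \<delta> \<sigma> \<otimes>\<^bsub>G\<^esub> inv\<^bsub>G\<^esub> (t (rfl \<gamma> \<delta>) \<sigma>)"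
  using t_rfl[OF assms] assms fibre_scale by (simp add: G.inv_mult_group)

end

section \<open>The central elements attached to index sets\<close>

lemma half_not_int: "(1::real) / 2 \<notin> \<int>"
proof
  assume "(1::real) / 2 \<in> \<int>"
  then obtain i :: int where "1 / 2 = real_of_int i" by (auto elim: Ints_cases)
  then have "2 * i = 1" by linarith
  then show False by presburger
qed

lemma sorted_list_of_set_pair: "r < (s::nat) \<Longrightarrow> sorted_list_of_set {r, s} = [r, s]"
  using sorted_list_of_set.idem_if_sorted_distinct[of "[r, s]"] by simp

locale ears_chosen = ears_data \<Phi> X a V1 V2 S1 S2 R \<sigma> m n
  for \<Phi> :: "'a::euclidean_space set" and X a and V1 V2 S1 S2 :: "'b::euclidean_space set"
    and R \<sigma> m n +
  fixes \<alpha>0 \<alpha>1 \<beta>0 \<beta>1 :: 'a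
  assumes chosen_short: "\<alpha>0 \<in> short_roots \<Phi>" "\<alpha>1 \<in> short_roots \<Phi>"
    and chosen_long: "\<beta>0 \<in> long_roots \<Phi>" "\<beta>1 \<in> long_roots \<Phi>" and chosen_neg: "\<alpha>1 \<bullet> \<beta>1 < 0"
begin

abbreviation zz :: "nat set \<Rightarrow> ('a \<times> 'b) word set" where
  "zz \<equiv> hat_z R m n \<sigma> S1 S2 \<alpha>0 \<beta>0 \<alpha>1 \<beta>1"
abbreviation SP1 where "SP1 \<equiv> supp \<sigma> {1..m} S1"
abbreviation SP2 where "SP2 \<equiv> supp \<sigma> {m+1..n} S2"
abbreviation JJ where "JJ \<equiv> index_sets X m n \<sigma> S1 S2"

definition sl :: "nat set \<Rightarrow> 'b list" where "sl J = map \<sigma> (sorted_list_of_set J)"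

lemma sum_sl: "finite J \<Longrightarrow> sum_list (sl J) = tau \<sigma> J"
  by (simp add: sl_def tau_def sum_list_distinct_conv_sum_set)

lemma set_sl: "finite J \<Longrightarrow> set (sl J) = \<sigma> ` J"
  by (simp add: sl_def)

lemma sl_pair: "r < s \<Longrightarrow> sl {r, s} = [\<sigma> r, \<sigma> s]"
  by (simp add: sl_def sorted_list_of_set_pair)

lemma tau_pair: "r \<noteq> s \<Longrightarrow> tau \<sigma> {r, s} = \<sigma> r + \<sigma> s" by (simp add: tau_def)

lemma ordered_prod_tlist: "ordered_prod G (\<lambda>r. hat_t R (\<gamma>, 0) (\<sigma> r)) J = tlist \<gamma> (sl J)"
  by (simp add: ordered_prod_def tlist_def sl_def foldr_map comp_def)

lemma supp_finite: "J \<in> supp \<sigma> {i..j} S \<Longrightarrow> finite J" 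
  by (auto simp: supp_def intro: finite_subset)

lemma sigma_short: "\<gamma> \<in> short_roots \<Phi> \<Longrightarrow> r \<in> {1..n} \<Longrightarrow> \<sigma> r \<in> L \<gamma>"
  using sigma_S1[of r] sigma_S2[of r] S_in_L_short[of \<gamma>] int_span_base[of "\<sigma> r" S2]
  by (cases "r \<le> m") auto

lemma sigma_long: "\<gamma> \<in> long_roots \<Phi> \<Longrightarrow> r \<in> {m+1..n} \<Longrightarrow> \<sigma> r \<in> L \<gamma>"
  using sigma_S2[of r] S_in_L_long[of \<gamma>] by auto

lemma k_sigma_long: "\<gamma> \<in> long_roots \<Phi> \<Longrightarrow> r \<in> {1..m} \<Longrightarrow> k *\<^sub>R \<sigma> r \<in> L \<gamma>"
  using sigma_S1[of r] S_in_L_long(1)[of \<gamma>] int_span_base by auto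

lemma zz_supp1: "J \<in> SP1 \<Longrightarrow> zz J = zlist \<alpha>0 (sl J)"
  by (simp add: hat_z_def Let_def zlist_def ordered_prod_tlist sum_sl supp_finite)

lemma zz_pair1: "r < s \<Longrightarrow> s \<le> m \<Longrightarrow> 1 \<le> r \<Longrightarrow> {r, s} \<notin> SP1 \<Longrightarrow> zz {r, s} = cm (t \<alpha>0 (\<sigma> r)) (t \<alpha>0 (\<sigma> s))"
  by (auto simp: hat_z_def Let_def)

lemma not_SP1: "J \<subseteq> {m+1..n} \<Longrightarrow> J \<noteq> {} \<Longrightarrow> J \<notin> SP1 \<and> \<not> J \<subseteq> {1..m}"
  by (fastforce simp: supp_def)

lemma zz_supp2: "J \<in> SP2 \<Longrightarrow> J \<noteq> {} \<Longrightarrow> zz J = zlist \<beta>0 (sl J)"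
  using not_SP1[of J] supp_finite[of J "m+1" n S2]
  by (simp add: hat_z_def Let_def zlist_def ordered_prod_tlist sum_sl) (simp add: supp_def)

lemma zz_pair2:
  assumes "r < s" "s \<le> n" "m + 1 \<le> r" "{r, s} \<notin> SP2"
  shows "zz {r, s} = cm (t \<beta>0 (\<sigma> r)) (t \<beta>0 (\<sigma> s))"
proof -
  have "{r, s} \<subseteq> {m+1..n}" "{r, s} \<noteq> {}" using assms by auto
  then show ?thesis using assms not_SP1[of "{r, s}"] by (simp add: hat_z_def Let_def)
qed

lemma zz_pair12:
  assumes "1 \<le> r" "r \<le> m" "m + 1 \<le> s" "s \<le> n"
  shows "zz {r, s} = cm (t \<beta>1 (\<sigma> s)) (t \<alpha>1 (\<sigma> r))"
  using assms by (auto simp: hat_z_def Let_def supp_def)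

lemma chosen_root: "\<alpha>0 \<in> \<Phi>" "\<alpha>1 \<in> \<Phi>" "\<beta>0 \<in> \<Phi>" "\<beta>1 \<in> \<Phi>"
  using chosen_short chosen_long short_root long_root by auto

lemma supp1_fibre:
  assumes "J \<in> SP1" "\<gamma> \<in> short_roots \<Phi>" shows "set (sl J) \<subseteq> L \<gamma>" "sum_list (sl J) \<in> L \<gamma>"
proof -
  have "J \<subseteq> {1..n}" using assms(1) m_le_n by (auto simp: supp_def)
  then show "set (sl J) \<subseteq> L \<gamma>" using set_sl[OF supp_finite[OF assms(1)]] assms(2) sigma_short by auto
  show "sum_list (sl J) \<in> L \<gamma>" using assms S_in_L_short(1)[OF assms(2)] sum_sl[OF supp_finite[OF assms(1)]]
    by (auto simp: supp_def)
qed

lemma supp2_fibre: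
  assumes "J \<in> SP2" "\<gamma> \<in> long_roots \<Phi>" shows "set (sl J) \<subseteq> L \<gamma>" "sum_list (sl J) \<in> L \<gamma>"
proof -
  have "J \<subseteq> {m+1..n}" using assms(1) by (auto simp: supp_def)
  then show "set (sl J) \<subseteq> L \<gamma>" using set_sl[OF supp_finite[OF assms(1)]] assms(2) sigma_long by auto
  show "sum_list (sl J) \<in> L \<gamma>" using assms S_in_L_long(2)[OF assms(2)] sum_sl[OF supp_finite[OF assms(1)]]
    by (auto simp: supp_def)
qed

lemma index_sets_supp: "JJ \<subseteq> {J \<in> SP1 \<union> SP2. 3 \<le> card J}"
  by (auto simp: index_sets_def Esupp_def split: root_type.splits if_splits)

lemma zz_K_supp: "J \<in> SP1 \<union> SP2 \<Longrightarrow> zz J \<in> K"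
proof (cases "J \<in> SP1")
  case True
  then show ?thesis unfolding zz_supp1[OF True]
    using supp1_fibre[OF True] chosen_short chosen_root by (intro zlist_K) auto
next
  case False
  moreover assume "J \<in> SP1 \<union> SP2"
  ultimately have J: "J \<in> SP2" "J \<noteq> {}" using S_zero by (auto simp: supp_def tau_def)
  show ?thesis unfolding zz_supp2[OF J]
    using supp2_fibre[OF J(1)] chosen_long chosen_root by (intro zlist_K) auto
qed

lemma pair_cases:
  assumes "(r, s) \<in> index_pairs n"
  obtains (short) "1 \<le> r" "r < s" "s \<le> m" | (long) "m + 1 \<le> r" "r < s" "s \<le> n"
    | (mixed) "1 \<le> r" "r \<le> m" "m + 1 \<le> s" "s \<le> n" "r < s"
proof -
  have "1 \<le> r" "r < s" "s \<le> n" using assms by (auto simp: index_pairs_def)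
  then show thesis using that by (cases "r \<le> m"; cases "s \<le> m") auto
qed

lemma zz_K_pair: assumes "(r, s) \<in> index_pairs n" shows "zz {r, s} \<in> K"
  using assms
proof (cases rule: pair_cases)
  case short
  show ?thesis
  proof (cases "{r, s} \<in> SP1")
    case False
    show ?thesis unfolding zz_pair1[OF short(2,3,1) False]
      using short m_le_n sigma_short chosen_short chosen_root by (intro cm_K t_H) auto
  qed (use zz_K_supp in blast)
next
  case long
  show ?thesis
  proof (cases "{r, s} \<in> SP2")
    case False
    show ?thesis unfolding zz_pair2[OF long(2,3,1) False]
      using long sigma_long chosen_long chosen_root by (intro cm_K t_H) auto
  qed (use zz_K_supp in blast)
next
  case mixed
  show ?thesis unfolding zz_pair12[OF mixed(1-4)]
    using mixed m_le_n sigma_short sigma_long chosen_short chosen_long chosen_root by (intro cm_K t_H) auto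
qed

text \<open>These elements are visibly central. By \<open>K_eq_Z0\<close> they generate the whole center.\<close>

definition Z0 where "Z0 = generate G ((\<lambda>(r, s). zz {r, s}) ` index_pairs n \<union> zz ` JJ)"

lemma Z0_gens_K: "(\<lambda>(r, s). zz {r, s}) ` index_pairs n \<union> zz ` JJ \<subseteq> K"
  using zz_K_pair zz_K_supp index_sets_supp by auto

lemma Z0_K: "Z0 \<subseteq> K"
  unfolding Z0_def by (rule G.generate_subgroup_incl[OF Z0_gens_K subgroup_K])

lemma subgroup_Z0: "subgroup Z0 G"
  unfolding Z0_def using Z0_gens_K K_carrier by (intro G.generate_is_subgroup) blast

lemma Z0_center: "Z0 \<subseteq> group_center G" using Z0_K K_central by blast

lemmas Z0_closed = subgroup.one_closed[OF subgroup_Z0] subgroup.m_closed[OF subgroup_Z0]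
  subgroup.m_inv_closed[OF subgroup_Z0]

lemma zz_pair_Z0: "(r, s) \<in> index_pairs n \<Longrightarrow> zz {r, s} \<in> Z0"
  unfolding Z0_def by (intro generate.incl) force

lemma zz_JJ_Z0: "J \<in> JJ \<Longrightarrow> zz J \<in> Z0"
  unfolding Z0_def by (intro generate.incl) blast

lemma cm_self: "x \<in> carrier G \<Longrightarrow> cm x x = \<one>\<^bsub>G\<^esub>" by (simp add: commutator_def G.m_assoc)

lemma cm_t_uminus:
  "\<lbrakk>\<gamma> \<in> \<Phi>; x \<in> L \<gamma>; y \<in> H\<rbrakk> \<Longrightarrow> cm (t \<gamma> x) y = inv\<^bsub>G\<^esub> (cm (t (- \<gamma>) x) y)"
  using cm_inv[of "t \<gamma> x" y] H_carrier[of y] by (simp add: t_uminus_root)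

text \<open>\<open>T\<close> is the set of the short or of the long roots, and \<open>I\<close> the corresponding part of the index set.
For orthogonal roots the commutator is trivial, for proportional ones it is, up to inversion, a
commutator along a single root, and otherwise it is a defect by \<open>cm_eq_defect\<close>. In the last two
cases the finite Weyl group moves the root to \<open>\<rho>\<close>.\<close>

lemma cm_side:
  assumes T: "T \<subseteq> \<Phi>" "\<And>\<gamma>. \<gamma> \<in> T \<Longrightarrow> - \<gamma> \<in> T" "\<And>\<gamma>. \<gamma> \<in> T \<Longrightarrow> \<exists>ks. set ks \<subseteq> {1..l} \<and> \<gamma> = rfls ks \<rho>"
    and rho: "\<rho> \<in> T" and fib: "\<And>\<gamma> r. \<gamma> \<in> T \<Longrightarrow> r \<in> I \<Longrightarrow> \<sigma> r \<in> L \<gamma>"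
    and same: "\<And>r s. r \<in> I \<Longrightarrow> s \<in> I \<Longrightarrow> r < s \<Longrightarrow> cm (t \<rho> (\<sigma> r)) (t \<rho> (\<sigma> s)) \<in> Z0"
    and close: "\<And>\<gamma> \<gamma>' r s. \<gamma> \<in> T \<Longrightarrow> \<gamma>' \<in> T \<Longrightarrow> pairing \<gamma>' \<gamma> = 1 \<Longrightarrow> r \<in> I \<Longrightarrow> s \<in> I \<Longrightarrow> r < s \<Longrightarrow>
       \<sigma> r + \<sigma> s \<in> L \<rho> \<and> zlist \<rho> [\<sigma> r, \<sigma> s] \<in> Z0"
    and g: "\<gamma> \<in> T" "\<gamma>' \<in> T" "r \<in> I" "s \<in> I"
  shows "cm (t \<gamma> (\<sigma> r)) (t \<gamma>' (\<sigma> s)) \<in> Z0"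
proof -
  have TP: "\<gamma> \<in> T \<Longrightarrow> \<gamma> \<in> \<Phi>" for \<gamma> using T by blast
  have rhoP: "\<rho> \<in> \<Phi>" using TP rho by blast
  have base: "cm (t \<rho> (\<sigma> r)) (t \<rho> (\<sigma> s)) \<in> Z0" if "r \<in> I" "s \<in> I" for r s
  proof -
    consider "r < s" | "s < r" | "r = s" by linarith
    then show ?thesis
    proof cases
      case 2
      then show ?thesis using same[OF that(2,1)] cm_swap[of "t \<rho> (\<sigma> s)" "t \<rho> (\<sigma> r)"] fib[OF rho] that rhoP
        by (simp add: Z0_closed)
    qed (use same that cm_self fib[OF rho] rhoP in \<open>auto simp: Z0_closed\<close>)
  qed
  have self: "cm (t \<gamma> (\<sigma> r)) (t \<gamma> (\<sigma> s)) \<in> Z0" if g: "\<gamma> \<in> T" "r \<in> I" "s \<in> I" for \<gamma> r s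
  proof -
    obtain ks where ks: "set ks \<subseteq> {1..l}" "\<gamma> = rfls ks \<rho>" using T(3)[OF g(1)] by blast
    then show ?thesis using cm_rfls[OF ks(1) rhoP rhoP fib[OF rho g(2)] fib[OF rho g(3)]] base g by simp
  qed
  have near: "cm (t \<gamma> (\<sigma> r)) (t \<gamma>' (\<sigma> s)) \<in> Z0" if g: "\<gamma> \<in> T" "\<gamma>' \<in> T" "pairing \<gamma>' \<gamma> = 1" "r \<in> I" "s \<in> I" for \<gamma> \<gamma>' r s
  proof -
    obtain ks where ks: "set ks \<subseteq> {1..l}" "\<gamma>' = rfls ks \<rho>" using T(3)[OF g(2)] by blast
    have f: "\<sigma> r \<in> L \<rho>" "\<sigma> s \<in> L \<rho>" "\<sigma> r \<in> L \<gamma>'" "\<sigma> s \<in> L \<gamma>'" "\<sigma> r \<in> L \<gamma>" using fib rho g by auto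
    have sum: "\<sigma> s + \<sigma> r \<in> L \<rho>"
      using fibre_add[OF TP[OF g(1)] TP[OF g(2)] f(5,4)] g(3) fibre_rfls[OF ks(1) rhoP] ks(2) by simp
    have "cm (t \<gamma> (\<sigma> r)) (t \<gamma>' (\<sigma> s)) = defect \<gamma>' (\<sigma> s) (\<sigma> r)"
      using cm_eq_defect[OF TP[OF g(1)] TP[OF g(2)] f(5,4)] g(3) by simp
    also have "\<dots> = defect \<rho> (\<sigma> s) (\<sigma> r)"
      unfolding ks(2) using ks(1) rhoP f sum by (intro defect_rfls)
    also have "\<dots> \<in> Z0"
    proof -
      consider "r < s" | "s < r" | "r = s" by linarith
      then show ?thesis
      proof cases
        case 1
        then have "defect \<rho> (\<sigma> r) (\<sigma> s) \<in> Z0"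
          using close[OF g(1,2,3,4,5)] defect_zlist[OF rhoP f(1,2)] by (simp add: Z0_closed)
        then show ?thesis using defect_swap[OF rhoP f(1,2)] sum base[OF g(4,5)] by (simp add: Z0_closed add.commute)
      next
        case 2
        then show ?thesis using close[OF g(1,2,3,5,4)] defect_zlist[OF rhoP f(2,1)] by (simp add: Z0_closed)
      qed (use defect_same rhoP f in \<open>simp add: Z0_closed\<close>)
    qed
    finally show ?thesis .
  qed
  have fg: "\<sigma> r \<in> L \<gamma>" "\<sigma> s \<in> L \<gamma>'" "\<sigma> r \<in> L (- \<gamma>)" using fib g T(2) by auto
  obtain ks ks' where "set ks \<subseteq> {1..l}" "\<gamma> = rfls ks \<rho>" "set ks' \<subseteq> {1..l}" "\<gamma>' = rfls ks' \<rho>"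
    using T(3)[OF g(1)] T(3)[OF g(2)] by blast
  then have "\<gamma>' \<bullet> \<gamma>' = \<gamma> \<bullet> \<gamma>" by (simp add: rfls_inner)
  note neg = cm_t_uminus[OF TP[OF g(1)] fg(1) t_H[OF TP[OF g(2)] fg(2)]]
  from same_norm_cases[OF TP[OF g(2)] TP[OF g(1)] \<open>\<gamma>' \<bullet> \<gamma>' = \<gamma> \<bullet> \<gamma>\<close>]
  consider "pairing \<gamma>' \<gamma> = 0" | "pairing \<gamma>' \<gamma> = 1" | "pairing \<gamma>' (- \<gamma>) = 1" | "\<gamma>' = \<gamma>" | "\<gamma>' = - \<gamma>"
    by (auto simp: pairing_simps)
  then show ?thesis
  proof cases
    case 1
    then have "\<gamma>' \<bullet> \<gamma> = 0" using root_nonzero[OF TP[OF g(1)]] by (simp add: pairing_def)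
    then show ?thesis using t_orthogonal[OF TP[OF g(1)] TP[OF g(2)] fg(1,2)] Z0_closed(1) by simp
  next
    case 3 then show ?thesis unfolding neg using near[OF T(2)[OF g(1)] g(2) _ g(3,4)] Z0_closed(3) by blast
  next
    case 4 then show ?thesis using self g by simp
  next
    case 5 then show ?thesis unfolding neg using self[OF T(2)[OF g(1)] g(3,4)] Z0_closed(3) by simp
  qed (use near g in blast)
qed

lemma cm_short:
  assumes "\<gamma> \<in> short_roots \<Phi>" "\<gamma>' \<in> short_roots \<Phi>" "r \<in> {1..m}" "s \<in> {1..m}"
  shows "cm (t \<gamma> (\<sigma> r)) (t \<gamma>' (\<sigma> s)) \<in> Z0"
proof (rule cm_side[where T = "short_roots \<Phi>" and I = "{1..m}" and \<rho> = \<alpha>0])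
  have in1: "(r, s) \<in> index_pairs n" if "r \<in> {1..m}" "s \<in> {1..m}" "r < s" for r s
    using that m_le_n by (auto simp: index_pairs_def)
  show "cm (t \<alpha>0 (\<sigma> r)) (t \<alpha>0 (\<sigma> s)) \<in> Z0" if rs: "r \<in> {1..m}" "s \<in> {1..m}" "r < s" for r s
  proof (cases "{r, s} \<in> SP1")
    case True
    have "zz {r, s} = zlist \<alpha>0 [\<sigma> r, \<sigma> s]" using zz_supp1[OF True] rs by (simp add: sl_pair)
    moreover have "zlist \<alpha>0 [\<sigma> r, \<sigma> s] \<otimes>\<^bsub>G\<^esub> zlist \<alpha>0 [\<sigma> r, \<sigma> s] = cm (t \<alpha>0 (\<sigma> r)) (t \<alpha>0 (\<sigma> s))"
      using supp1_fibre[OF True chosen_short(1)] rs chosen_root by (intro zlist_pair_square) (auto simp: sl_pair)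
    ultimately show ?thesis using Z0_closed(2)[OF zz_pair_Z0 zz_pair_Z0, OF in1 in1, OF rs rs] by simp
  next
    case False
    then show ?thesis using zz_pair1[OF rs(3) _ _ False] zz_pair_Z0[OF in1[OF rs]] rs by simp
  qed
  fix \<gamma> \<gamma>' r s
  assume g: "\<gamma> \<in> short_roots \<Phi>" "\<gamma>' \<in> short_roots \<Phi>" "pairing \<gamma>' \<gamma> = 1" and rs: "r \<in> {1..m}" "s \<in> {1..m}" "r < s"
  have "X \<noteq> TypeB i" for i
    using even_pairing_short[of i \<gamma> \<gamma>'] g short_root half_not_int by auto
  then have "int_span S1 = S1" by (rule S1_lattice)
  then have "\<sigma> r + \<sigma> s \<in> S1" using int_span_add[of "\<sigma> r" S1 "\<sigma> s"] sigma_S1 rs by simp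
  then have SP: "{r, s} \<in> SP1" using rs by (auto simp: supp_def tau_pair)
  show "\<sigma> r + \<sigma> s \<in> L \<alpha>0 \<and> zlist \<alpha>0 [\<sigma> r, \<sigma> s] \<in> Z0"
    using supp1_fibre(2)[OF SP chosen_short(1)] zz_supp1[OF SP] zz_pair_Z0[OF in1[OF rs]] rs by (simp add: sl_pair)
qed (use assms short_root uminus_short_long short_transitive[OF chosen_short(1)] chosen_short sigma_short m_le_n in auto)

lemma cm_long:
  assumes "\<gamma> \<in> long_roots \<Phi>" "\<gamma>' \<in> long_roots \<Phi>" "r \<in> {m+1..n}" "s \<in> {m+1..n}"
  shows "cm (t \<gamma> (\<sigma> r)) (t \<gamma>' (\<sigma> s)) \<in> Z0"
proof (rule cm_side[where T = "long_roots \<Phi>" and I = "{m+1..n}" and \<rho> = \<beta>0])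
  have in1: "(r, s) \<in> index_pairs n" if "r \<in> {m+1..n}" "s \<in> {m+1..n}" "r < s" for r s
    using that by (auto simp: index_pairs_def)
  show "cm (t \<beta>0 (\<sigma> r)) (t \<beta>0 (\<sigma> s)) \<in> Z0" if rs: "r \<in> {m+1..n}" "s \<in> {m+1..n}" "r < s" for r s
  proof (cases "{r, s} \<in> SP2")
    case True
    have "zz {r, s} = zlist \<beta>0 [\<sigma> r, \<sigma> s]" using zz_supp2[OF True] rs by (simp add: sl_pair)
    moreover have "zlist \<beta>0 [\<sigma> r, \<sigma> s] \<otimes>\<^bsub>G\<^esub> zlist \<beta>0 [\<sigma> r, \<sigma> s] = cm (t \<beta>0 (\<sigma> r)) (t \<beta>0 (\<sigma> s))"
      using supp2_fibre[OF True chosen_long(1)] rs chosen_root by (intro zlist_pair_square) (auto simp: sl_pair)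
    ultimately show ?thesis using Z0_closed(2)[OF zz_pair_Z0 zz_pair_Z0, OF in1 in1, OF rs rs] by simp
  next
    case False
    then show ?thesis using zz_pair2[OF rs(3) _ _ False] zz_pair_Z0[OF in1[OF rs]] rs by simp
  qed
  fix \<gamma> \<gamma>' r s
  assume g: "\<gamma> \<in> long_roots \<Phi>" "\<gamma>' \<in> long_roots \<Phi>" "pairing \<gamma>' \<gamma> = 1" and rs: "r \<in> {m+1..n}" "s \<in> {m+1..n}" "r < s"
  have "\<not> (X = TypeB 2 \<or> X = TypeC i)" for i
    using even_pairing_long[of i \<gamma> \<gamma>'] g half_not_int by auto
  then have "int_span S2 = S2" by (intro S2_lattice) auto
  then have "\<sigma> r + \<sigma> s \<in> S2" using int_span_add[of "\<sigma> r" S2 "\<sigma> s"] sigma_S2 rs by simp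
  then have SP: "{r, s} \<in> SP2" using rs by (auto simp: supp_def tau_pair)
  show "\<sigma> r + \<sigma> s \<in> L \<beta>0 \<and> zlist \<beta>0 [\<sigma> r, \<sigma> s] \<in> Z0"
    using supp2_fibre(2)[OF SP chosen_long(1)] zz_supp2[OF SP] zz_pair_Z0[OF in1[OF rs]] rs by (simp add: sl_pair)
qed (use assms long_root uminus_short_long long_transitive[OF chosen_long(1)] chosen_long sigma_long in auto)

text \<open>Such a commutator is a defect at the short root \<open>\<gamma>\<close>, up to inversion, and so is the element
\<open>z\<close> of the pair for the roots \<open>\<alpha>1\<close> and \<open>\<beta>1\<close>. The two short roots are conjugate.\<close>

lemma cm_mixed:
  assumes g: "\<gamma> \<in> short_roots \<Phi>" "\<delta> \<in> long_roots \<Phi>" "r \<in> {1..m}" "s \<in> {m+1..n}"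
  shows "cm (t \<delta> (\<sigma> s)) (t \<gamma> (\<sigma> r)) \<in> Z0"
proof -
  have in1: "(r, s) \<in> index_pairs n" using assms by (auto simp: index_pairs_def)
  have P: "\<gamma> \<in> \<Phi>" "\<delta> \<in> \<Phi>" "- \<delta> \<in> \<Phi>" using g short_root long_root root_uminus by auto
  have f: "\<sigma> s \<in> L \<beta>" if "\<beta> \<in> long_roots \<Phi>" for \<beta> using g that sigma_long by auto
  have f': "\<sigma> r \<in> L \<beta>" "\<sigma> s \<in> L \<beta>" if "\<beta> \<in> short_roots \<Phi>" for \<beta> using g that sigma_short m_le_n by auto
  have p: "pairing \<alpha>1 (- \<beta>1) = 1"
  proof -
    have "pairing \<alpha>1 \<beta>1 < 0" using chosen_neg root_nonzero chosen_root by (simp add: pairing_def divide_neg_pos)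
    then show ?thesis using pairing_short_long[OF chosen_short(2) chosen_long(2)] by (auto simp: pairing_simps)
  qed
  have sum: "\<sigma> r + \<sigma> s \<in> L \<alpha>1"
    using fibre_add[of "- \<beta>1" \<alpha>1 "\<sigma> s" "\<sigma> r"] p chosen_root root_uminus f uminus_short_long chosen_long f' chosen_short by simp
  have ds: "defect \<alpha>1 (\<sigma> r) (\<sigma> s) \<in> Z0"
  proof -
    have "defect \<alpha>1 (\<sigma> r) (\<sigma> s) = cm (t (- \<beta>1) (\<sigma> s)) (t \<alpha>1 (\<sigma> r))"
      using cm_eq_defect[of "- \<beta>1" \<alpha>1 "\<sigma> s" "\<sigma> r"] p chosen_root root_uminus f uminus_short_long chosen_long f' chosen_short by simp
    also have "\<dots> = inv\<^bsub>G\<^esub> (zz {r, s})"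
      using cm_t_uminus[of "- \<beta>1" "\<sigma> s" "t \<alpha>1 (\<sigma> r)"] zz_pair12 g chosen_root root_uminus f f' uminus_short_long chosen_long chosen_short
      by simp
    finally show ?thesis using zz_pair_Z0[OF in1] Z0_closed by simp
  qed
  have near: "cm (t \<delta> (\<sigma> s)) (t \<gamma> (\<sigma> r)) \<in> Z0" if d: "\<delta> \<in> long_roots \<Phi>" "pairing \<gamma> \<delta> = 1" for \<delta>
  proof -
    obtain ks where ks: "set ks \<subseteq> {1..l}" "\<gamma> = rfls ks \<alpha>1" using short_transitive[OF chosen_short(2) g(1)] by blast
    have "cm (t \<delta> (\<sigma> s)) (t \<gamma> (\<sigma> r)) = defect \<gamma> (\<sigma> r) (\<sigma> s)"
      using cm_eq_defect[of \<delta> \<gamma> "\<sigma> s" "\<sigma> r"] d P long_root f f' g by simp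
    also have "\<dots> = defect \<alpha>1 (\<sigma> r) (\<sigma> s)"
      unfolding ks(2) using ks(1) chosen_root f' chosen_short sum by (intro defect_rfls) auto
    finally show ?thesis using ds by simp
  qed
  have neg: "cm (t \<delta> (\<sigma> s)) (t \<gamma> (\<sigma> r)) = inv\<^bsub>G\<^esub> (cm (t (- \<delta>) (\<sigma> s)) (t \<gamma> (\<sigma> r)))"
    using P f f' g by (intro cm_t_uminus t_H) auto
  from pairing_short_long[OF g(1,2)] consider "pairing \<gamma> \<delta> = 0" | "pairing \<gamma> \<delta> = 1" | "pairing \<gamma> (- \<delta>) = 1"
    by (auto simp: pairing_simps)
  then show ?thesis
  proof cases
    case 1
    then have "\<gamma> \<bullet> \<delta> = 0" using root_nonzero[OF P(2)] by (simp add: pairing_def)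
    then show ?thesis using t_orthogonal[OF P(2,1)] f f' g Z0_closed(1) by simp
  next
    case 3 then show ?thesis unfolding neg using near uminus_short_long g Z0_closed(3) by blast
  qed (use near g in blast)
qed

end

section \<open>Generation of the center\<close>

context ears_chosen begin

text \<open>Commutators depend on the action on \<open>V\<close> only, so \<open>Z0\<close> contains all of them if it contains those
of a set of elements that generates all translations of \<open>V\<close> coming from \<open>Ht\<close>. Short roots for the
first part of the basis and long roots for the second part suffice.\<close>

definition basis_ts where
  "basis_ts = {t \<gamma> (\<sigma> r) | \<gamma> r. \<gamma> \<in> short_roots \<Phi> \<and> r \<in> {1..m}} \<union>
        {t \<gamma> (\<sigma> r) | \<gamma> r. \<gamma> \<in> long_roots \<Phi> \<and> r \<in> {m+1..n}}"

lemma basis_ts_H: "basis_ts \<subseteq> H"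
  using sigma_short sigma_long m_le_n short_root long_root by (auto simp: basis_ts_def)

lemma basis_ts_cm:
  assumes "x \<in> basis_ts" "y \<in> basis_ts" shows "cm x y \<in> Z0"
proof -
  have mix: "cm (t \<gamma> (\<sigma> r)) (t \<delta> (\<sigma> s)) \<in> Z0"
    if "\<gamma> \<in> short_roots \<Phi>" "\<delta> \<in> long_roots \<Phi>" "r \<in> {1..m}" "s \<in> {m+1..n}" for \<gamma> \<delta> r s
  proof -
    have "t \<gamma> (\<sigma> r) \<in> H" "t \<delta> (\<sigma> s) \<in> H"
      using that sigma_short sigma_long m_le_n short_root long_root by auto
    from G.commute_mod_sym[OF subgroup_Z0 H_carrier[OF this(2)] H_carrier[OF this(1)] cm_mixed[OF that]]
    show ?thesis .
  qed
  from assms show ?thesis unfolding basis_ts_def using cm_short cm_long cm_mixed mix by blast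
qed

abbreviation Y where "Y \<equiv> generate G (basis_ts \<union> K)"

lemma basis_ts_K_H: "basis_ts \<union> K \<subseteq> H"
  using basis_ts_H by (auto simp: K_def H_def intro!: exI[of _ "\<lambda>_. 0"])

lemma subgroup_Y: "subgroup Y G"
  using basis_ts_K_H H_carrier by (intro G.generate_is_subgroup) blast

lemma Y_cm: assumes "x \<in> Y" "y \<in> Y" shows "cm x y \<in> Z0"
proof (rule G.generate_commute_mod[OF subgroup_Z0 Z0_center _ _ _ assms])
  show "basis_ts \<union> K \<subseteq> carrier G" "basis_ts \<union> K \<subseteq> carrier G" using basis_ts_K_H H_carrier by blast+
  fix x y assume xy: "x \<in> basis_ts \<union> K" "y \<in> basis_ts \<union> K"
  then have H: "x \<in> H" "y \<in> H" using basis_ts_K_H by auto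
  consider "x \<in> K" | "y \<in> K" | "x \<in> basis_ts" "y \<in> basis_ts" using xy by blast
  then show "cm x y \<in> Z0"
  proof cases
    case 1 then show ?thesis using cm_K_left[OF 1 H(2)] Z0_closed(1) by simp
  next
    case 2 then show ?thesis using cm_swap[OF H(2,1)] cm_K_left[OF 2 H(1)] Z0_closed(1) by simp
  qed (rule basis_ts_cm)
qed

text \<open>The translations \<open>s\<close> along \<open>\<gamma>\<close> that are induced by elements of \<open>Y\<close>. As \<open>Y\<close> contains \<open>K\<close>, it contains
\<open>t \<gamma> s\<close> for each such \<open>s\<close>.\<close>

definition transl :: "'a \<Rightarrow> 'b set" where
  "transl \<gamma> = {s. \<exists>v\<in>Y. \<forall>x y. act v (x, y) = (x, y + pairing x \<gamma> *\<^sub>R s)}"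

lemma transl_zero: "0 \<in> transl \<gamma>"
  using subgroup.one_closed[OF subgroup_Y] by (auto simp: transl_def intro!: bexI[of _ "\<one>\<^bsub>G\<^esub>"])

lemma transl_uminus: assumes "s \<in> transl \<gamma>" shows "- s \<in> transl \<gamma>"
proof -
  from assms obtain v where v: "v \<in> Y" "\<And>x y. act v (x, y) = (x, y + pairing x \<gamma> *\<^sub>R s)" by (auto simp: transl_def)
  have c: "v \<in> carrier G" using subgroup.mem_carrier[OF subgroup_Y v(1)] .
  have "act (inv\<^bsub>G\<^esub> v) (x, y) = (x, y + pairing x \<gamma> *\<^sub>R (- s))" for x y
    using act_inv[OF c, of "(x, y - pairing x \<gamma> *\<^sub>R s)"] by (simp add: v)
  then show ?thesis using subgroup.m_inv_closed[OF subgroup_Y v(1)] by (auto simp: transl_def)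
qed

lemma transl_add: assumes "s \<in> transl \<gamma>" "u \<in> transl \<gamma>" shows "s + u \<in> transl \<gamma>"
proof -
  from assms obtain v where v: "v \<in> Y" "\<And>x y. act v (x, y) = (x, y + pairing x \<gamma> *\<^sub>R s)" by (auto simp: transl_def)
  from assms obtain v' where v': "v' \<in> Y" "\<And>x y. act v' (x, y) = (x, y + pairing x \<gamma> *\<^sub>R u)" by (auto simp: transl_def)
  have c: "v \<in> carrier G" "v' \<in> carrier G" using subgroup.mem_carrier[OF subgroup_Y] v v' by auto
  have "act (v \<otimes>\<^bsub>G\<^esub> v') (x, y) = (x, y + pairing x \<gamma> *\<^sub>R (s + u))" for x y
    using c by (simp add: v v' algebra_simps)
  then show ?thesis using subgroup.m_closed[OF subgroup_Y v(1) v'(1)] by (auto simp: transl_def)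
qed

lemma transl_diff: "s \<in> transl \<gamma> \<Longrightarrow> u \<in> transl \<gamma> \<Longrightarrow> s - u \<in> transl \<gamma>"
  using transl_add[of s \<gamma> "- u"] transl_uminus by simp

lemma t_transl: "\<gamma> \<in> \<Phi> \<Longrightarrow> s \<in> L \<gamma> \<Longrightarrow> t \<gamma> s \<in> Y \<Longrightarrow> s \<in> transl \<gamma>"
  by (auto simp: transl_def act_t intro!: bexI[of _ "t \<gamma> s"])

lemma transl_t: assumes "\<gamma> \<in> \<Phi>" "s \<in> L \<gamma>" "s \<in> transl \<gamma>" shows "t \<gamma> s \<in> Y"
proof -
  from assms obtain v where v: "v \<in> Y" "\<And>x y. act v (x, y) = (x, y + pairing x \<gamma> *\<^sub>R s)" by (auto simp: transl_def)
  have c: "v \<in> carrier G" using subgroup.mem_carrier[OF subgroup_Y v(1)] .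
  have "t \<gamma> s \<otimes>\<^bsub>G\<^esub> inv\<^bsub>G\<^esub> v \<in> K" using assms c by (intro same_act_K) (auto simp: act_t v)
  then have "t \<gamma> s \<otimes>\<^bsub>G\<^esub> inv\<^bsub>G\<^esub> v \<in> Y" by (intro generate.incl) blast
  from subgroup.m_closed[OF subgroup_Y this v(1)] show ?thesis using c assms by (simp add: G.m_assoc)
qed

lemma Y_partner:
  assumes "\<gamma> \<in> \<Phi>" "\<delta> \<in> \<Phi>" "s \<in> L \<delta>" "t \<delta> s \<in> Y" "t (rfl \<gamma> \<delta>) s \<in> Y"
  shows "t \<gamma> (pairing \<gamma> \<delta> *\<^sub>R s) \<in> Y"
  unfolding t_partner[OF assms(1-3)]
  using assms subgroup.m_closed[OF subgroup_Y] subgroup.m_inv_closed[OF subgroup_Y] by blast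

lemma int_span_basis: "int_span (\<sigma> ` {1..m}) = int_span S1" "int_span (\<sigma> ` {m+1..n}) = int_span S2"
  using basis1 basis2 by (simp_all add: int_basis_def)

text \<open>For the missing combinations of root length and basis vector, \<open>t_partner\<close> passes to the other
length.\<close>

lemma t_in_Y: assumes "\<gamma> \<in> \<Phi>" "s \<in> L \<gamma>" shows "t \<gamma> s \<in> Y"
proof (rule transl_t[OF assms])
  have XY: "x \<in> Y" if "x \<in> basis_ts" for x using that by (intro generate.incl) blast
  consider (short) "\<gamma> \<in> short_roots \<Phi>" | (long) "\<gamma> \<in> long_roots \<Phi>" using short_or_long assms by blast
  then show "s \<in> transl \<gamma>"
  proof cases
    case short
    have "\<sigma> r \<in> transl \<gamma>" if "r \<in> {1..m}" for r
      using short that assms(1) sigma_short m_le_n by (intro t_transl XY) (auto simp: basis_ts_def)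
    then have 1: "int_span S1 \<subseteq> transl \<gamma>"
      unfolding int_span_basis(1)[symmetric]
      by (intro int_span_minimal) (auto intro: transl_zero transl_add transl_diff)
    obtain \<delta> where d: "\<delta> \<in> long_roots \<Phi>" "pairing \<gamma> \<delta> = 1" using short_long_partner[OF short] by blast
    have dP: "\<delta> \<in> \<Phi>" "rfl \<gamma> \<delta> \<in> long_roots \<Phi>" using d long_root rfl_short_long(2) assms(1) by auto
    have "\<sigma> r \<in> transl \<gamma>" if r: "r \<in> {m+1..n}" for r
    proof -
      have "t \<delta> (\<sigma> r) \<in> basis_ts" "t (rfl \<gamma> \<delta>) (\<sigma> r) \<in> basis_ts"
        unfolding basis_ts_def using d(1) dP(2) r by blast+
      note XY[OF this(1)] XY[OF this(2)]
      from Y_partner[OF assms(1) dP(1) sigma_long[OF d(1) r] this] d(2)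
      show ?thesis using sigma_short[OF short, of r] r assms(1) by (intro t_transl) auto
    qed
    then have 2: "int_span S2 \<subseteq> transl \<gamma>"
      unfolding int_span_basis(2)[symmetric]
      by (intro int_span_minimal) (auto intro: transl_zero transl_add transl_diff)
    obtain x y where "x \<in> S1" "y \<in> int_span S2" "s = x + y" using assms(2) by (auto simp: L_short[OF short])
    then show ?thesis using transl_add[of x \<gamma> y] subsetD[OF 1 int_span_base] subsetD[OF 2] by simp
  next
    case long
    have "\<sigma> r \<in> transl \<gamma>" if "r \<in> {m+1..n}" for r
      using long that assms(1) sigma_long by (intro t_transl XY) (auto simp: basis_ts_def)
    then have 2: "int_span S2 \<subseteq> transl \<gamma>"
      unfolding int_span_basis(2)[symmetric]
      by (intro int_span_minimal) (auto intro: transl_zero transl_add transl_diff)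
    obtain \<delta> where d: "\<delta> \<in> short_roots \<Phi>" "pairing \<gamma> \<delta> = k" using long_short_partner[OF long] by blast
    have dP: "\<delta> \<in> \<Phi>" "rfl \<gamma> \<delta> \<in> short_roots \<Phi>" using d short_root rfl_short_long(1) assms(1) by auto
    have "k *\<^sub>R \<sigma> r \<in> transl \<gamma>" if r: "r \<in> {1..m}" for r
    proof -
      have r': "r \<in> {1..n}" using r m_le_n by auto
      have "t \<delta> (\<sigma> r) \<in> basis_ts" "t (rfl \<gamma> \<delta>) (\<sigma> r) \<in> basis_ts"
        unfolding basis_ts_def using d(1) dP(2) r by blast+
      note XY[OF this(1)] XY[OF this(2)]
      from Y_partner[OF assms(1) dP(1) sigma_short[OF d(1) r'] this] d(2)
      show ?thesis using k_sigma_long[OF long r] assms(1) by (intro t_transl) auto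
    qed
    then have 1: "int_span S1 \<subseteq> {x. k *\<^sub>R x \<in> transl \<gamma>}"
      unfolding int_span_basis(1)[symmetric]
      by (intro int_span_minimal) (auto simp: scaleR_add_right scaleR_diff_right intro: transl_zero transl_add transl_diff)
    obtain x y where "x \<in> int_span S1" "y \<in> S2" "s = k *\<^sub>R x + y" using assms(2) by (auto simp: L_long[OF long])
    then show ?thesis using transl_add[of "k *\<^sub>R x" \<gamma> y] subsetD[OF 2 int_span_base] subsetD[OF 1] by simp
  qed
qed

lemma cm_Z0: "\<lbrakk>\<gamma> \<in> \<Phi>; s \<in> L \<gamma>; \<delta> \<in> \<Phi>; u \<in> L \<delta>\<rbrakk> \<Longrightarrow> cm (t \<gamma> s) (t \<delta> u) \<in> Z0"
  using t_in_Y Y_cm by blast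

text \<open>The translations by which \<open>t \<gamma>\<close> can be extended additively modulo \<open>Z0\<close> without leaving \<open>P\<close>. They
form a subgroup, which by \<open>cm_eq_defect\<close> contains the multiples of \<open>L \<delta>\<close> by \<open>pairing \<gamma> \<delta>\<close> that \<open>t \<gamma>\<close> maps
into \<open>P\<close>.\<close>

definition additive :: "('a \<times> 'b) word set set \<Rightarrow> 'a \<Rightarrow> 'b set" where
  "additive P \<gamma> = {s \<in> L \<gamma>. t \<gamma> s \<in> P \<and> (\<forall>u\<in>L \<gamma>. u + s \<in> L \<gamma> \<and> defect \<gamma> u s \<in> Z0)}"

context
  fixes P \<gamma> assumes P: "subgroup P G" "Z0 \<subseteq> P" and \<gamma>: "\<gamma> \<in> \<Phi>"
begin

lemmas P_closed = subgroup.one_closed[OF P(1)] subgroup.m_closed[OF P(1)] subgroup.m_inv_closed[OF P(1)]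

lemma additive_zero: "0 \<in> additive P \<gamma>"
  using \<gamma> P_closed Z0_closed fibre_zero by (simp add: additive_def defect_def)

lemma additive_step:
  assumes "u \<in> L \<gamma>" "t \<gamma> u \<in> P" "s \<in> additive P \<gamma>" shows "t \<gamma> (u + s) \<in> P"
proof -
  have s: "s \<in> L \<gamma>" "t \<gamma> s \<in> P" "u + s \<in> L \<gamma>" "defect \<gamma> u s \<in> Z0" using assms by (auto simp: additive_def)
  show ?thesis unfolding t_add_defect[OF \<gamma> assms(1) s(1,3)]
    using s assms(2) P(2) by (intro P_closed) auto
qed

lemma additive_add:
  assumes s: "s \<in> additive P \<gamma>" and s': "s' \<in> additive P \<gamma>" shows "s + s' \<in> additive P \<gamma>"
proof -
  have a: "s \<in> L \<gamma>" "t \<gamma> s \<in> P" "\<And>u. u \<in> L \<gamma> \<Longrightarrow> u + s \<in> L \<gamma>" "\<And>u. u \<in> L \<gamma> \<Longrightarrow> defect \<gamma> u s \<in> Z0"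
    using s by (auto simp: additive_def)
  have b: "s' \<in> L \<gamma>" "t \<gamma> s' \<in> P" "\<And>u. u \<in> L \<gamma> \<Longrightarrow> u + s' \<in> L \<gamma>" "\<And>u. u \<in> L \<gamma> \<Longrightarrow> defect \<gamma> u s' \<in> Z0"
    using s' by (auto simp: additive_def)
  have "u + (s + s') \<in> L \<gamma> \<and> defect \<gamma> u (s + s') \<in> Z0" if u: "u \<in> L \<gamma>" for u
  proof
    have us: "u + s + s' \<in> L \<gamma>" using a b u by blast
    then show "u + (s + s') \<in> L \<gamma>" by (simp add: add.assoc)
    let ?A = "t \<gamma> u" and ?B = "t \<gamma> s" and ?C = "t \<gamma> s'"
    have c: "?A \<in> carrier G" "?B \<in> carrier G" "?C \<in> carrier G" using \<gamma> u a b by auto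
    let ?d1 = "defect \<gamma> (u + s) s'" and ?d2 = "defect \<gamma> u s" and ?d3 = "defect \<gamma> s s'"
    have d: "?d1 \<in> Z0" "?d2 \<in> Z0" "?d3 \<in> Z0" using a b u by auto
    have dc: "?d1 \<in> carrier G" "?d2 \<in> carrier G" "?d3 \<in> carrier G" using d subgroup.mem_carrier[OF subgroup_Z0] by auto
    have i3: "inv\<^bsub>G\<^esub> ?d3 \<in> group_center G" using d Z0_closed Z0_center by blast
    have "defect \<gamma> u (s + s') = t \<gamma> (u + s + s') \<otimes>\<^bsub>G\<^esub> inv\<^bsub>G\<^esub> (?A \<otimes>\<^bsub>G\<^esub> t \<gamma> (s + s'))"
      by (simp add: defect_def add.assoc)
    also have "t \<gamma> (u + s + s') = ?d1 \<otimes>\<^bsub>G\<^esub> (?d2 \<otimes>\<^bsub>G\<^esub> (?A \<otimes>\<^bsub>G\<^esub> ?B) \<otimes>\<^bsub>G\<^esub> ?C)"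
      using t_add_defect[OF \<gamma> _ b(1) us] t_add_defect[OF \<gamma> u a(1)] a b u by simp
    also have "t \<gamma> (s + s') = ?d3 \<otimes>\<^bsub>G\<^esub> (?B \<otimes>\<^bsub>G\<^esub> ?C)"
      using t_add_defect[OF \<gamma> a(1) b(1)] a b by simp
    also have "?d1 \<otimes>\<^bsub>G\<^esub> (?d2 \<otimes>\<^bsub>G\<^esub> (?A \<otimes>\<^bsub>G\<^esub> ?B) \<otimes>\<^bsub>G\<^esub> ?C) \<otimes>\<^bsub>G\<^esub> inv\<^bsub>G\<^esub> (?A \<otimes>\<^bsub>G\<^esub> (?d3 \<otimes>\<^bsub>G\<^esub> (?B \<otimes>\<^bsub>G\<^esub> ?C)))
       = ?d1 \<otimes>\<^bsub>G\<^esub> (?d2 \<otimes>\<^bsub>G\<^esub> inv\<^bsub>G\<^esub> ?d3)"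
      using c dc G.centerD[OF i3, of "inv\<^bsub>G\<^esub> ?A"] G.center_lcomm[OF i3]
      by (simp add: G.inv_mult_group G.m_assoc)
    finally show "defect \<gamma> u (s + s') \<in> Z0" using d Z0_closed by simp
  qed
  then show ?thesis using a b additive_step[OF a(1,2) s'] by (simp add: additive_def)
qed

lemma additive_uminus:
  assumes s: "s \<in> additive P \<gamma>" shows "- s \<in> additive P \<gamma>"
proof -
  have a: "s \<in> L \<gamma>" "t \<gamma> s \<in> P" "\<And>u. u \<in> L \<gamma> \<Longrightarrow> u + s \<in> L \<gamma>" "\<And>u. u \<in> L \<gamma> \<Longrightarrow> defect \<gamma> u s \<in> Z0"
    using s by (auto simp: additive_def)
  have "u + - s \<in> L \<gamma> \<and> defect \<gamma> u (- s) \<in> Z0" if u: "u \<in> L \<gamma>" for u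
  proof
    have mu1: "- u \<in> L \<gamma>" using fibre_neg u \<gamma> by blast
    note mu = mu1 a(3)[OF mu1]
    then show "u + - s \<in> L \<gamma>" using fibre_neg[OF \<gamma> mu(2)] by simp
    let ?A = "t \<gamma> u" and ?B = "t \<gamma> s" and ?d = "defect \<gamma> (- u) s" and ?c = "cm (inv\<^bsub>G\<^esub> (t \<gamma> s)) (t \<gamma> u)"
    have c: "?A \<in> carrier G" "?B \<in> carrier G" using \<gamma> u a by auto
    have d: "?d \<in> Z0" "?d \<in> carrier G" using a(4)[OF mu(1)] subgroup.mem_carrier[OF subgroup_Z0] by auto
    have cc: "?c \<in> Z0" using cm_Z0[OF \<gamma> fibre_neg[OF \<gamma> a(1)] \<gamma> u] a \<gamma> by (simp add: t_uminus)
    have "t \<gamma> (- u + s) = ?d \<otimes>\<^bsub>G\<^esub> (inv\<^bsub>G\<^esub> ?A \<otimes>\<^bsub>G\<^esub> ?B)"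
      using t_add_defect[OF \<gamma> mu(1) a(1) mu(2)] \<gamma> u by (simp add: t_uminus)
    then have "t \<gamma> (u + - s) = inv\<^bsub>G\<^esub> (?d \<otimes>\<^bsub>G\<^esub> (inv\<^bsub>G\<^esub> ?A \<otimes>\<^bsub>G\<^esub> ?B))"
      using t_uminus[OF \<gamma> mu(2)] by simp
    also have "\<dots> = (inv\<^bsub>G\<^esub> ?B \<otimes>\<^bsub>G\<^esub> ?A) \<otimes>\<^bsub>G\<^esub> inv\<^bsub>G\<^esub> ?d" using c d by (simp add: G.inv_mult_group)
    also have "inv\<^bsub>G\<^esub> ?B \<otimes>\<^bsub>G\<^esub> ?A = ?c \<otimes>\<^bsub>G\<^esub> (?A \<otimes>\<^bsub>G\<^esub> inv\<^bsub>G\<^esub> ?B)"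
      using \<gamma> u a subgroup.m_inv_closed[OF subgroup_H] by (intro mult_cm) auto
    finally have e: "t \<gamma> (u + - s) = ?c \<otimes>\<^bsub>G\<^esub> (?A \<otimes>\<^bsub>G\<^esub> inv\<^bsub>G\<^esub> ?B) \<otimes>\<^bsub>G\<^esub> inv\<^bsub>G\<^esub> ?d" .
    have "inv\<^bsub>G\<^esub> ?d \<in> K" using d Z0_closed Z0_K by blast
    then have k: "?A \<otimes>\<^bsub>G\<^esub> inv\<^bsub>G\<^esub> ?B \<otimes>\<^bsub>G\<^esub> inv\<^bsub>G\<^esub> ?d \<otimes>\<^bsub>G\<^esub> inv\<^bsub>G\<^esub> (?A \<otimes>\<^bsub>G\<^esub> inv\<^bsub>G\<^esub> ?B) = inv\<^bsub>G\<^esub> ?d"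
      using c by (intro K_conj) auto
    have "defect \<gamma> u (- s) = t \<gamma> (u + - s) \<otimes>\<^bsub>G\<^esub> inv\<^bsub>G\<^esub> (?A \<otimes>\<^bsub>G\<^esub> inv\<^bsub>G\<^esub> ?B)"
      unfolding defect_def[of \<gamma> u "- s"] t_uminus[OF \<gamma> a(1)] ..
    also have "\<dots> = ?c \<otimes>\<^bsub>G\<^esub> (?A \<otimes>\<^bsub>G\<^esub> inv\<^bsub>G\<^esub> ?B \<otimes>\<^bsub>G\<^esub> inv\<^bsub>G\<^esub> ?d \<otimes>\<^bsub>G\<^esub> inv\<^bsub>G\<^esub> (?A \<otimes>\<^bsub>G\<^esub> inv\<^bsub>G\<^esub> ?B))"
      unfolding e using c d subgroup.mem_carrier[OF subgroup_Z0 cc] by (simp add: G.m_assoc)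
    finally have "defect \<gamma> u (- s) = ?c \<otimes>\<^bsub>G\<^esub> inv\<^bsub>G\<^esub> ?d" unfolding k .
    then show "defect \<gamma> u (- s) \<in> Z0" using cc d Z0_closed by simp
  qed
  then show ?thesis using a \<gamma> P_closed by (simp add: additive_def t_uminus fibre_neg)
qed

lemma additive_diff: "s \<in> additive P \<gamma> \<Longrightarrow> s' \<in> additive P \<gamma> \<Longrightarrow> s - s' \<in> additive P \<gamma>"
  using additive_add[of s "- s'"] additive_uminus by simp

lemma additive_partner:
  assumes "\<delta> \<in> \<Phi>" "s \<in> L \<delta>" "t \<gamma> (pairing \<gamma> \<delta> *\<^sub>R s) \<in> P"
  shows "pairing \<gamma> \<delta> *\<^sub>R s \<in> additive P \<gamma>"
  using assms \<gamma> fibre_scale fibre_add cm_eq_defect[OF assms(1) \<gamma> assms(2)] cm_Z0[OF assms(1,2) \<gamma>]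
  by (simp add: additive_def)

lemma additive_double:
  assumes "s \<in> L \<gamma>" "t \<gamma> s \<in> P" shows "2 *\<^sub>R s \<in> additive P \<gamma>"
  using additive_partner[OF \<gamma> assms(1)] assms \<gamma> P_closed by (simp add: pairing_self root_nz t_double)

lemma t_tau_in:
  assumes "finite J" "set (sl J) \<subseteq> L \<gamma>" "tau \<sigma> J \<in> L \<gamma>" "\<And>r. r \<in> J \<Longrightarrow> t \<gamma> (\<sigma> r) \<in> P" "zlist \<gamma> (sl J) \<in> P"
  shows "t \<gamma> (tau \<sigma> J) \<in> P"
proof -
  have "tlist \<gamma> xs \<in> P" if "set xs \<subseteq> \<sigma> ` J" for xs
    using that by (induction xs) (auto simp: tlist_simps assms intro!: P_closed)
  then have p: "tlist \<gamma> (sl J) \<in> P" using set_sl[OF assms(1)] by simp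
  have c: "tlist \<gamma> (sl J) \<in> carrier G" "zlist \<gamma> (sl J) \<in> carrier G"
    using assms \<gamma> subgroup.mem_carrier[OF P(1)] by auto
  have "t \<gamma> (tau \<sigma> J) = tlist \<gamma> (sl J) \<otimes>\<^bsub>G\<^esub> inv\<^bsub>G\<^esub> (zlist \<gamma> (sl J))"
    using c assms \<gamma> by (simp add: zlist_def sum_sl t_uminus G.inv_mult_group)
  then show ?thesis using p assms P_closed by simp
qed

end

text \<open>The cosets modulo doubles are represented by the sums over subsets of the basis: take the indices with odd
coefficient.\<close>

lemma coset_rep:
  assumes "finite I" "x = (\<Sum>r\<in>I. of_int (c r) *\<^sub>R \<sigma> r)"
  shows "\<exists>J\<subseteq>I. \<exists>d\<in>int_span (\<sigma> ` I). x = tau \<sigma> J + 2 *\<^sub>R d"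
proof (intro exI[of _ "{r \<in> I. odd (c r)}"] conjI bexI)
  show "(\<Sum>r\<in>I. of_int (c r div 2) *\<^sub>R \<sigma> r) \<in> int_span (\<sigma> ` I)"
    using assms(1)
  proof -
    have "(\<Sum>r\<in>F. of_int (c r div 2) *\<^sub>R \<sigma> r) \<in> int_span (\<sigma> ` I)" if "finite F" "F \<subseteq> I" for F
      using that by (induction F) (auto simp: int_span_zero intro!: int_span_add int_span_scale intro: int_span_base)
    then show ?thesis using assms(1) by blast
  qed
  have "tau \<sigma> {r \<in> I. odd (c r)} = (\<Sum>r\<in>I. of_int (c r mod 2) *\<^sub>R \<sigma> r)"
    unfolding tau_def using assms(1) by (intro sum.mono_neutral_cong_left) (auto simp: odd_iff_mod_2_eq_one)
  moreover have "2 *\<^sub>R (\<Sum>r\<in>I. of_int (c r div 2) *\<^sub>R \<sigma> r) = (\<Sum>r\<in>I. of_int (2 * (c r div 2)) *\<^sub>R \<sigma> r)"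
    by (simp add: scaleR_sum_right)
  ultimately have "tau \<sigma> {r \<in> I. odd (c r)} + 2 *\<^sub>R (\<Sum>r\<in>I. of_int (c r div 2) *\<^sub>R \<sigma> r)
      = (\<Sum>r\<in>I. of_int (c r mod 2 + 2 * (c r div 2)) *\<^sub>R \<sigma> r)"
    by (simp only: of_int_add scaleR_add_left sum.distrib)
  then show "x = tau \<sigma> {r \<in> I. odd (c r)} + 2 *\<^sub>R (\<Sum>r\<in>I. of_int (c r div 2) *\<^sub>R \<sigma> r)"
    by (simp add: assms(2))
qed auto

lemma card_le_2_cases:
  assumes "finite J" "card J < 3"
  obtains "J = {}" | r where "J = {r}" | r s where "J = {r, s}" "(r::nat) < s"
proof -
  have "card J = 0 \<or> card J = 1 \<or> card J = 2" using assms(2) by linarith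
  moreover have "J = {}" if "card J = 0" using that assms(1) by simp
  ultimately consider "J = {}" | "card J = 1" | "card J = 2" by blast
  then show thesis
  proof cases
    case 2
    then obtain r where "J = {r}" using card_1_singletonE by blast
    then show ?thesis by (rule that(2))
  next
    case 3
    then obtain r s where "J = {r, s}" "r \<noteq> s" by (auto simp: card_2_iff)
    then show ?thesis using that(3)[of r s] that(3)[of s r] by (cases "r < s") (auto simp: insert_commute)
  qed (use that in blast)
qed

lemma zlist_short_list: "\<gamma> \<in> \<Phi> \<Longrightarrow> zlist \<gamma> [] = \<one>\<^bsub>G\<^esub>" "\<gamma> \<in> \<Phi> \<Longrightarrow> x \<in> L \<gamma> \<Longrightarrow> zlist \<gamma> [x] = \<one>\<^bsub>G\<^esub>"
  by (simp_all add: zlist_def tlist_simps t_uminus)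

lemma sl_small: "sl {} = []" "sl {r} = [\<sigma> r]" by (simp_all add: sl_def)

text \<open>The set \<open>J\<close> indexes a generator of \<open>Z0\<close> if it has at least two elements.\<close>

lemma zlist_Z0_short:
  assumes X: "X = TypeB i" and J: "J \<in> SP1" and g: "\<gamma> \<in> short_roots \<Phi>" shows "zlist \<gamma> (sl J) \<in> Z0"
proof -
  obtain ks where ks: "set ks \<subseteq> {1..l}" "\<gamma> = rfls ks \<alpha>0" using short_transitive[OF chosen_short(1) g] by blast
  have e: "zlist \<gamma> (sl J) = zlist \<alpha>0 (sl J)"
    unfolding ks(2) using ks(1) chosen_root supp1_fibre[OF J chosen_short(1)] by (intro zlist_rfls) auto
  show ?thesis
  proof (cases "card J < 3")
    case False
    then have "J \<in> JJ" using J X by (auto simp: index_sets_def Esupp_def)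
    then show ?thesis unfolding e using zz_JJ_Z0 zz_supp1[OF J] by metis
  next
    case True
    have JI: "J \<subseteq> {1..m}" using J by (auto simp: supp_def)
    from supp_finite[OF J] True show ?thesis
    proof (cases rule: card_le_2_cases)
      case 1 then show ?thesis unfolding e using chosen_root Z0_closed by (simp add: sl_small zlist_short_list)
    next
      case (2 r)
      then show ?thesis unfolding e using chosen_root Z0_closed supp1_fibre(1)[OF J chosen_short(1)] by (simp add: sl_small zlist_short_list)
    next
      case (3 r s)
      then have "(r, s) \<in> index_pairs n" using JI m_le_n by (auto simp: index_pairs_def)
      then show ?thesis unfolding e using zz_pair_Z0 zz_supp1[OF J] 3 by metis
    qed
  qed
qed

lemma zlist_Z0_long:
  assumes X: "X = TypeB 2 \<or> X = TypeC i" and J: "J \<in> SP2" and g: "\<gamma> \<in> long_roots \<Phi>" shows "zlist \<gamma> (sl J) \<in> Z0"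
proof -
  obtain ks where ks: "set ks \<subseteq> {1..l}" "\<gamma> = rfls ks \<beta>0" using long_transitive[OF chosen_long(1) g] by blast
  have e: "zlist \<gamma> (sl J) = zlist \<beta>0 (sl J)"
    unfolding ks(2) using ks(1) chosen_root supp2_fibre[OF J chosen_long(1)] by (intro zlist_rfls) auto
  show ?thesis
  proof (cases "card J < 3")
    case False
    then have "J \<in> JJ" "J \<noteq> {}" using J X by (auto simp: index_sets_def Esupp_def)
    then show ?thesis unfolding e using zz_JJ_Z0 zz_supp2[OF J] by metis
  next
    case True
    have JI: "J \<subseteq> {m+1..n}" using J by (auto simp: supp_def)
    from supp_finite[OF J] True show ?thesis
    proof (cases rule: card_le_2_cases)
      case 1 then show ?thesis unfolding e using chosen_root Z0_closed by (simp add: sl_small zlist_short_list)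
    next
      case (2 r)
      then show ?thesis unfolding e using chosen_root Z0_closed supp2_fibre(1)[OF J chosen_long(1)] by (simp add: sl_small zlist_short_list)
    next
      case (3 r s)
      then have "(r, s) \<in> index_pairs n" "J \<noteq> {}" using JI by (auto simp: index_pairs_def)
      then show ?thesis unfolding e using zz_pair_Z0 zz_supp2[OF J] 3 by metis
    qed
  qed
qed

text \<open>If there are two short roots at an angle of 60 degrees, then \<open>t \<gamma>\<close> is additive modulo \<open>Z0\<close>. In type
\<open>B\<close> it is so for doubles of \<open>S1\<close> and for the span of \<open>S2\<close>, and the remaining cosets are represented
by the \<open>\<tau>\<^sub>J\<close>, where the failure of additivity is \<open>z\<^sub>J\<close>.\<close>

lemma short_t_in:
  assumes P: "subgroup P G" "Z0 \<subseteq> P" and g: "\<gamma> \<in> short_roots \<Phi>"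
    and gens: "\<And>r. r \<in> {1..n} \<Longrightarrow> t \<gamma> (\<sigma> r) \<in> P" and s: "s \<in> L \<gamma>"
  shows "t \<gamma> s \<in> P"
proof -
  have gP: "\<gamma> \<in> \<Phi>" using g short_root by blast
  note add = additive_zero[OF P gP] additive_add[OF P gP] additive_diff[OF P gP]
  obtain \<delta> where d: "\<delta> \<in> long_roots \<Phi>" "pairing \<gamma> \<delta> = 1" using short_long_partner[OF g] by blast
  have "\<sigma> r \<in> additive P \<gamma>" if "r \<in> {m+1..n}" for r
    using additive_partner[OF P gP long_root[OF d(1)] sigma_long[OF d(1) that]] d(2) gens[of r] that by simp
  then have 2: "int_span S2 \<subseteq> additive P \<gamma>"
    unfolding int_span_basis(2)[symmetric] by (intro int_span_minimal) (auto intro: add)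
  obtain x y where xy: "x \<in> S1" "y \<in> int_span S2" "s = x + y" using s by (auto simp: L_short[OF g])
  show ?thesis
  proof (cases "\<exists>i. X = TypeB i")
    \<comment> \<open>Type \<open>B\<close>: \<open>x\<close> is \<open>\<tau>\<^sub>J\<close> plus a double for some \<open>J\<close>, and \<open>J\<close> belongs to the support because \<open>S1\<close> is
    closed under subtracting doubles.\<close>
    case True
    have "2 *\<^sub>R \<sigma> r \<in> additive P \<gamma>" if "r \<in> {1..m}" for r
      using that m_le_n gens sigma_short[OF g] by (intro additive_double[OF P gP]) auto
    then have 1: "int_span S1 \<subseteq> {x. 2 *\<^sub>R x \<in> additive P \<gamma>}"
      unfolding int_span_basis(1)[symmetric]
      by (intro int_span_minimal) (auto simp: scaleR_add_right scaleR_diff_right intro: add)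
    obtain c :: "nat \<Rightarrow> int" where "x = (\<Sum>r=1..m. of_int (c r) *\<^sub>R \<sigma> r)" using expand_S1 int_span_base xy by blast
    from coset_rep[OF _ this] obtain J d where J: "J \<subseteq> {1..m}" "d \<in> int_span S1" "x = tau \<sigma> J + 2 *\<^sub>R d"
      unfolding int_span_basis(1) by auto
    have "tau \<sigma> J = x - 2 *\<^sub>R d" using J by simp
    then have "tau \<sigma> J \<in> S1" using semilattice_diff_double[OF semi(1) xy(1) J(2)] by simp
    then have SP: "J \<in> SP1" using J by (simp add: supp_def)
    have tj: "tau \<sigma> J \<in> L \<gamma>" using S_in_L_short(1)[OF g] \<open>tau \<sigma> J \<in> S1\<close> by blast
    have "t \<gamma> (tau \<sigma> J) \<in> P"
      using supp1_fibre[OF SP g] tj gens J m_le_n zlist_Z0_short[OF _ SP g] True P(2) supp_finite[OF SP]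
      by (intro t_tau_in[OF P gP]) auto
    moreover have "2 *\<^sub>R d + y \<in> additive P \<gamma>" using 1 2 J xy add by blast
    ultimately have "t \<gamma> (tau \<sigma> J + (2 *\<^sub>R d + y)) \<in> P" using additive_step[OF P gP tj] by blast
    then show ?thesis using xy J by (simp add: add.assoc)
  next
    case False
    then obtain \<delta> where d: "\<delta> \<in> short_roots \<Phi>" "pairing \<gamma> \<delta> = 1" using short_short_partner[OF _ g] by blast
    have "\<sigma> r \<in> additive P \<gamma>" if "r \<in> {1..m}" for r
    proof -
      have r: "r \<in> {1..n}" using that m_le_n by auto
      show ?thesis using additive_partner[OF P gP short_root[OF d(1)] sigma_short[OF d(1) r]] d(2) gens[OF r] by simp
    qed
    then have 1: "int_span S1 \<subseteq> additive P \<gamma>"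
      unfolding int_span_basis(1)[symmetric] by (intro int_span_minimal) (auto intro: add)
    have "s \<in> additive P \<gamma>" unfolding xy(3) using 1 2 xy int_span_base add by blast
    then show ?thesis by (simp add: additive_def)
  qed
qed

text \<open>The argument of \<open>short_t_in\<close> with the roles of \<open>S1\<close> and \<open>S2\<close> exchanged; only multiples of \<open>k\<close> of the
basis vectors in \<open>S1\<close> occur for a long root.\<close>

lemma long_t_in:
  assumes P: "subgroup P G" "Z0 \<subseteq> P" and g: "\<gamma> \<in> long_roots \<Phi>"
    and gens: "\<And>r. r \<in> {1..m} \<Longrightarrow> t \<gamma> (k *\<^sub>R \<sigma> r) \<in> P" "\<And>r. r \<in> {m+1..n} \<Longrightarrow> t \<gamma> (\<sigma> r) \<in> P" and s: "s \<in> L \<gamma>"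
  shows "t \<gamma> s \<in> P"
proof -
  have gP: "\<gamma> \<in> \<Phi>" using g long_root by blast
  note add = additive_zero[OF P gP] additive_add[OF P gP] additive_diff[OF P gP]
  obtain \<delta> where d: "\<delta> \<in> short_roots \<Phi>" "pairing \<gamma> \<delta> = k" using long_short_partner[OF g] by blast
  have "k *\<^sub>R \<sigma> r \<in> additive P \<gamma>" if r: "r \<in> {1..m}" for r
  proof -
    have r': "r \<in> {1..n}" using r m_le_n by auto
    show ?thesis using additive_partner[OF P gP short_root[OF d(1)] sigma_short[OF d(1) r']] d(2) gens(1)[OF r] by simp
  qed
  then have 1: "int_span S1 \<subseteq> {x. k *\<^sub>R x \<in> additive P \<gamma>}"
    unfolding int_span_basis(1)[symmetric]
    by (intro int_span_minimal) (auto simp: scaleR_add_right scaleR_diff_right intro: add)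
  obtain x y where xy: "x \<in> int_span S1" "y \<in> S2" "s = k *\<^sub>R x + y" using s by (auto simp: L_long[OF g])
  show ?thesis
  proof (cases "X = TypeB 2 \<or> (\<exists>i. X = TypeC i)")
    case True
    have "2 *\<^sub>R \<sigma> r \<in> additive P \<gamma>" if "r \<in> {m+1..n}" for r
      using that gens sigma_long[OF g] by (intro additive_double[OF P gP]) auto
    then have 2: "int_span S2 \<subseteq> {x. 2 *\<^sub>R x \<in> additive P \<gamma>}"
      unfolding int_span_basis(2)[symmetric]
      by (intro int_span_minimal) (auto simp: scaleR_add_right scaleR_diff_right intro: add)
    obtain c :: "nat \<Rightarrow> int" where "y = (\<Sum>r=m+1..n. of_int (c r) *\<^sub>R \<sigma> r)" using expand_S2 int_span_base xy by blast
    from coset_rep[OF _ this] obtain J d where J: "J \<subseteq> {m+1..n}" "d \<in> int_span S2" "y = tau \<sigma> J + 2 *\<^sub>R d"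
      unfolding int_span_basis(2) by auto
    have "tau \<sigma> J = y - 2 *\<^sub>R d" using J by simp
    then have "tau \<sigma> J \<in> S2" using semilattice_diff_double[OF semi(2) xy(2) J(2)] by simp
    then have SP: "J \<in> SP2" using J by (simp add: supp_def)
    have tj: "tau \<sigma> J \<in> L \<gamma>" using S_in_L_long(2)[OF g] \<open>tau \<sigma> J \<in> S2\<close> by blast
    have "zlist \<gamma> (sl J) \<in> Z0" using zlist_Z0_long[OF _ SP g] True by blast
    then have "t \<gamma> (tau \<sigma> J) \<in> P"
      using supp2_fibre[OF SP g] tj gens J P(2) supp_finite[OF SP]
      by (intro t_tau_in[OF P gP]) auto
    moreover have "k *\<^sub>R x + 2 *\<^sub>R d \<in> additive P \<gamma>" using 1 2 J xy add by blast
    ultimately have "t \<gamma> (tau \<sigma> J + (k *\<^sub>R x + 2 *\<^sub>R d)) \<in> P" using additive_step[OF P gP tj] by blast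
    then show ?thesis using xy J by (simp add: algebra_simps)
  next
    case False
    then obtain \<delta> where d: "\<delta> \<in> long_roots \<Phi>" "pairing \<gamma> \<delta> = 1" using long_long_partner[OF _ _ g] by blast
    have "\<sigma> r \<in> additive P \<gamma>" if r: "r \<in> {m+1..n}" for r
      using additive_partner[OF P gP long_root[OF d(1)] sigma_long[OF d(1) r]] d(2) gens(2)[OF r] by simp
    then have 2: "int_span S2 \<subseteq> additive P \<gamma>"
      unfolding int_span_basis(2)[symmetric] by (intro int_span_minimal) (auto intro: add)
    have "s \<in> additive P \<gamma>" unfolding xy(3) using 1 2 xy int_span_base add by blast
    then show ?thesis by (simp add: additive_def)
  qed
qed

text \<open>The shortest multiple of \<open>\<sigma> r\<close> by which the simple root \<open>a i\<close> can be translated.\<close>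

definition simple_dir :: "nat \<Rightarrow> nat \<Rightarrow> 'b" where
  "simple_dir i r = (if a i \<in> short_roots \<Phi> \<or> m < r then \<sigma> r else k *\<^sub>R \<sigma> r)"

lemma simple_dir_fibre: "i \<in> {1..l} \<Longrightarrow> r \<in> {1..n} \<Longrightarrow> simple_dir i r \<in> L (a i)"
  using short_or_long[OF simple_root[of i]] sigma_short sigma_long k_sigma_long
  by (auto simp: simple_dir_def)

definition gens where "gens = (\<lambda>(i, r). t (a i) (simple_dir i r)) ` ({1..l} \<times> {1..n})"

lemma gens_H: "gens \<subseteq> H" using simple_dir_fibre simple_root by (auto simp: gens_def)

text \<open>From simple roots to all roots with \<open>t_rfl\<close>.\<close>

lemma Ht_generated: "Ht \<subseteq> generate G (gens \<union> Z0)"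
proof -
  let ?P = "generate G (gens \<union> Z0)"
  have P: "subgroup ?P G" using gens_H H_carrier subgroup.subset[OF subgroup_Z0] by (intro G.generate_is_subgroup) blast
  have ZP: "Z0 \<subseteq> ?P" using generate.incl[of _ "gens \<union> Z0" G] by blast
  have simple: "t (a i) s \<in> ?P" if i: "i \<in> {1..l}" and s: "s \<in> L (a i)" for i s
  proof -
    have gen: "t (a i) (simple_dir i r) \<in> ?P" if "r \<in> {1..n}" for r
      using i that by (intro generate.incl) (auto simp: gens_def)
    show ?thesis
    proof (cases "a i \<in> short_roots \<Phi>")
      case True
      have "t (a i) (\<sigma> r) \<in> ?P" if "r \<in> {1..n}" for r
        using gen[OF that] True by (simp only: simple_dir_def simp_thms if_True)
      from short_t_in[OF P ZP True this s] show ?thesis .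
    next
      case False
      then have L': "a i \<in> long_roots \<Phi>" using short_or_long simple_root i by blast
      have A: "t (a i) (k *\<^sub>R \<sigma> r) \<in> ?P" if "r \<in> {1..m}" for r
        using gen[of r] that m_le_n False by (simp add: simple_dir_def)
      have B: "t (a i) (\<sigma> r) \<in> ?P" if "r \<in> {m+1..n}" for r
        using gen[of r] that by (simp add: simple_dir_def)
      from long_t_in[OF P ZP L' A B s] show ?thesis .
    qed
  qed
  have all: "t (rfls ks (a i)) s \<in> ?P" if "set ks \<subseteq> {1..l}" "i \<in> {1..l}" "s \<in> L (a i)" for ks i s
    using that
  proof (induction ks)
    case (Cons j ks)
    let ?g = "rfls ks (a i)"
    have g: "?g \<in> \<Phi>" "s \<in> L ?g" using Cons fibre_rfls simple_root rfls_root by auto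
    have j: "j \<in> {1..l}" "a j \<in> \<Phi>" using Cons simple_root by auto
    have "t (a j) (pairing (a j) ?g *\<^sub>R s) \<in> ?P" using simple[OF j(1)] fibre_scale[OF g(1) j(2) g(2)] by blast
    then show ?case using t_rfl[OF j(2) g] Cons
        subgroup.m_closed[OF P] subgroup.m_inv_closed[OF P] by simp
  qed (use simple in simp)
  have "t \<gamma> s \<in> ?P" if "\<gamma> \<in> \<Phi>" "s \<in> L \<gamma>" for \<gamma> s
  proof -
    obtain ks i where "set ks \<subseteq> {1..l}" "i \<in> {1..l}" "\<gamma> = rfls ks (a i)" using root_from_simple[OF \<open>\<gamma> \<in> \<Phi>\<close>] by blast
    then show ?thesis using all that fibre_rfls simple_root by auto
  qed
  then show ?thesis unfolding Ht_def by (intro G.generate_subgroup_incl[OF _ P]) blast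
qed

lemma dual_simple:
  assumes i: "i \<in> {1..l}"
  shows "\<exists>x. \<forall>j\<in>{1..l}. pairing x (a j) = (if j = i then 1 else 0)"
proof -
  obtain f :: "'a \<Rightarrow> real" where f: "linear f" "\<forall>v\<in>a ` {1..l}. f v = (if v = a i then (v \<bullet> v) / 2 else 0)"
    using linear_independent_extend[OF simple_independent, of "\<lambda>v. if v = a i then (v \<bullet> v) / 2 else 0"] by blast
  have fx: "f v = v \<bullet> adjoint f 1" for v using adjoint_works[OF f(1), of v 1] by (simp add: inner_commute)
  show ?thesis
  proof (intro exI[of _ "adjoint f 1"] ballI)
    fix j assume j: "j \<in> {1..l}"
    have nz: "a j \<noteq> 0" using simple_root j root_nonzero by blast
    have e: "a j = a i \<longleftrightarrow> j = i" using simple_inj i j by (auto dest: inj_onD)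
    have "pairing (adjoint f 1) (a j) = 2 * f (a j) / (a j \<bullet> a j)" by (simp add: pairing_def fx inner_commute)
    also have "f (a j) = (if a j = a i then (a j \<bullet> a j) / 2 else 0)" using f(2) j by blast
    finally show "pairing (adjoint f 1) (a j) = (if j = i then 1 else 0)"
      using nz by (cases "j = i") (auto simp: e)
  qed
qed

text \<open>The coordinate functions for \<open>in_center_by_coordinates\<close> evaluate the translation at a vector dual to
a simple root and take a coordinate with respect to \<open>\<sigma>\<close>; elements of \<open>K\<close> do not translate.\<close>

theorem K_eq_Z0: "K = Z0"
proof
  show "Z0 \<subseteq> K" by (rule Z0_K)
  show "K \<subseteq> Z0"
  proof
    fix u assume u: "u \<in> K"
    obtain d where d: "\<And>i j. i \<in> {1..l} \<Longrightarrow> j \<in> {1..l} \<Longrightarrow> pairing (d i) (a j) = (if j = i then 1 else 0)"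
      using dual_simple by metis
    let ?I = "{1..l} \<times> {1..n}" and ?b = "\<lambda>(i, r). t (a i) (simple_dir i r)"
      and ?f = "\<lambda>(i, r) u. coord r (snd (act u (d i, 0)))"
    have fK: "?f j v = 0" if "v \<in> K" for j v using that by (auto simp: K_def coord_zero split: prod.split)
    have fb: "?f (i, r) (?b (j, s)) = (if i = j \<and> r = s then coord r (simple_dir j s) else 0)"
      if "i \<in> {1..l}" "j \<in> {1..l}" "r \<in> {1..n}" "s \<in> {1..n}" for i j r s
      using that d[of i j] simple_dir_fibre simple_root by (auto simp: act_t coord_zero coord_linear coord_sigma simple_dir_def)
    show "u \<in> Z0"
    proof (rule G.in_center_by_coordinates[OF subgroup_Z0 Z0_center subgroup_H, of ?f ?I ?b])
      show "Z0 \<subseteq> H" using Z0_K basis_ts_K_H by blast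
      show "?f j (x \<otimes>\<^bsub>G\<^esub> y) = ?f j x + ?f j y" if "x \<in> H" "y \<in> H" for j x y
      proof -
        from that obtain g h where "\<And>v w. act x (v, w) = (v, w + g v)" "\<And>v w. act y (v, w) = (v, w + h v)"
          "x \<in> carrier G" "y \<in> carrier G" by (auto simp: H_def)
        then show ?thesis by (cases j) (simp add: coord_linear)
      qed
      show "?f j z = 0" if "z \<in> Z0" for j z using fK that Z0_K by blast
      show "?b ` ?I \<subseteq> H" using gens_H by (simp add: gens_def)
      show "cm (?b i) (?b j) \<in> Z0" if "i \<in> ?I" "j \<in> ?I" for i j
        using that simple_dir_fibre simple_root cm_Z0 by auto
      show "?f i (?b i) \<noteq> 0" if "i \<in> ?I" for i
        using that fb k_cases by (cases i) (auto simp: simple_dir_def coord_linear coord_sigma)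
      show "?f i (?b j) = 0" if "i \<in> ?I" "j \<in> ?I" "i \<noteq> j" for i j
        using that fb by (cases i; cases j) auto
      show "u \<in> generate G (?b ` ?I \<union> Z0)" using K_subset_Ht[OF u] Ht_generated by (auto simp: gens_def)
      show "?f i u = 0" if "i \<in> ?I" for i using fK u by blast
    qed auto
  qed
qed

end

section \<open>Products of central elements\<close>

abbreviation (in group) Cen where "Cen \<equiv> G\<lparr>carrier := group_center G\<rparr>"

lemma (in group) comm_monoid_center: "comm_monoid Cen"
proof -
  have "group Cen" by (rule subgroup.subgroup_is_group[OF subgroup_center is_group])
  then have "comm_group Cen"
    by (rule group.group_comm_groupI) (simp, metis centerD center_carrier)
  then show ?thesis by (rule comm_group.axioms)
qed

lemma (in group) center_int_pow: "z \<in> group_center G \<Longrightarrow> z [^] (i::int) \<in> group_center G"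
  by (rule subgroup_int_pow_closed[OF subgroup_center])

text \<open>Inside the center the order of the factors is irrelevant, so these products can be taken over sets.\<close>

definition (in group) cprod :: "('c \<Rightarrow> 'a) \<Rightarrow> ('c \<Rightarrow> int) \<Rightarrow> 'c set \<Rightarrow> 'a" where
  "cprod z g A = finprod Cen (\<lambda>p. z p [^] g p) A"

context group begin

lemma cprod_closed: "z ` A \<subseteq> group_center G \<Longrightarrow> cprod z g A \<in> group_center G"
proof -
  note C = comm_monoid_center
  assume "z ` A \<subseteq> group_center G"
  then show ?thesis unfolding cprod_def
    using comm_monoid.finprod_closed[OF C, of "\<lambda>p. z p [^] g p" A] center_int_pow by (auto simp: Pi_def)
qed

lemma cprod_empty: "cprod z g {} = \<one>"
proof -
  note C = comm_monoid_center
  show ?thesis using comm_monoid.finprod_empty[OF C] by (simp add: cprod_def)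
qed

lemma cprod_insert:
  assumes "finite A" "a \<notin> A" "z ` insert a A \<subseteq> group_center G"
  shows "cprod z g (insert a A) = z a [^] g a \<otimes> cprod z g A"
proof -
  note C = comm_monoid_center
  show ?thesis unfolding cprod_def
    using comm_monoid.finprod_insert[OF C, of A a "\<lambda>p. z p [^] g p"] assms center_int_pow by (auto simp: Pi_def)
qed

lemma cprod_cong:
  assumes "z ` A \<subseteq> group_center G" "\<And>p. p \<in> A \<Longrightarrow> z' p [^] g' p = z p [^] (g p :: int)"
  shows "cprod z' g' A = cprod z g A"
proof -
  note C = comm_monoid_center
  show ?thesis unfolding cprod_def
    using assms center_int_pow by (intro comm_monoid.finprod_cong'[OF C]) (auto simp: Pi_def)
qed

lemma cprod_add:
  assumes "finite A" "z ` A \<subseteq> group_center G"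
  shows "cprod z (\<lambda>p. g p + h p) A = cprod z g A \<otimes> cprod z h A"
  using assms
proof (induction A)
  case (insert a A)
  let ?a = "z a [^] g a" and ?b = "z a [^] h a" and ?A = "cprod z g A" and ?B = "cprod z h A"
  have Z: "?a \<in> group_center G" "?b \<in> group_center G" "?A \<in> group_center G" "?B \<in> group_center G"
    using insert center_int_pow cprod_closed[of z A] by auto
  have c: "?a \<in> carrier G" "?b \<in> carrier G" "?A \<in> carrier G" "?B \<in> carrier G" "z a \<in> carrier G"
    using Z insert center_carrier by auto
  have "cprod z (\<lambda>p. g p + h p) (insert a A) = (?a \<otimes> ?b) \<otimes> (?A \<otimes> ?B)"
    using insert c by (simp add: cprod_insert int_pow_mult)
  also have "\<dots> = (?a \<otimes> ?A) \<otimes> (?b \<otimes> ?B)"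
    using c by (simp add: m_assoc center_lcomm[OF Z(2) c(3)])
  also have "\<dots> = cprod z g (insert a A) \<otimes> cprod z h (insert a A)"
    using insert by (simp add: cprod_insert)
  finally show ?case .
qed (simp add: cprod_empty)

lemma cprod_zero: "finite A \<Longrightarrow> z ` A \<subseteq> group_center G \<Longrightarrow> cprod z (\<lambda>p. 0) A = \<one>"
  by (induction A rule: finite_induct) (auto simp: cprod_empty cprod_insert)

lemma cprod_uminus:
  assumes "finite A" "z ` A \<subseteq> group_center G" shows "cprod z (\<lambda>p. - g p) A = inv (cprod z g A)"
proof (rule inv_equality[symmetric])
  show "cprod z (\<lambda>p. - g p) A \<otimes> cprod z g A = \<one>"
    using cprod_add[OF assms, of "\<lambda>p. - g p" g] cprod_zero[OF assms] by simp
qed (use cprod_closed[OF assms(2)] center_carrier in blast)+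

lemma cprod_sum:
  assumes "finite A" "z ` A \<subseteq> group_center G" "finite B" "\<And>b. b \<in> B \<Longrightarrow> y b [^] (h b :: int) = cprod z (g b) A"
    "y ` B \<subseteq> group_center G"
  shows "cprod y h B = cprod z (\<lambda>p. \<Sum>b\<in>B. g b p) A"
  using assms(3-5)
proof (induction B)
  case empty then show ?case using cprod_zero[OF assms(1,2)] by (simp add: cprod_empty)
next
  case (insert b B)
  then show ?case using cprod_add[OF assms(1,2)] by (simp add: cprod_insert)
qed

lemma cprod_delta:
  assumes "finite A" "z ` A \<subseteq> group_center G" "a \<in> A"
  shows "cprod z (\<lambda>p. if p = a then 1 else 0) A = z a"
proof -
  have A: "A = insert a (A - {a})" "finite (A - {a})" "z ` (A - {a}) \<subseteq> group_center G" using assms by auto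
  have "cprod z (\<lambda>p. if p = a then 1 else 0) (A - {a}) = cprod z (\<lambda>p. 0) (A - {a})"
    using A by (intro cprod_cong) auto
  also have "\<dots> = \<one>" using A by (intro cprod_zero)
  finally show ?thesis using A assms center_carrier cprod_insert[of "A - {a}" a z]
    by (subst A(1)) auto
qed

lemma commutator_mult_right:
  assumes "x \<in> carrier G" "y \<in> carrier G" "y' \<in> carrier G"
    "commutator G x y \<in> group_center G" "commutator G x y' \<in> group_center G"
  shows "commutator G x (y \<otimes> y') = commutator G x y \<otimes> commutator G x y'"
proof -
  have c: "commutator G y x \<in> group_center G" "commutator G y' x \<in> group_center G"
    using commute_mod_sym[OF subgroup_center] assms by auto
  have "commutator G x (y \<otimes> y') = inv (commutator G (y \<otimes> y') x)"
    using assms by (intro commutator_inverse) auto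
  also have "\<dots> = inv (commutator G y' x) \<otimes> inv (commutator G y x)"
    using commutator_mult_left[OF assms(2,3,1) c] assms by (simp add: inv_mult_group)
  also have "\<dots> = commutator G x y' \<otimes> commutator G x y"
    using commutator_inverse[OF assms(2,1)] commutator_inverse[OF assms(3,1)] assms by simp
  finally show ?thesis using centerD[OF assms(4)] assms by simp
qed

end

section \<open>Squares of the central elements\<close>

context fibred_roots_basis begin

text \<open>Moving one translation past a product of others.\<close>

lemma cm_tlist:
  assumes "\<gamma> \<in> \<Phi>" "x \<in> L \<gamma>" "\<And>r. r \<in> set rs \<Longrightarrow> \<tau> r \<in> L \<gamma>" "distinct rs"
  shows "cm (t \<gamma> x) (tlist \<gamma> (map \<tau> rs)) = G.cprod (\<lambda>s. cm (t \<gamma> x) (t \<gamma> (\<tau> s))) (\<lambda>_. 1) (set rs)"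
  using assms(3,4)
proof (induction rs)
  case Nil then show ?case using assms by (simp add: tlist_simps commutator_def G.cprod_empty)
next
  case (Cons r rs)
  have H: "t \<gamma> x \<in> H" "\<And>s. s \<in> set (r # rs) \<Longrightarrow> t \<gamma> (\<tau> s) \<in> H" "tlist \<gamma> (map \<tau> rs) \<in> H"
    using Cons assms by (auto intro!: t_H tlist_H)
  note c = H_carrier[OF H(1)] H_carrier[OF H(2)] H_carrier[OF H(3)]
  have "cm (t \<gamma> x) (tlist \<gamma> (map \<tau> (r # rs))) = cm (t \<gamma> x) (t \<gamma> (\<tau> r)) \<otimes>\<^bsub>G\<^esub> cm (t \<gamma> x) (tlist \<gamma> (map \<tau> rs))"
    using H c by (simp add: tlist_simps G.commutator_mult_right)
  also have "\<dots> = G.cprod (\<lambda>s. cm (t \<gamma> x) (t \<gamma> (\<tau> s))) (\<lambda>_. 1) (set (r # rs))"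
    using Cons H c by (subst Cons.IH) (auto simp: G.cprod_insert image_subset_iff)
  finally show ?case .
qed

text \<open>Reversing the order of a product costs one commutator for each pair of factors. In the induction
the first factor is moved past all others.\<close>

lemma tlist_reverse:
  assumes "\<gamma> \<in> \<Phi>" "\<And>r. r \<in> set rs \<Longrightarrow> \<tau> r \<in> L \<gamma>" "sorted rs" "distinct (rs :: nat list)"
  shows "inv\<^bsub>G\<^esub> (tlist \<gamma> (rev (map \<tau> rs))) \<otimes>\<^bsub>G\<^esub> tlist \<gamma> (map \<tau> rs)
    = G.cprod (\<lambda>(r, s). cm (t \<gamma> (\<tau> r)) (t \<gamma> (\<tau> s))) (\<lambda>_. 1) {(r, s). r \<in> set rs \<and> s \<in> set rs \<and> r < s}"
  using assms(2-4)
proof (induction rs)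
  case Nil then show ?case by (simp add: tlist_simps G.cprod_empty)
next
  case (Cons r rs)
  let ?x = "t \<gamma> (\<tau> r)" and ?p = "tlist \<gamma> (map \<tau> rs)" and ?q = "tlist \<gamma> (rev (map \<tau> rs))"
  let ?z = "\<lambda>(r, s). cm (t \<gamma> (\<tau> r)) (t \<gamma> (\<tau> s))" and ?S = "\<lambda>rs. {(r, s). r \<in> set rs \<and> s \<in> set rs \<and> r < s}"
  have f: "set (map \<tau> (r # rs)) \<subseteq> L \<gamma>" "set (map \<tau> rs) \<subseteq> L \<gamma>" "\<tau> r \<in> L \<gamma>" using Cons by auto
  have c: "?x \<in> carrier G" "?p \<in> carrier G" "?q \<in> carrier G" using assms f by auto
  let ?k = "inv\<^bsub>G\<^esub> ?q \<otimes>\<^bsub>G\<^esub> ?p"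
  have k: "?k \<in> K" using c f assms by (intro same_act_K) (auto simp: act_tlist sum_list_rev simp del: rev_map)
  have "inv\<^bsub>G\<^esub> (tlist \<gamma> (rev (map \<tau> (r # rs)))) \<otimes>\<^bsub>G\<^esub> tlist \<gamma> (map \<tau> (r # rs))
      = (inv\<^bsub>G\<^esub> ?x \<otimes>\<^bsub>G\<^esub> ?k \<otimes>\<^bsub>G\<^esub> ?x) \<otimes>\<^bsub>G\<^esub> cm ?x ?p"
    using c f assms by (simp add: tlist_simps tlist_append commutator_def G.inv_mult_group G.m_assoc)
  also have "inv\<^bsub>G\<^esub> ?x \<otimes>\<^bsub>G\<^esub> ?k \<otimes>\<^bsub>G\<^esub> ?x = ?k" using K_conj[OF k, of "inv\<^bsub>G\<^esub> ?x"] c by simp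
  also have "?k = G.cprod ?z (\<lambda>_. 1) (?S rs)" using Cons by simp
  also have "cm ?x ?p = G.cprod (\<lambda>s. cm ?x (t \<gamma> (\<tau> s))) (\<lambda>_. 1) (set rs)"
    using Cons assms by (intro cm_tlist) auto
  also have "\<dots> = G.cprod ?z (\<lambda>_. 1) (Pair r ` set rs)"
  proof -
    note C = G.comm_monoid_center
    have "cm ?x (t \<gamma> (\<tau> s)) \<in> group_center G" if "s \<in> set rs" for s
      using that Cons assms by (intro cm_central t_H) auto
    then show ?thesis unfolding G.cprod_def using G.center_int_pow
      by (subst comm_monoid.finprod_reindex[OF C]) (auto simp: inj_on_def)
  qed
  also have "G.cprod ?z (\<lambda>_. 1) (?S rs) \<otimes>\<^bsub>G\<^esub> \<dots> = G.cprod ?z (\<lambda>_. 1) (?S rs \<union> Pair r ` set rs)"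
  proof -
    note C = G.comm_monoid_center
    have z: "?z p \<in> group_center G" if "p \<in> ?S rs \<union> Pair r ` set rs" for p
      using that Cons assms by (auto intro!: cm_central t_H)
    have "finite (?S rs)" by (rule finite_subset[of _ "set rs \<times> set rs"]) auto
    moreover have "?S rs \<inter> Pair r ` set rs = {}" using Cons by auto
    ultimately show ?thesis unfolding G.cprod_def using z G.center_int_pow
      by (subst comm_monoid.finprod_Un_disjoint[OF C]) (auto simp: Pi_def)
  qed
  also have "?S rs \<union> Pair r ` set rs = ?S (r # rs)"
    using Cons by (force simp: order.strict_iff_order)
  finally show ?case .
qed

end

context ears_chosen begin

lemma finite_pairs: "finite (index_pairs n)"
  by (rule finite_subset[of _ "{1..n} \<times> {1..n}"]) (auto simp: index_pairs_def)

lemma finite_JJ: "finite JJ"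
proof (rule finite_subset)
  show "JJ \<subseteq> Pow {1..n}" using index_sets_supp m_le_n by (fastforce simp: supp_def)
qed simp

abbreviation zp where "zp \<equiv> (\<lambda>(r, s). zz {r, s})"

lemma zp_center: "zp ` index_pairs n \<subseteq> group_center G"
  using zz_K_pair K_central by auto

lemma zz_JJ_K: "J \<in> JJ \<Longrightarrow> zz J \<in> K" using zz_K_supp index_sets_supp by blast

lemma zz_center: "zz ` JJ \<subseteq> group_center G" using zz_JJ_K K_central by auto

text \<open>The exponent \<open>2 / Delta\<close> for which the commutator of the translations by \<open>\<sigma> r\<close> and \<open>\<sigma> s\<close> is a power
of the \<open>z\<close> of the pair: this \<open>z\<close> is either the commutator itself or a square root of it.\<close>

definition pair_exp :: "nat \<Rightarrow> nat \<Rightarrow> int" where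
  "pair_exp r s = (if Delta m n \<sigma> S1 S2 r s = 1 then 2 else 1)"

lemma pair_exp_Delta: "of_int (pair_exp r s) = 2 / Delta m n \<sigma> S1 S2 r s"
  by (simp add: pair_exp_def Delta_def)

lemma cm_eq_zz_short:
  assumes "1 \<le> r" "r < s" "s \<le> m"
  shows "cm (t \<alpha>0 (\<sigma> r)) (t \<alpha>0 (\<sigma> s)) = zz {r, s} [^]\<^bsub>G\<^esub> pair_exp r s"
proof (cases "{r, s} \<in> SP1")
  case True
  have z: "zz {r, s} = zlist \<alpha>0 [\<sigma> r, \<sigma> s]" using zz_supp1[OF True] assms by (simp add: sl_pair)
  moreover have "zlist \<alpha>0 [\<sigma> r, \<sigma> s] \<otimes>\<^bsub>G\<^esub> zlist \<alpha>0 [\<sigma> r, \<sigma> s] = cm (t \<alpha>0 (\<sigma> r)) (t \<alpha>0 (\<sigma> s))"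
    using supp1_fibre[OF True chosen_short(1)] assms chosen_root by (intro zlist_pair_square) (auto simp: sl_pair)
  moreover have "pair_exp r s = 1 + 1" using True assms by (simp add: pair_exp_def Delta_def)
  moreover have "zz {r, s} \<in> carrier G" using zz_K_supp True K_carrier by blast
  ultimately show ?thesis by (simp only: G.int_pow_mult G.int_pow_1)
next
  case False
  have "{r, s} \<notin> SP2" using assms by (auto simp: supp_def)
  then have "pair_exp r s = 1" using False assms by (simp add: pair_exp_def Delta_def)
  moreover have "cm (t \<alpha>0 (\<sigma> r)) (t \<alpha>0 (\<sigma> s)) \<in> carrier G"
    using assms chosen_root chosen_short sigma_short m_le_n by simp
  ultimately show ?thesis using zz_pair1[OF assms(2,3,1) False] by simp
qed

lemma cm_eq_zz_long:
  assumes "m + 1 \<le> r" "r < s" "s \<le> n"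
  shows "cm (t \<beta>0 (\<sigma> r)) (t \<beta>0 (\<sigma> s)) = zz {r, s} [^]\<^bsub>G\<^esub> pair_exp r s"
proof (cases "{r, s} \<in> SP2")
  case True
  have z: "zz {r, s} = zlist \<beta>0 [\<sigma> r, \<sigma> s]" using zz_supp2[OF True] assms by (simp add: sl_pair)
  moreover have "zlist \<beta>0 [\<sigma> r, \<sigma> s] \<otimes>\<^bsub>G\<^esub> zlist \<beta>0 [\<sigma> r, \<sigma> s] = cm (t \<beta>0 (\<sigma> r)) (t \<beta>0 (\<sigma> s))"
    using supp2_fibre[OF True chosen_long(1)] assms chosen_root by (intro zlist_pair_square) (auto simp: sl_pair)
  moreover have "pair_exp r s = 1 + 1" using True assms by (simp add: pair_exp_def Delta_def)
  moreover have "zz {r, s} \<in> carrier G" using zz_K_supp True K_carrier by blast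
  ultimately show ?thesis by (simp only: G.int_pow_mult G.int_pow_1)
next
  case False
  have "{r, s} \<notin> SP1" using assms by (auto simp: supp_def)
  then have "pair_exp r s = 1" using False assms by (simp add: pair_exp_def Delta_def)
  moreover have "cm (t \<beta>0 (\<sigma> r)) (t \<beta>0 (\<sigma> s)) \<in> carrier G"
    using assms chosen_root chosen_long sigma_long by simp
  ultimately show ?thesis using zz_pair2[OF assms(2,3,1) False] by simp
qed

lemma zlist_square_pairs:
  assumes g: "\<gamma> \<in> \<Phi>" and J: "finite J" "J \<subseteq> {1..n}" "3 \<le> card J" and f: "set (sl J) \<subseteq> L \<gamma>" "sum_list (sl J) \<in> L \<gamma>"
    and e: "\<And>r s. r \<in> J \<Longrightarrow> s \<in> J \<Longrightarrow> r < s \<Longrightarrow> cm (t \<gamma> (\<sigma> r)) (t \<gamma> (\<sigma> s)) = zz {r, s} [^]\<^bsub>G\<^esub> pair_exp r s"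
  shows "zlist \<gamma> (sl J) \<otimes>\<^bsub>G\<^esub> zlist \<gamma> (sl J) = G.cprod zp (\<lambda>(r, s). pair_exp r s * chi J r s) (index_pairs n)"
proof -
  let ?S = "{(r, s). r \<in> J \<and> s \<in> J \<and> r < s}"
  have fJ: "\<sigma> r \<in> L \<gamma>" if "r \<in> J" for r using f(1) set_sl[OF J(1)] that by auto
  have chi: "chi J r s = (if (r, s) \<in> ?S then 1 else 0)" if "(r, s) \<in> index_pairs n" for r s
  proof -
    have "r < s" using that by (simp add: index_pairs_def)
    have "{r, s} \<noteq> J" using J(3) by (auto simp: card_insert_if split: if_splits)
    then show ?thesis using \<open>r < s\<close> by (auto simp: chi_def)
  qed
  have sub: "?S \<subseteq> index_pairs n" using J(2) by (auto simp: index_pairs_def)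
  have "zlist \<gamma> (sl J) \<otimes>\<^bsub>G\<^esub> zlist \<gamma> (sl J) = G.cprod (\<lambda>(r, s). cm (t \<gamma> (\<sigma> r)) (t \<gamma> (\<sigma> s))) (\<lambda>_. 1) ?S"
    unfolding zlist_square[OF g f]
    using tlist_reverse[OF g, of "sorted_list_of_set J" \<sigma>] fJ J(1) by (simp add: sl_def)
  also have "\<dots> = G.cprod zp (\<lambda>(r, s). pair_exp r s * chi J r s) ?S"
  proof (rule G.cprod_cong)
    show "zp ` ?S \<subseteq> group_center G" using sub zp_center by blast
    fix p assume "p \<in> ?S"
    then obtain r s where p: "p = (r, s)" "r \<in> J" "s \<in> J" "r < s" by auto
    have "chi J r s = 1" using chi[of r s] sub p by auto
    moreover have "cm (t \<gamma> (\<sigma> r)) (t \<gamma> (\<sigma> s)) \<in> carrier G" using fJ p g by simp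
    ultimately show "(case p of (r, s) \<Rightarrow> cm (t \<gamma> (\<sigma> r)) (t \<gamma> (\<sigma> s))) [^]\<^bsub>G\<^esub> (1::int)
       = zp p [^]\<^bsub>G\<^esub> (case p of (r, s) \<Rightarrow> pair_exp r s * chi J r s)"
      using e[OF p(2-4)] by (simp add: p)
  qed
  also have "\<dots> = G.cprod zp (\<lambda>(r, s). pair_exp r s * chi J r s) (index_pairs n)"
  proof -
    note C = G.comm_monoid_center
    show ?thesis unfolding G.cprod_def
    proof (rule comm_monoid.finprod_mono_neutral_cong_left[OF C finite_pairs sub])
      show "zp p [^]\<^bsub>G\<^esub> (case p of (r, s) \<Rightarrow> pair_exp r s * chi J r s) = \<one>\<^bsub>G.Cen\<^esub>" if "p \<in> index_pairs n - ?S" for p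
        using chi[of "fst p" "snd p"] that by (cases p) auto
      show "(\<lambda>p. zp p [^]\<^bsub>G\<^esub> (case p of (r, s) \<Rightarrow> pair_exp r s * chi J r s)) \<in> index_pairs n \<rightarrow> carrier G.Cen"
        using zp_center G.center_int_pow by auto
    qed auto
  qed
  finally show ?thesis .
qed

text \<open>By \<open>zlist_square\<close> the square compares a product with its reversal, and \<open>tlist_reverse\<close> counts the
commutators.\<close>

lemma zz_square:
  assumes J: "J \<in> JJ"
  shows "zz J \<otimes>\<^bsub>G\<^esub> zz J = G.cprod zp (\<lambda>(r, s). pair_exp r s * chi J r s) (index_pairs n)"
proof -
  have J': "J \<in> SP1 \<union> SP2" "3 \<le> card J" "J \<noteq> {}" using J index_sets_supp by auto
  then have JI: "finite J" "J \<subseteq> {1..n}" using supp_finite m_le_n by (auto simp: supp_def)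
  consider "J \<in> SP1" | "J \<in> SP2" using J' by blast
  then show ?thesis
  proof cases
    case 1
    then have "J \<subseteq> {1..m}" by (simp add: supp_def)
    then show ?thesis unfolding zz_supp1[OF 1] using J' JI supp1_fibre[OF 1 chosen_short(1)] chosen_root
      by (intro zlist_square_pairs cm_eq_zz_short) auto
  next
    case 2
    then have "J \<subseteq> {m+1..n}" by (simp add: supp_def)
    then show ?thesis unfolding zz_supp2[OF 2 J'(3)] using J' JI supp2_fibre[OF 2 chosen_long(1)] chosen_root
      by (intro zlist_square_pairs cm_eq_zz_long) auto
  qed
qed

end

section \<open>Characters that detect a single index set\<close>

definition sign_group :: "int monoid" where
  "sign_group = \<lparr>carrier = {1, -1}, mult = (*), one = 1\<rparr>"

lemma group_sign_group: "group sign_group"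
  by (rule groupI) (auto simp: sign_group_def)

lemma (in group) cprod_int_pow:
  assumes "finite A" "z ` A \<subseteq> group_center G"
  shows "cprod z g A [^] (i::int) = cprod z (\<lambda>p. g p * i) A"
proof (induction i rule: int_induct[where k = 0])
  case base show ?case using cprod_zero[OF assms] by simp
next
  case (step1 i)
  have "cprod z g A \<in> carrier G" using cprod_closed[OF assms(2)] center_carrier by blast
  then show ?case using step1 cprod_add[OF assms, of "\<lambda>p. g p * i" g] by (simp add: int_pow_mult distrib_left)
next
  case (step2 i)
  have "cprod z g A \<in> carrier G" using cprod_closed[OF assms(2)] center_carrier by blast
  then show ?case using step2 cprod_add[OF assms, of "\<lambda>p. g p * i" "\<lambda>p. - g p"] cprod_uminus[OF assms, of g]
    by (simp add: int_pow_diff right_diff_distrib)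
qed

context fibred_roots begin

text \<open>With values of square one, the relations ask for nothing but invariance under reflections.\<close>

lemma sign_character:
  assumes c: "\<And>\<gamma> s. c (\<gamma>, s) = 1 \<or> c (\<gamma>, s) = (-1::int)"
    and inv: "\<And>\<alpha> \<beta> s u. \<alpha> \<in> \<Phi> \<Longrightarrow> \<beta> \<in> \<Phi> \<Longrightarrow> s \<in> L \<alpha> \<Longrightarrow> u \<in> L \<beta> \<Longrightarrow>
       c (rfl \<alpha> \<beta>, u - pairing \<beta> \<alpha> *\<^sub>R s) = c (\<beta>, u)"
  shows "\<exists>h. (\<forall>x\<in>carrier G. \<forall>y\<in>carrier G. h (x \<otimes>\<^bsub>G\<^esub> y) = h x * h y) \<and>
    (\<forall>x\<in>carrier G. h x = 1 \<or> h x = (-1::int)) \<and> (\<forall>\<gamma>\<in>\<Phi>. \<forall>s\<in>L \<gamma>. h (w \<gamma> s) = c (\<gamma>, s))"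
proof -
  let ?h = "presented_lift sign_group c"
  have im: "c ` nonisotropic R \<subseteq> carrier sign_group"
  proof
    fix y assume "y \<in> c ` nonisotropic R"
    then obtain \<gamma> s where "y = c (\<gamma>, s)" by auto
    then show "y \<in> carrier sign_group" using c[of \<gamma> s] by (auto simp: sign_group_def)
  qed
  have sq: "c (\<gamma>, s) * c (\<gamma>, s) = 1" "c (\<gamma>, s) * (x * c (\<gamma>, s)) = x" for \<gamma> s x using c[of \<gamma> s] by auto
  have rel: "eval_word sign_group c u = eval_word sign_group c v" if "(u, v) \<in> conj_relations R" for u v
    using that unfolding conj_relations_def
  proof (elim UnE CollectE exE conjE)
    fix \<alpha> assume "(u, v) = ([(\<alpha>, True), (\<alpha>, True)], [])" "\<alpha> \<in> nonisotropic R"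
    then show ?thesis using sq by (cases \<alpha>) (simp add: eval_word_def sign_group_def)
  next
    fix \<alpha> \<beta> assume *: "(u, v) = ([(\<alpha>, True), (\<beta>, True), (\<alpha>, True)], [(reflection form \<alpha> \<beta>, True)])"
      "\<alpha> \<in> nonisotropic R" "\<beta> \<in> nonisotropic R"
    obtain \<gamma> s \<delta> u' where "\<alpha> = (\<gamma>, s)" "\<beta> = (\<delta>, u')" by (metis prod.exhaust)
    then show ?thesis using * sq inv[of \<gamma> \<delta> s u']
      by (simp add: eval_word_def sign_group_def nonisotropic_eq reflection_form_eq)
  qed
  have "?h \<in> hom G sign_group"
    unfolding hat_weyl_def by (rule presented_lift_hom(1)[OF group_sign_group im]) (rule rel)
  then have "\<forall>x\<in>carrier G. \<forall>y\<in>carrier G. ?h (x \<otimes>\<^bsub>G\<^esub> y) = ?h x * ?h y" "\<forall>x\<in>carrier G. ?h x = 1 \<or> ?h x = -1"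
    by (auto simp: hom_def sign_group_def)
  moreover have "?h (w \<gamma> s) = c (\<gamma>, s)" if "\<gamma> \<in> \<Phi>" "s \<in> L \<gamma>" for \<gamma> s
    unfolding hat_w_def by (rule presented_lift_hom(2)[OF group_sign_group im _ nonisotropicI[OF that]]) (rule rel)
  ultimately show ?thesis by blast
qed

end

context ears_chosen begin

lemma coord_tau: "J \<subseteq> {1..n} \<Longrightarrow> r \<in> {1..n} \<Longrightarrow> coord r (tau \<sigma> J) = (if r \<in> J then 1 else 0)"
proof -
  assume J: "J \<subseteq> {1..n}" "r \<in> {1..n}"
  have "coord r (tau \<sigma> J) = (\<Sum>s\<in>J. if s = r then 1 else 0)"
    unfolding tau_def coord_sum using J by (intro sum.cong) (auto simp: coord_sigma)
  also have "\<dots> = (if r \<in> J then 1 else 0)" using finite_subset[OF J(1)] by simp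
  finally show ?thesis .
qed

text \<open>The character is \<open>-1\<close> on the reflections in roots of \<open>T\<close> with translation part in \<open>\<tau>\<^sub>J + D\<close>.
Reflections move the translation parts of roots in \<open>T\<close> by elements of \<open>D\<close>, so this is well defined.
The coset contains \<open>- \<tau>\<^sub>J\<close>, because \<open>D\<close> contains \<open>2 \<tau>\<^sub>J\<close>. As \<open>J\<close> has more than one element, neither
\<open>0\<close> nor any \<open>\<sigma> r\<close> lies in \<open>\<tau>\<^sub>J + D\<close>, and only the factor \<open>t \<gamma> (- \<tau>\<^sub>J)\<close> of \<open>z\<^sub>J\<close> contributes a sign.\<close>

lemma detecting_character:
  assumes T: "\<And>\<alpha> \<beta>. \<alpha> \<in> \<Phi> \<Longrightarrow> \<beta> \<in> \<Phi> \<Longrightarrow> rfl \<alpha> \<beta> \<in> T \<longleftrightarrow> \<beta> \<in> T"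
    and D: "0 \<in> D" "\<And>x y. x \<in> D \<Longrightarrow> y \<in> D \<Longrightarrow> x + y \<in> D" "\<And>x y. x \<in> D \<Longrightarrow> y \<in> D \<Longrightarrow> x - y \<in> D"
    and move: "\<And>\<alpha> \<beta> s. \<alpha> \<in> \<Phi> \<Longrightarrow> \<beta> \<in> \<Phi> \<Longrightarrow> \<beta> \<in> T \<Longrightarrow> s \<in> L \<alpha> \<Longrightarrow> pairing \<beta> \<alpha> *\<^sub>R s \<in> D"
    and dbl: "\<And>r. r \<in> I \<Longrightarrow> 2 *\<^sub>R \<sigma> r \<in> D" and par: "\<And>d r. d \<in> D \<Longrightarrow> r \<in> I \<Longrightarrow> coord r d / 2 \<in> \<int>"
    and J: "J \<subseteq> I" "3 \<le> card J" and I: "I \<subseteq> {1..n}"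
  shows "\<exists>h. (\<forall>x\<in>carrier G. \<forall>y\<in>carrier G. h (x \<otimes>\<^bsub>G\<^esub> y) = h x * h y) \<and>
    (\<forall>x\<in>carrier G. h x = 1 \<or> h x = (-1::int)) \<and>
    (\<forall>\<gamma>\<in>\<Phi>. \<forall>xs. set xs \<subseteq> L \<gamma> \<longrightarrow> sum_list xs \<in> L \<gamma> \<longrightarrow> \<gamma> \<notin> T \<longrightarrow> h (zlist \<gamma> xs) = 1) \<and>
    (\<forall>\<gamma>\<in>\<Phi>. \<forall>J'\<subseteq>I. set (sl J') \<subseteq> L \<gamma> \<longrightarrow> sum_list (sl J') \<in> L \<gamma> \<longrightarrow> \<gamma> \<in> T \<longrightarrow>
        h (zlist \<gamma> (sl J')) = (if J' = J then -1 else 1))"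
proof -
  define c where "c = (\<lambda>(\<gamma>, s). if \<gamma> \<in> T \<and> s - tau \<sigma> J \<in> D then -1 else (1::int))"
  have cv: "c (\<gamma>, s) = 1 \<or> c (\<gamma>, s) = -1" for \<gamma> s by (simp add: c_def)
  have ci: "c (rfl \<alpha> \<beta>, u - pairing \<beta> \<alpha> *\<^sub>R s) = c (\<beta>, u)"
    if "\<alpha> \<in> \<Phi>" "\<beta> \<in> \<Phi>" "s \<in> L \<alpha>" "u \<in> L \<beta>" for \<alpha> \<beta> s u
  proof (cases "\<beta> \<in> T")
    case True
    let ?d = "pairing \<beta> \<alpha> *\<^sub>R s"
    have d: "?d \<in> D" using move that True by blast
    have e: "u - ?d - tau \<sigma> J = (u - tau \<sigma> J) - ?d" "u - tau \<sigma> J = (u - ?d - tau \<sigma> J) + ?d" by simp_all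
    have "u - ?d - tau \<sigma> J \<in> D \<longleftrightarrow> u - tau \<sigma> J \<in> D"
      using D(2)[OF _ d] D(3)[OF _ d] e by metis
    then show ?thesis using T that by (simp add: c_def)
  qed (use T that in \<open>simp add: c_def\<close>)
  from sign_character[of c, OF cv ci] obtain h where h: "\<And>x y. x \<in> carrier G \<Longrightarrow> y \<in> carrier G \<Longrightarrow> h (x \<otimes>\<^bsub>G\<^esub> y) = h x * h y"
    "\<And>x. x \<in> carrier G \<Longrightarrow> h x = 1 \<or> h x = -1" "\<And>\<gamma> s. \<gamma> \<in> \<Phi> \<Longrightarrow> s \<in> L \<gamma> \<Longrightarrow> h (w \<gamma> s) = c (\<gamma>, s)"
    by blast
  have h1: "h \<one>\<^bsub>G\<^esub> = 1" using h(1)[of "\<one>\<^bsub>G\<^esub>" "\<one>\<^bsub>G\<^esub>"] h(2)[of "\<one>\<^bsub>G\<^esub>"] by auto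
  have ht: "h (t \<gamma> s) = c (\<gamma>, s) * c (\<gamma>, 0)" if "\<gamma> \<in> \<Phi>" "s \<in> L \<gamma>" for \<gamma> s
    using that fibre_zero by (simp add: t_eq h)
  have htl: "h (tlist \<gamma> xs) = (\<Prod>x\<leftarrow>xs. c (\<gamma>, x) * c (\<gamma>, 0))" if "\<gamma> \<in> \<Phi>" "set xs \<subseteq> L \<gamma>" for \<gamma> xs
    using that(2) by (induction xs) (use that(1) in \<open>auto simp: tlist_simps h1 h(1) ht\<close>)
  have hz: "h (zlist \<gamma> xs) = c (\<gamma>, - sum_list xs) * c (\<gamma>, 0) * (\<Prod>x\<leftarrow>xs. c (\<gamma>, x) * c (\<gamma>, 0))"
    if "\<gamma> \<in> \<Phi>" "set xs \<subseteq> L \<gamma>" "sum_list xs \<in> L \<gamma>" for \<gamma> xs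
    using that fibre_neg by (simp add: zlist_def h(1) ht htl)
  have out: "h (zlist \<gamma> xs) = 1" if "\<gamma> \<in> \<Phi>" "set xs \<subseteq> L \<gamma>" "sum_list xs \<in> L \<gamma>" "\<gamma> \<notin> T" for \<gamma> xs
  proof -
    have "(\<Prod>x\<leftarrow>xs. c (\<gamma>, x) * c (\<gamma>, 0)) = 1" using that(4) by (induction xs) (auto simp: c_def)
    then show ?thesis using that by (simp add: hz c_def)
  qed
  have finI: "finite I" using I finite_subset by blast
  \<comment> \<open>Coordinates of elements of \<open>D\<close> are even, those of \<open>\<tau>\<^sub>J\<close> are \<open>0\<close> and \<open>1\<close>.\<close>
  have diff: "tau \<sigma> J' - tau \<sigma> J \<in> D \<longleftrightarrow> J' = J" if J': "J' \<subseteq> I" for J'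
  proof
    assume d: "tau \<sigma> J' - tau \<sigma> J \<in> D"
    have "r \<in> J' \<longleftrightarrow> r \<in> J" if r: "r \<in> I" for r
    proof -
      have "((if r \<in> J' then 1 else 0) - (if r \<in> J then 1 else 0)) / 2 \<in> (\<int> :: real set)"
        using par[OF d r] r I J J' by (auto simp: coord_linear coord_tau subset_iff)
      then show ?thesis using half_not_int Ints_minus[of "- 1 / 2 :: real"] by (auto split: if_splits)
    qed
    then show "J' = J" using J J' by blast
  qed (use D in simp)
  have two: "2 *\<^sub>R tau \<sigma> J' \<in> D" if "J' \<subseteq> I" for J'
  proof -
    have "(\<Sum>r\<in>F. 2 *\<^sub>R \<sigma> r) \<in> D" if "finite F" "F \<subseteq> I" for F
      using that by (induction F) (auto simp: D dbl)
    then show ?thesis using that finI finite_subset by (auto simp: tau_def scaleR_sum_right)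
  qed
  have cp: "c (\<gamma>, tau \<sigma> J') = (if J' = J then -1 else 1)" "c (\<gamma>, - tau \<sigma> J') = (if J' = J then -1 else 1)"
    if "\<gamma> \<in> T" "J' \<subseteq> I" for \<gamma> J'
  proof -
    show "c (\<gamma>, tau \<sigma> J') = (if J' = J then -1 else 1)" using diff that by (simp add: c_def)
    have "- tau \<sigma> J' - tau \<sigma> J = (tau \<sigma> J' - tau \<sigma> J) - 2 *\<^sub>R tau \<sigma> J'"
      "tau \<sigma> J' - tau \<sigma> J = (- tau \<sigma> J' - tau \<sigma> J) + 2 *\<^sub>R tau \<sigma> J'" by (simp_all add: scaleR_2)
    then have "- tau \<sigma> J' - tau \<sigma> J \<in> D \<longleftrightarrow> tau \<sigma> J' - tau \<sigma> J \<in> D"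
      using D(2)[OF _ two[OF that(2)]] D(3)[OF _ two[OF that(2)]] by metis
    then show "c (\<gamma>, - tau \<sigma> J') = (if J' = J then -1 else 1)" using diff that by (simp add: c_def)
  qed
  have inn: "h (zlist \<gamma> (sl J')) = (if J' = J then -1 else 1)"
    if g: "\<gamma> \<in> \<Phi>" "J' \<subseteq> I" "set (sl J') \<subseteq> L \<gamma>" "sum_list (sl J') \<in> L \<gamma>" "\<gamma> \<in> T" for \<gamma> J'
  proof -
    have fin: "finite J'" using g(2) finI finite_subset by blast
    have small: "{} \<noteq> J" "{r} \<noteq> J" for r using J(2) by auto
    have c0: "c (\<gamma>, 0) = 1" using cp(1)[OF g(5), of "{}"] small by (simp add: tau_def)
    have c1: "c (\<gamma>, \<sigma> r) = 1" if "r \<in> I" for r using cp(1)[OF g(5), of "{r}"] small that by (simp add: tau_def)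
    have "(\<Prod>x\<leftarrow>xs. c (\<gamma>, x) * c (\<gamma>, 0)) = 1" if "set xs \<subseteq> \<sigma> ` J'" for xs
      using that g(2) by (induction xs) (auto simp: c0 c1)
    then show ?thesis using g cp(2)[OF g(5,2)] set_sl[OF fin] by (simp add: hz c0 sum_sl fin)
  qed
  show ?thesis using h(1,2) out inn by (intro exI[of _ h]) blast
qed

lemma JJ_cases:
  assumes "J \<in> JJ"
  obtains (short) i where "X = TypeB i" "J \<in> SP1" | (long) i where "X = TypeB 2 \<or> X = TypeC i" "J \<in> SP2"
  using assms that by (auto simp: index_sets_def Esupp_def split: root_type.splits if_splits)

lemma coord_int_span:
  assumes "x \<in> int_span (\<sigma> ` I)" "I \<subseteq> {1..n}" "r \<in> {1..n}" shows "coord r x \<in> \<int>"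
  using assms(1)
  by (induction rule: int_span_induct) (use assms(2,3) in \<open>auto simp: coord_zero coord_linear coord_sigma subset_iff\<close>)

lemma coord_span_other:
  assumes "x \<in> int_span (\<sigma> ` I)" "I \<subseteq> {1..n}" "r \<in> {1..n}" "r \<notin> I" shows "coord r x = 0"
  using assms(1)
  by (induction rule: int_span_induct) (use assms(2-4) in \<open>auto simp: coord_zero coord_linear coord_sigma subset_iff\<close>)

lemma double_closed:
  assumes "c / 2 \<in> \<int>" "x \<in> int_span S" shows "\<exists>y\<in>int_span S. c *\<^sub>R x = 2 *\<^sub>R y"
  using int_span_Ints[OF assms] by (intro bexI[of _ "(c / 2) *\<^sub>R x"]) auto

text \<open>An index of an integral collection occurs only for a length of roots whose mutual pairings are even. This
makes the group \<open>D\<close> small enough: in the relevant part of the basis its elements have even coordinates.\<close>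

lemma detect:
  assumes J: "J \<in> JJ"
  shows "\<exists>h. (\<forall>x\<in>carrier G. \<forall>y\<in>carrier G. h (x \<otimes>\<^bsub>G\<^esub> y) = h x * h y) \<and>
    (\<forall>x\<in>carrier G. h x = 1 \<or> h x = (-1::int)) \<and>
    (\<forall>J'\<in>SP1 \<union> SP2 - {{}}. h (zz J') = (if J' = J then -1 else 1))"
proof -
  have J3: "3 \<le> card J" using J index_sets_supp by auto
  from J show ?thesis
  proof (cases rule: JJ_cases)
    case (short i)
    have k2: "k = 2" using short by simp
    \<comment> \<open>The translations of short roots lie in \<open>S1 + \<langle>S2\<rangle>\<close>, and their pairings with short roots are even.\<close>
    let ?D = "{2 *\<^sub>R x + y | x y. x \<in> int_span S1 \<and> y \<in> int_span S2}"
    have DI: "2 *\<^sub>R x + y \<in> ?D" if "x \<in> int_span S1" "y \<in> int_span S2" for x y using that by blast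
    have "\<exists>h. (\<forall>x\<in>carrier G. \<forall>y\<in>carrier G. h (x \<otimes>\<^bsub>G\<^esub> y) = h x * h y) \<and>
      (\<forall>x\<in>carrier G. h x = 1 \<or> h x = (-1::int)) \<and>
      (\<forall>\<gamma>\<in>\<Phi>. \<forall>xs. set xs \<subseteq> L \<gamma> \<longrightarrow> sum_list xs \<in> L \<gamma> \<longrightarrow> \<gamma> \<notin> short_roots \<Phi> \<longrightarrow> h (zlist \<gamma> xs) = 1) \<and>
      (\<forall>\<gamma>\<in>\<Phi>. \<forall>J'\<subseteq>{1..m}. set (sl J') \<subseteq> L \<gamma> \<longrightarrow> sum_list (sl J') \<in> L \<gamma> \<longrightarrow> \<gamma> \<in> short_roots \<Phi> \<longrightarrow>
        h (zlist \<gamma> (sl J')) = (if J' = J then -1 else 1))" (is "\<exists>h. ?P h")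
    proof (rule detecting_character [where D = ?D])
      show "0 \<in> ?D" using DI[OF int_span_zero int_span_zero] by simp
      show "x + y \<in> ?D" "x - y \<in> ?D" if "x \<in> ?D" "y \<in> ?D" for x y
      proof -
        from that obtain a b a' b' where e: "x = 2 *\<^sub>R a + b" "y = 2 *\<^sub>R a' + b'"
          "a \<in> int_span S1" "b \<in> int_span S2" "a' \<in> int_span S1" "b' \<in> int_span S2" by blast
        have s: "x + y = 2 *\<^sub>R (a + a') + (b + b')" "x - y = 2 *\<^sub>R (a - a') + (b - b')" by (simp_all add: e algebra_simps)
        show "x + y \<in> ?D" unfolding s(1) by (intro DI int_span_add e)
        show "x - y \<in> ?D" unfolding s(2) by (intro DI int_span_diff e)
      qed
      show "pairing \<beta> \<alpha> *\<^sub>R s \<in> ?D" if ab: "\<alpha> \<in> \<Phi>" "\<beta> \<in> \<Phi>" "\<beta> \<in> short_roots \<Phi>" "s \<in> L \<alpha>" for \<alpha> \<beta> s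
      proof (cases "\<alpha> \<in> short_roots \<Phi>")
        case True
        obtain x y where xy: "x \<in> S1" "y \<in> int_span S2" "s = x + y" using ab(4) by (auto simp: L_short[OF True])
        obtain x' where x': "x' \<in> int_span S1" "pairing \<beta> \<alpha> *\<^sub>R x = 2 *\<^sub>R x'"
          using double_closed[OF even_pairing_short[OF short(1) True ab(2)] int_span_base[OF xy(1)]] by blast
        show ?thesis using DI[OF x'(1) int_span_Ints[OF root_pairing_int[OF ab(1,2)] xy(2)]]
          by (simp add: xy x' scaleR_add_right)
      next
        case False
        then have l: "\<alpha> \<in> long_roots \<Phi>" using short_or_long ab by blast
        obtain x y where xy: "x \<in> int_span S1" "y \<in> S2" "s = 2 *\<^sub>R x + y" using ab(4) k2 by (auto simp: L_long[OF l])
        show ?thesis using DI[OF int_span_Ints[OF root_pairing_int[OF ab(1,2)] xy(1)]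
              int_span_Ints[OF root_pairing_int[OF ab(1,2)] int_span_base[OF xy(2)]]]
          by (simp add: xy scaleR_add_right mult.commute)
      qed
      show "2 *\<^sub>R \<sigma> r \<in> ?D" if "r \<in> {1..m}" for r
        using DI[OF int_span_base[OF sigma_S1[OF that]] int_span_zero] by simp
      show "coord r d / 2 \<in> \<int>" if d: "d \<in> ?D" and r: "r \<in> {1..m}" for d r
      proof -
        from d obtain x y where xy: "d = 2 *\<^sub>R x + y" "x \<in> int_span (\<sigma> ` {1..m})" "y \<in> int_span (\<sigma> ` {m+1..n})"
          unfolding int_span_basis by blast
        have "coord r y = 0" using xy r m_le_n by (intro coord_span_other[OF xy(3)]) auto
        moreover have "coord r x \<in> \<int>" using r m_le_n by (intro coord_int_span[OF xy(2)]) auto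
        ultimately show ?thesis by (simp add: xy(1) coord_linear)
      qed
      show "J \<subseteq> {1..m}" using short by (simp add: supp_def)
      show "{1..m} \<subseteq> {1..n}" using m_le_n by simp
    qed (rule rfl_short_long J3 | assumption)+
    then obtain h where hh: "?P h" by (rule exE)
    note h12 = hh[THEN conjunct1] hh[THEN conjunct2, THEN conjunct1]
    note h3 = hh[THEN conjunct2, THEN conjunct2, THEN conjunct1, rule_format]
    note h4 = hh[THEN conjunct2, THEN conjunct2, THEN conjunct2, rule_format]
    have "h (zz J') = (if J' = J then -1 else 1)" if J': "J' \<in> SP1 \<union> SP2 - {{}}" for J'
    proof (cases "J' \<in> SP1")
      case True
      then show ?thesis using h4[OF chosen_root(1) _ supp1_fibre[OF True chosen_short(1)] chosen_short(1)]
        by (simp add: zz_supp1 supp_def)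
    next
      case False
      then have S: "J' \<in> SP2" "J' \<noteq> {}" "J' \<noteq> J" using J' short by auto
      then show ?thesis using h3[OF chosen_root(3) supp2_fibre[OF S(1) chosen_long(1)]]
          not_short_and_long chosen_long by (auto simp: zz_supp2)
    qed
    then show ?thesis using h12 by (intro exI[of _ h]) blast
  next
    case (long i)
    have k2: "k = 2" using long by auto
    let ?D = "{2 *\<^sub>R x + 2 *\<^sub>R y | x y. x \<in> int_span S1 \<and> y \<in> int_span S2}"
    have DI: "2 *\<^sub>R x + 2 *\<^sub>R y \<in> ?D" if "x \<in> int_span S1" "y \<in> int_span S2" for x y using that by blast
    have "\<exists>h. (\<forall>x\<in>carrier G. \<forall>y\<in>carrier G. h (x \<otimes>\<^bsub>G\<^esub> y) = h x * h y) \<and>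
      (\<forall>x\<in>carrier G. h x = 1 \<or> h x = (-1::int)) \<and>
      (\<forall>\<gamma>\<in>\<Phi>. \<forall>xs. set xs \<subseteq> L \<gamma> \<longrightarrow> sum_list xs \<in> L \<gamma> \<longrightarrow> \<gamma> \<notin> long_roots \<Phi> \<longrightarrow> h (zlist \<gamma> xs) = 1) \<and>
      (\<forall>\<gamma>\<in>\<Phi>. \<forall>J'\<subseteq>{m+1..n}. set (sl J') \<subseteq> L \<gamma> \<longrightarrow> sum_list (sl J') \<in> L \<gamma> \<longrightarrow> \<gamma> \<in> long_roots \<Phi> \<longrightarrow>
        h (zlist \<gamma> (sl J')) = (if J' = J then -1 else 1))" (is "\<exists>h. ?P h")
    proof (rule detecting_character [where D = ?D])
      show "0 \<in> ?D" using DI[OF int_span_zero int_span_zero] by simp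
      show "x + y \<in> ?D" "x - y \<in> ?D" if "x \<in> ?D" "y \<in> ?D" for x y
      proof -
        from that obtain a b a' b' where e: "x = 2 *\<^sub>R a + 2 *\<^sub>R b" "y = 2 *\<^sub>R a' + 2 *\<^sub>R b'"
          "a \<in> int_span S1" "b \<in> int_span S2" "a' \<in> int_span S1" "b' \<in> int_span S2" by blast
        have s: "x + y = 2 *\<^sub>R (a + a') + 2 *\<^sub>R (b + b')" "x - y = 2 *\<^sub>R (a - a') + 2 *\<^sub>R (b - b')" by (simp_all add: e algebra_simps)
        show "x + y \<in> ?D" unfolding s(1) by (intro DI int_span_add e)
        show "x - y \<in> ?D" unfolding s(2) by (intro DI int_span_diff e)
      qed
      show "pairing \<beta> \<alpha> *\<^sub>R s \<in> ?D" if ab: "\<alpha> \<in> \<Phi>" "\<beta> \<in> \<Phi>" "\<beta> \<in> long_roots \<Phi>" "s \<in> L \<alpha>" for \<alpha> \<beta> s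
      proof -
        obtain x y where xy: "x \<in> int_span S1" "y \<in> int_span S2" "s = x + y"
        proof (cases "\<alpha> \<in> short_roots \<Phi>")
          case True
          then show ?thesis using that ab(4) int_span_base by (auto simp: L_short)
        next
          case False
          then have l: "\<alpha> \<in> long_roots \<Phi>" using short_or_long ab by blast
          obtain x y where "x \<in> int_span S1" "y \<in> S2" "s = 2 *\<^sub>R x + y" using ab(4) k2 by (auto simp: L_long[OF l])
          then show ?thesis using that[of "2 *\<^sub>R x" y] int_span_scale[of x S1 2] int_span_base by auto
        qed
        have even: "pairing \<beta> \<alpha> / 2 \<in> \<int>"
        proof (cases "\<alpha> \<in> short_roots \<Phi>")
          case True
          then show ?thesis using pairing_long_short[OF True ab(3)] k2 root_pairing_int[OF ab(2,1)] by simp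
        next
          case False
          then show ?thesis using even_pairing_long[OF long(1) _ ab(3)] short_or_long ab(1) by blast
        qed
        obtain x' y' where "x' \<in> int_span S1" "pairing \<beta> \<alpha> *\<^sub>R x = 2 *\<^sub>R x'" "y' \<in> int_span S2" "pairing \<beta> \<alpha> *\<^sub>R y = 2 *\<^sub>R y'"
          using double_closed[OF even xy(1)] double_closed[OF even xy(2)] by blast
        then show ?thesis using DI[of x' y'] by (simp add: xy scaleR_add_right)
      qed
      show "2 *\<^sub>R \<sigma> r \<in> ?D" if "r \<in> {m+1..n}" for r
        using DI[OF int_span_zero int_span_base[OF sigma_S2[OF that]]] by simp
      show "coord r d / 2 \<in> \<int>" if d: "d \<in> ?D" and r: "r \<in> {m+1..n}" for d r
      proof -
        from d obtain x y where xy: "d = 2 *\<^sub>R x + 2 *\<^sub>R y" "x \<in> int_span (\<sigma> ` {1..m})" "y \<in> int_span (\<sigma> ` {m+1..n})"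
          unfolding int_span_basis by blast
        have "coord r y \<in> \<int>" using r by (intro coord_int_span[OF xy(3)]) auto
        moreover have "coord r x \<in> \<int>" using r m_le_n by (intro coord_int_span[OF xy(2)]) auto
        ultimately show ?thesis by (simp add: xy(1) coord_linear add_divide_distrib)
      qed
      show "J \<subseteq> {m+1..n}" using long by (simp add: supp_def)
      show "{m+1..n} \<subseteq> {1..n}" by simp
    qed (rule rfl_short_long J3 | assumption)+
    then obtain h where hh: "?P h" by (rule exE)
    note h12 = hh[THEN conjunct1] hh[THEN conjunct2, THEN conjunct1]
    note h3 = hh[THEN conjunct2, THEN conjunct2, THEN conjunct1, rule_format]
    note h4 = hh[THEN conjunct2, THEN conjunct2, THEN conjunct2, rule_format]
    have "h (zz J') = (if J' = J then -1 else 1)" if J': "J' \<in> SP1 \<union> SP2 - {{}}" for J'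
    proof (cases "J' \<in> SP2")
      case True
      moreover have "J' \<noteq> {}" using J' by blast
      ultimately show ?thesis using h4[OF chosen_root(3) _ supp2_fibre[OF True chosen_long(1)] chosen_long(1)]
        by (simp add: zz_supp2 supp_def)
    next
      case False
      then have S: "J' \<in> SP1" "J' \<noteq> J" using J' long by auto
      then show ?thesis using h3[OF chosen_root(1) supp1_fibre[OF S(1) chosen_short(1)]]
          not_short_and_long chosen_short by (auto simp: zz_supp1)
    qed
    then show ?thesis using h12 by (intro exI[of _ h]) blast
  qed
qed

end

section \<open>The kernel\<close>

context ears_chosen begin

abbreviation IC where "IC \<equiv> integral_collections X m n \<sigma> S1 S2"
abbreviation uhat where "uhat \<equiv> hat_u X R m n \<sigma> S1 S2 \<alpha>0 \<beta>0 \<alpha>1 \<beta>1"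
abbreviation eb where "eb \<equiv> eps_bar X m n \<sigma> S1 S2"
abbreviation A where "A \<equiv> index_pairs n"

lemma uhat_eq: "uhat \<epsilon> = G.cprod zp (\<lambda>(r, s). - \<lfloor>eb \<epsilon> r s\<rfloor>) A \<otimes>\<^bsub>G\<^esub> G.cprod zz \<epsilon> JJ"
  unfolding hat_u_def Let_def G.cprod_def by (simp add: case_prod_unfold)

lemma uhat_center: "uhat \<epsilon> \<in> group_center G"
  unfolding uhat_eq
  by (intro subgroup.m_closed[OF G.subgroup_center] G.cprod_closed zp_center zz_center)

lemma double_zz:
  assumes "J \<in> JJ"
  shows "zz J [^]\<^bsub>G\<^esub> (2 * d) = G.cprod zp (\<lambda>(r, s). pair_exp r s * chi J r s * d) A"
proof -
  have c: "zz J \<in> carrier G" using zz_JJ_K[OF assms] K_carrier by blast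
  have "zz J [^]\<^bsub>G\<^esub> (2 * d) = (zz J [^]\<^bsub>G\<^esub> (2::int)) [^]\<^bsub>G\<^esub> d" using c by (simp add: G.int_pow_pow)
  also have "zz J [^]\<^bsub>G\<^esub> (2::int) = zz J \<otimes>\<^bsub>G\<^esub> zz J" using G.int_pow_mult[OF c, of 1 1] c by simp
  also have "\<dots> = G.cprod zp (\<lambda>(r, s). pair_exp r s * chi J r s) A" by (rule zz_square[OF assms])
  also have "\<dots> [^]\<^bsub>G\<^esub> d = G.cprod zp (\<lambda>p. (case p of (r, s) \<Rightarrow> pair_exp r s * chi J r s) * d) A"
    by (rule G.cprod_int_pow[OF finite_pairs zp_center])
  finally show ?thesis by (simp add: case_prod_unfold)
qed

text \<open>Even powers of the \<open>z\<^sub>J\<close> are products of powers of the \<open>z\<close> of pairs.\<close>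

lemma double_zz_prod:
  "G.cprod zz (\<lambda>J. 2 * d J) JJ = G.cprod zp (\<lambda>(r, s). pair_exp r s * (\<Sum>J\<in>JJ. chi J r s * d J)) A"
proof -
  have "G.cprod zz (\<lambda>J. 2 * d J) JJ
      = G.cprod zp (\<lambda>p. \<Sum>J\<in>JJ. (\<lambda>(r, s). pair_exp r s * chi J r s * d J) p) A"
    by (rule G.cprod_sum[OF finite_pairs zp_center finite_JJ double_zz zz_center])
  then show ?thesis by (simp add: case_prod_unfold sum_distrib_left mult.assoc)
qed

lemma square_of_prod:
  "(G.cprod zp f A \<otimes>\<^bsub>G\<^esub> G.cprod zz g JJ) \<otimes>\<^bsub>G\<^esub> (G.cprod zp f A \<otimes>\<^bsub>G\<^esub> G.cprod zz g JJ)
    = G.cprod zp (\<lambda>(r, s). 2 * f (r, s) + pair_exp r s * (\<Sum>J\<in>JJ. chi J r s * g J)) A"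
proof -
  let ?P = "G.cprod zp f A" and ?Q = "G.cprod zz g JJ"
  have Z: "?P \<in> group_center G" "?Q \<in> group_center G"
    by (intro G.cprod_closed zp_center zz_center)+
  note c = G.center_carrier[OF Z(1)] G.center_carrier[OF Z(2)]
  have "(?P \<otimes>\<^bsub>G\<^esub> ?Q) \<otimes>\<^bsub>G\<^esub> (?P \<otimes>\<^bsub>G\<^esub> ?Q) = (?P \<otimes>\<^bsub>G\<^esub> ?P) \<otimes>\<^bsub>G\<^esub> (?Q \<otimes>\<^bsub>G\<^esub> ?Q)"
    using c G.center_lcomm[OF Z(1) c(2) c(2)] by (simp add: G.m_assoc)
  also have "?P \<otimes>\<^bsub>G\<^esub> ?P = G.cprod zp (\<lambda>p. f p + f p) A"
    by (rule G.cprod_add[OF finite_pairs zp_center, symmetric])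
  also have "?Q \<otimes>\<^bsub>G\<^esub> ?Q = G.cprod zz (\<lambda>J. g J + g J) JJ"
    by (rule G.cprod_add[OF finite_JJ zz_center, symmetric])
  also have "(\<lambda>J. g J + g J) = (\<lambda>J. 2 * g J)" by (simp add: fun_eq_iff)
  also have "G.cprod zz (\<lambda>J. 2 * g J) JJ = G.cprod zp (\<lambda>(r, s). pair_exp r s * (\<Sum>J\<in>JJ. chi J r s * g J)) A"
    by (rule double_zz_prod)
  also have "G.cprod zp (\<lambda>p. f p + f p) A \<otimes>\<^bsub>G\<^esub> \<dots>
     = G.cprod zp (\<lambda>p. (f p + f p) + (\<lambda>(r, s). pair_exp r s * (\<Sum>J\<in>JJ. chi J r s * g J)) p) A"
    by (rule G.cprod_add[OF finite_pairs zp_center, symmetric])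
  finally show ?thesis by (simp add: case_prod_unfold)
qed

text \<open>Integrality says that the exponent of a pair in the square of the product of the \<open>z\<^sub>J\<close> is even;
\<open>hat_u\<close> uses half of it.\<close>

lemma eb_floor:
  assumes "\<epsilon> \<in> IC" "(r, s) \<in> A"
  shows "2 * \<lfloor>eb \<epsilon> r s\<rfloor> = pair_exp r s * (\<Sum>J\<in>JJ. chi J r s * \<epsilon> J)"
proof -
  have "eb \<epsilon> r s \<in> \<int>" using assms by (auto simp: integral_collections_def)
  then have "2 * real_of_int \<lfloor>eb \<epsilon> r s\<rfloor> = 2 * eb \<epsilon> r s" by (auto elim: Ints_cases)
  also have "\<dots> = of_int (pair_exp r s) * of_int (\<Sum>J\<in>JJ. chi J r s * \<epsilon> J)"
    unfolding pair_exp_Delta eps_bar_def by (simp add: field_simps)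
  finally have "real_of_int (2 * \<lfloor>eb \<epsilon> r s\<rfloor>) = real_of_int (pair_exp r s * (\<Sum>J\<in>JJ. chi J r s * \<epsilon> J))" by simp
  then show ?thesis by (simp only: of_int_eq_iff)
qed

text \<open>The exponents of the pairs in \<open>hat_u\<close> are chosen so that they cancel the squares of the \<open>z\<^sub>J\<close>.\<close>

lemma uhat_square: assumes "\<epsilon> \<in> IC" shows "uhat \<epsilon> \<otimes>\<^bsub>G\<^esub> uhat \<epsilon> = \<one>\<^bsub>G\<^esub>"
proof -
  have "uhat \<epsilon> \<otimes>\<^bsub>G\<^esub> uhat \<epsilon> = G.cprod zp (\<lambda>_. 0) A"
    unfolding uhat_eq square_of_prod using eb_floor[OF assms] zp_center
    by (intro G.cprod_cong) auto
  then show ?thesis by (simp add: G.cprod_zero[OF finite_pairs zp_center])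
qed

lemma uhat_kernel: assumes "\<epsilon> \<in> IC" shows "uhat \<epsilon> \<in> kernel G W \<psi>"
proof (rule finite_order_kernel[of _ 2])
  have c: "uhat \<epsilon> \<in> carrier G" using uhat_center G.center_carrier by blast
  show "uhat \<epsilon> [^]\<^bsub>G\<^esub> (2::nat) = \<one>\<^bsub>G\<^esub>" using uhat_square[OF assms] c by (simp add: numeral_2_eq_2)
qed (use uhat_center center_is_K in auto)

text \<open>Immediate from \<open>K_eq_Z0\<close>, because the right-hand sides form a group.\<close>

lemma K_normal_form:
  assumes "u \<in> K" shows "\<exists>f g. u = G.cprod zp f A \<otimes>\<^bsub>G\<^esub> G.cprod zz g JJ"
proof -
  let ?T = "{G.cprod zp f A \<otimes>\<^bsub>G\<^esub> G.cprod zz g JJ | f g. True}"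
  have Z: "G.cprod zp f A \<in> group_center G" "G.cprod zz g JJ \<in> group_center G" for f g
    by (intro G.cprod_closed zp_center zz_center)+
  note c = G.center_carrier[OF Z(1)] G.center_carrier[OF Z(2)]
  have P0: "G.cprod zp (\<lambda>_. 0) A = \<one>\<^bsub>G\<^esub>" and Q0: "G.cprod zz (\<lambda>_. 0) JJ = \<one>\<^bsub>G\<^esub>"
    by (rule G.cprod_zero[OF finite_pairs zp_center] G.cprod_zero[OF finite_JJ zz_center])+
  have "subgroup ?T G"
  proof (rule G.subgroupI)
    show "?T \<subseteq> carrier G" using c by auto
    show "?T \<noteq> {}" by blast
    show "inv\<^bsub>G\<^esub> x \<in> ?T" if "x \<in> ?T" for x
    proof -
      from that obtain f g where "x = G.cprod zp f A \<otimes>\<^bsub>G\<^esub> G.cprod zz g JJ" by blast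
      then have "inv\<^bsub>G\<^esub> x = inv\<^bsub>G\<^esub> (G.cprod zz g JJ) \<otimes>\<^bsub>G\<^esub> inv\<^bsub>G\<^esub> (G.cprod zp f A)" using c by (simp add: G.inv_mult_group)
      also have "\<dots> = G.cprod zz (\<lambda>J. - g J) JJ \<otimes>\<^bsub>G\<^esub> G.cprod zp (\<lambda>p. - f p) A"
        by (simp only: G.cprod_uminus[OF finite_pairs zp_center] G.cprod_uminus[OF finite_JJ zz_center])
      also have "\<dots> = G.cprod zp (\<lambda>p. - f p) A \<otimes>\<^bsub>G\<^esub> G.cprod zz (\<lambda>J. - g J) JJ"
        by (rule G.centerD[OF Z(2) c(1)])
      finally show ?thesis by blast
    qed
    show "x \<otimes>\<^bsub>G\<^esub> y \<in> ?T" if "x \<in> ?T" "y \<in> ?T" for x y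
    proof -
      from that obtain f g f' g' where xy: "x = G.cprod zp f A \<otimes>\<^bsub>G\<^esub> G.cprod zz g JJ"
        "y = G.cprod zp f' A \<otimes>\<^bsub>G\<^esub> G.cprod zz g' JJ" by blast
      have "x \<otimes>\<^bsub>G\<^esub> y = (G.cprod zp f A \<otimes>\<^bsub>G\<^esub> G.cprod zp f' A) \<otimes>\<^bsub>G\<^esub> (G.cprod zz g JJ \<otimes>\<^bsub>G\<^esub> G.cprod zz g' JJ)"
        using c G.center_lcomm[OF Z(1) c(2) c(2)] by (simp add: xy G.m_assoc)
      also have "\<dots> = G.cprod zp (\<lambda>p. f p + f' p) A \<otimes>\<^bsub>G\<^esub> G.cprod zz (\<lambda>J. g J + g' J) JJ"
        by (simp only: G.cprod_add[OF finite_pairs zp_center] G.cprod_add[OF finite_JJ zz_center])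
      finally show ?thesis by blast
    qed
  qed
  moreover have "zp ` A \<union> zz ` JJ \<subseteq> ?T"
  proof (intro Un_least image_subsetI)
    fix p assume p: "p \<in> A"
    then have zc: "zp p \<in> carrier G" using zp_center G.center_carrier by blast
    have "zp p = G.cprod zp (\<lambda>q. if q = p then 1 else 0) A \<otimes>\<^bsub>G\<^esub> G.cprod zz (\<lambda>_. 0) JJ"
      unfolding G.cprod_delta[OF finite_pairs zp_center p] Q0 using zc by simp
    then show "zp p \<in> ?T" by blast
  next
    fix J assume J: "J \<in> JJ"
    then have zc: "zz J \<in> carrier G" using zz_center G.center_carrier by blast
    have "zz J = G.cprod zp (\<lambda>_. 0) A \<otimes>\<^bsub>G\<^esub> G.cprod zz (\<lambda>q. if q = J then 1 else 0) JJ"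
      unfolding G.cprod_delta[OF finite_JJ zz_center J] P0 using zc by simp
    then show "zz J \<in> ?T" by blast
  qed
  ultimately have "Z0 \<subseteq> ?T" unfolding Z0_def by (intro G.generate_subgroup_incl)
  then show ?thesis using assms K_eq_Z0 by blast
qed

text \<open>The even parts of the exponents of the \<open>z\<^sub>J\<close> are absorbed into the pairs.\<close>

lemma K_reduced_form:
  assumes "u \<in> K"
  shows "\<exists>f. \<exists>\<epsilon>\<in>JJ \<rightarrow>\<^sub>E {0, 1}. u = G.cprod zp f A \<otimes>\<^bsub>G\<^esub> G.cprod zz \<epsilon> JJ"
proof -
  obtain f g where u: "u = G.cprod zp f A \<otimes>\<^bsub>G\<^esub> G.cprod zz g JJ" using K_normal_form[OF assms] by blast
  let ?e = "restrict (\<lambda>J. g J mod 2) JJ"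
  let ?h = "\<lambda>(r, s). pair_exp r s * (\<Sum>J\<in>JJ. chi J r s * (g J div 2))"
  have Z: "G.cprod zp f A \<in> group_center G" "G.cprod zz g JJ \<in> group_center G" for f g
    by (intro G.cprod_closed zp_center zz_center)+
  note c = G.center_carrier[OF Z(1)] G.center_carrier[OF Z(2)]
  have "G.cprod zz g JJ = G.cprod zz (\<lambda>J. 2 * (g J div 2) + g J mod 2) JJ" by simp
  also have "\<dots> = G.cprod zz (\<lambda>J. 2 * (g J div 2)) JJ \<otimes>\<^bsub>G\<^esub> G.cprod zz (\<lambda>J. g J mod 2) JJ"
    by (rule G.cprod_add[OF finite_JJ zz_center])
  also have "G.cprod zz (\<lambda>J. g J mod 2) JJ = G.cprod zz ?e JJ"
    using zz_center by (intro G.cprod_cong) auto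
  finally have "u = (G.cprod zp f A \<otimes>\<^bsub>G\<^esub> G.cprod zp ?h A) \<otimes>\<^bsub>G\<^esub> G.cprod zz ?e JJ"
    unfolding u double_zz_prod using c by (simp add: G.m_assoc)
  also have "G.cprod zp f A \<otimes>\<^bsub>G\<^esub> G.cprod zp ?h A = G.cprod zp (\<lambda>p. f p + ?h p) A"
    by (rule G.cprod_add[OF finite_pairs zp_center, symmetric])
  finally have eq: "u = G.cprod zp (\<lambda>p. f p + ?h p) A \<otimes>\<^bsub>G\<^esub> G.cprod zz ?e JJ" .
  have "?e \<in> JJ \<rightarrow>\<^sub>E {0, 1}" by (rule restrict_PiE_iff[THEN iffD2]) auto
  then show ?thesis by (intro exI bexI) (rule eq)
qed

lemma shear_zz_pair:
  assumes "(r, s) \<in> A"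
  shows "\<exists>\<kappa>. \<kappa> \<noteq> 0 \<and> (\<forall>l. shear (zz {r, s}) l =
     (0, \<kappa> *\<^sub>R (blinfun_apply l (\<sigma> r) *\<^sub>R \<sigma> s - blinfun_apply l (\<sigma> s) *\<^sub>R \<sigma> r)))"
proof -
  have same: ?thesis if g: "\<gamma> \<in> \<Phi>" "\<sigma> r \<in> L \<gamma>" "\<sigma> s \<in> L \<gamma>"
    and e: "cm (t \<gamma> (\<sigma> r)) (t \<gamma> (\<sigma> s)) = zz {r, s} [^]\<^bsub>G\<^esub> pair_exp r s" for \<gamma>
  proof -
    let ?c = "4 * (\<gamma> \<bullet> \<gamma>) / ((\<gamma> \<bullet> \<gamma>) * (\<gamma> \<bullet> \<gamma>)) / of_int (pair_exp r s)"
    have e0: "pair_exp r s \<noteq> 0" by (simp add: pair_exp_def)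
    have "shear (zz {r, s}) l = (0, ?c *\<^sub>R (blinfun_apply l (\<sigma> r) *\<^sub>R \<sigma> s - blinfun_apply l (\<sigma> s) *\<^sub>R \<sigma> r))" for l
    proof -
      have "of_int (pair_exp r s) *\<^sub>R shear (zz {r, s}) l = shear (cm (t \<gamma> (\<sigma> r)) (t \<gamma> (\<sigma> s))) l"
        unfolding e by (rule shear_int_pow[OF zz_K_pair[OF assms], symmetric])
      then have "(1 / of_int (pair_exp r s)) *\<^sub>R (of_int (pair_exp r s) *\<^sub>R shear (zz {r, s}) l)
         = (1 / of_int (pair_exp r s)) *\<^sub>R shear (cm (t \<gamma> (\<sigma> r)) (t \<gamma> (\<sigma> s))) l" by simp
      then show ?thesis using e0 g by (simp add: shear_cm)
    qed
    moreover have "?c \<noteq> 0" using e0 root_nonzero[OF g(1)] by simp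
    ultimately show ?thesis by blast
  qed
  from assms show ?thesis
  proof (cases rule: pair_cases)
    case short
    then show ?thesis using same[OF chosen_root(1) _ _ cm_eq_zz_short] sigma_short[OF chosen_short(1)] m_le_n by auto
  next
    case long
    then show ?thesis using same[OF chosen_root(3) _ _ cm_eq_zz_long] sigma_long[OF chosen_long(1)] by auto
  next
    case mixed
    let ?c = "4 * (\<beta>1 \<bullet> \<alpha>1) / ((\<beta>1 \<bullet> \<beta>1) * (\<alpha>1 \<bullet> \<alpha>1))"
    have f: "\<sigma> s \<in> L \<beta>1" "\<sigma> r \<in> L \<alpha>1"
      using mixed sigma_long[OF chosen_long(2)] sigma_short[OF chosen_short(2)] m_le_n by auto
    have "shear (zz {r, s}) l = (0, (- ?c) *\<^sub>R (blinfun_apply l (\<sigma> r) *\<^sub>R \<sigma> s - blinfun_apply l (\<sigma> s) *\<^sub>R \<sigma> r))" for l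
      unfolding zz_pair12[OF mixed(1-4)] shear_cm[OF chosen_root(4) f(1) chosen_root(2) f(2)]
      by (simp add: algebra_simps)
    moreover have "?c \<noteq> 0" using chosen_neg chosen_root root_nonzero by (auto simp: inner_commute)
    ultimately show ?thesis by (intro exI[of _ "- ?c"]) auto
  qed
qed

lemma shear_cprod:
  assumes "finite B" "z ` B \<subseteq> K" shows "shear (G.cprod z f B) ph = (\<Sum>p\<in>B. of_int (f p) *\<^sub>R shear (z p) ph)"
proof -
  have Kc: "x \<in> K \<Longrightarrow> x \<in> group_center G" for x using center_is_K by simp
  show ?thesis
    using assms
  proof (induction B)
    case (insert b B)
    have zc: "z ` insert b B \<subseteq> group_center G" using insert Kc by blast
    have "G.cprod z f B \<in> K" using G.cprod_closed[of z B f] zc center_is_K by simp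
    moreover have "z b [^]\<^bsub>G\<^esub> f b \<in> K" using K_int_pow insert by blast
    ultimately show ?case
      using insert by (simp add: G.cprod_insert[OF insert(1,2) zc] shear_mult shear_int_pow)
  qed (simp add: G.cprod_empty shear_one)
qed

text \<open>The shears are multiples of the bivectors of pairs of basis vectors. Evaluating at the coordinate
functional of \<open>\<sigma> r0\<close> and taking the coordinate at \<open>\<sigma> s0\<close> isolates the exponent of the pair \<open>(r0, s0)\<close>.\<close>

lemma pairs_independent:
  assumes "\<And>l. shear (G.cprod zp f A) l = 0" "pp \<in> A" shows "f pp = 0"
proof -
  have "\<forall>q\<in>A. \<exists>\<kappa>. \<kappa> \<noteq> 0 \<and> (\<forall>l. shear (zp q) l =
     (0, \<kappa> *\<^sub>R (blinfun_apply l (\<sigma> (fst q)) *\<^sub>R \<sigma> (snd q) - blinfun_apply l (\<sigma> (snd q)) *\<^sub>R \<sigma> (fst q))))" (is "\<forall>q\<in>A. ?P q")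
  proof
    fix q assume q: "q \<in> A"
    then have "(fst q, snd q) \<in> A" by simp
    from shear_zz_pair[OF this] show "?P q" by (simp only: case_prod_unfold)
  qed
  from bchoice[OF this] obtain \<kappa> where kk: "\<forall>q\<in>A. \<kappa> q \<noteq> 0 \<and> (\<forall>l. shear (zp q) l =
     (0, \<kappa> q *\<^sub>R (blinfun_apply l (\<sigma> (fst q)) *\<^sub>R \<sigma> (snd q) - blinfun_apply l (\<sigma> (snd q)) *\<^sub>R \<sigma> (fst q))))"
    by (rule exE)
  have k: "\<kappa> q \<noteq> 0" "shear (zp q) ph =
     (0, \<kappa> q *\<^sub>R (blinfun_apply ph (\<sigma> (fst q)) *\<^sub>R \<sigma> (snd q) - blinfun_apply ph (\<sigma> (snd q)) *\<^sub>R \<sigma> (fst q)))"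
    if "q \<in> A" for q ph
    by (rule bspec[OF kk that, THEN conjunct1], rule bspec[OF kk that, THEN conjunct2, THEN spec])
  obtain r0 s0 where pp: "pp = (r0, s0)" by (cases pp)
  have rs0: "r0 < s0" "r0 \<in> {1..n}" "s0 \<in> {1..n}" using assms(2) pp by (auto simp: index_pairs_def)
  have zK: "zp ` A \<subseteq> K" using zz_K_pair by auto
  have single: "coord s0 (snd (of_int (f q) *\<^sub>R shear (zp q) (coord_fun r0))) = (if q = pp then of_int (f pp) * \<kappa> pp else 0)"
    if q: "q \<in> A" for q
  proof -
    obtain r s where rs: "q = (r, s)" by (cases q)
    then have "r < s" "r \<in> {1..n}" "s \<in> {1..n}" using q by (auto simp: index_pairs_def)
    then show ?thesis using rs0 unfolding k(2)[OF q] by (auto simp: rs pp coord_linear coord_fun_apply coord_sigma)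
  qed
  \<comment> \<open>Only the pair \<open>(r0, s0)\<close> itself survives, with the coefficient \<open>\<kappa> pp\<close>.\<close>
  have "0 = coord s0 (snd (\<Sum>q\<in>A. of_int (f q) *\<^sub>R shear (zp q) (coord_fun r0)))"
    using assms(1)[of "coord_fun r0"] shear_cprod[OF finite_pairs zK] by (simp add: coord_zero)
  also have "\<dots> = (\<Sum>q\<in>A. coord s0 (snd (of_int (f q) *\<^sub>R shear (zp q) (coord_fun r0))))"
    by (simp only: snd_sum coord_sum)
  also have "\<dots> = (\<Sum>q\<in>A. if q = pp then of_int (f pp) * \<kappa> pp else 0)"
    by (intro sum.cong HOL.refl single)
  also have "\<dots> = of_int (f pp) * \<kappa> pp" using assms(2) finite_pairs by simp
  finally show ?thesis using k(1)[OF assms(2)] by simp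
qed

text \<open>The square of the reduced form is a product of pairs with zero shear. Its exponents vanish, which
says both that the collection is integral and that the exponents of the pairs are those of \<open>hat_u\<close>.\<close>

lemma kernel_uhat: assumes u: "u \<in> kernel G W \<psi>" shows "\<exists>\<epsilon>\<in>IC. u = uhat \<epsilon>"
proof -
  have uK: "u \<in> K" and sh: "\<And>l. shear u l = 0" using u kernel_iff by auto
  obtain f \<epsilon> where e: "\<epsilon> \<in> JJ \<rightarrow>\<^sub>E {0, 1}" "u = G.cprod zp f A \<otimes>\<^bsub>G\<^esub> G.cprod zz \<epsilon> JJ"
    using K_reduced_form[OF uK] by blast
  have "shear (u \<otimes>\<^bsub>G\<^esub> u) l = 0" for l using sh shear_mult[OF uK uK] by simp
  then have z: "2 * f (r, s) + pair_exp r s * (\<Sum>J\<in>JJ. chi J r s * \<epsilon> J) = 0" if "(r, s) \<in> A" for r s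
    using pairs_independent[of _ "(r, s)"] that unfolding e(2) square_of_prod by fastforce
  have eb: "eb \<epsilon> r s = of_int (- f (r, s))" if "(r, s) \<in> A" for r s
  proof -
    have "2 * eb \<epsilon> r s = of_int (pair_exp r s) * of_int (\<Sum>J\<in>JJ. chi J r s * \<epsilon> J)"
      unfolding pair_exp_Delta eps_bar_def by (simp add: field_simps)
    also have "\<dots> = of_int (- 2 * f (r, s))" using z[OF that] by (simp only: flip: of_int_mult)
    finally show ?thesis by simp
  qed
  have "\<epsilon> \<in> IC" using e(1) eb by (auto simp: integral_collections_def)
  moreover have "u = uhat \<epsilon>"
    unfolding uhat_eq e(2) using eb zp_center by (subst G.cprod_cong[of zp A zp f]) auto
  ultimately show ?thesis by blast
qed

text \<open>The character of \<open>detect\<close> is trivial on the pairs: their index sets are too small to be \<open>J\<close>, and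
commutators vanish in the commutative group of signs.\<close>

lemma character_uhat:
  assumes J: "J \<in> JJ"
  shows "\<exists>h. \<forall>\<epsilon>\<in>IC. h (uhat \<epsilon>) = (if \<epsilon> J = 1 then -1 else (1::int))"
proof -
  obtain h where h: "\<forall>x\<in>carrier G. \<forall>y\<in>carrier G. h (x \<otimes>\<^bsub>G\<^esub> y) = h x * h y"
    "\<forall>x\<in>carrier G. h x = 1 \<or> h x = (-1::int)"
    "\<forall>J'\<in>SP1 \<union> SP2 - {{}}. h (zz J') = (if J' = J then -1 else 1)"
    using detect[OF J] by blast
  have hm: "h (x \<otimes>\<^bsub>G\<^esub> y) = h x * h y" if "x \<in> carrier G" "y \<in> carrier G" for x y using h(1) that by blast
  have h1: "h \<one>\<^bsub>G\<^esub> = 1" using hm[of "\<one>\<^bsub>G\<^esub>" "\<one>\<^bsub>G\<^esub>"] h(2) by force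
  have hinv: "h (inv\<^bsub>G\<^esub> x) = h x" if "x \<in> carrier G" for x
    using hm[of x "inv\<^bsub>G\<^esub> x"] that h1 bspec[OF h(2) that] by auto
  have hcm: "h (cm x y) = 1" if "x \<in> carrier G" "y \<in> carrier G" for x y
    using that bspec[OF h(2), of x] bspec[OF h(2), of y] by (auto simp: commutator_def hm hinv)
  have hpow: "h (x [^]\<^bsub>G\<^esub> (i::int)) = 1" if x: "x \<in> carrier G" "h x = 1" for x i
  proof -
    have "h (x [^]\<^bsub>G\<^esub> (j::nat)) = 1" for j by (induction j) (auto simp: h1 hm x)
    then show ?thesis using x by (cases i rule: int_cases2) (auto simp: int_pow_int G.int_pow_neg hinv)
  qed
  have hprod: "h (G.cprod z g B) = (\<Prod>p\<in>B. h (z p [^]\<^bsub>G\<^esub> g p))"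
    if "finite B" "z ` B \<subseteq> group_center G" for z :: "'c \<Rightarrow> _" and g B
    using that
  proof (induction B)
    case (insert b B)
    have "G.cprod z g B \<in> carrier G" "z b \<in> carrier G"
      using insert G.cprod_closed[of z B g] G.center_carrier by auto
    then show ?case using insert by (simp add: G.cprod_insert hm)
  qed (simp add: G.cprod_empty h1)
  have card: "card J \<ge> 3" using J index_sets_supp by auto
  have pair: "h (zp p) = 1" if "p \<in> A" for p
  proof -
    obtain r s where p: "p = (r, s)" by (cases p)
    have "card {r, s} \<le> 2" by (simp add: card_insert_if)
    then have ne: "{r, s} \<noteq> J" "{r, s} \<noteq> {}" using card by auto
    have cl: "zz {r, s} \<in> carrier G" using zz_K_pair that p K_carrier by blast
    show ?thesis
    proof (cases "{r, s} \<in> SP1 \<union> SP2")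
      case True then show ?thesis using h(3) ne p by auto
    next
      case False
      have "(r, s) \<in> A" using that p by simp
      then show ?thesis
      proof (cases rule: pair_cases)
        case short
        then have "zz {r, s} = cm (t \<alpha>0 (\<sigma> r)) (t \<alpha>0 (\<sigma> s))" using zz_pair1 False by blast
        then show ?thesis using hcm short m_le_n chosen_root sigma_short chosen_short p by simp
      next
        case long
        then have "zz {r, s} = cm (t \<beta>0 (\<sigma> r)) (t \<beta>0 (\<sigma> s))" using zz_pair2 False by blast
        then show ?thesis using hcm long chosen_root sigma_long chosen_long p by simp
      next
        case mixed
        then show ?thesis using hcm zz_pair12[OF mixed(1-4)] m_le_n chosen_root sigma_long chosen_long sigma_short chosen_short p by simp
      qed
    qed
  qed
  have "h (uhat \<epsilon>) = (if \<epsilon> J = 1 then -1 else 1)" if e: "\<epsilon> \<in> IC" for \<epsilon>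
  proof -
    have e01: "\<epsilon> J' = 0 \<or> \<epsilon> J' = 1" if "J' \<in> JJ" for J' using e that by (auto simp: integral_collections_def PiE_iff)
    have c: "G.cprod zp g A \<in> carrier G" "G.cprod zz g' JJ \<in> carrier G" for g g'
      using G.cprod_closed[OF zp_center] G.cprod_closed[OF zz_center] G.center_carrier by auto
    have "h (uhat \<epsilon>) = h (G.cprod zz \<epsilon> JJ)"
    proof -
      have "h (G.cprod zp g A) = 1" for g
        unfolding hprod[OF finite_pairs zp_center]
        using pair hpow zp_center G.center_carrier by (intro prod.neutral) blast
      then show ?thesis unfolding uhat_eq hm[OF c] by simp
    qed
    also have "\<dots> = (\<Prod>J'\<in>JJ. if J' = J then (if \<epsilon> J = 1 then -1 else 1) else 1)"
      unfolding hprod[OF finite_JJ zz_center]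
    proof (rule prod.cong[OF HOL.refl])
      fix J' assume J': "J' \<in> JJ"
      have zc: "zz J' \<in> carrier G" using zz_JJ_K[OF J'] K_carrier by blast
      have "J' \<in> SP1 \<union> SP2 - {{}}" using J' index_sets_supp by auto
      then have "h (zz J') = (if J' = J then -1 else 1)" using h(3) by blast
      then show "h (zz J' [^]\<^bsub>G\<^esub> \<epsilon> J') = (if J' = J then (if \<epsilon> J = 1 then -1 else 1) else 1)"
        using e01[OF J'] zc h1 by (cases "J' = J") auto
    qed
    also have "\<dots> = (if \<epsilon> J = 1 then -1 else 1)" using J finite_JJ by simp
    finally show ?thesis .
  qed
  then show ?thesis by blast
qed

lemma uhat_inj: "inj_on uhat IC"
proof (rule inj_onI)
  fix \<epsilon> \<epsilon>' assume e: "\<epsilon> \<in> IC" "\<epsilon>' \<in> IC" "uhat \<epsilon> = uhat \<epsilon>'"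
  have E: "\<epsilon> \<in> JJ \<rightarrow>\<^sub>E {0, 1}" "\<epsilon>' \<in> JJ \<rightarrow>\<^sub>E {0, 1}" using e by (auto simp: integral_collections_def)
  show "\<epsilon> = \<epsilon>'"
  proof (rule PiE_ext[OF E])
    fix J assume J: "J \<in> JJ"
    obtain h :: "_ \<Rightarrow> int" where "\<forall>\<epsilon>\<in>IC. h (uhat \<epsilon>) = (if \<epsilon> J = 1 then -1 else 1)" using character_uhat[OF J] by blast
    then have "(\<epsilon> J = 1) = (\<epsilon>' J = 1)" using e by (metis one_neq_neg_one)
    moreover have "\<epsilon> J \<in> {0, 1}" "\<epsilon>' J \<in> {0, 1}" using PiE_mem[OF E(1) J] PiE_mem[OF E(2) J] .
    ultimately show "\<epsilon> J = \<epsilon>' J" by auto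
  qed
qed

text \<open>Each of the sets is contained in the next one, and the last one in the first: elements of the kernel are
of the form \<open>hat_u\<close>, these have square one, and central elements of finite order are in the kernel.\<close>

theorem kernel_description:
  "kernel G W \<psi> = {u \<in> group_center G. u [^]\<^bsub>G\<^esub> (2::nat) = \<one>\<^bsub>G\<^esub>}"
  "{u \<in> group_center G. u [^]\<^bsub>G\<^esub> (2::nat) = \<one>\<^bsub>G\<^esub>} = {u \<in> group_center G. \<exists>i::nat. i > 0 \<and> u [^]\<^bsub>G\<^esub> i = \<one>\<^bsub>G\<^esub>}"
  "{u \<in> group_center G. \<exists>i::nat. i > 0 \<and> u [^]\<^bsub>G\<^esub> i = \<one>\<^bsub>G\<^esub>} = {uhat \<epsilon> | \<epsilon>. \<epsilon> \<in> IC}"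
  "bij_betw uhat IC (kernel G W \<psi>)"
proof -
  let ?two = "{u \<in> group_center G. u [^]\<^bsub>G\<^esub> (2::nat) = \<one>\<^bsub>G\<^esub>}"
  let ?fin = "{u \<in> group_center G. \<exists>i::nat. i > 0 \<and> u [^]\<^bsub>G\<^esub> i = \<one>\<^bsub>G\<^esub>}"
  let ?U = "{uhat \<epsilon> | \<epsilon>. \<epsilon> \<in> IC}"
  have 1: "kernel G W \<psi> \<subseteq> ?U" using kernel_uhat by blast
  have 2: "?U \<subseteq> ?two"
  proof
    fix u assume "u \<in> ?U"
    then obtain \<epsilon> where u: "u = uhat \<epsilon>" "\<epsilon> \<in> IC" by blast
    have "u \<in> group_center G" using u uhat_center by blast
    then show "u \<in> ?two" using uhat_square[OF u(2)] G.center_carrier[of u] u(1) by (simp add: numeral_2_eq_2)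
  qed
  have 3: "?two \<subseteq> ?fin" by (auto intro: exI[of _ 2])
  have 4: "?fin \<subseteq> kernel G W \<psi>"
  proof
    fix u assume "u \<in> ?fin"
    then obtain i :: nat where "u \<in> K" "i > 0" "u [^]\<^bsub>G\<^esub> i = \<one>\<^bsub>G\<^esub>" unfolding center_is_K by blast
    then show "u \<in> kernel G W \<psi>" by (rule finite_order_kernel)
  qed
  show "kernel G W \<psi> = ?two" by (rule subset_antisym[OF subset_trans[OF 1 2] subset_trans[OF 3 4]])
  show "?two = ?fin" by (rule subset_antisym[OF 3 subset_trans[OF 4 subset_trans[OF 1 2]]])
  show "?fin = ?U" by (rule subset_antisym[OF subset_trans[OF 4 1] subset_trans[OF 2 3]])
  have "uhat ` IC = kernel G W \<psi>"
  proof
    show "uhat ` IC \<subseteq> kernel G W \<psi>" using uhat_kernel by (rule image_subsetI)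
    show "kernel G W \<psi> \<subseteq> uhat ` IC" using 1 by (simp add: Setcompr_eq_image)
  qed
  then show "bij_betw uhat IC (kernel G W \<psi>)" using uhat_inj by (rule bij_betw_imageI[rotated])
qed

end

theorem proposition23:
  fixes X :: root_type
    and \<Phi> :: "'a::euclidean_space set"
    and V1 V2 S1 S2 :: "'b::euclidean_space set"
    and R :: "('a \<times> 'b) set"
    and \<sigma> :: "nat \<Rightarrow> 'b"
    and t \<nu> :: nat
    and \<alpha> \<alpha>' \<beta> \<beta>' :: 'a
  assumes "valid_type X"
    and "root_system_of_type X \<Phi>"
    and "subspace V1" and "subspace V2" and "V1 \<inter> V2 = {0}" and "V1 + V2 = UNIV"
    and "t = dim V1" and "\<nu> = DIM('b)"
    and "semilattice_in V1 S1" and "semilattice_in V2 S2"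
    and "\<And>l. X = TypeB l \<Longrightarrow> l \<ge> 3 \<Longrightarrow> is_lattice S2"
    and "\<And>l. X = TypeC l \<Longrightarrow> is_lattice S1"
    and "X = TypeF4 \<or> X = TypeG2 \<Longrightarrow> is_lattice S1 \<and> is_lattice S2"
    and "R = ears X \<Phi> S1 S2"
    and "\<sigma> ` {1..t} \<subseteq> S1" and "int_basis {1..t} \<sigma> (int_span S1)"
    and "\<sigma> ` {t+1..\<nu>} \<subseteq> S2" and "int_basis {t+1..\<nu>} \<sigma> (int_span S2)"
    and "\<alpha> \<in> short_roots \<Phi>" and "\<alpha>' \<in> short_roots \<Phi>"
    and "\<beta> \<in> long_roots \<Phi>" and "\<beta>' \<in> long_roots \<Phi>" and "\<alpha>' \<bullet> \<beta>' < 0"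
  shows
    "kernel (hat_weyl R) (weyl_group R) (weyl_proj R)
       = {u \<in> group_center (hat_weyl R). u [^]\<^bsub>hat_weyl R\<^esub> (2::nat) = \<one>\<^bsub>hat_weyl R\<^esub>} \<and>
     {u \<in> group_center (hat_weyl R). u [^]\<^bsub>hat_weyl R\<^esub> (2::nat) = \<one>\<^bsub>hat_weyl R\<^esub>}
       = {u \<in> group_center (hat_weyl R). \<exists>n::nat. n > 0 \<and> u [^]\<^bsub>hat_weyl R\<^esub> n = \<one>\<^bsub>hat_weyl R\<^esub>} \<and>
     {u \<in> group_center (hat_weyl R). \<exists>n::nat. n > 0 \<and> u [^]\<^bsub>hat_weyl R\<^esub> n = \<one>\<^bsub>hat_weyl R\<^esub>}
       = {hat_u X R t \<nu> \<sigma> S1 S2 \<alpha> \<beta> \<alpha>' \<beta>' \<epsilon> | \<epsilon>. \<epsilon> \<in> integral_collections X t \<nu> \<sigma> S1 S2} \<and>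
     bij_betw (hat_u X R t \<nu> \<sigma> S1 S2 \<alpha> \<beta> \<alpha>' \<beta>') (integral_collections X t \<nu> \<sigma> S1 S2)
       (kernel (hat_weyl R) (weyl_group R) (weyl_proj R))"
proof -
  from assms(2) obtain a where a: "root_system \<Phi>" "irreducible_roots \<Phi>" "root_base \<Phi> (type_rank X) a"
    "\<And>i j. i \<in> {1..type_rank X} \<Longrightarrow> j \<in> {1..type_rank X} \<Longrightarrow>
       pairing (a i) (a j) = of_int (cartan_matrix X i j)"
    unfolding root_system_of_type_def pairing_def by blast
  interpret ears_chosen \<Phi> X a V1 V2 S1 S2 R \<sigma> t \<nu> \<alpha> \<alpha>' \<beta> \<beta>'
    by unfold_locales (fact assms a)+
  show ?thesis by (intro conjI kernel_description)
qed

end
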